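(* Let $M$ be a complete, connected, noncompact $n$-dimensional Riemannian manifold, let $m\in(0,1)$ and let $u_0\in L^1_{\mathrm{loc}}(M)$. Then there exists a distributional solution $u$ of the Cauchy problem $$u_t=\Delta u^m \ \text{ in } M\times(0,+\infty),\qquad u=u_0\ \text{ on } M\times\{0\}.$$ In addition, $u\in C([0,+\infty);L^1_{\mathrm{loc}}(M))$.
   Context: $\Delta$ is the Laplace-Beltrami operator on $M$ and $d\mu$ is the Riemannian volume measure. For sign-changing functions, $u^m:=\operatorname{sign}(u)|u|^m$. Distributional solution: given $m\in(0,1)$ and $u_0\in L^1_{\mathrm{loc}}(M)$, a function $u\in L^1_{\mathrm{loc}}(M\times[0,+\infty))$ is a (distributional, or very weak) solution of the Cauchy problem if $u_t=\Delta u^m$ in $\mathcal D'(M\times(0,+\infty))$ and, in the sense of essential limits, $$\lim_{t\to0^+}\int_M u(x,t)\,\eta(x)\,d\mu=\int_M u_0\,\eta\,d\mu\qquad\forall \eta\in C_c^\infty(M).$$ *)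

theory Defs
  imports "HOL-Analysis.Analysis"
begin

section \<open>Smooth functions on open subsets of normed spaces\<close>

text \<open>Only meaningful for open \<open>S\<close>.\<close>

primrec Ck_on :: "nat \<Rightarrow> 'v set \<Rightarrow> ('v::real_normed_vector \<Rightarrow> 'w::real_normed_vector) \<Rightarrow> bool" where
  "Ck_on 0 S f \<longleftrightarrow> continuous_on S f"
| "Ck_on (Suc k) S f \<longleftrightarrow>
     f differentiable_on S \<and> (\<forall>v. Ck_on k S (\<lambda>x. frechet_derivative f (at x) v))"

definition smooth_on :: "'v set \<Rightarrow> ('v::real_normed_vector \<Rightarrow> 'w::real_normed_vector) \<Rightarrow> bool" where
  "smooth_on S f \<longleftrightarrow> (\<forall>k. Ck_on k S f)"

definition partial :: "'n \<Rightarrow> (real^'n::finite \<Rightarrow> real) \<Rightarrow> real^'n \<Rightarrow> real" where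
  "partial i f y = frechet_derivative f (at y) (axis i 1)"


section \<open>Riemannian manifolds\<close>

text \<open>
  The underlying set of the manifold is the whole type \<open>'a\<close>, and its dimension is \<open>CARD('n)\<close>.
  A chart is a pair of its domain and its coordinate map; the values of the coordinate
  map outside the domain are irrelevant.
\<close>

type_synonym ('a, 'n) chart = "'a set \<times> ('a \<Rightarrow> real^'n)"

abbreviation dom_of :: "('a, 'n::finite) chart \<Rightarrow> 'a set" where
  "dom_of c \<equiv> fst c"

abbreviation img_of :: "('a, 'n::finite) chart \<Rightarrow> (real^'n) set" where
  "img_of c \<equiv> snd c ` fst c"

abbreviation inv_of :: "('a, 'n::finite) chart \<Rightarrow> real^'n \<Rightarrow> 'a" where
  "inv_of c \<equiv> inv_into (fst c) (snd c)"

definition smooth_atlas ::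
  "('a::{t2_space, second_countable_topology}, 'n::finite) chart set \<Rightarrow> bool" where
  "smooth_atlas A \<longleftrightarrow>
     (\<Union>c\<in>A. dom_of c) = UNIV \<and>
     (\<forall>c\<in>A. open (dom_of c) \<and> open (img_of c) \<and>
            homeomorphism (dom_of c) (img_of c) (snd c) (inv_of c)) \<and>
     (\<forall>c\<in>A. \<forall>d\<in>A. smooth_on (snd c ` (dom_of c \<inter> dom_of d)) (snd d \<circ> inv_of c))"

text \<open>
  A metric tensor is given by its component matrices: \<open>g c p\<close> is the matrix
  \<open>g\<^sub>i\<^sub>j(p)\<close> with respect to the coordinate frame of the chart \<open>c\<close>.  The last clause is the
  transformation law of a covariant 2-tensor, i.e. the bilinear form on the
  tangent space at \<open>p\<close> does not depend on the chart.
\<close>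

type_synonym ('a, 'n) metric_tensor = "('a, 'n) chart \<Rightarrow> 'a \<Rightarrow> real^'n^'n"

definition riemannian_manifold ::
  "('a::{t2_space, second_countable_topology}, 'n::finite) chart set \<Rightarrow> ('a, 'n) metric_tensor \<Rightarrow> bool"
  where
  "riemannian_manifold A g \<longleftrightarrow>
     smooth_atlas A \<and>
     (\<forall>c\<in>A. smooth_on (img_of c) (\<lambda>y. g c (inv_of c y))) \<and>
     (\<forall>c\<in>A. \<forall>p\<in>dom_of c. transpose (g c p) = g c p \<and> (\<forall>v. v \<noteq> 0 \<longrightarrow> v \<bullet> (g c p *v v) > 0)) \<and>
     (\<forall>c\<in>A. \<forall>d\<in>A. \<forall>p\<in>dom_of c \<inter> dom_of d.
        let J = matrix (frechet_derivative (snd d \<circ> inv_of c) (at (snd c p)))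
        in g c p = transpose J ** g d p ** J)"

text \<open>
  Speed, volume and Laplacian below do not depend on the chart, so an arbitrary chart
  around the point may be used to compute them.
\<close>

definition chart_at :: "('a, 'n::finite) chart set \<Rightarrow> 'a \<Rightarrow> ('a, 'n) chart" where
  "chart_at A p = (SOME c. c \<in> A \<and> p \<in> dom_of c)"


subsection \<open>Riemannian distance and completeness\<close>

text \<open>Piecewise \<open>C\<^sup>1\<close> in the sense of \<^const>\<open>piecewise_C1_differentiable_on\<close>.\<close>

definition piecewise_C1_curve ::
  "('a::topological_space, 'n::finite) chart set \<Rightarrow> (real \<Rightarrow> 'a) \<Rightarrow> bool" where
  "piecewise_C1_curve A \<gamma> \<longleftrightarrow>
     continuous_on {0..1} \<gamma> \<and>
     (\<exists>S. finite S \<and>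
          (\<forall>c\<in>A. (snd c \<circ> \<gamma>) C1_differentiable_on {t \<in> {0..1} - S. \<gamma> t \<in> dom_of c}))"

definition speed ::
  "('a, 'n::finite) chart set \<Rightarrow> ('a, 'n) metric_tensor \<Rightarrow> (real \<Rightarrow> 'a) \<Rightarrow> real \<Rightarrow> real" where
  "speed A g \<gamma> t =
     (let c = chart_at A (\<gamma> t); v = vector_derivative (snd c \<circ> \<gamma>) (at t)
      in sqrt (v \<bullet> (g c (\<gamma> t) *v v)))"

definition curve_length ::
  "('a, 'n::finite) chart set \<Rightarrow> ('a, 'n) metric_tensor \<Rightarrow> (real \<Rightarrow> 'a) \<Rightarrow> ennreal" where
  "curve_length A g \<gamma> = (\<integral>\<^sup>+t\<in>{0..1}. ennreal (speed A g \<gamma> t) \<partial>lborel)"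

text \<open>On a connected manifold the infimum is finite for all pairs of points.\<close>

definition riemannian_distance ::
  "('a::topological_space, 'n::finite) chart set \<Rightarrow> ('a, 'n) metric_tensor \<Rightarrow> 'a \<Rightarrow> 'a \<Rightarrow> real" where
  "riemannian_distance A g p q =
     enn2real (INF \<gamma>\<in>{\<gamma>. piecewise_C1_curve A \<gamma> \<and> \<gamma> 0 = p \<and> \<gamma> 1 = q}. curve_length A g \<gamma>)"

definition complete_manifold ::
  "('a::topological_space, 'n::finite) chart set \<Rightarrow> ('a, 'n) metric_tensor \<Rightarrow> bool" where
  "complete_manifold A g \<longleftrightarrow> Metric_space.mcomplete UNIV (riemannian_distance A g)"


subsection \<open>Volume measure and Laplace--Beltrami operator\<close>

definition volume_density ::
  "('a, 'n::finite) metric_tensor \<Rightarrow> ('a, 'n) chart \<Rightarrow> real^'n \<Rightarrow> real" where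
  "volume_density g c y = sqrt (det (g c (inv_of c y)))"

text \<open>The unique Borel measure that has density \<open>\<surd>det g\<close> in every chart.\<close>

definition volume_measure ::
  "('a::topological_space, 'n::finite) chart set \<Rightarrow> ('a, 'n) metric_tensor \<Rightarrow> 'a measure" where
  "volume_measure A g =
     (THE \<mu>. sets \<mu> = sets borel \<and>
        (\<forall>c\<in>A. \<forall>B\<in>sets borel. B \<subseteq> dom_of c \<longrightarrow>
           emeasure \<mu> B = (\<integral>\<^sup>+y\<in>snd c ` B. ennreal (volume_density g c y) \<partial>lborel)))"

text \<open>\<open>\<Delta>f = (1/\<surd>det g) \<Sum>\<^sub>i \<partial>\<^sub>i (\<surd>det g \<Sum>\<^sub>j g\<^sup>i\<^sup>j \<partial>\<^sub>j f)\<close> in local coordinates.\<close>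

definition laplace_beltrami ::
  "('a, 'n::finite) chart set \<Rightarrow> ('a, 'n) metric_tensor \<Rightarrow> ('a \<Rightarrow> real) \<Rightarrow> 'a \<Rightarrow> real" where
  "laplace_beltrami A g f p =
     (let c = chart_at A p;
          \<rho> = volume_density g c;
          G = (\<lambda>y. matrix_inv (g c (inv_of c y)))
      in (\<Sum>i\<in>UNIV. partial i
            (\<lambda>y. \<rho> y * (\<Sum>j\<in>UNIV. G y $ i $ j * partial j (f \<circ> inv_of c) y)) (snd c p))
         / \<rho> (snd c p))"


section \<open>Test functions and local integrability\<close>

text \<open>\<open>C\<^sub>c\<^sup>\<infinity>(M)\<close>\<close>

definition test_functions ::
  "('a::topological_space, 'n::finite) chart set \<Rightarrow> ('a \<Rightarrow> real) set" where
  "test_functions A =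
     {\<eta>. (\<forall>c\<in>A. smooth_on (img_of c) (\<eta> \<circ> inv_of c)) \<and> compact (closure {x. \<eta> x \<noteq> 0})}"

text \<open>
  \<open>C\<^sub>c\<^sup>\<infinity>(M \<times> (0,\<infinity>))\<close>; its elements are extended by zero to \<open>t \<le> 0\<close>.
\<close>

definition spacetime_test_functions ::
  "('a::topological_space, 'n::finite) chart set \<Rightarrow> ('a \<times> real \<Rightarrow> real) set" where
  "spacetime_test_functions A =
     {\<zeta>. (\<forall>c\<in>A. smooth_on (img_of c \<times> UNIV) (\<lambda>(y, t). \<zeta> (inv_of c y, t))) \<and>
         compact (closure {z. \<zeta> z \<noteq> 0}) \<and> closure {z. \<zeta> z \<noteq> 0} \<subseteq> UNIV \<times> {0<..}}"

text \<open>
  \<open>L\<^sup>1\<^sub>l\<^sub>o\<^sub>c(S)\<close>, for functions rather than equivalence classes modulo null sets.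
\<close>

definition L1_loc :: "'b::topological_space measure \<Rightarrow> 'b set \<Rightarrow> ('b \<Rightarrow> real) set" where
  "L1_loc \<mu> S = {f. \<forall>K. compact K \<and> K \<subseteq> S \<longrightarrow> set_integrable \<mu> K f}"

text \<open>\<open>C([0,\<infinity>); L\<^sup>1\<^sub>l\<^sub>o\<^sub>c(M))\<close>\<close>

definition C_L1_loc :: "'a::topological_space measure \<Rightarrow> ('a \<times> real \<Rightarrow> real) set" where
  "C_L1_loc \<mu> =
     {u. (\<forall>t\<ge>0. (\<lambda>x. u (x, t)) \<in> L1_loc \<mu> UNIV) \<and>
         (\<forall>s\<ge>0. \<forall>K. compact K \<longrightarrow>
            ((\<lambda>t. \<integral>x\<in>K. \<bar>u (x, t) - u (x, s)\<bar> \<partial>\<mu>) \<longlongrightarrow> 0) (at s within {0..}))}"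


section \<open>Distributional solutions of the fast diffusion equation\<close>

definition spow :: "real \<Rightarrow> real \<Rightarrow> real" where
  "spow r m = sgn r * \<bar>r\<bar> powr m"

text \<open>
  The distributions \<open>u\<^sub>t\<close> and \<open>\<Delta>w\<close> on \<open>M \<times> (0,\<infinity>)\<close> associated with locally integrable \<open>u\<close>, \<open>w\<close>.
\<close>

definition distr_time_derivative ::
  "('a::topological_space, 'n::finite) chart set \<Rightarrow> ('a, 'n) metric_tensor
     \<Rightarrow> ('a \<times> real \<Rightarrow> real) \<Rightarrow> ('a \<times> real \<Rightarrow> real) \<Rightarrow> real" where
  "distr_time_derivative A g u \<zeta> =
     - (\<integral>(x, t). u (x, t) * deriv (\<lambda>s. \<zeta> (x, s)) t \<partial>(volume_measure A g \<Otimes>\<^sub>M lborel))"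

definition distr_laplacian ::
  "('a::topological_space, 'n::finite) chart set \<Rightarrow> ('a, 'n) metric_tensor
     \<Rightarrow> ('a \<times> real \<Rightarrow> real) \<Rightarrow> ('a \<times> real \<Rightarrow> real) \<Rightarrow> real" where
  "distr_laplacian A g w \<zeta> =
     (\<integral>(x, t). w (x, t) * laplace_beltrami A g (\<lambda>x'. \<zeta> (x', t)) x
        \<partial>(volume_measure A g \<Otimes>\<^sub>M lborel))"

text \<open>
  The filter \<open>inf (at_right 0) (ae_filter lborel)\<close> expresses the essential limit
  as \<open>t \<rightarrow> 0+\<close>.  The values of \<open>u\<close> at negative times are irrelevant.
\<close>

definition distributional_solution ::
  "('a::topological_space, 'n::finite) chart set \<Rightarrow> ('a, 'n) metric_tensor
     \<Rightarrow> real \<Rightarrow> ('a \<Rightarrow> real) \<Rightarrow> ('a \<times> real \<Rightarrow> real) \<Rightarrow> bool" where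
  "distributional_solution A g m u\<^sub>0 u \<longleftrightarrow>
     u \<in> L1_loc (volume_measure A g \<Otimes>\<^sub>M lborel) (UNIV \<times> {0..}) \<and>
     (\<forall>\<zeta>\<in>spacetime_test_functions A.
        distr_time_derivative A g u \<zeta> = distr_laplacian A g (\<lambda>z. spow (u z) m) \<zeta>) \<and>
     (\<forall>\<eta>\<in>test_functions A.
        ((\<lambda>t. \<integral>x. u (x, t) * \<eta> x \<partial>volume_measure A g)
           \<longlongrightarrow> (\<integral>x. u\<^sub>0 x * \<eta> x \<partial>volume_measure A g)) (inf (at_right 0) (ae_filter lborel)))"

end

theory Submission
  imports Defs
begin

text \<open>
 Write \<open>E f h\<close> for the integral of the inner product of the gradients. The Laplacian enters only
 through the identity \<open>E f \<eta> = - \<integral>f \<Delta>\<eta>\<close> for \<open>C\<^sup>1\<close> functions \<open>f\<close> of compact support. For bounded data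
 the equation is solved by implicit time steps: the solution \<open>w\<close> of \<open>w\<^bsup>1/m\<^esup> - h \<Delta>w = f\<close> minimises a
 uniformly convex functional, the map from \<open>f\<close> to \<open>w\<^bsup>1/m\<^esup>\<close> is an order preserving contraction of \<open>L\<^sup>1\<close>, and the steps
 converge by the Crandall--Liggett argument in the form of Kobayashi. For ordered solutions \<open>V \<le> W\<close> and a
 cut-off \<open>\<eta>\<close> with \<open>\<bar>\<Delta>\<eta>\<bar> \<le> C \<eta>\<^bsup>m\<^esup>\<close>, Hoelder's inequality bounds the derivative of \<open>Y = \<integral>(W - V) \<eta>\<close> by a multiple of \<open>Y\<^bsup>m\<^esup>\<close>, so
 that \<open>Y\<^bsup>1-m\<^esup>\<close> is Lipschitz in time (Herrero--Pierre). This local bound does not see the data elsewhere;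
 it makes the solutions converge when the positive and then the negative part of the data is
 truncated on an exhausting sequence of compact sets and the truncation is removed monotonically.
\<close>

text \<open>Neither the data nor the curvature is controlled at infinity, so every estimate has to
  survive multiplication by a cut-off. Order makes this possible: if V \<le> W, then \<integral>(W -
  V) \<eta> is linear in W and V and has a time derivative, whereas \<integral>|W - V| \<eta> would
  call for an inequality of Kato type. Data of both signs are not ordered with 0; their truncations
  therefore carry two indices, lie between a nonpositive and a nonnegative solution, and are
  monotone in each index. The constant in the local bound depends on the cut-off alone. It bounds
  the approximations and also keeps their distance to the limit small near a given time, which gives
  continuity in time. The exponents 1 + 1/m and 1 + m are conjugate: the unknown w = u^m lives in
  the first space, the datum f in the second. The Crandall-Liggett argument needs a dense domain. It
  is built from bumps that are C^2 in a single chart, and since their Laplacian is a weak one,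
  second derivatives are never transformed between charts.\<close>

type_synonym 'a fn = "'a \<Rightarrow> real"

section \<open>Elementary inequalities for powers\<close>

lemma powr_add_le:
 fixes a b r :: real
 assumes "r \<ge> 0"
 shows "\<bar>a + b\<bar> powr r \<le> 2 powr r * (\<bar>a\<bar> powr r + \<bar>b\<bar> powr r)"
proof -
 have "\<bar>a + b\<bar> powr r \<le> (2 * max \<bar>a\<bar> \<bar>b\<bar>) powr r"
  using assms by (intro powr_mono2) auto
 also have "\<dots> = 2 powr r * max \<bar>a\<bar> \<bar>b\<bar> powr r"
  by (simp add: powr_mult)
 also have "max \<bar>a\<bar> \<bar>b\<bar> powr r \<le> \<bar>a\<bar> powr r + \<bar>b\<bar> powr r"
  by (simp add: max_def)
 finally show ?thesis by simp
qed

text \<open>For two positive points this is \<open>powr_convex\<close>. If one point is 0, convexity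
  comes down to c powr r \<le> c for 0 < c < 1.\<close>

lemma powr_convex0:
 fixes r :: real
 assumes "r \<ge> 1"
 shows "convex_on {0..} (\<lambda>x. x powr r)"
proof (rule convex_onI)
 fix t x y :: real assume t: "0 < t" "t < 1" and xy: "x \<in> {0..}" "y \<in> {0..}"
 have *: "(c * z) powr r \<le> c * z powr r" if "0 < c" "c < 1" "z \<ge> 0" for c z :: real
 proof -
  have "c powr r \<le> c" using powr_mono'[of 1 r c] that assms by simp
  thus ?thesis using that by (simp add: powr_mult mult_right_mono)
 qed
 show "((1 - t) *\<^sub>R x + t *\<^sub>R y) powr r \<le> (1 - t) * x powr r + t * y powr r"
 proof (cases "x = 0 \<or> y = 0")
  case True
  thus ?thesis using t xy *[of t y] *[of "1-t" x] assms by auto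
 next
  case False
  hence "x > 0" "y > 0" using xy by auto
  thus ?thesis using convex_onD[OF powr_convex[OF assms], of t x y] t by auto
 qed
qed auto

text \<open>A triangle inequality whose first factor tends to 1 as \<theta> tends to 0, at the price
  of the second. It is convexity at the points x / (1 - \<theta>) and y / \<theta>.\<close>

lemma powr_convex_split:
 fixes x y r \<theta> :: real
 assumes "x \<ge> 0" "y \<ge> 0" "r \<ge> 1" "0 < \<theta>" "\<theta> < 1"
 shows "(x + y) powr r \<le> (1 - \<theta>) powr (1 - r) * x powr r + \<theta> powr (1 - r) * y powr r"
proof -
 have cv: "convex_on {0..} (\<lambda>x::real. x powr r)" using powr_convex0 assms by auto
 have "(x + y) powr r = ((1 - \<theta>) *\<^sub>R (x / (1 - \<theta>)) + \<theta> *\<^sub>R (y / \<theta>)) powr r"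
  using assms by simp
 also have "\<dots> \<le> (1 - \<theta>) * (x / (1 - \<theta>)) powr r + \<theta> * (y / \<theta>) powr r"
  using assms by (intro convex_onD[OF cv]) auto
 also have "\<dots> = (1 - \<theta>) powr (1 - r) * x powr r + \<theta> powr (1 - r) * y powr r"
  using assms by (simp add: powr_divide powr_diff)
 finally show ?thesis .
qed

text \<open>The fractions of x + y lie in [0, 1], where t powr s \<le> t, and they add up to
  1.\<close>

lemma powr_superadd:
 fixes x y s :: real
 assumes "x \<ge> 0" "y \<ge> 0" "s \<ge> 1"
 shows "x powr s + y powr s \<le> (x + y) powr s"
proof (cases "x + y = 0")
 case True thus ?thesis using assms by (auto simp: add_nonneg_eq_0_iff)
next
 case False
 hence p: "x + y > 0" using assms by auto
 have *: "t powr s \<le> t" if "0 \<le> t" "t \<le> 1" for t :: real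
  using powr_mono'[of 1 s t] that assms by (simp)
 have "(x / (x+y)) powr s + (y / (x+y)) powr s \<le> x / (x+y) + y / (x+y)"
  using assms p by (intro add_mono *) auto
 also have "\<dots> = 1" using p by (simp add: add_divide_distrib[symmetric])
 finally have "(x powr s + y powr s) / (x + y) powr s \<le> 1"
  using assms p by (simp add: powr_divide add_divide_distrib)
 thus ?thesis using p by (simp add: divide_simps split: if_splits)
qed

text \<open>Clarkson's inequality, the source of uniform convexity. In terms of squares it combines
  superadditivity of t powr (r / 2), the parallelogram identity and convexity of the same
  power.\<close>

lemma clarkson:
 fixes a b r :: real
 assumes "r \<ge> 2"
 shows "\<bar>(a + b) / 2\<bar> powr r + \<bar>(a - b) / 2\<bar> powr r \<le> (\<bar>a\<bar> powr r + \<bar>b\<bar> powr r) / 2"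
proof -
 have sq: "\<bar>x\<bar> powr r = (x\<^sup>2) powr (r / 2)" for x :: real
 proof -
  have "x\<^sup>2 = \<bar>x\<bar> powr 2" by (simp add: powr_numeral)
  hence "x\<^sup>2 powr (r / 2) = \<bar>x\<bar> powr (2 * (r / 2))" by (simp only: powr_powr)
  thus ?thesis by simp
 qed
 have cv: "convex_on {0..} (\<lambda>x::real. x powr (r / 2))" using powr_convex0 assms by auto
 have "\<bar>(a + b) / 2\<bar> powr r + \<bar>(a - b) / 2\<bar> powr r
   \<le> (((a + b) / 2)\<^sup>2 + ((a - b) / 2)\<^sup>2) powr (r / 2)"
  unfolding sq using assms by (intro powr_superadd) auto
 also have "((a + b) / 2)\<^sup>2 + ((a - b) / 2)\<^sup>2 = (1 - 1/2) *\<^sub>R a\<^sup>2 + (1/2) *\<^sub>R b\<^sup>2"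
  by (simp add: power2_eq_square field_simps)
 also have "\<dots> powr (r / 2) \<le> (1 - 1/2) * (a\<^sup>2) powr (r/2) + (1/2) * (b\<^sup>2) powr (r/2)"
  by (intro convex_onD[OF cv]) auto
 also have "\<dots> = (\<bar>a\<bar> powr r + \<bar>b\<bar> powr r) / 2" unfolding sq by simp
 finally show ?thesis .
qed

lemma young_simple:
 fixes a b r s :: real
 assumes "a \<ge> 0" "b \<ge> 0" "r > 1" "s > 1" "1 / r + 1 / s = 1"
 shows "a * b \<le> a powr s + b powr r"
proof -
 have "a powr s / s \<le> a powr s / 1" "b powr r / r \<le> b powr r / 1"
  using assms by (intro divide_left_mono; simp)+
 thus ?thesis using Youngs_inequality[of s r a b] assms by (simp add: add.commute)
qed

text \<open>Young's inequality for the pair \<delta> a, b / \<delta>. The free weight lets it do the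
  work of Hoelder's inequality.\<close>

lemma young_delta:
 fixes a b r s \<delta> :: real
 assumes "r > 1" "s > 1" "1 / r + 1 / s = 1" "\<delta> > 0"
 shows "\<bar>a * b\<bar> \<le> \<delta> powr s * \<bar>a\<bar> powr s + \<delta> powr (- r) * \<bar>b\<bar> powr r"
proof -
 have "\<bar>a * b\<bar> = (\<delta> * \<bar>a\<bar>) * (\<bar>b\<bar> / \<delta>)" using assms by (simp add: abs_mult)
 also have "\<dots> \<le> (\<delta> * \<bar>a\<bar>) powr s + (\<bar>b\<bar> / \<delta>) powr r"
  using assms by (intro young_simple) auto
 also have "\<dots> = \<delta> powr s * \<bar>a\<bar> powr s + \<delta> powr (- r) * \<bar>b\<bar> powr r"
  using assms by (simp add: powr_mult powr_divide powr_minus_divide)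
 finally show ?thesis .
qed

section \<open>Functions with integrable powers\<close>

abbreviation "nnint M f \<equiv> \<integral>\<^sup>+x. ennreal (f x) \<partial>M"
text \<open>Powers of the norm and of the distance: only their size and convergence matter, so no
  r-th root is taken.\<close>

abbreviation "npow M r f \<equiv> LINT x|M. \<bar>f x :: real\<bar> powr r"
abbreviation "dpow M r f g \<equiv> LINT x|M. \<bar>f x - g x :: real\<bar> powr r"

definition Lp :: "'a measure \<Rightarrow> real \<Rightarrow> 'a fn set" where
 "Lp M r = {f \<in> borel_measurable M. integrable M (\<lambda>x. \<bar>f x\<bar> powr r)}"

lemma Lp_meas [measurable_dest]: "f \<in> Lp M r ==> f \<in> borel_measurable M"
 by (simp add: Lp_def)

lemma Lp_int: "f \<in> Lp M r ==> integrable M (\<lambda>x. \<bar>f x\<bar> powr r)"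
 by (simp add: Lp_def)

lemma Lp_1_iff: "f \<in> Lp M 1 \<longleftrightarrow> integrable M f"
 by (auto simp: Lp_def integrable_abs_iff)

lemma Lp_add:
 assumes "f \<in> Lp M r" "g \<in> Lp M r" "r \<ge> 0"
 shows "(\<lambda>x. f x + g x) \<in> Lp M r"
proof -
 note [measurable] = Lp_meas[OF assms(1)] Lp_meas[OF assms(2)]
 have "integrable M (\<lambda>x. 2 powr r * (\<bar>f x\<bar> powr r + \<bar>g x\<bar> powr r))"
  using assms by (auto simp: Lp_int)
 hence "integrable M (\<lambda>x. \<bar>f x + g x\<bar> powr r)"
  by (rule Bochner_Integration.integrable_bound) (auto intro!: AE_I2 powr_add_le assms)
 thus ?thesis by (simp add: Lp_def)
qed

lemma Lp_cmult:
 assumes "f \<in> Lp M r"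
 shows "(\<lambda>x. c * f x) \<in> Lp M r"
 using assms by (auto simp: Lp_def abs_mult powr_mult)

lemma Lp_minus: "f \<in> Lp M r ==> (\<lambda>x. - f x) \<in> Lp M r"
 using Lp_cmult[of f M r "-1"] by simp

lemma Lp_diff:
 assumes "f \<in> Lp M r" "g \<in> Lp M r" "r \<ge> 0"
 shows "(\<lambda>x. f x - g x) \<in> Lp M r"
 using Lp_add[OF assms(1) Lp_minus[OF assms(2)] assms(3)] by simp

lemma Lp_bound:
 assumes "g \<in> Lp M r" "f \<in> borel_measurable M" "\<And>x. \<bar>f x\<bar> \<le> C * \<bar>g x\<bar>" "r \<ge> 0"
 shows "f \<in> Lp M r"
proof -
 have "integrable M (\<lambda>x. \<bar>C * g x\<bar> powr r)" using Lp_int[OF Lp_cmult[OF assms(1)]] .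
 hence "integrable M (\<lambda>x. \<bar>f x\<bar> powr r)"
 proof (rule Bochner_Integration.integrable_bound)
  have "\<bar>f x\<bar> \<le> \<bar>C * g x\<bar>" for x
   using assms(3)[of x] by (simp add: abs_mult) (smt (verit) abs_ge_self abs_ge_zero mult_right_mono)
  thus "AE x in M. norm (\<bar>f x\<bar> powr r) \<le> norm (\<bar>C * g x\<bar> powr r)"
   using assms(4) by (auto intro!: AE_I2 powr_mono2)
 qed (use assms(2) in measurable)
 thus ?thesis using assms by (simp add: Lp_def)
qed

text \<open>Bounded with a support of finite measure: an algebra inside every \<open>Lp M r\<close>
  with r > 0, stable under composition with continuous P such that P 0 = 0. It holds test functions,
  their Laplacians and the inner products of gradients.\<close>

definition bfs :: "'a measure \<Rightarrow> 'a fn set" where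
 "bfs M = {f \<in> borel_measurable M. (\<exists>C. \<forall>x. \<bar>f x\<bar> \<le> C) \<and>
   (\<exists>K\<in>sets M. emeasure M K < \<infinity> \<and> (\<forall>x. x \<notin> K \<longrightarrow> f x = 0))}"

lemma bfs_meas [measurable_dest]: "f \<in> bfs M ==> f \<in> borel_measurable M"
 by (simp add: bfs_def)

lemma bfs_bounded:
 assumes "f \<in> bfs M" shows "\<exists>C>0. \<forall>x. \<bar>f x\<bar> \<le> C"
proof -
 obtain C where C: "\<And>x. \<bar>f x\<bar> \<le> C" using assms unfolding bfs_def by blast
 have "\<bar>f x\<bar> \<le> \<bar>C\<bar> + 1" for x using C[of x] by linarith
 thus ?thesis by (intro exI[of _ "\<bar>C\<bar> + 1"]) auto
qed

lemma bfsE: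
 assumes "f \<in> bfs M"
 obtains C K where "\<And>x. \<bar>f x\<bar> \<le> C" "K \<in> sets M" "emeasure M K < \<infinity>" "\<And>x. x \<notin> K ==> f x = 0"
 using assms unfolding bfs_def by blast

lemma bfs_integrable:
 assumes "f \<in> bfs M" shows "integrable M f"
proof -
 obtain C K where C: "\<And>x. \<bar>f x\<bar> \<le> C" and K: "K \<in> sets M" "emeasure M K < \<infinity>" "\<And>x. x \<notin> K ==> f x = 0"
  by (rule bfsE[OF assms]) (rule that)
 note [measurable] = bfs_meas[OF assms]
 have "integrable M (\<lambda>x. C * indicator K x)"
  using K by (intro integrable_mult_right integrable_real_indicator) auto
 moreover have "\<bar>f x\<bar> \<le> \<bar>C * indicator K x\<bar>" for x
  using C[of x] K(3)[of x] by (cases "x \<in> K") auto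
 ultimately show ?thesis
  by (intro Bochner_Integration.integrable_bound[of M "\<lambda>x. C * indicator K x" f]) auto
qed

lemma bfs_comp:
 assumes f: "f \<in> bfs M" and P: "P \<in> borel_measurable borel" "P 0 = 0"
  and b: "\<And>C. \<exists>D. \<forall>s::real. \<bar>s\<bar> \<le> C \<longrightarrow> \<bar>P s\<bar> \<le> D"
 shows "(\<lambda>x. P (f x)) \<in> bfs M"
proof -
 obtain C K where C: "\<And>x. \<bar>f x\<bar> \<le> C" and K: "K \<in> sets M" "emeasure M K < \<infinity>" "\<And>x. x \<notin> K ==> f x = 0"
  by (rule bfsE[OF f]) (rule that)
 obtain D where D: "\<And>s. \<bar>s\<bar> \<le> C ==> \<bar>P s\<bar> \<le> D" using b[of C] by blast
 note [measurable] = bfs_meas[OF f] P(1)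
 have "(\<lambda>x. P (f x)) \<in> borel_measurable M" by measurable
 thus ?thesis using K P(2) D C unfolding bfs_def by force
qed

lemma bfs_comp_cont:
 assumes f: "f \<in> bfs M" and P: "continuous_on UNIV P" "P 0 = (0::real)"
 shows "(\<lambda>x. P (f x)) \<in> bfs M"
proof (rule bfs_comp[OF f])
 show "P \<in> borel_measurable borel" using P(1) by (rule borel_measurable_continuous_onI)
 fix C :: real
 have "compact (P ` {-C..C})"
  using P(1) by (intro compact_continuous_image continuous_on_subset[OF P(1)]) auto
 then obtain D where "\<And>s. s \<in> {-C..C} ==> norm (P s) \<le> D"
  using bounded_iff compact_imp_bounded by (metis image_eqI)
 thus "\<exists>D. \<forall>s. \<bar>s\<bar> \<le> C \<longrightarrow> \<bar>P s\<bar> \<le> D" by (metis abs_le_iff atLeastAtMost_iff minus_le_iff real_norm_def)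
qed (use P in auto)

lemma bfs_add:
 assumes "f \<in> bfs M" "g \<in> bfs M" shows "(\<lambda>x. f x + g x) \<in> bfs M"
proof -
 obtain C K where C: "\<And>x. \<bar>f x\<bar> \<le> C" and K: "K \<in> sets M" "emeasure M K < \<infinity>" "\<And>x. x \<notin> K ==> f x = 0"
  by (rule bfsE[OF assms(1)]) (rule that)
 obtain C' K' where C': "\<And>x. \<bar>g x\<bar> \<le> C'" and K': "K' \<in> sets M" "emeasure M K' < \<infinity>" "\<And>x. x \<notin> K' ==> g x = 0"
  by (rule bfsE[OF assms(2)]) (rule that)
 note [measurable] = bfs_meas[OF assms(1)] bfs_meas[OF assms(2)]
 have "\<bar>f x + g x\<bar> \<le> C + C'" for x using C[of x] C'[of x] by linarith
 moreover have "emeasure M (K \<union> K') < \<infinity>"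
  using K K' emeasure_subadditive[of K M K'] by (metis ennreal_add_less_top infinity_ennreal_def order_le_less_trans)
 ultimately show ?thesis using K K' unfolding bfs_def
  by (intro CollectI conjI exI[of _ "C+C'"] bexI[of _ "K \<union> K'"]) auto
qed

lemma bfs_mult_bounded:
 assumes "f \<in> bfs M" "g \<in> borel_measurable M" "\<And>x. \<bar>g x\<bar> \<le> C" shows "(\<lambda>x. g x * f x) \<in> bfs M"
proof -
 obtain D K where D: "\<And>x. \<bar>f x\<bar> \<le> D" and K: "K \<in> sets M" "emeasure M K < \<infinity>" "\<And>x. x \<notin> K ==> f x = 0"
  by (rule bfsE[OF assms(1)]) (rule that)
 note [measurable] = bfs_meas[OF assms(1)] assms(2)
 have "\<bar>g x * f x\<bar> \<le> C * D" for x unfolding abs_mult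
  using D[of x] assms(3)[of x] by (intro mult_mono) auto
 thus ?thesis using K unfolding bfs_def by auto
qed

lemma bfs_mult:
 assumes "f \<in> bfs M" "g \<in> bfs M" shows "(\<lambda>x. g x * f x) \<in> bfs M"
 using bfs_mult_bounded[OF assms(1) bfs_meas[OF assms(2)]] bfs_bounded[OF assms(2)] by blast

lemma bfs_cmult: "f \<in> bfs M ==> (\<lambda>x. c * f x) \<in> bfs M"
 using bfs_mult_bounded[of f M "\<lambda>_. c" "\<bar>c\<bar>"] by simp

lemma bfs_Lp:
 assumes "f \<in> bfs M" "r > 0" shows "f \<in> Lp M r"
proof -
 have "(\<lambda>x. \<bar>f x\<bar> powr r) \<in> bfs M"
 proof (rule bfs_comp[OF assms(1)])
  show "\<exists>D. \<forall>s. \<bar>s\<bar> \<le> C \<longrightarrow> \<bar>\<bar>s\<bar> powr r\<bar> \<le> D" for C :: real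
   using assms by (intro exI[of _ "C powr r"]) (auto intro!: powr_mono2)
 qed auto
 thus ?thesis using bfs_integrable bfs_meas[OF assms(1)] by (auto simp: Lp_def)
qed

text \<open>Young's inequality under the integral with the weight left free:
  \<open>Lp_dual_tendsto\<close> lets it depend on the accuracy, \<open>J_lower\<close> fixes it so
  as to absorb a term.\<close>

lemma Lp_dual_bound:
 fixes r s :: real
 assumes rs: "r > 1" "s > 1" "1 / r + 1 / s = 1" and u: "u \<in> Lp M s" and d: "d \<in> Lp M r" and "\<delta> > 0"
 shows "integrable M (\<lambda>x. u x * d x)"
  and "(LINT x|M. \<bar>u x * d x\<bar>) \<le> \<delta> powr s * npow M s u + \<delta> powr (-r) * npow M r d"
proof -
 note [measurable] = Lp_meas[OF u] Lp_meas[OF d]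
 let ?b = "\<lambda>\<delta> x. \<delta> powr s * \<bar>u x\<bar> powr s + \<delta> powr (-r) * \<bar>d x\<bar> powr r"
 have ib: "integrable M (?b \<delta>)" using u d by (auto simp: Lp_int)
 thus i: "integrable M (\<lambda>x. u x * d x)"
 proof (rule Bochner_Integration.integrable_bound)
  show "AE x in M. norm (u x * d x) \<le> norm (?b \<delta> x)"
   using young_delta[OF rs \<open>\<delta> > 0\<close>, of "u _" "d _"] by (intro AE_I2) (simp add: abs_of_nonneg)
 qed measurable
 have "(LINT x|M. \<bar>u x * d x\<bar>) \<le> (LINT x|M. ?b \<delta> x)"
  using i ib by (intro integral_mono young_delta rs assms) auto
 also have "\<dots> = \<delta> powr s * npow M s u + \<delta> powr (-r) * npow M r d"
  using u d by (simp add: Lp_int)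
 finally show "(LINT x|M. \<bar>u x * d x\<bar>) \<le> \<delta> powr s * npow M s u + \<delta> powr (-r) * npow M r d" .
qed

lemma Lp_dual_tendsto:
 fixes r s :: real
 assumes rs: "r > 1" "s > 1" "1 / r + 1 / s = 1" and u: "u \<in> Lp M s" and d: "\<And>k::nat. d k \<in> Lp M r"
  and lim: "(\<lambda>k. npow M r (d k)) \<longlonglongrightarrow> 0"
 shows "(\<lambda>k. LINT x|M. \<bar>u x * d k x\<bar>) \<longlonglongrightarrow> 0" "(\<lambda>k. LINT x|M. u x * d k x) \<longlonglongrightarrow> 0"
proof -
 let ?U = "npow M s u"
 show 1: "(\<lambda>k. LINT x|M. \<bar>u x * d k x\<bar>) \<longlonglongrightarrow> 0"
 proof (rule LIMSEQ_I)
  fix e :: real assume e: "e > 0"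
  have U: "?U \<ge> 0" by simp
  \<comment> \<open>Gives \<delta> powr s * (?U + 1) = e / 2; the + 1 covers ?U = 0.\<close>
  define \<delta> where "\<delta> = (e / 2 / (?U + 1)) powr (1 / s)"
  have "e / 2 / (?U + 1) > 0" using e U by (intro divide_pos_pos) linarith+
  hence dp: "\<delta> > 0" unfolding \<delta>_def by (metis powr_gt_zero less_irrefl)
  have "\<delta> powr s = e / 2 / (?U + 1)" using e U rs by (simp add: \<delta>_def powr_powr)
  hence dU: "\<delta> powr s * ?U < e / 2"
  proof -
   have "\<delta> powr s * ?U < \<delta> powr s * (?U + 1)" using dp by (intro mult_strict_left_mono) auto
   also have "\<dots> = e / 2"
   proof -
    have "?U + 1 \<noteq> 0" using U by linarith
    thus ?thesis using \<open>\<delta> powr s = e / 2 / (?U + 1)\<close> by (metis nonzero_eq_divide_eq)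
   qed
   finally show ?thesis .
  qed
  have "eventually (\<lambda>k. (npow M r (d k)) < e / 2 / \<delta> powr (- r)) sequentially"
   using e dp by (intro order_tendstoD(2)[OF lim]) auto
  then obtain N where N: "\<And>k. k \<ge> N ==> (npow M r (d k)) < e / 2 / \<delta> powr (- r)"
   by (auto simp: eventually_sequentially)
  have "norm ((LINT x|M. \<bar>u x * d k x\<bar>) - 0) < e" if "k \<ge> N" for k
  proof -
   have "\<delta> powr (-r) * npow M r (d k) < e / 2"
    using N[OF that] dp by (simp add: field_simps)
   hence "(LINT x|M. \<bar>u x * d k x\<bar>) < e"
    using Lp_dual_bound(2)[OF rs u d[of k] dp] dU by linarith
   thus ?thesis by simp
  qed
  thus "\<exists>N. \<forall>k\<ge>N. norm ((LINT x|M. \<bar>u x * d k x\<bar>) - 0) < e" by blast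
 qed
 show "(\<lambda>k. LINT x|M. u x * d k x) \<longlonglongrightarrow> 0"
 proof (rule Lim_null_comparison[OF _ 1])
  show "\<forall>\<^sub>F k in sequentially. norm (LINT x|M. u x * d k x) \<le> (LINT x|M. \<bar>u x * d k x\<bar>)"
   using integral_abs_bound by (intro always_eventually) auto
 qed
qed

text \<open>The terms are (2 ^ j * |a (Suc j) - a j|) powr r. They tend to 0, so from some index on
  the increments are at most (1/2) ^ j.\<close>

lemma Cauchy_of_fast:
 fixes a :: "nat \<Rightarrow> real"
 assumes r: "r > 0" and fin: "(\<Sum>j. ennreal (2 powr (real j * r) * \<bar>a (Suc j) - a j\<bar> powr r)) \<noteq> \<infinity>"
 shows "convergent a"
proof -
 have "summable (\<lambda>j. 2 powr (real j * r) * \<bar>a (Suc j) - a j\<bar> powr r)"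
  using fin by (intro summable_suminf_not_top) auto
 hence "(\<lambda>j. 2 powr (real j * r) * \<bar>a (Suc j) - a j\<bar> powr r) \<longlonglongrightarrow> 0" by (rule summable_LIMSEQ_zero)
 hence "eventually (\<lambda>j. 2 powr (real j * r) * \<bar>a (Suc j) - a j\<bar> powr r < 1) sequentially"
  by (rule order_tendstoD) simp
 hence "eventually (\<lambda>j. norm (a (Suc j) - a j) \<le> (1/2)^j) sequentially"
 proof eventually_elim
  case (elim j)
  have "2 powr (real j * r) * \<bar>a (Suc j) - a j\<bar> powr r = (2 ^ j * \<bar>a (Suc j) - a j\<bar>) powr r"
   by (simp add: powr_mult powr_powr[symmetric] powr_realpow)
  with elim have "(2 ^ j * \<bar>a (Suc j) - a j\<bar>) powr r < 1 powr r" by simp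
  hence "2 ^ j * \<bar>a (Suc j) - a j\<bar> \<le> 1"
   using powr_mono2[of r 1 "2 ^ j * \<bar>a (Suc j) - a j\<bar>"] r by force
  thus ?case by (simp add: field_simps power_one_over)
 qed
 hence "summable (\<lambda>j. a (Suc j) - a j)"
  by (rule summable_comparison_test_ev) simp
 hence "convergent (\<lambda>n. \<Sum>j<n. a (Suc j) - a j)" by (simp add: summable_iff_convergent)
 hence "convergent (\<lambda>n. (a n - a 0) + a 0)"
  by (intro convergent_add) (auto simp: sum_lessThan_telescope convergent_const)
 thus ?thesis by simp
qed

text \<open>Riesz-Fischer: a rapidly Cauchy subsequence converges almost everywhere, and Fatou's
  lemma turns closeness to its members into closeness to its limit.\<close>

lemma Lp_complete:
 assumes r: "r > 0" and f: "\<And>k::nat. f k \<in> Lp M r"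
  and cau: "\<And>e. e > 0 ==> \<exists>N. \<forall>k\<ge>N. \<forall>l\<ge>N. (dpow M r (f k) (f l)) < e"
 shows "\<exists>g\<in>Lp M r. (\<lambda>k. dpow M r (f k) g) \<longlonglongrightarrow> 0"
proof -
 note [measurable] = Lp_meas[OF f]
 have fi: "integrable M (\<lambda>x. \<bar>f k x - f l x\<bar> powr r)" for k l
  using Lp_int[OF Lp_diff[OF f f]] r by simp
 \<comment> \<open>The divisor cancels the weight 2 powr (j * r) in \<open>t\<close>, which leaves
   \<integral>t j \<le> (1/2) ^ j.\<close>
 define eps where "eps j = (1/2::real)^j / 2 powr (real j * r)" for j
 have ep: "eps j > 0" for j by (simp add: eps_def)
 have "\<exists>\<sigma>. \<forall>j. (\<forall>k\<ge>\<sigma> j. \<forall>l\<ge>\<sigma> j. (dpow M r (f k) (f l)) < eps j) \<and> \<sigma> (Suc j) > (\<sigma> j :: nat)"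
 proof (intro dependent_nat_choice)
  show "\<exists>x. \<forall>k\<ge>x. \<forall>l\<ge>x. (dpow M r (f k) (f l)) < eps 0" using cau[OF ep] .
  fix n j :: nat
  obtain N where N: "\<forall>k\<ge>N. \<forall>l\<ge>N. (dpow M r (f k) (f l)) < eps (Suc j)" using cau[OF ep] by blast
  thus "\<exists>y. (\<forall>k\<ge>y. \<forall>l\<ge>y. (dpow M r (f k) (f l)) < eps (Suc j)) \<and> n < y"
   by (intro exI[of _ "max N (Suc n)"]) auto
 qed
 then obtain \<sigma> where s1: "\<And>j k l. k \<ge> \<sigma> j ==> l \<ge> \<sigma> j ==> (dpow M r (f k) (f l)) < eps j"
  and s2: "\<And>j. \<sigma> j < (\<sigma> (Suc j) :: nat)" by blast
 have sm: "strict_mono \<sigma>" using s2 by (simp add: strict_mono_Suc_iff)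
 define t where "t j x = 2 powr (real j * r) * \<bar>f (\<sigma> (Suc j)) x - f (\<sigma> j) x\<bar> powr r" for j x
 have "(\<integral>\<^sup>+x. (\<Sum>j. ennreal (t j x)) \<partial>M) = (\<Sum>j. nnint M (t j))"
  unfolding t_def by (intro nn_integral_suminf) measurable
 also have "\<dots> \<le> (\<Sum>j. ennreal ((1/2)^j))"
 proof (intro suminf_le)
  fix j
  have "nnint M (t j) = ennreal (LINT x|M. t j x)"
   unfolding t_def using fi by (intro nn_integral_eq_integral) auto
  also have "(LINT x|M. t j x) \<le> (1/2)^j"
   using s1[of j "\<sigma> (Suc j)" "\<sigma> j"] s2[of j] by (simp add: t_def eps_def field_simps)
  finally show "nnint M (t j) \<le> ennreal ((1/2)^j)" by (simp add: ennreal_leI)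
 qed auto
 also have "\<dots> < \<infinity>" by (simp add: summable_geometric suminf_ennreal2)
 finally have "(\<integral>\<^sup>+x. (\<Sum>j. ennreal (t j x)) \<partial>M) \<noteq> \<infinity>" by simp
 hence "AE x in M. (\<Sum>j. ennreal (t j x)) \<noteq> \<infinity>"
  by (intro nn_integral_noteq_infinite) (auto simp: t_def)
 hence cv: "AE x in M. convergent (\<lambda>j. f (\<sigma> j) x)"
 proof eventually_elim
  case (elim x)
  thus ?case unfolding t_def by (intro Cauchy_of_fast[OF r]) auto
 qed
 define g where "g x = lim (\<lambda>j. f (\<sigma> j) x)" for x
 have [measurable]: "g \<in> borel_measurable M" unfolding g_def by measurable
 have bd: "nnint M (\<lambda>x. \<bar>f k x - g x\<bar> powr r) \<le> ennreal (eps j)" if k: "k \<ge> \<sigma> j" for j k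
 proof -
  have "nnint M (\<lambda>x. \<bar>f k x - g x\<bar> powr r) = (\<integral>\<^sup>+x. liminf (\<lambda>i. ennreal (\<bar>f k x - f (\<sigma> i) x\<bar> powr r)) \<partial>M)"
  proof (intro nn_integral_cong_AE)
   show "AE x in M. ennreal (\<bar>f k x - g x\<bar> powr r) = liminf (\<lambda>i. ennreal (\<bar>f k x - f (\<sigma> i) x\<bar> powr r))"
    using cv
   proof eventually_elim
    case (elim x)
    hence "(\<lambda>j. f (\<sigma> j) x) \<longlonglongrightarrow> g x" by (simp add: g_def convergent_LIMSEQ_iff)
    hence "(\<lambda>j. \<bar>f k x - f (\<sigma> j) x\<bar> powr r) \<longlonglongrightarrow> \<bar>f k x - g x\<bar> powr r"
     using r by (intro tendsto_powr2 tendsto_intros) auto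
    thus ?case by (metis lim_imp_Liminf sequentially_bot tendsto_ennrealI)
   qed
  qed
  also have "\<dots> \<le> liminf (\<lambda>i. nnint M (\<lambda>x. \<bar>f k x - f (\<sigma> i) x\<bar> powr r))"
   by (intro nn_integral_liminf) measurable
  also have "\<dots> \<le> ennreal (eps j)"
  proof (rule Liminf_le)
   show "\<forall>\<^sub>F i in sequentially. (nnint M (\<lambda>x. \<bar>f k x - f (\<sigma> i) x\<bar> powr r)) \<le> ennreal (eps j)"
    using eventually_ge_at_top[of j]
   proof eventually_elim
    case (elim i)
    hence "\<sigma> i \<ge> \<sigma> j" using sm by (simp add: strict_mono_less_eq)
    thus ?case using s1[OF k, of "\<sigma> i"] fi
     by (subst nn_integral_eq_integral) (auto intro!: ennreal_leI)
   qed
  qed simp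
  finally show ?thesis .
 qed
 have dI: "integrable M (\<lambda>x. \<bar>f k x - g x\<bar> powr r)" if "k \<ge> \<sigma> 0" for k
 proof (rule integrableI_bounded)
  have "nnint M (\<lambda>x. norm (\<bar>f k x - g x\<bar> powr r)) \<le> ennreal (eps 0)"
   using bd[OF that] by simp
  also have "\<dots> < \<infinity>" by simp
  finally show "nnint M (\<lambda>x. norm (\<bar>f k x - g x\<bar> powr r)) < \<infinity>" .
 qed measurable
 have "(\<lambda>x. f (\<sigma> 0) x - g x) \<in> Lp M r" using dI[of "\<sigma> 0"] by (simp add: Lp_def)
 from Lp_diff[OF f[of "\<sigma> 0"] this] r have gL: "g \<in> Lp M r" by simp
 have "(\<lambda>k. dpow M r (f k) g) \<longlonglongrightarrow> 0"
 proof (rule LIMSEQ_I)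
  fix e :: real assume "e > 0"
  then obtain j where j: "(1/2::real)^j < e" using real_arch_pow_inv[of e "1/2"] by auto
  have "eps j \<le> (1/2)^j / 1" unfolding eps_def using r by (intro divide_left_mono) (auto simp: ge_one_powr_ge_zero)
  hence ej: "eps j < e" using j by simp
  have "norm (dpow M r (f k) g - 0) < e" if "k \<ge> \<sigma> j" for k
  proof -
   have "\<sigma> j \<ge> \<sigma> 0" using sm by (simp add: strict_mono_less_eq)
   hence "ennreal (dpow M r (f k) g) \<le> ennreal (eps j)"
    using bd[OF that] dI[of k] that by (subst (asm) nn_integral_eq_integral) auto
   thus ?thesis using ej ep[of j] by (simp add: ennreal_le_iff)
  qed
  thus "\<exists>N. \<forall>k\<ge>N. norm (dpow M r (f k) g - 0) < e" by blast
 qed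
 thus ?thesis using gL by blast
qed

text \<open>Both arguments are sequences, so that the convergent sequence and its limit can exchange
  roles in \<open>Lp_norm_tendsto\<close>.\<close>

lemma Lp_norm_tendsto_aux:
 assumes r: "r \<ge> 1" and f: "\<And>k::nat. f k \<in> Lp M r" and g: "\<And>k::nat. g k \<in> Lp M r"
  and lim: "(\<lambda>k. dpow M r (f k) (g k)) \<longlonglongrightarrow> 0"
  and \<theta>: "0 < \<theta>" "\<theta> < 1" and e: "e > 0"
 shows "eventually (\<lambda>k. (npow M r (f k)) < (1 - \<theta>) powr (1 - r) * npow M r (g k) + e) sequentially"
proof -
 have "eventually (\<lambda>k. (dpow M r (f k) (g k)) < e / \<theta> powr (1 - r)) sequentially"
  using e \<theta> by (intro order_tendstoD(2)[OF lim]) auto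
 thus ?thesis
 proof eventually_elim
  case (elim k)
  have I: "integrable M (\<lambda>x. \<bar>f k x - g k x\<bar> powr r)" using Lp_int[OF Lp_diff[OF f g]] r by simp
  have "npow M r (f k) \<le> (LINT x|M. (1 - \<theta>) powr (1 - r) * \<bar>g k x\<bar> powr r + \<theta> powr (1 - r) * \<bar>f k x - g k x\<bar> powr r)"
  proof (rule integral_mono)
   fix x
   have "\<bar>f k x\<bar> powr r \<le> (\<bar>g k x\<bar> + \<bar>f k x - g k x\<bar>) powr r" using r by (intro powr_mono2) auto
   also have "\<dots> \<le> (1 - \<theta>) powr (1 - r) * \<bar>g k x\<bar> powr r + \<theta> powr (1 - r) * \<bar>f k x - g k x\<bar> powr r"
    using r \<theta> by (intro powr_convex_split) auto
   finally show "\<bar>f k x\<bar> powr r \<le> (1 - \<theta>) powr (1 - r) * \<bar>g k x\<bar> powr r + \<theta> powr (1 - r) * \<bar>f k x - g k x\<bar> powr r" .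
  qed (use f g I in \<open>auto simp: Lp_int\<close>)
  also have "\<dots> = (1 - \<theta>) powr (1 - r) * npow M r (g k) + \<theta> powr (1 - r) * dpow M r (f k) (g k)"
   using f g I by (simp add: Lp_int)
  also have "\<theta> powr (1 - r) * dpow M r (f k) (g k) < e" using elim \<theta> by (simp add: field_simps)
  finally show ?case by simp
 qed
qed

lemma small_theta:
 fixes a b r :: real
 assumes "a < b"
 shows "\<exists>\<theta>. 0 < \<theta> \<and> \<theta> < 1 \<and> (1 - \<theta>) powr (1 - r) * a < b"
proof -
 have "((\<lambda>\<theta>. (1 - \<theta>) powr (1 - r) * a) \<longlongrightarrow> (1 - 0) powr (1 - r) * a) (at_right 0)"
  by (intro tendsto_intros) auto
 hence "eventually (\<lambda>\<theta>. (1 - \<theta>) powr (1 - r) * a < b) (at_right 0)"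
  using assms by (intro order_tendstoD) auto
 moreover have "eventually (\<lambda>\<theta>. 0 < \<theta> \<and> \<theta> < 1) (at_right (0::real))"
  by (auto simp: eventually_at_right[of 0 1] intro!: exI[of _ 1])
 ultimately have "eventually (\<lambda>\<theta>. 0 < \<theta> \<and> \<theta> < 1 \<and> (1 - \<theta>) powr (1 - r) * a < b) (at_right 0)"
  by eventually_elim simp
 thus ?thesis by (rule eventually_happens'[rotated]) simp
qed

lemma Lp_norm_tendsto:
 assumes r: "r \<ge> 1" and f: "\<And>k::nat. f k \<in> Lp M r" and g: "g \<in> Lp M r"
  and lim: "(\<lambda>k. dpow M r (f k) g) \<longlonglongrightarrow> 0"
 shows "(\<lambda>k. npow M r (f k)) \<longlonglongrightarrow> npow M r g"
proof (rule order_tendstoI)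
 fix a assume "npow M r g < a"
 then obtain \<theta> where \<theta>: "0 < \<theta>" "\<theta> < 1" "(1 - \<theta>) powr (1 - r) * npow M r g < a"
  using small_theta[of "npow M r g" a r] by auto
 show "\<forall>\<^sub>F k in sequentially. npow M r (f k) < a"
  using Lp_norm_tendsto_aux[OF r f g lim \<theta>(1,2), of "a - (1 - \<theta>) powr (1 - r) * npow M r g"] \<theta>(3) by simp
next
 fix a assume "a < npow M r g"
 then obtain \<theta> where \<theta>: "0 < \<theta>" "\<theta> < 1" "(1 - \<theta>) powr (1 - r) * a < npow M r g"
  using small_theta[of a "npow M r g" r] by auto
 have "(\<lambda>k. dpow M r g (f k)) \<longlonglongrightarrow> 0" using lim by (simp add: abs_minus_commute)
 from Lp_norm_tendsto_aux[OF r g f this \<theta>(1,2), of "npow M r g - (1 - \<theta>) powr (1 - r) * a"] \<theta>(3)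
 have "\<forall>\<^sub>F k in sequentially. (1 - \<theta>) powr (1 - r) * a < (1 - \<theta>) powr (1 - r) * npow M r (f k)" by simp
 thus "\<forall>\<^sub>F k in sequentially. a < npow M r (f k)" by eventually_elim (use \<theta> in simp)
qed

section \<open>The signed power\<close>

lemma abs_spow: "\<bar>spow x a\<bar> = \<bar>x\<bar> powr a"
 by (auto simp: spow_def abs_mult sgn_if)

lemma spow_0 [simp]: "spow 0 a = 0"
 by (simp add: spow_def)

lemma spow_minus: "spow (- x) a = - spow x a"
 by (simp add: spow_def)

lemma sgn_spow: "sgn (spow x a) = sgn x"
 by (auto simp: spow_def sgn_mult sgn_if)

lemma spow_spow: "spow (spow x a) b = spow x (a * b)"
 unfolding spow_def[of "spow x a"] sgn_spow abs_spow by (simp add: spow_def powr_powr)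

lemma spow_one [simp]: "spow x 1 = x"
 by (auto simp: spow_def sgn_if)

lemma spow_inverse:
 assumes "m \<noteq> 0"
 shows "spow (spow x (1 / m)) m = x" "spow (spow x m) (1 / m) = x"
 using assms by (auto simp: spow_spow)

lemma spow_nonneg: "x \<ge> 0 ==> spow x a = x powr a"
 by (auto simp: spow_def sgn_if)

lemma spow_mono:
 assumes "a \<ge> 0" "x \<le> y"
 shows "spow x a \<le> spow y a"
proof -
 consider "0 \<le> x" | "x < 0" "0 \<le> y" | "x < 0" "y < 0" by linarith
 thus ?thesis
 proof cases
  case 1 thus ?thesis using assms by (simp add: spow_nonneg powr_mono2)
 next
  case 2 thus ?thesis by (simp add: spow_def sgn_if) (smt (verit) powr_ge_zero)
 next
  case 3 thus ?thesis using assms by (simp add: spow_def powr_mono2)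
 qed
qed

lemma continuous_spow:
 assumes "a > 0"
 shows "continuous_on UNIV (\<lambda>x. spow x a)"
proof -
 have *: "spow x a = (max x 0) powr a - (max (- x) 0) powr a" for x
  using assms by (auto simp: spow_def sgn_if max_def)
 show ?thesis unfolding * using assms by (intro continuous_on_diff continuous_on_powr' continuous_intros) auto
qed

lemma borel_measurable_spow [measurable]: "(\<lambda>x. spow x a) \<in> borel_measurable borel"
 unfolding spow_def by measurable

lemma tendsto_spow:
 assumes "a > 0" "(f \<longlongrightarrow> l) F" shows "((\<lambda>x. spow (f x) a) \<longlongrightarrow> spow l a) F"
 by (rule continuous_on_tendsto_compose[OF continuous_spow[OF assms(1)] assms(2)]) auto

text \<open>The convex function |z| powr r / r lies above its tangents, with slope
  \<open>spow z (r - 1)\<close> at z. Young's inequality with the conjugate exponent q shows this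
  without a derivative.\<close>

lemma spow_tangent:
 fixes r a z :: real
 assumes r: "r > 1"
 shows "\<bar>z\<bar> powr r / r + spow z (r - 1) * (a - z) \<le> \<bar>a\<bar> powr r / r"
proof -
 define q where "q = r / (r - 1)"
 have q: "q > 1" "1 / q + 1 / r = 1" using r by (auto simp: q_def field_simps)
 have "spow z (r - 1) * a \<le> \<bar>z\<bar> powr (r - 1) * \<bar>a\<bar>"
  by (metis abs_ge_self abs_mult abs_spow)
 also have "\<dots> \<le> (\<bar>z\<bar> powr (r - 1)) powr q / q + \<bar>a\<bar> powr r / r"
  using q r by (intro Youngs_inequality) auto
 also have "(\<bar>z\<bar> powr (r - 1)) powr q = \<bar>z\<bar> powr r" using r by (simp add: powr_powr q_def)
 finally have 1: "spow z (r - 1) * a \<le> \<bar>z\<bar> powr r / q + \<bar>a\<bar> powr r / r" .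
 have "spow z (r - 1) * z = \<bar>z\<bar> powr r"
  using powr_mult_base[of "\<bar>z\<bar>" "r - 1"] by (auto simp: spow_def sgn_if mult.commute)
 moreover have "\<bar>z\<bar> powr r / q = \<bar>z\<bar> powr r - \<bar>z\<bar> powr r / r"
  using r by (simp add: q_def field_simps)
 ultimately show ?thesis using 1 by (simp add: algebra_simps)
qed

section \<open>Dirichlet forms with a chain rule\<close>

text \<open>\<open>P 0 = 0\<close> makes composition with P preserve supports. P' may be unbounded:
  the functions to be composed with P are bounded.\<close>

definition C1_fun :: "(real \<Rightarrow> real) \<Rightarrow> (real \<Rightarrow> real) \<Rightarrow> bool" where
 "C1_fun P P' \<longleftrightarrow> (\<forall>s. (P has_real_derivative P' s) (at s)) \<and> continuous_on UNIV P' \<and> P 0 = 0"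

lemma C1_fun_cont: "C1_fun P P' ==> continuous_on UNIV P"
 unfolding C1_fun_def by (meson DERIV_isCont continuous_at_imp_continuous_on)

text \<open>As \<open>n\<close> grows, these \<open>C\<^sup>1\<close> functions approach the indicator function of the positive half line.\<close>

definition heav :: "real \<Rightarrow> real \<Rightarrow> real" where
 "heav n s = (max 0 (n * s))\<^sup>2 / (1 + (max 0 (n * s))\<^sup>2)"

definition heav' :: "real \<Rightarrow> real \<Rightarrow> real" where
 "heav' n s = 2 * n * max 0 (n * s) / (1 + (max 0 (n * s))\<^sup>2)\<^sup>2"

lemma max_sq_deriv: "((\<lambda>s::real. (max 0 s)\<^sup>2) has_real_derivative 2 * max 0 s) (at s)"
proof -
 consider "s > 0" | "s < 0" | "s = 0" by linarith
 thus ?thesis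
 proof cases
  case 1
  have "((\<lambda>s::real. s\<^sup>2) has_real_derivative 2 * max 0 s) (at s)"
   using 1 by (auto intro!: derivative_eq_intros)
  thus ?thesis
   by (rule has_field_derivative_transform_within_open[where S = "{0<..}"]) (use 1 in auto)
 next
  case 2
  have "((\<lambda>s::real. 0) has_real_derivative 2 * max 0 s) (at s)"
   using 2 by (auto intro!: derivative_eq_intros)
  thus ?thesis
   by (rule has_field_derivative_transform_within_open[where S = "{..<0}"]) (use 2 in auto)
 next
  case 3
  have "((\<lambda>h::real. (max 0 h)\<^sup>2 / h) \<longlongrightarrow> 0) (at 0)"
  proof (rule Lim_null_comparison)
   show "\<forall>\<^sub>F h in at 0. norm ((max 0 h)\<^sup>2 / h) \<le> \<bar>h\<bar>"
    by (intro always_eventually) (auto simp: max_def power2_eq_square)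
   show "((\<lambda>h::real. \<bar>h\<bar>) \<longlongrightarrow> 0) (at 0)" by (rule tendsto_rabs_zero) (rule tendsto_ident_at)
  qed
  thus ?thesis using 3 by (simp add: has_field_derivative_iff)
 qed
qed

lemma heav_C1: "C1_fun (heav n) (heav' n)"
proof -
 have p: "1 + (max 0 x)\<^sup>2 \<noteq> 0" for x :: real
  by (metis add_less_le_mono add.right_neutral less_irrefl zero_le_power2 zero_less_one)
 have "(heav n has_real_derivative heav' n s) (at s)" for s
 proof -
  have 1: "((\<lambda>s. (max 0 (n * s))\<^sup>2) has_real_derivative 2 * max 0 (n * s) * n) (at s)"
   by (rule DERIV_chain2[OF max_sq_deriv]) (auto intro!: derivative_eq_intros)
  show ?thesis unfolding heav_def[abs_def] heav'_def
   by (rule derivative_eq_intros 1 refl p)+ (simp add: field_simps power2_eq_square)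
 qed
 moreover have "continuous_on UNIV (heav' n)"
  unfolding heav'_def using p by (intro continuous_intros ballI) auto
 ultimately show ?thesis unfolding C1_fun_def by (simp add: heav_def)
qed

lemma heav_bounds: "0 \<le> heav n s" "heav n s \<le> 1"
 by (auto simp: heav_def divide_le_eq add_pos_nonneg)

lemma heav'_bounds:
 assumes "n \<ge> 0" shows "0 \<le> heav' n s" "heav' n s \<le> 2 * n"
proof -
 show "0 \<le> heav' n s" using assms by (auto simp: heav'_def)
 define t where "t = max 0 (n * s)"
 have t: "t \<ge> 0" by (simp add: t_def)
 have "t \<le> 1 + t\<^sup>2" using sum_power2_ge_zero[of "t - 1" 0] t by (auto simp: power2_eq_square algebra_simps)
 also have "\<dots> = 1 * (1 + t\<^sup>2)" by simp
 also have "\<dots> \<le> (1 + t\<^sup>2) * (1 + t\<^sup>2)" by (intro mult_right_mono) auto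
 also have "\<dots> = (1 + t\<^sup>2)\<^sup>2" by (simp only: power2_eq_square)
 finally have "t / (1 + t\<^sup>2)\<^sup>2 \<le> 1" by (simp add: divide_le_eq_1)
 hence "2 * n * (t / (1 + t\<^sup>2)\<^sup>2) \<le> 2 * n * 1" using assms by (intro mult_left_mono) auto
 thus "heav' n s \<le> 2 * n" by (simp add: heav'_def t_def)
qed

lemma heav_nonpos:
 assumes "n \<ge> 0" "s \<le> 0" shows "heav n s = 0"
proof -
 have "max 0 (n * s) = 0" using mult_nonneg_nonpos[OF assms] by simp
 thus ?thesis by (simp add: heav_def)
qed

lemma heav_lipschitz:
 assumes "n \<ge> 0" shows "\<bar>heav n a - heav n b\<bar> \<le> 2 * n * \<bar>a - b\<bar>"
 using field_differentiable_bound[of UNIV "heav n" "heav' n" "2 * n" a b] heav_C1[of n] heav'_bounds[OF assms]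
 by (auto simp: C1_fun_def)

text \<open>For a minimising sequence: I is the infimum, u the value at the midpoint, a and b are
  the values at two members.\<close>

lemma midpoint_aux:
 fixes I u X Y a b p q :: real
 assumes "I \<le> u" "u + X + Y \<le> (a + b) / 2" "a < I + p" "b < I + q"
 shows "X + Y \<le> (p + q) / 2"
 using assms by (simp add: field_simps)

lemma heav_limit:
 assumes "s > 0" shows "(\<lambda>k. heav (real k) s) \<longlonglongrightarrow> 1"
proof -
 have "(\<lambda>k. 1 - 1 / (1 + (real k * s)\<^sup>2)) \<longlonglongrightarrow> 1 - 0"
 proof (intro tendsto_diff tendsto_const)
  have "filterlim (\<lambda>k. real k * s) at_top sequentially"
   using assms by (intro filterlim_tendsto_pos_mult_at_top[of _ s] filterlim_real_sequentially
     filterlim_at_top_mult_tendsto_pos[of _ s]) (auto intro: tendsto_const)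
  hence "filterlim (\<lambda>k. 1 + (real k * s)\<^sup>2) at_top sequentially"
   by (intro filterlim_tendsto_add_at_top[OF tendsto_const] filterlim_pow_at_top) auto
  thus "(\<lambda>k. 1 / (1 + (real k * s)\<^sup>2)) \<longlonglongrightarrow> 0"
   by (intro real_tendsto_divide_at_top[OF tendsto_const])
 qed
 moreover have "heav (real k) s = 1 - 1 / (1 + (real k * s)\<^sup>2)" for k
 proof -
  have "1 + (real k * s)\<^sup>2 \<noteq> 0" by (metis add_less_le_mono add.right_neutral less_irrefl zero_le_power2 zero_less_one)
  thus ?thesis using assms by (simp add: heav_def max_def field_simps)
 qed
 ultimately show ?thesis by simp
qed

text \<open>In the application \<open>M\<close> is the volume measure, \<open>D\<close> consists of the \<open>C\<^sup>1\<close> functions with compact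
 support and \<open>\<Gamma> f h\<close> is the inner product of the gradients.\<close>

locale dirichlet_form =
 fixes M :: "'a measure" and D :: "'a fn set"
  and \<Gamma> :: "'a fn \<Rightarrow> 'a fn \<Rightarrow> 'a \<Rightarrow> real"
  and m :: real
 assumes m_pos: "0 < m" and m_less1: "m < 1"
  and D_bfs: "f \<in> D ==> f \<in> bfs M"
  and D_0: "(\<lambda>_. 0) \<in> D"
  and D_add: "f \<in> D ==> h \<in> D ==> (\<lambda>x. f x + h x) \<in> D"
  and D_comp: "f \<in> D ==> C1_fun P P' ==> (\<lambda>x. P (f x)) \<in> D"
  and \<Gamma>_bfs: "f \<in> D ==> h \<in> D ==> \<Gamma> f h \<in> bfs M"
  and \<Gamma>_sym: "f \<in> D ==> h \<in> D ==> \<Gamma> f h = \<Gamma> h f"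
  and \<Gamma>_add: "f \<in> D ==> f' \<in> D ==> h \<in> D ==> \<Gamma> (\<lambda>x. f x + f' x) h = (\<lambda>x. \<Gamma> f h x + \<Gamma> f' h x)"
  and \<Gamma>_comp: "f \<in> D ==> h \<in> D ==> C1_fun P P' ==> \<Gamma> (\<lambda>x. P (f x)) h = (\<lambda>x. P' (f x) * \<Gamma> f h x)"
  and \<Gamma>_nonneg: "f \<in> D ==> \<Gamma> f f x \<ge> 0"
begin

text \<open>\<open>bet\<close> inverts the signed power of order m: for w = u^m it recovers
  u.\<close>

abbreviation "bet s \<equiv> spow s (1 / m)"
abbreviation "ip u v \<equiv> LINT x|M. u x * (v x :: real)"
abbreviation "sip u v \<equiv> LINT x|M. spow (u x) m * v x"

text \<open>The exponent conjugate to 1 + m, chosen so that |w| powr rr / rr has the derivative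
  \<open>bet w\<close>.\<close>

definition rr :: real where "rr = 1 + 1 / m"

lemma rr: "rr > 2" "1 / rr + 1 / (1 + m) = 1" "rr - 1 = 1 / m"
 using m_pos m_less1 by (auto simp: rr_def field_simps)

lemma rr1: "rr > 1" "rr > 0" "rr \<ge> 1" "rr \<ge> 0" "1 + m > 1" "1 + m \<ge> 0" using rr(1) m_pos by linarith+

lemma D_cmult: "f \<in> D ==> (\<lambda>x. c * f x) \<in> D"
 using D_comp[of f "\<lambda>s. c * s" "\<lambda>_. c"] by (auto simp: C1_fun_def intro!: derivative_eq_intros)

lemma D_diff: "f \<in> D ==> h \<in> D ==> (\<lambda>x. f x - h x) \<in> D"
 using D_add[of f "\<lambda>x. (-1) * h x"] D_cmult[of h "-1"] by simp

lemma D_Lp: "f \<in> D ==> r > 0 ==> f \<in> Lp M r"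
 by (intro bfs_Lp D_bfs)

lemma \<Gamma>_cmult: "f \<in> D ==> h \<in> D ==> \<Gamma> (\<lambda>x. c * f x) h = (\<lambda>x. c * \<Gamma> f h x)"
 using \<Gamma>_comp[of f h "\<lambda>s. c * s" "\<lambda>_. c"] by (auto simp: C1_fun_def intro!: derivative_eq_intros)

lemma \<Gamma>_diff:
 assumes "f \<in> D" "f' \<in> D" "h \<in> D"
 shows "\<Gamma> (\<lambda>x. f x - f' x) h = (\<lambda>x. \<Gamma> f h x - \<Gamma> f' h x)"
 using \<Gamma>_add[OF assms(1) D_cmult[OF assms(2), of "-1"] assms(3)] \<Gamma>_cmult[OF assms(2,3), of "-1"] by simp

definition E :: "'a fn \<Rightarrow> 'a fn \<Rightarrow> real" where
 "E f h = (LINT x|M. \<Gamma> f h x)"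

abbreviation "Ed f h \<equiv> E (\<lambda>x. f x - h x) (\<lambda>x. f x - h x)"

lemma E_sym: "f \<in> D ==> h \<in> D ==> E f h = E h f"
 by (simp add: E_def \<Gamma>_sym)

lemma E_add:
 assumes "f \<in> D" "f' \<in> D" "h \<in> D"
 shows "E (\<lambda>x. f x + f' x) h = E f h + E f' h"
 unfolding E_def \<Gamma>_add[OF assms]
 by (rule Bochner_Integration.integral_add[OF bfs_integrable[OF \<Gamma>_bfs[OF assms(1,3)]] bfs_integrable[OF \<Gamma>_bfs[OF assms(2,3)]]])

lemma E_diff:
 assumes "f \<in> D" "f' \<in> D" "h \<in> D"
 shows "E (\<lambda>x. f x - f' x) h = E f h - E f' h"
 unfolding E_def \<Gamma>_diff[OF assms]
 by (rule Bochner_Integration.integral_diff[OF bfs_integrable[OF \<Gamma>_bfs[OF assms(1,3)]] bfs_integrable[OF \<Gamma>_bfs[OF assms(2,3)]]])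

lemma E_cmult: "f \<in> D ==> h \<in> D ==> E (\<lambda>x. c * f x) h = c * E f h"
 by (simp add: E_def \<Gamma>_cmult)

lemma E_add2:
 assumes "f \<in> D" "f' \<in> D" "h \<in> D"
 shows "E h (\<lambda>x. f x + f' x) = E h f + E h f'"
 using E_add[OF assms] E_sym[OF D_add[OF assms(1,2)] assms(3)] E_sym[OF assms(1,3)] E_sym[OF assms(2,3)] by simp

lemma E_diff2:
 assumes "f \<in> D" "f' \<in> D" "h \<in> D"
 shows "E h (\<lambda>x. f x - f' x) = E h f - E h f'"
 using E_diff[OF assms] E_sym[OF D_diff[OF assms(1,2)] assms(3)] E_sym[OF assms(1,3)] E_sym[OF assms(2,3)] by simp

lemma E_cmult2: "f \<in> D ==> h \<in> D ==> E h (\<lambda>x. c * f x) = c * E h f"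
 using E_cmult[of f h c] E_sym[of "\<lambda>x. c * f x" h] E_sym[of f h] D_cmult[of f c] by simp

lemma E_nonneg: "f \<in> D ==> E f f \<ge> 0"
 by (simp add: E_def \<Gamma>_nonneg)

lemma E_shift: "f \<in> D ==> h \<in> D ==> E (\<lambda>x. f x + s * h x) (\<lambda>x. f x + s * h x) = E f f + 2 * s * E f h + s\<^sup>2 * E h h"
 using E_sym[of f h] by (simp add: E_add E_add2 E_cmult E_cmult2 D_add D_cmult power2_eq_square algebra_simps)

lemma E_CS:
 assumes f: "f \<in> D" and h: "h \<in> D"
 shows "(E f h)\<^sup>2 \<le> E f f * E h h"
proof (cases "E h h = 0")
 case False
 hence p: "E h h > 0" using E_nonneg[OF h] by simp
 define s where "s = - E f h / E h h"
 have "0 \<le> E (\<lambda>x. f x + s * h x) (\<lambda>x. f x + s * h x)" by (intro E_nonneg D_add D_cmult f h)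
 also have "\<dots> = E f f - (E f h)\<^sup>2 / E h h"
  unfolding E_shift[OF f h] s_def using p by (simp add: field_simps power2_eq_square)
 finally show ?thesis using p by (simp add: field_simps)
next
 case True
 have "E f h = 0"
 proof (rule ccontr)
  assume n: "E f h \<noteq> 0"
  \<comment> \<open>Makes E f f + 2 * s * E f h equal to -1: an affine function of s cannot stay
    nonnegative.\<close>
  define s where "s = - (E f f + 1) / (2 * E f h)"
  have "0 \<le> E (\<lambda>x. f x + s * h x) (\<lambda>x. f x + s * h x)" by (intro E_nonneg D_add D_cmult f h)
  also have "\<dots> = -1" unfolding E_shift[OF f h] s_def using n True by (simp add: field_simps)
  finally show False by simp
 qed
 thus ?thesis using True by simp
qed

section \<open>The resolvent equation\<close>

text \<open>The Euler-Lagrange equation of this functional is bet w - h \<Delta>w = f.\<close>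

definition J :: "real \<Rightarrow> 'a fn \<Rightarrow> 'a fn \<Rightarrow> real" where
 "J h f w = npow M rr w / rr + h / 2 * E w w - ip f w"

text \<open>Weak solutions \<open>w\<close> of \<open>bet w - h \<Delta>w = f\<close> in the completion of \<open>D\<close>.\<close>

definition esol :: "real \<Rightarrow> 'a fn \<Rightarrow> 'a fn \<Rightarrow> bool" where
 "esol h f w \<longleftrightarrow> w \<in> Lp M rr \<and> (\<exists>ws. (\<forall>k::nat. ws k \<in> D) \<and>
   (\<lambda>k. dpow M rr (ws k) w) \<longlonglongrightarrow> 0 \<and>
   (\<forall>e>0. \<exists>N. \<forall>k\<ge>N. \<forall>l\<ge>N. Ed (ws k) (ws l) < e) \<and>
   (\<forall>\<eta>\<in>D. (\<lambda>k. E (ws k) \<eta>) \<longlonglongrightarrow> (LINT x|M. (f x - bet (w x)) * \<eta> x) / h))"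

lemma Lp_spow: "w \<in> Lp M rr ==> (\<lambda>x. bet (w x)) \<in> Lp M (1 + m)"
proof -
 have "1 / m * (1 + m) = rr" using m_pos by (simp add: rr_def field_simps)
 thus "w \<in> Lp M rr ==> (\<lambda>x. bet (w x)) \<in> Lp M (1 + m)"
  by (auto simp: Lp_def abs_spow powr_powr)
qed

lemma Lp_pair: "u \<in> Lp M (1 + m) ==> v \<in> Lp M rr ==> integrable M (\<lambda>x. u x * v x)"
 by (rule Lp_dual_bound(1)[OF rr1(1) rr1(5) rr(2) _ _ zero_less_one])

lemma J_lower:
 assumes h: "h \<ge> 0" and f: "f \<in> Lp M (1 + m)"
 shows "\<exists>C. \<forall>w\<in>D. C \<le> J h f w"
proof -
 \<comment> \<open>With this weight Young's inequality absorbs the linear term exactly into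
   \<open>npow M rr w / rr\<close>.\<close>
 define \<delta> where "\<delta> = rr powr (1 / rr)"
 have d: "\<delta> > 0" "\<delta> powr (- rr) = 1 / rr"
  using rr1 by (auto simp: \<delta>_def powr_powr powr_minus_divide)
 have "- (\<delta> powr (1 + m) * (LINT x|M. \<bar>f x\<bar> powr (1 + m))) \<le> J h f w" if w: "w \<in> D" for w
 proof -
  note b = Lp_dual_bound[OF rr1(1) rr1(5) rr(2) f D_Lp[OF w rr1(2)] d(1)]
  have "ip f w \<le> (LINT x|M. \<bar>f x * w x\<bar>)"
   using b(1) by (intro integral_mono) auto
  moreover have "0 \<le> h / 2 * E w w" using h E_nonneg[OF w] by simp
  ultimately show ?thesis using b(2) unfolding J_def d(2) by simp
 qed
 thus ?thesis by blast
qed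

text \<open>Uniform convexity in the \<open>rr\<close>-distance and in the energy at once:
  Clarkson's inequality for the power, the parallelogram identity for E, while the linear term
  cancels.\<close>

lemma J_mid:
 assumes a: "a \<in> D" and b: "b \<in> D" and f: "f \<in> Lp M (1 + m)"
 defines "d \<equiv> \<lambda>x. a x - b x"
 shows "J h f (\<lambda>x. 1/2 * (a x + b x)) + (1/2) powr rr / rr * npow M rr d + h / 8 * E d d
   \<le> (J h f a + J h f b) / 2"
proof -
 have ab: "(\<lambda>x. a x + b x) \<in> D" "d \<in> D" unfolding d_def by (intro D_add D_diff a b)+
 have I: "integrable M (\<lambda>x. \<bar>w x\<bar> powr rr)" if "w \<in> D" for w using Lp_int[OF D_Lp[OF that rr1(2)]] .
 have F: "integrable M (\<lambda>x. f x * w x)" if "w \<in> D" for w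
  using Lp_pair[OF f D_Lp[OF that rr1(2)]] by simp
 have "(LINT x|M. \<bar>1/2 * (a x + b x)\<bar> powr rr) + (LINT x|M. \<bar>1/2 * d x\<bar> powr rr)
   = (LINT x|M. \<bar>1/2 * (a x + b x)\<bar> powr rr + \<bar>1/2 * d x\<bar> powr rr)"
  by (intro Bochner_Integration.integral_add[symmetric] I D_cmult ab)
 also have "\<dots> \<le> (LINT x|M. (\<bar>a x\<bar> powr rr + \<bar>b x\<bar> powr rr) / 2)"
 proof (rule integral_mono)
  show "integrable M (\<lambda>x. \<bar>1/2 * (a x + b x)\<bar> powr rr + \<bar>1/2 * d x\<bar> powr rr)"
   by (intro Bochner_Integration.integrable_add I D_cmult ab)
  show "integrable M (\<lambda>x. (\<bar>a x\<bar> powr rr + \<bar>b x\<bar> powr rr) / 2)" using I[OF a] I[OF b] by simp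
  show "\<bar>1/2 * (a x + b x)\<bar> powr rr + \<bar>1/2 * d x\<bar> powr rr \<le> (\<bar>a x\<bar> powr rr + \<bar>b x\<bar> powr rr) / 2" for x
   using clarkson[of rr "a x" "b x"] rr by (simp add: d_def)
 qed
 also have "\<dots> = (npow M rr a + npow M rr b) / 2" using I[OF a] I[OF b] by simp
 finally have "((LINT x|M. \<bar>1/2 * (a x + b x)\<bar> powr rr) + (LINT x|M. \<bar>1/2 * d x\<bar> powr rr)) / rr
   \<le> ((npow M rr a + npow M rr b) / 2) / rr"
  using rr1 by (intro divide_right_mono)
 hence 1: "(LINT x|M. \<bar>1/2 * (a x + b x)\<bar> powr rr) / rr + (LINT x|M. \<bar>1/2 * d x\<bar> powr rr) / rr
   \<le> ((npow M rr a) / rr + npow M rr b / rr) / 2"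
  by (simp only: add_divide_distrib divide_divide_eq_left mult.commute)
 have 2: "(LINT x|M. \<bar>1/2 * d x\<bar> powr rr) = (1/2) powr rr * npow M rr d"
  unfolding abs_mult powr_mult by simp
 have 3: "E (\<lambda>x. 1/2 * (a x + b x)) (\<lambda>x. 1/2 * (a x + b x)) = 1/4 * (E a a + 2 * E a b + E b b)"
  using a b ab E_sym[OF a b] by (simp only: E_cmult E_cmult2 E_add E_add2 D_cmult) simp
 have 4: "E d d = E a a - 2 * E a b + E b b"
  unfolding d_def using a b E_sym[OF a b] by (simp add: E_diff E_diff2 D_diff)
 have 5: "(LINT x|M. f x * (1/2 * (a x + b x))) = (ip f a + ip f b) / 2"
  using F[OF a] F[OF b] by (simp add: ring_distribs add_divide_distrib)
 have 6: "(LINT x|M. \<bar>1/2 * d x\<bar> powr rr) / rr = (1/2) powr rr / rr * npow M rr d"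
  unfolding 2 by simp
 have aux: "P + h / 2 * (1/4 * (u + 2 * v + w)) - (p + q) / 2 + X + h / 8 * (u - 2 * v + w)
   \<le> (A + h / 2 * u - p + (B + h / 2 * w - q)) / 2" if "P + X \<le> (A + B) / 2" for P X A B u v w p q :: real
  using that by (simp add: algebra_simps add_divide_distrib diff_divide_distrib)
 show ?thesis unfolding J_def 3 4 5 using 1 unfolding 6 by (rule aux)
qed

text \<open>Cauchy-Schwarz; K + 1 instead of K avoids a division by 0.\<close>

lemma E_abs_less:
 assumes f: "f \<in> D" and h: "h \<in> D" and e: "e > 0" and K: "E h h \<le> K" and s: "E f f < e\<^sup>2 / (K + 1)"
 shows "\<bar>E f h\<bar> < e"
proof -
 have K0: "K \<ge> 0" using E_nonneg[OF h] K by linarith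
 have "(E f h)\<^sup>2 \<le> E f f * E h h" by (rule E_CS[OF f h])
 also have "\<dots> \<le> E f f * (K + 1)" using E_nonneg[OF f] K by (intro mult_left_mono) auto
 also have "\<dots> < e\<^sup>2" using s K0 by (simp add: pos_less_divide_eq)
 finally show ?thesis using e by (metis abs_of_pos real_sqrt_abs real_sqrt_less_iff)
qed

text \<open>The direct method. By \<open>J_mid\<close> a minimising sequence is Cauchy in the
  \<open>rr\<close>-distance and in energy, so it converges strongly. The limit w may lie outside D;
  its energy enters only through the limits of E (ws k) \<eta>.\<close>

lemma resolvent_exists:
 assumes h: "h > 0" and f: "f \<in> Lp M (1 + m)"
 shows "\<exists>w. esol h f w"
proof -
 obtain C where C: "\<And>w. w \<in> D ==> C \<le> J h f w" using J_lower[of h f] h f by auto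
 define I where "I = Inf (J h f ` D)"
 have bdd: "bdd_below (J h f ` D)" using C by (intro bdd_belowI2) auto
 have I: "I \<le> J h f w" if "w \<in> D" for w unfolding I_def using that bdd by (intro cInf_lower) auto
 have "\<exists>w\<in>D. J h f w < I + 1 / real (Suc k)" for k
  using cInf_lessD[of "J h f ` D" "I + 1 / real (Suc k)"] D_0 unfolding I_def by auto
 then obtain ws where ws: "\<And>k. ws k \<in> D" "\<And>k. J h f (ws k) < I + 1 / real (Suc k)" by metis
 have Jlim: "(\<lambda>k. J h f (ws k)) \<longlonglongrightarrow> I"
 proof (rule tendsto_sandwich)
  show "\<forall>\<^sub>F k in sequentially. I \<le> J h f (ws k)" using I ws by (intro always_eventually) auto
  show "\<forall>\<^sub>F k in sequentially. J h f (ws k) \<le> I + 1 / real (Suc k)" using ws(2) by (intro always_eventually) (auto intro: less_imp_le)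
  show "(\<lambda>k. I + 1 / real (Suc k)) \<longlonglongrightarrow> I"
   using tendsto_add[OF tendsto_const[of I] LIMSEQ_inverse_real_of_nat] by (simp add: inverse_eq_divide)
 qed simp
 define A where "A k l = dpow M rr (ws k) (ws l)" for k l
 define B where "B k l = Ed (ws k) (ws l)" for k l
 have A0: "A k l \<ge> 0" and B0: "B k l \<ge> 0" for k l
  unfolding A_def B_def by (auto intro!: E_nonneg D_diff ws)
 have c0: "(1/2) powr rr / rr > 0" using rr1 by simp
 \<comment> \<open>The midpoint of two nearly minimal members cannot fall below the infimum, so the
   surplus in \<open>J_mid\<close> must be small.\<close>
 have AB: "(1/2) powr rr / rr * A k l + h / 8 * B k l \<le> (1 / real (Suc k) + 1 / real (Suc l)) / 2" for k l
 proof -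
  have "I \<le> J h f (\<lambda>x. 1/2 * (ws k x + ws l x))" by (intro I D_cmult D_add ws)
  thus ?thesis using J_mid[OF ws(1)[of k] ws(1)[of l] f, of h, folded A_def B_def] ws(2)[of k] ws(2)[of l]
   by (rule midpoint_aux)
 qed
 have sm: "\<exists>N. \<forall>k\<ge>N. \<forall>l\<ge>N. (1 / real (Suc k) + 1 / real (Suc l)) / 2 < e" if e: "e > 0" for e :: real
 proof -
  obtain N where N: "1 / real (Suc N) < e" by (rule nat_approx_posE[OF e])
  have *: "1 / real (Suc k) < e" if "k \<ge> N" for k
   by (rule le_less_trans[OF _ N]) (use that in \<open>simp add: frac_le\<close>)
  have "(1 / real (Suc k) + 1 / real (Suc l)) / 2 < e" if "k \<ge> N" "l \<ge> N" for k l
   using add_strict_mono[OF *[OF that(1)] *[OF that(2)]] by simp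
  thus ?thesis by blast
 qed
 have cauA: "\<exists>N. \<forall>k\<ge>N. \<forall>l\<ge>N. A k l < e" if e: "e > 0" for e
 proof -
  obtain N where N: "\<And>k l. k \<ge> N ==> l \<ge> N ==> (1 / real (Suc k) + 1 / real (Suc l)) / 2 < (1/2) powr rr / rr * e"
   using sm[of "(1/2) powr rr / rr * e"] e c0 by (metis mult_pos_pos)
  have "A k l < e" if "k \<ge> N" "l \<ge> N" for k l
  proof -
   have "0 \<le> h / 8 * B k l" using h B0 by simp
   hence "(1/2) powr rr / rr * A k l < (1/2) powr rr / rr * e" using AB[of k l] N[OF that] by linarith
   thus ?thesis using c0 by (simp only: mult_less_cancel_left_pos)
  qed
  thus ?thesis by blast
 qed
 have cauB: "\<exists>N. \<forall>k\<ge>N. \<forall>l\<ge>N. B k l < e" if e: "e > 0" for e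
 proof -
  obtain N where N: "\<And>k l. k \<ge> N ==> l \<ge> N ==> (1 / real (Suc k) + 1 / real (Suc l)) / 2 < h / 8 * e"
   using sm[of "h / 8 * e"] e h by (metis mult_pos_pos zero_less_divide_iff zero_less_numeral)
  have "B k l < e" if "k \<ge> N" "l \<ge> N" for k l
  proof -
   have "0 \<le> (1/2) powr rr / rr * A k l" using c0 A0[of k l] by (metis less_imp_le mult_nonneg_nonneg)
   hence "h / 8 * B k l < h / 8 * e" using AB[of k l] N[OF that] by linarith
   thus ?thesis using h by simp
  qed
  thus ?thesis by blast
 qed
 obtain w where w: "w \<in> Lp M rr" "(\<lambda>k. dpow M rr (ws k) w) \<longlonglongrightarrow> 0"
  using Lp_complete[of rr ws M] rr1 D_Lp[OF ws(1)] cauA unfolding A_def by blast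
 have [measurable]: "w \<in> borel_measurable M" "f \<in> borel_measurable M"
  using w(1) f by (auto dest: Lp_meas)
 \<comment> \<open>The sequence is Cauchy in energy, so Cauchy-Schwarz makes its pairing with each
   fixed \<eta> converge.\<close>
 have cE: "convergent (\<lambda>k. E (ws k) \<eta>)" if \<eta>: "\<eta> \<in> D" for \<eta>
 proof (rule real_Cauchy_convergent, rule metric_CauchyI)
  fix e :: real assume e: "e > 0"
  obtain N where N: "\<And>k l. k \<ge> N ==> l \<ge> N ==> B k l < e\<^sup>2 / (E \<eta> \<eta> + 1)"
   using cauB[of "e\<^sup>2 / (E \<eta> \<eta> + 1)"] e E_nonneg[OF \<eta>] by (auto simp: add_nonneg_pos)
  have "dist (E (ws k) \<eta>) (E (ws l) \<eta>) < e" if "k \<ge> N" "l \<ge> N" for k l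
   using E_abs_less[OF D_diff[OF ws(1) ws(1)] \<eta> e order_refl N[OF that, unfolded B_def]] E_diff[OF ws(1)[of k] ws(1)[of l] \<eta>]
   by (simp add: dist_real_def)
  thus "\<exists>N. \<forall>k\<ge>N. \<forall>l\<ge>N. dist (E (ws k) \<eta>) (E (ws l) \<eta>) < e" by blast
 qed
 \<comment> \<open>One half of the Euler-Lagrange equation; the other half is \<open>key\<close>
   applied to - \<eta>.\<close>
 have key: "0 \<le> (LINT x|M. bet (w x) * \<eta> x) + h * l - ip f \<eta>"
  if \<eta>: "\<eta> \<in> D" and l: "(\<lambda>k. E (ws k) \<eta>) \<longlonglongrightarrow> l" for \<eta> l
 proof -
  have \<eta>L: "\<eta> \<in> Lp M rr" by (rule D_Lp[OF \<eta> rr1(2)])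
  have [measurable]: "\<eta> \<in> borel_measurable M" using \<eta>L by (rule Lp_meas)
  have fI: "integrable M (\<lambda>x. f x * v x)" if "v \<in> Lp M rr" for v
   using Lp_pair[OF f that] by simp
  have shL: "(\<lambda>x. v x + s * \<eta> x) \<in> Lp M rr" if "v \<in> Lp M rr" for v s
   using Lp_add[OF that Lp_cmult[OF \<eta>L]] rr1 by auto
  \<comment> \<open>Minimality against ws k + s \<eta>, with k sent to infinity. The energies of ws
    k cancel between the two values of J, so only E (ws k) \<eta> has to converge.\<close>
  have a: "0 \<le> ((LINT x|M. \<bar>w x + s * \<eta> x\<bar> powr rr) - npow M rr w) / rr + h * s * l + h * s\<^sup>2 / 2 * E \<eta> \<eta> - s * ip f \<eta>" for s
  proof -
   have 1: "I - J h f (ws k) \<le> ((LINT x|M. \<bar>ws k x + s * \<eta> x\<bar> powr rr) - npow M rr (ws k)) / rr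
      + h * s * E (ws k) \<eta> + h * s\<^sup>2 / 2 * E \<eta> \<eta> - s * ip f \<eta>" for k
   proof -
    have "I \<le> J h f (\<lambda>x. ws k x + s * \<eta> x)" by (intro I D_add D_cmult ws \<eta>)
    moreover have "(LINT x|M. f x * (ws k x + s * \<eta> x)) = ip f (ws k) + s * ip f \<eta>"
     using fI[OF D_Lp[OF ws(1)[of k] rr1(2)]] fI[OF \<eta>L] by (simp add: ring_distribs mult.left_commute[of _ s])
    ultimately show ?thesis unfolding J_def E_shift[OF ws(1)[of k] \<eta>]
     by (simp add: algebra_simps add_divide_distrib diff_divide_distrib)
   qed
   have 2: "(\<lambda>k. LINT x|M. \<bar>ws k x + s * \<eta> x\<bar> powr rr) \<longlonglongrightarrow> (LINT x|M. \<bar>w x + s * \<eta> x\<bar> powr rr)"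
    using w(2) by (intro Lp_norm_tendsto rr1 shL w D_Lp ws) simp
   have 3: "(\<lambda>k. npow M rr (ws k)) \<longlonglongrightarrow> npow M rr w"
    by (intro Lp_norm_tendsto rr1 w D_Lp ws)
   have "(\<lambda>k. ((LINT x|M. \<bar>ws k x + s * \<eta> x\<bar> powr rr) - npow M rr (ws k)) / rr
      + h * s * E (ws k) \<eta> + h * s\<^sup>2 / 2 * E \<eta> \<eta> - s * ip f \<eta>)
     \<longlonglongrightarrow> ((LINT x|M. \<bar>w x + s * \<eta> x\<bar> powr rr) - npow M rr w) / rr + h * s * l + h * s\<^sup>2 / 2 * E \<eta> \<eta> - s * ip f \<eta>"
    by (intro tendsto_add tendsto_diff tendsto_divide tendsto_mult tendsto_const l 2 3) (use rr1 in auto)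
   from LIMSEQ_le[OF tendsto_diff[OF tendsto_const Jlim] this, of I] 1
   have "I - I \<le> ((LINT x|M. \<bar>w x + s * \<eta> x\<bar> powr rr) - npow M rr w) / rr + h * s * l + h * s\<^sup>2 / 2 * E \<eta> \<eta> - s * ip f \<eta>"
    by blast
   thus ?thesis by simp
  qed
  \<comment> \<open>The tangent inequality bounds the increment of the power by s times the slope at
    the shifted point. After division by s only continuity in s remains.\<close>
  have b: "0 \<le> (LINT x|M. bet (w x + s * \<eta> x) * \<eta> x) + h * l + h * s / 2 * E \<eta> \<eta> - ip f \<eta>" if s: "s > 0" for s
  proof -
   have iS: "integrable M (\<lambda>x. bet (w x + s * \<eta> x) * \<eta> x)"
    using Lp_pair[OF Lp_spow[OF shL[OF w(1)]] \<eta>L] by simp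
   have "((LINT x|M. \<bar>w x + s * \<eta> x\<bar> powr rr) - npow M rr w) / rr
    = (LINT x|M. (\<bar>w x + s * \<eta> x\<bar> powr rr - \<bar>w x\<bar> powr rr) / rr)"
    using Lp_int[OF shL[OF w(1), of s]] Lp_int[OF w(1)] by simp
   also have "\<dots> \<le> (LINT x|M. s * (bet (w x + s * \<eta> x) * \<eta> x))"
   proof (rule integral_mono)
    show "integrable M (\<lambda>x. (\<bar>w x + s * \<eta> x\<bar> powr rr - \<bar>w x\<bar> powr rr) / rr)"
     using Lp_int[OF shL[OF w(1), of s]] Lp_int[OF w(1)] by simp
    show "integrable M (\<lambda>x. s * (bet (w x + s * \<eta> x) * \<eta> x))" using iS by simp
    show "(\<bar>w x + s * \<eta> x\<bar> powr rr - \<bar>w x\<bar> powr rr) / rr \<le> s * (bet (w x + s * \<eta> x) * \<eta> x)" for x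
     using spow_tangent[OF rr1(1), of "w x + s * \<eta> x" "w x"] rr(3) by (simp add: diff_divide_distrib algebra_simps)
   qed
   also have "\<dots> = s * (LINT x|M. bet (w x + s * \<eta> x) * \<eta> x)" by simp
   finally have "0 \<le> s * (LINT x|M. bet (w x + s * \<eta> x) * \<eta> x) + h * s * l + h * s\<^sup>2 / 2 * E \<eta> \<eta> - s * ip f \<eta>"
    using a[of s] by linarith
   also have "\<dots> = s * ((LINT x|M. bet (w x + s * \<eta> x) * \<eta> x) + h * l + h * s / 2 * E \<eta> \<eta> - ip f \<eta>)"
    by (simp add: algebra_simps power2_eq_square)
   finally show ?thesis using s by (simp add: zero_le_mult_iff)
  qed
  define s where "s k = 1 / real (Suc k)" for k
  have s0: "s \<longlonglongrightarrow> 0" unfolding s_def using LIMSEQ_inverse_real_of_nat by (simp add: inverse_eq_divide)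
  have s1: "0 < s k" "s k \<le> 1" for k by (auto simp: s_def)
  have "(\<lambda>k. LINT x|M. bet (w x + s k * \<eta> x) * \<eta> x) \<longlonglongrightarrow> (LINT x|M. bet (w x) * \<eta> x)"
  proof (rule integral_dominated_convergence)
   \<comment> \<open>Since 0 < s k \<le> 1, this dominates all shifts at once.\<close>
   show "integrable M (\<lambda>x. \<bar>bet (\<bar>w x\<bar> + \<bar>\<eta> x\<bar>) * \<eta> x\<bar>)"
   proof (intro integrable_abs Lp_pair[OF Lp_spow \<eta>L])
    have "(\<lambda>x. \<bar>v x\<bar>) \<in> Lp M rr" if "v \<in> Lp M rr" for v using that by (auto simp: Lp_def)
    thus "(\<lambda>x. \<bar>w x\<bar> + \<bar>\<eta> x\<bar>) \<in> Lp M rr" using w(1) \<eta>L rr1 by (intro Lp_add) auto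
   qed
   show "AE x in M. norm (bet (w x + s k * \<eta> x) * \<eta> x) \<le> \<bar>bet (\<bar>w x\<bar> + \<bar>\<eta> x\<bar>) * \<eta> x\<bar>" for k
   proof (intro AE_I2)
    fix x
    have "\<bar>s k * \<eta> x\<bar> \<le> \<bar>\<eta> x\<bar>" using s1[of k] by (simp add: abs_mult mult_left_le_one_le)
    hence "\<bar>w x + s k * \<eta> x\<bar> \<le> \<bar>\<bar>w x\<bar> + \<bar>\<eta> x\<bar>\<bar>" by linarith
    thus "norm (bet (w x + s k * \<eta> x) * \<eta> x) \<le> \<bar>bet (\<bar>w x\<bar> + \<bar>\<eta> x\<bar>) * \<eta> x\<bar>"
     using m_pos unfolding real_norm_def abs_mult abs_spow by (intro mult_right_mono powr_mono2) auto
   qed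
   show "AE x in M. (\<lambda>k. bet (w x + s k * \<eta> x) * \<eta> x) \<longlonglongrightarrow> bet (w x) * \<eta> x"
   proof (intro AE_I2 tendsto_mult tendsto_const tendsto_spow)
    fix x show "(\<lambda>k. w x + s k * \<eta> x) \<longlonglongrightarrow> w x"
     using tendsto_add[OF tendsto_const[of "w x"] tendsto_mult[OF s0 tendsto_const[of "\<eta> x"]]] by simp
   qed (use m_pos in auto)
  qed measurable
  hence "(\<lambda>k. (LINT x|M. bet (w x + s k * \<eta> x) * \<eta> x) + h * l + h * s k / 2 * E \<eta> \<eta> - ip f \<eta>)
    \<longlonglongrightarrow> (LINT x|M. bet (w x) * \<eta> x) + h * l + h * 0 / 2 * E \<eta> \<eta> - ip f \<eta>"
   by (intro tendsto_intros s0) auto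
  thus ?thesis using b[OF s1(1)] by (intro LIMSEQ_le_const) auto
 qed
 have "(\<lambda>k. E (ws k) \<eta>) \<longlonglongrightarrow> (LINT x|M. (f x - bet (w x)) * \<eta> x) / h" if \<eta>: "\<eta> \<in> D" for \<eta>
 proof -
  obtain l where l: "(\<lambda>k. E (ws k) \<eta>) \<longlonglongrightarrow> l" using cE[OF \<eta>] by (auto simp: convergent_def)
  have \<eta>L: "\<eta> \<in> Lp M rr" by (rule D_Lp[OF \<eta> rr1(2)])
  have l': "(\<lambda>k. E (ws k) (\<lambda>x. -1 * \<eta> x)) \<longlonglongrightarrow> - l" using tendsto_minus[OF l] E_cmult2[OF \<eta> ws(1), where c = "-1"] by simp
  have "(LINT x|M. bet (w x) * \<eta> x) + h * l - ip f \<eta> = 0"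
   using key[OF \<eta> l] key[OF D_cmult[OF \<eta>] l'] by simp
  moreover have "(LINT x|M. (f x - bet (w x)) * \<eta> x) = ip f \<eta> - (LINT x|M. bet (w x) * \<eta> x)"
   unfolding left_diff_distrib
   using Lp_pair[OF _ \<eta>L] f Lp_spow[OF w(1)]
   by (intro Bochner_Integration.integral_diff) auto
  ultimately have "l = (LINT x|M. (f x - bet (w x)) * \<eta> x) / h" using h by (simp add: field_simps)
  thus ?thesis using l by simp
 qed
 thus ?thesis unfolding esol_def using w ws(1) cauB unfolding B_def by blast
qed

lemma E_add_le:
 assumes "f \<in> D" "h \<in> D"
 shows "E (\<lambda>x. f x + h x) (\<lambda>x. f x + h x) \<le> 2 * E f f + 2 * E h h"
 using E_shift[OF assms, of 1] E_shift[OF assms, of "-1"] E_nonneg[OF D_diff[OF assms]] by simp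

lemma E_diff_le:
 assumes "f \<in> D" "h \<in> D"
 shows "Ed f h \<le> 2 * E f f + 2 * E h h"
 using E_shift[OF assms, of 1] E_shift[OF assms, of "-1"] E_nonneg[OF D_add[OF assms]] by simp

text \<open>Monotonicity of - \<Delta> tested with a nondecreasing function of d: by the chain rule
  the pairing is the integral of heav' n (d) times \<Gamma> d d. The second bound serves
  Cauchy-Schwarz.\<close>

lemma E_heav:
 assumes d: "d \<in> D" and n: "n \<ge> 0"
 shows "0 \<le> E d (\<lambda>x. heav n (d x))"
  and "E (\<lambda>x. heav n (d x)) (\<lambda>x. heav n (d x)) \<le> (2 * n)\<^sup>2 * E d d"
proof -
 let ?\<eta> = "\<lambda>x. heav n (d x)"
 have \<eta>: "?\<eta> \<in> D" by (rule D_comp[OF d heav_C1])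
 have 1: "\<Gamma> ?\<eta> h = (\<lambda>x. heav' n (d x) * \<Gamma> d h x)" if "h \<in> D" for h by (rule \<Gamma>_comp[OF d that heav_C1])
 have 2: "\<Gamma> d ?\<eta> = (\<lambda>x. heav' n (d x) * \<Gamma> d d x)" using \<Gamma>_sym[OF d \<eta>] 1[OF d] by simp
 show "0 \<le> E d ?\<eta>" unfolding E_def 2 using heav'_bounds[OF n] \<Gamma>_nonneg[OF d] by (intro Bochner_Integration.integral_nonneg) auto
 have 3: "\<Gamma> ?\<eta> ?\<eta> = (\<lambda>x. heav' n (d x) * (heav' n (d x) * \<Gamma> d d x))" unfolding 1[OF \<eta>] 2 ..
 have "E ?\<eta> ?\<eta> \<le> (LINT x|M. (2 * n)\<^sup>2 * \<Gamma> d d x)" unfolding E_def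
 proof (rule integral_mono)
  show "integrable M (\<Gamma> ?\<eta> ?\<eta>)" by (intro bfs_integrable \<Gamma>_bfs \<eta>)
  show "integrable M (\<lambda>x. (2 * n)\<^sup>2 * \<Gamma> d d x)" using bfs_integrable[OF \<Gamma>_bfs[OF d d]] by simp
  fix x
  have "heav' n (d x) * heav' n (d x) \<le> (2 * n) * (2 * n)" using heav'_bounds[OF n, of "d x"] n by (intro mult_mono) auto
  hence "(heav' n (d x) * heav' n (d x)) * \<Gamma> d d x \<le> (2 * n)\<^sup>2 * \<Gamma> d d x"
   using \<Gamma>_nonneg[OF d] by (intro mult_right_mono) (auto simp: power2_eq_square)
  thus "\<Gamma> ?\<eta> ?\<eta> x \<le> (2 * n)\<^sup>2 * \<Gamma> d d x" by (simp add: 3)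
 qed
 thus "E ?\<eta> ?\<eta> \<le> (2 * n)\<^sup>2 * E d d" by (simp add: E_def)
qed

lemma Lp_heav: "d \<in> Lp M rr ==> n \<ge> 0 ==> (\<lambda>x. heav n (d x)) \<in> Lp M rr"
proof (rule Lp_bound[where C = "2 * n"])
 assume d: "d \<in> Lp M rr" and n: "n \<ge> 0"
 have [measurable]: "heav n \<in> borel_measurable borel"
  by (rule borel_measurable_continuous_onI[OF C1_fun_cont[OF heav_C1]])
 show "(\<lambda>x. heav n (d x)) \<in> borel_measurable M" using Lp_meas[OF d] by measurable
 show "\<bar>heav n (d x)\<bar> \<le> 2 * n * \<bar>d x\<bar>" for x
  using heav_lipschitz[OF n, of "d x" 0] by (simp add: heav_def)
qed (use rr1 in auto)

text \<open>The difference of the two equations is tested with heav n (w1 - w2). As w1 - w2 may lie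
  outside D, the test function is \<eta> k = heav n (d k), and the limits are taken one after the
  other: in l with \<eta> k fixed, then in k.\<close>

lemma comparison_heav:
 assumes h: "h > 0" and f: "f1 \<in> Lp M (1 + m)" "f2 \<in> Lp M (1 + m)"
  and s1: "esol h f1 w1" and s2: "esol h f2 w2" and n: "n \<ge> 0"
 defines "g \<equiv> \<lambda>x. (f1 x - bet (w1 x)) - (f2 x - bet (w2 x))"
 shows "0 \<le> (LINT x|M. g x * heav n (w1 x - w2 x))"
proof -
 define cau where "cau ws \<longleftrightarrow> (\<forall>e>0. \<exists>N. \<forall>k\<ge>N. \<forall>l\<ge>N. Ed (ws k) (ws l) < e)" for ws :: "nat \<Rightarrow> 'a \<Rightarrow> real"
 obtain a where a: "\<And>k. a k \<in> D" "(\<lambda>k. dpow M rr (a k) w1) \<longlonglongrightarrow> 0" "cau a"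
  "\<And>\<eta>. \<eta> \<in> D ==> (\<lambda>k. E (a k) \<eta>) \<longlonglongrightarrow> (LINT x|M. (f1 x - bet (w1 x)) * \<eta> x) / h"
  using s1 unfolding esol_def cau_def[abs_def] by blast
 obtain b where b: "\<And>k. b k \<in> D" "(\<lambda>k. dpow M rr (b k) w2) \<longlonglongrightarrow> 0" "cau b"
  "\<And>\<eta>. \<eta> \<in> D ==> (\<lambda>k. E (b k) \<eta>) \<longlonglongrightarrow> (LINT x|M. (f2 x - bet (w2 x)) * \<eta> x) / h"
  using s2 unfolding esol_def cau_def[abs_def] by blast
 have w: "w1 \<in> Lp M rr" "w2 \<in> Lp M rr" using s1 s2 unfolding esol_def by auto
 define d where "d k x = a k x - b k x" for k x
 have dD: "d k \<in> D" for k unfolding d_def[abs_def] by (intro D_diff a b)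
 define w where "w x = w1 x - w2 x" for x
 have wL: "w \<in> Lp M rr" unfolding w_def[abs_def] using w rr1 by (intro Lp_diff) auto
 have g1: "(\<lambda>x. f1 x - bet (w1 x)) \<in> Lp M (1 + m)" "(\<lambda>x. f2 x - bet (w2 x)) \<in> Lp M (1 + m)"
  using f w rr1 by (auto intro!: Lp_diff Lp_spow)
 have gL: "g \<in> Lp M (1 + m)" unfolding g_def by (rule Lp_diff[OF g1 rr1(6)])
 have caud: "\<exists>N. \<forall>k\<ge>N. \<forall>l\<ge>N. Ed (d k) (d l) < e" if e: "e > 0" for e
 proof -
  have e4: "e / 4 > 0" using e by simp
  obtain N1 where N1: "\<And>k l. k \<ge> N1 ==> l \<ge> N1 ==> Ed (a k) (a l) < e / 4"
   using a(3) e4 unfolding cau_def by blast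
  obtain N2 where N2: "\<And>k l. k \<ge> N2 ==> l \<ge> N2 ==> Ed (b k) (b l) < e / 4"
   using b(3) e4 unfolding cau_def by blast
  have "Ed (d k) (d l) < e" if "k \<ge> max N1 N2" "l \<ge> max N1 N2" for k l
  proof -
   have "(\<lambda>x. d k x - d l x) = (\<lambda>x. (a k x - a l x) - (b k x - b l x))" by (simp add: d_def fun_eq_iff)
   thus ?thesis using E_diff_le[OF D_diff[OF a(1) a(1)] D_diff[OF b(1) b(1)], of k l k l] N1[of k l] N2[of k l] that by simp
  qed
  thus ?thesis by blast
 qed
 obtain N0 where N0: "\<And>k. k \<ge> N0 ==> Ed (d k) (d N0) < 1"
  using caud[of 1] by auto
 define C where "C = 2 + 2 * E (d N0) (d N0)"
 have C: "E (d k) (d k) \<le> C" if "k \<ge> N0" for k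
  using E_add_le[OF D_diff[OF dD dD] dD, of k N0 N0] N0[OF that] by (simp add: C_def)
 have C0: "C \<ge> 0" using E_nonneg[OF dD, of N0] by (simp add: C_def)
 define \<eta> where "\<eta> k x = heav n (d k x)" for k x
 have \<eta>D: "\<eta> k \<in> D" for k unfolding \<eta>_def[abs_def] by (rule D_comp[OF dD heav_C1])
 \<comment> \<open>Bounds E (\<eta> k) (\<eta> k) for all k \<ge> N0, so that Cauchy-Schwarz
   controls the pairing of d l - d k with \<eta> k.\<close>
 define K where "K = (2 * n)\<^sup>2 * C"
 have K0: "K \<ge> 0" using C0 by (simp add: K_def)
 have \<eta>K: "E (\<eta> k) (\<eta> k) \<le> K" if "k \<ge> N0" for k
  using E_heav(2)[OF dD n, of k] mult_left_mono[OF C[OF that], of "(2 * n)\<^sup>2"] unfolding \<eta>_def[abs_def] K_def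
  by (meson order_trans zero_le_power2)
 have lim: "(\<lambda>l. E (d l) v) \<longlonglongrightarrow> ip g v / h" if v: "v \<in> D" for v
 proof -
  have vL: "v \<in> Lp M rr" using D_Lp[OF v] rr1 by blast
  have "ip g v = (LINT x|M. (f1 x - bet (w1 x)) * v x) - (LINT x|M. (f2 x - bet (w2 x)) * v x)"
   unfolding g_def left_diff_distrib[of "f1 _ - _" "f2 _ - _"]
   by (intro Bochner_Integration.integral_diff Lp_pair[OF _ vL] g1)
  moreover have "E (d l) v = E (a l) v - E (b l) v" for l unfolding d_def[abs_def] by (rule E_diff[OF a(1) b(1) v])
  ultimately show ?thesis using tendsto_diff[OF a(4)[OF v] b(4)[OF v]] by (simp add: diff_divide_distrib)
 qed
 \<comment> \<open>For large k and l the pairing E (d l) (\<eta> k) differs from E (d k) (\<eta> k)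
   \<ge> 0 by less than e / h.\<close>
 have low: "\<exists>N. \<forall>k\<ge>N. - e \<le> ip g (\<eta> k)" if e: "e > 0" for e
 proof -
  have eh: "e / h > 0" using e h by simp
  have "K + 1 > 0" using K0 by linarith
  hence p: "(e / h)\<^sup>2 / (K + 1) > 0" by (intro divide_pos_pos zero_less_power eh)
  obtain N where N: "\<And>k l. k \<ge> N ==> l \<ge> N ==> Ed (d k) (d l) < (e / h)\<^sup>2 / (K + 1)"
   using caud[OF p] by blast
  have "- e \<le> ip g (\<eta> k)" if k: "k \<ge> max N N0" for k
  proof -
   have "- (e / h) \<le> E (d l) (\<eta> k)" if l: "l \<ge> N" for l
   proof -
    have "\<bar>E (\<lambda>x. d l x - d k x) (\<eta> k)\<bar> < e / h"
     using N[of l k] l k by (intro E_abs_less[OF D_diff[OF dD dD] \<eta>D eh \<eta>K]) auto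
    moreover have "0 \<le> E (d k) (\<eta> k)" unfolding \<eta>_def[abs_def] by (rule E_heav(1)[OF dD n])
    ultimately show ?thesis using E_diff[OF dD dD \<eta>D, of l k k] by linarith
   qed
   hence "- (e / h) \<le> ip g (\<eta> k) / h"
    by (intro LIMSEQ_le_const[OF lim[OF \<eta>D]]) auto
   thus ?thesis using h by (simp add: field_simps)
  qed
  thus ?thesis by blast
 qed
 have "(\<lambda>k. LINT x|M. g x * (\<eta> k x - heav n (w x))) \<longlonglongrightarrow> 0"
 proof (rule Lp_dual_tendsto(2)[OF rr1(1) rr1(5) rr(2) gL])
  show dL: "(\<lambda>x. \<eta> k x - heav n (w x)) \<in> Lp M rr" for k
   using Lp_diff[OF D_Lp[OF \<eta>D] Lp_heav[OF wL n]] rr1 by auto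
  have I: "integrable M (\<lambda>x. \<bar>a k x - w1 x\<bar> powr rr)" "integrable M (\<lambda>x. \<bar>b k x - w2 x\<bar> powr rr)" for k
   using Lp_int[OF Lp_diff[OF D_Lp[OF a(1)] w(1)]] Lp_int[OF Lp_diff[OF D_Lp[OF b(1)] w(2)]] rr1 by auto
  let ?B = "\<lambda>k. (2 * n) powr rr * (2 powr rr * (dpow M rr (a k) w1 + dpow M rr (b k) w2))"
  have B0: "?B \<longlonglongrightarrow> (2 * n) powr rr * (2 powr rr * (0 + 0))"
   by (intro tendsto_intros a b)
  have le: "(LINT x|M. \<bar>\<eta> k x - heav n (w x)\<bar> powr rr) \<le> ?B k" for k
  proof -
   have "(LINT x|M. \<bar>\<eta> k x - heav n (w x)\<bar> powr rr)
     \<le> (LINT x|M. (2 * n) powr rr * (2 powr rr * (\<bar>a k x - w1 x\<bar> powr rr + \<bar>b k x - w2 x\<bar> powr rr)))"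
   proof (rule integral_mono)
    show "integrable M (\<lambda>x. \<bar>\<eta> k x - heav n (w x)\<bar> powr rr)" by (rule Lp_int[OF dL])
    show "integrable M (\<lambda>x. (2 * n) powr rr * (2 powr rr * (\<bar>a k x - w1 x\<bar> powr rr + \<bar>b k x - w2 x\<bar> powr rr)))"
     using I by simp
    fix x
    have "\<bar>\<eta> k x - heav n (w x)\<bar> powr rr \<le> (2 * n * \<bar>d k x - w x\<bar>) powr rr"
     unfolding \<eta>_def using rr1 by (intro powr_mono2 heav_lipschitz n) auto
    also have "\<dots> = (2 * n) powr rr * \<bar>(a k x - w1 x) + - (b k x - w2 x)\<bar> powr rr"
     by (simp add: powr_mult d_def w_def algebra_simps)
    also have "\<dots> \<le> (2 * n) powr rr * (2 powr rr * (\<bar>a k x - w1 x\<bar> powr rr + \<bar>-(b k x - w2 x)\<bar> powr rr))"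
     using rr1 by (intro mult_left_mono powr_add_le) auto
    finally show "\<bar>\<eta> k x - heav n (w x)\<bar> powr rr \<le> (2 * n) powr rr * (2 powr rr * (\<bar>a k x - w1 x\<bar> powr rr + \<bar>b k x - w2 x\<bar> powr rr))"
     unfolding abs_minus_cancel .
   qed
   also have "\<dots> = ?B k" using I by simp
   finally show ?thesis .
  qed
  show "(\<lambda>k. LINT x|M. \<bar>\<eta> k x - heav n (w x)\<bar> powr rr) \<longlonglongrightarrow> 0"
  proof (rule tendsto_sandwich[OF _ _ tendsto_const])
   show "?B \<longlonglongrightarrow> 0" using B0 by simp
   show "\<forall>\<^sub>F k in sequentially. 0 \<le> (LINT x|M. \<bar>\<eta> k x - heav n (w x)\<bar> powr rr)" by simp
   show "\<forall>\<^sub>F k in sequentially. (LINT x|M. \<bar>\<eta> k x - heav n (w x)\<bar> powr rr) \<le> ?B k" using le by (intro always_eventually) blast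
  qed
 qed
 moreover have "(LINT x|M. g x * (\<eta> k x - heav n (w x))) = ip g (\<eta> k) - (LINT x|M. g x * heav n (w x))" for k
  unfolding right_diff_distrib
  by (intro Bochner_Integration.integral_diff Lp_pair[OF gL _] D_Lp \<eta>D Lp_heav wL n rr1)
 ultimately have lim2: "(\<lambda>k. ip g (\<eta> k)) \<longlonglongrightarrow> (LINT x|M. g x * heav n (w x))"
  by (simp add: LIM_zero_iff)
 have ge: "- e \<le> (LINT x|M. g x * heav n (w x))" if "e > 0" for e
  using low[OF that] by (intro LIMSEQ_le_const[OF lim2]) auto
 have "0 \<le> (LINT x|M. g x * heav n (w x))"
  using ge[of "- (LINT x|M. g x * heav n (w x)) / 2"] by linarith
 thus ?thesis by (simp add: w_def)
qed

lemma integral_le_nn_integral: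
 assumes "integrable N g" shows "ennreal (LINT x|N. g x) \<le> (\<integral>\<^sup>+x. ennreal (g x) \<partial>N)"
proof -
 have i: "integrable N (\<lambda>x. max 0 (g x))" using assms by (intro integrable_max) auto
 have "(LINT x|N. g x) \<le> (LINT x|N. max 0 (g x))" using assms i by (intro integral_mono) auto
 also have "ennreal \<dots> = (\<integral>\<^sup>+x. ennreal (max 0 (g x)) \<partial>N)" using i by (intro nn_integral_eq_integral[symmetric]) auto
 also have "\<dots> = (\<integral>\<^sup>+x. ennreal (g x) \<partial>N)" by (intro nn_integral_cong) (simp add: max_def ennreal_neg)
 finally show ?thesis by (simp add: ennreal_leI)
qed

text \<open>As n grows, heav n (w1 - w2) tends to the indicator of w1 > w2, which is also where bet
  w1 > bet w2; Fatou's lemma yields the left side. The integrals are taken in \<open>ennreal\<close>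
  because f1 - f2 is only known to lie in \<open>Lp M (1 + m)\<close>.\<close>

theorem esol_comparison:
 assumes h: "h > 0" and f: "f1 \<in> Lp M (1 + m)" "f2 \<in> Lp M (1 + m)"
  and s1: "esol h f1 w1" and s2: "esol h f2 w2"
 shows "nnint M (\<lambda>x. bet (w1 x) - bet (w2 x)) \<le> nnint M (\<lambda>x. f1 x - f2 x)"
proof -
 let ?u = "\<lambda>x. bet (w1 x) - bet (w2 x)"
 let ?f = "\<lambda>x. f1 x - f2 x"
 let ?w = "\<lambda>x. w1 x - w2 x"
 have w: "w1 \<in> Lp M rr" "w2 \<in> Lp M rr" using s1 s2 unfolding esol_def by auto
 have uL: "?u \<in> Lp M (1 + m)" and fL: "?f \<in> Lp M (1 + m)" and wL: "?w \<in> Lp M rr"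
  using w f rr1 by (auto intro!: Lp_diff Lp_spow)
 note [measurable] = Lp_meas[OF uL] Lp_meas[OF fL] Lp_meas[OF wL] Lp_meas[OF w(1)] Lp_meas[OF w(2)]
 have [measurable]: "heav n \<in> borel_measurable borel" for n
  by (rule borel_measurable_continuous_onI[OF C1_fun_cont[OF heav_C1]])
 have step: "nnint M (\<lambda>x. ?u x * heav (real n) (?w x)) \<le> nnint M ?f" for n
 proof -
  have hL: "(\<lambda>x. heav (real n) (?w x)) \<in> Lp M rr" by (rule Lp_heav[OF wL]) simp
  note I = Lp_pair[OF _ hL]
  have "0 \<le> (LINT x|M. (?f x - ?u x) * heav (real n) (?w x))"
   using comparison_heav[OF h f s1 s2, of "real n"] by (simp add: algebra_simps)
  also have "\<dots> = (LINT x|M. ?f x * heav (real n) (?w x)) - (LINT x|M. ?u x * heav (real n) (?w x))"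
   unfolding left_diff_distrib[of "?f _"] by (intro Bochner_Integration.integral_diff I fL uL)
  finally have le: "(LINT x|M. ?u x * heav (real n) (?w x)) \<le> (LINT x|M. ?f x * heav (real n) (?w x))" by simp
  have nn: "0 \<le> ?u x * heav (real n) (?w x)" for x
  proof (cases "?w x \<le> 0")
   case True thus ?thesis by (simp add: heav_nonpos)
  next
   case False
   hence "bet (w2 x) \<le> bet (w1 x)" using m_pos by (intro spow_mono) auto
   thus ?thesis using heav_bounds by simp
  qed
  have "nnint M (\<lambda>x. ?u x * heav (real n) (?w x)) = ennreal (LINT x|M. ?u x * heav (real n) (?w x))"
   using nn by (intro nn_integral_eq_integral I uL) auto
  also have "\<dots> \<le> ennreal (LINT x|M. ?f x * heav (real n) (?w x))" using le by (rule ennreal_leI)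
  also have "\<dots> \<le> nnint M (\<lambda>x. ?f x * heav (real n) (?w x))" by (intro integral_le_nn_integral I fL)
  also have "\<dots> \<le> nnint M ?f"
  proof (intro nn_integral_mono)
   fix x
   show "ennreal (?f x * heav (real n) (?w x)) \<le> ennreal (?f x)"
   proof (cases "?f x \<ge> 0")
    case True thus ?thesis using heav_bounds[of "real n" "?w x"] by (intro ennreal_leI) (simp add: mult_left_le)
   next
    case False
    hence "?f x * heav (real n) (?w x) \<le> 0" using heav_bounds[of "real n" "?w x"] by (simp add: mult_nonpos_nonneg)
    thus ?thesis by (simp add: ennreal_neg)
   qed
  qed
  finally show ?thesis .
 qed
 have "nnint M ?u = (\<integral>\<^sup>+x. liminf (\<lambda>n. ennreal (?u x * heav (real n) (?w x))) \<partial>M)"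
 proof (intro nn_integral_cong)
  fix x
  have "(\<lambda>n. ennreal (?u x * heav (real n) (?w x))) \<longlonglongrightarrow> ennreal (?u x)"
  proof (cases "?w x \<le> 0")
   case True
   hence "?u x \<le> 0" using spow_mono[of "1/m" "w1 x" "w2 x"] m_pos by simp
   thus ?thesis using True by (simp add: heav_nonpos ennreal_neg)
  next
   case False
   hence "(\<lambda>n. ?u x * heav (real n) (?w x)) \<longlonglongrightarrow> ?u x * 1" by (intro tendsto_mult tendsto_const heav_limit) auto
   thus ?thesis by (intro tendsto_ennrealI) simp
  qed
  thus "ennreal (?u x) = liminf (\<lambda>n. ennreal (?u x * heav (real n) (?w x)))"
   by (metis lim_imp_Liminf sequentially_bot)
 qed
 also have "\<dots> \<le> liminf (\<lambda>n. nnint M (\<lambda>x. ?u x * heav (real n) (?w x)))"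
  by (intro nn_integral_liminf) measurable
 also have "\<dots> \<le> nnint M ?f"
  using step by (intro Liminf_le always_eventually) auto
 finally show ?thesis .
qed

section \<open>The resolvent as a contraction of \<open>L\<^sup>1\<close>\<close>

text \<open>\<open>Lp M (1 + m)\<close> serves the variational problem, integrability the
  contraction in L^1. The resolvent maps X into itself by \<open>res_X\<close>.\<close>

definition X :: "'a fn set" where
 "X = {f. integrable M f \<and> f \<in> Lp M (1 + m)}"

definition nrm :: "'a fn \<Rightarrow> real" where
 "nrm f = (LINT x|M. \<bar>f x\<bar>)"

abbreviation "dst f g \<equiv> nrm (\<lambda>x. f x - g x)"

text \<open>The equation u - h \<Delta>(u^m) = f in the weak sense. It is a relation, as u is
  determined only almost everywhere.\<close>

definition res :: "real \<Rightarrow> 'a fn \<Rightarrow> 'a fn \<Rightarrow> bool" where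
 "res h f u \<longleftrightarrow> esol h f (\<lambda>x. spow (u x) m)"

lemma res_alt: "res h f u \<longleftrightarrow> (\<exists>w. esol h f w \<and> u = (\<lambda>x. bet (w x)))"
 using m_pos by (auto simp: res_def spow_inverse intro!: exI[of _ "\<lambda>x. spow (u x) m"])

lemma X_int: "f \<in> X ==> integrable M f" and X_Lp: "f \<in> X ==> f \<in> Lp M (1 + m)"
 by (auto simp: X_def)

lemma X_add: "f \<in> X ==> g \<in> X ==> (\<lambda>x. f x + g x) \<in> X"
 using rr1 by (auto simp: X_def intro!: Lp_add)

lemma X_cmult: "f \<in> X ==> (\<lambda>x. c * f x) \<in> X"
 by (auto simp: X_def intro!: Lp_cmult)

lemma X_diff: "f \<in> X ==> g \<in> X ==> (\<lambda>x. f x - g x) \<in> X"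
 using rr1 by (auto simp: X_def intro!: Lp_diff)

lemma bfs_X: "f \<in> bfs M ==> f \<in> X"
 using rr1 by (auto simp: X_def intro!: bfs_integrable bfs_Lp)

lemma nrm_diff_sym: "dst f g = dst g f"
 by (simp add: nrm_def abs_minus_commute)

lemma nrm_tri:
 assumes [simp]: "integrable M f" "integrable M g" "integrable M k"
 shows "dst f k \<le> dst f g + dst g k"
proof -
 have "dst f k \<le> (LINT x|M. \<bar>f x - g x\<bar> + \<bar>g x - k x\<bar>)"
  unfolding nrm_def by (intro integral_mono) auto
 also have "\<dots> = dst f g + dst g k"
  unfolding nrm_def by (intro Bochner_Integration.integral_add) auto
 finally show ?thesis .
qed

lemma nrm_nonneg [simp]: "nrm f \<ge> 0"
 by (simp add: nrm_def)

lemma res_comparison: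
 assumes "h > 0" "f \<in> X" "f' \<in> X" "res h f u" "res h f' u'"
 shows "nnint M (\<lambda>x. u x - u' x) \<le> nnint M (\<lambda>x. f x - f' x)"
 using esol_comparison[OF assms(1) X_Lp[OF assms(2)] X_Lp[OF assms(3)] assms(4,5)[unfolded res_def]]
 using m_pos by (simp add: spow_inverse)

lemma esol_0: "h > 0 ==> esol h (\<lambda>_. 0) (\<lambda>_. 0)"
proof -
 have "E (\<lambda>x. 0) h = 0" if "h \<in> D" for h using E_cmult[OF D_0 that, of 0] by simp
 thus ?thesis unfolding esol_def using D_0 D_Lp[OF D_0] rr1
  by (auto intro!: exI[of _ "\<lambda>k x. 0"])
qed

lemma res_0: "h > 0 ==> res h (\<lambda>_. 0) (\<lambda>_. 0)"
 using esol_0 by (simp add: res_def)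

lemma zero_X: "(\<lambda>_. 0) \<in> X" by (intro bfs_X D_bfs D_0)

lemma nn_abs_split: "f \<in> borel_measurable M ==>
 (\<integral>\<^sup>+x. ennreal \<bar>f x\<bar> \<partial>M) = nnint M f + nnint M (\<lambda>x. - f x)"
 by (subst nn_integral_add[symmetric]) (auto intro!: nn_integral_cong simp: abs_if ennreal_neg)

lemma res_abs:
 assumes "h > 0" "f \<in> X" "f' \<in> X" "res h f u" "res h f' u'"
 shows "(\<integral>\<^sup>+x. ennreal \<bar>u x - u' x\<bar> \<partial>M) \<le> (\<integral>\<^sup>+x. ennreal \<bar>f x - f' x\<bar> \<partial>M)"
proof -
 have m: "u \<in> borel_measurable M" "u' \<in> borel_measurable M" "f \<in> borel_measurable M" "f' \<in> borel_measurable M"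
  using assms unfolding res_alt esol_def by (auto dest!: Lp_meas X_Lp)
 have "(\<integral>\<^sup>+x. ennreal \<bar>u x - u' x\<bar> \<partial>M) = nnint M (\<lambda>x. u x - u' x) + nnint M (\<lambda>x. u' x - u x)"
  using m nn_abs_split[of "\<lambda>x. u x - u' x"] by simp
 also have "\<dots> \<le> nnint M (\<lambda>x. f x - f' x) + nnint M (\<lambda>x. f' x - f x)"
  by (intro add_mono res_comparison[OF assms] res_comparison[OF assms(1,3,2,5,4)])
 also have "\<dots> = (\<integral>\<^sup>+x. ennreal \<bar>f x - f' x\<bar> \<partial>M)"
  using m nn_abs_split[of "\<lambda>x. f x - f' x"] by simp
 finally show ?thesis .
qed

text \<open>Comparison with the zero solution bounds the L^1 norm of u by that of f.\<close>

lemma res_X: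
 assumes "h > 0" "f \<in> X" "res h f u"
 shows "u \<in> X"
proof -
 have L: "u \<in> Lp M (1 + m)" using assms(3) Lp_spow unfolding res_alt esol_def by auto
 have "(\<integral>\<^sup>+x. ennreal \<bar>u x\<bar> \<partial>M) \<le> (\<integral>\<^sup>+x. ennreal \<bar>f x\<bar> \<partial>M)"
  using res_abs[OF assms(1,2) zero_X assms(3) res_0[OF assms(1)]] by simp
 also have "\<dots> < \<infinity>" using X_int[OF assms(2)] unfolding integrable_iff_bounded by simp
 finally have "integrable M u" using L unfolding integrable_iff_bounded by (auto dest: Lp_meas)
 thus ?thesis using L by (simp add: X_def)
qed

lemma res_contraction:
 assumes "h > 0" "f \<in> X" "f' \<in> X" "res h f u" "res h f' u'"
 shows "dst u u' \<le> dst f f'"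
proof -
 have i: "integrable M (\<lambda>x. \<bar>u x - u' x\<bar>)" "integrable M (\<lambda>x. \<bar>f x - f' x\<bar>)"
  using assms res_X X_int by (auto intro!: integrable_abs)
 have "ennreal (dst u u') \<le> ennreal (dst f f')"
  unfolding nrm_def using res_abs[OF assms] i by (simp add: nn_integral_eq_integral)
 thus ?thesis by (simp add: ennreal_le_iff)
qed

lemma res_mono:
 assumes "h > 0" "f \<in> X" "f' \<in> X" "res h f u" "res h f' u'" "AE x in M. f x \<le> f' x"
 shows "AE x in M. u x \<le> u' x"
proof -
 have m: "u \<in> borel_measurable M" "u' \<in> borel_measurable M"
  using assms unfolding res_alt esol_def by (auto dest!: Lp_meas X_Lp)
 have "nnint M (\<lambda>x. f x - f' x) = 0"
  using assms(2,3,6) by (subst nn_integral_0_iff_AE) (auto simp: ennreal_eq_0_iff dest!: X_Lp Lp_meas)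
 hence "nnint M (\<lambda>x. u x - u' x) = 0" using res_comparison[OF assms(1-5)] by simp
 thus ?thesis using m by (subst (asm) nn_integral_0_iff_AE) (auto simp: ennreal_eq_0_iff)
qed

lemma res_exists:
 assumes "h > 0" "f \<in> X" shows "\<exists>u. res h f u"
 using resolvent_exists[OF assms(1) X_Lp[OF assms(2)]] unfolding res_alt by blast

text \<open>The resolvent identity: (f - u) / lam is the same element - \<Delta>(u^m) whatever the
  step, so the datum that belongs to the step \<mu> is u + \<mu> * (f - u) / lam.\<close>

lemma res_identity:
 assumes l: "lam > 0" and mu: "\<mu> > 0" and f: "f \<in> X" and r: "res lam f u"
 shows "res \<mu> (\<lambda>x. \<mu> / lam * f x + (1 - \<mu> / lam) * u x) u"
proof -
 let ?w = "\<lambda>x. spow (u x) m"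
 have "(LINT x|M. ((\<mu> / lam * f x + (1 - \<mu> / lam) * u x) - bet (?w x)) * \<eta> x) / \<mu>
   = (LINT x|M. (f x - bet (?w x)) * \<eta> x) / lam" for \<eta> :: "'a \<Rightarrow> real"
 proof -
  have "((\<mu> / lam * f x + (1 - \<mu> / lam) * u x) - bet (?w x)) * \<eta> x = \<mu> / lam * ((f x - bet (?w x)) * \<eta> x)" for x
   using m_pos by (simp add: spow_inverse algebra_simps)
  thus ?thesis using l mu by simp
 qed
 thus ?thesis using r unfolding res_def esol_def by simp
qed

section \<open>Weak Laplacians\<close>

text \<open>\<open>L\<close> is the Laplacian of \<open>\<eta>\<close> in the weak sense; second derivatives never occur.\<close>

definition wl :: "'a fn \<Rightarrow> 'a fn \<Rightarrow> bool" where
 "wl \<eta> L \<longleftrightarrow> \<eta> \<in> D \<and> L \<in> bfs M \<and> (\<forall>f\<in>D. E f \<eta> = - ip f L)"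

lemma wl_D: "wl \<eta> L ==> \<eta> \<in> D" and wl_bfs: "wl \<eta> L ==> L \<in> bfs M"
 and wl_E: "wl \<eta> L ==> f \<in> D ==> E f \<eta> = - ip f L"
 by (auto simp: wl_def)

lemma D_spow_X: "w \<in> D ==> (\<lambda>x. bet (w x)) \<in> X"
 using m_pos by (intro bfs_X bfs_comp_cont[OF D_bfs continuous_spow]) auto

text \<open>Puts \<open>bet w\<close> into the domain of the generator; the constant sequence w is
  the approximation required by \<open>esol\<close>.\<close>

lemma res_of_wl:
 assumes h: "h > 0" and w: "wl w L"
 shows "res h (\<lambda>x. bet (w x) - h * L x) (\<lambda>x. bet (w x))"
proof -
 have wD: "w \<in> D" by (rule wl_D[OF w])
 have 0: "E (\<lambda>x. 0) h = 0" if "h \<in> D" for h using E_cmult[OF D_0 that, of 0] by simp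
 have "E w \<eta> = (LINT x|M. ((bet (w x) - h * L x) - bet (w x)) * \<eta> x) / h" if "\<eta> \<in> D" for \<eta>
  using wl_E[OF w that] E_sym[OF wD that] h by (simp add: mult_ac)
 thus ?thesis unfolding res_def esol_def using wD D_Lp[OF wD rr1(2)] m_pos rr1 0[OF D_0]
  by (auto intro!: exI[of _ "\<lambda>k. w"] simp: spow_inverse)
qed

text \<open>One implicit step in the very weak form, with both derivatives on \<eta>. The
  approximations behind \<open>esol\<close> converge to u^m in \<open>Lp M rr\<close>, which is
  paired with the space of L.\<close>

lemma res_weak:
 assumes h: "h > 0" and f: "f \<in> X" and r: "res h f u" and \<eta>: "wl \<eta> L"
 shows "ip u \<eta> - ip f \<eta> = h * sip u L"
proof -
 let ?w = "\<lambda>x. spow (u x) m"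
 have uX: "u \<in> X" by (rule res_X[OF h f r])
 obtain a where a: "\<And>k. a k \<in> D" "(\<lambda>k. dpow M rr (a k) ?w) \<longlonglongrightarrow> 0"
  "(\<lambda>k. E (a k) \<eta>) \<longlonglongrightarrow> (LINT x|M. (f x - bet (?w x)) * \<eta> x) / h"
  using r wl_D[OF \<eta>] unfolding res_def esol_def by blast
 have wL: "?w \<in> Lp M rr" using r unfolding res_def esol_def by auto
 have LL: "L \<in> Lp M (1 + m)" using bfs_Lp[OF wl_bfs[OF \<eta>]] rr1 by simp
 have \<eta>L: "\<eta> \<in> Lp M rr" using D_Lp[OF wl_D[OF \<eta>]] rr1 by simp
 have aL: "a k \<in> Lp M rr" for k using D_Lp[OF a(1)] rr1 by simp
 note I = Lp_pair
 have "(\<lambda>k. LINT x|M. L x * (a k x - ?w x)) \<longlonglongrightarrow> 0"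
  by (rule Lp_dual_tendsto(2)[OF rr1(1) rr1(5) rr(2) LL _ a(2)]) (use Lp_diff[OF aL wL] rr1 in auto)
 moreover have "(LINT x|M. L x * (a k x - ?w x)) = - E (a k) \<eta> - ip ?w L" for k
  unfolding wl_E[OF \<eta> a(1)] right_diff_distrib
  by (subst Bochner_Integration.integral_diff) (auto intro!: I LL aL wL simp: mult.commute)
 ultimately have "(\<lambda>k. - E (a k) \<eta>) \<longlonglongrightarrow> ip ?w L" by (simp add: LIM_zero_iff)
 from LIMSEQ_unique[OF this tendsto_minus[OF a(3)]]
 have "ip ?w L = - (LINT x|M. (f x - u x) * \<eta> x) / h" using m_pos by (simp add: spow_inverse)
 moreover have "(LINT x|M. (f x - u x) * \<eta> x) = ip f \<eta> - ip u \<eta>"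
  unfolding left_diff_distrib by (intro Bochner_Integration.integral_diff I \<eta>L X_Lp f uX)
 ultimately show ?thesis using h by (simp add: field_simps)
qed

end

section \<open>Moduli of continuity of the signed power\<close>

lemma spow_lipschitz:
 fixes p R a b :: real
 assumes p: "p > 1" and R: "\<bar>a\<bar> \<le> R" "\<bar>b\<bar> \<le> R"
 shows "\<bar>spow a p - spow b p\<bar> \<le> p * R powr (p - 1) * \<bar>a - b\<bar>"
proof -
 have pos: "x powr p - y powr p \<le> p * R powr (p - 1) * (x - y)" if xy: "0 \<le> y" "y \<le> x" "x \<le> R" for x y :: real
 proof -
  have "x powr p / p + spow x (p - 1) * (y - x) \<le> y powr p / p"
   using spow_tangent[OF p, of x y] xy by simp
  hence "x powr p - y powr p \<le> p * (x powr (p - 1) * (x - y))"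
   using p xy mult_left_mono[of "x powr p / p + x powr (p - 1) * (y - x)" "y powr p / p" p]
   by (simp add: spow_nonneg distrib_left algebra_simps)
  also have "\<dots> \<le> p * (R powr (p - 1) * (x - y))"
   using p xy by (intro mult_left_mono mult_right_mono powr_mono2) auto
  finally show ?thesis by (simp add: mult_ac)
 qed
 have main: "\<bar>spow x p - spow y p\<bar> \<le> p * R powr (p - 1) * \<bar>x - y\<bar>" if xy: "y \<le> x" "\<bar>x\<bar> \<le> R" "\<bar>y\<bar> \<le> R" for x y :: real
 proof -
  have "spow y p \<le> spow x p" using p xy by (intro spow_mono) auto
  moreover consider "0 \<le> y" | "x \<le> 0" | "y < 0" "0 < x" by linarith
  hence "spow x p - spow y p \<le> p * R powr (p - 1) * (x - y)"
  proof cases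
   case 1 thus ?thesis using pos[of y x] xy by (simp add: spow_nonneg)
  next
   case 2 thus ?thesis using pos[of "- x" "- y"] xy spow_nonneg[of "-x" p] spow_nonneg[of "-y" p] by (simp add: spow_minus)
  next
   case 3 thus ?thesis using pos[of 0 x] pos[of 0 "- y"] xy spow_nonneg[of x p] spow_nonneg[of "-y" p] p
    by (simp add: spow_minus algebra_simps)
  qed
  ultimately show ?thesis using xy by simp
 qed
 show ?thesis using main[of a b] main[of b a] R by (cases "b \<le> a") (simp_all add: abs_minus_commute)
qed

lemma powr_subadd:
 fixes x y a :: real
 assumes "x \<ge> 0" "y \<ge> 0" "0 \<le> a" "a \<le> 1"
 shows "(x + y) powr a \<le> x powr a + y powr a"
proof (cases "x + y = 0")
 case True thus ?thesis using assms by (auto simp: add_nonneg_eq_0_iff)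
next
 case False
 hence p: "x + y > 0" using assms by auto
 have *: "t \<le> t powr a" if "0 \<le> t" "t \<le> 1" for t :: real
  using powr_mono'[of a 1 t] that assms by simp
 have "1 = x / (x+y) + y / (x+y)" using p by (simp add: add_divide_distrib[symmetric])
 also have "\<dots> \<le> (x / (x+y)) powr a + (y / (x+y)) powr a"
  using assms p by (intro add_mono *) auto
 finally have "1 \<le> (x powr a + y powr a) / (x + y) powr a"
  using assms p by (simp add: powr_divide add_divide_distrib)
 thus ?thesis using p by (simp add: divide_simps split: if_splits)
qed

text \<open>For arguments of one sign subadditivity of t powr m gives the constant 1; the 2 covers
  opposite signs.\<close>

lemma spow_holder:
 assumes "0 < m" "m \<le> 1"
 shows "\<bar>spow a m - spow b m\<bar> \<le> 2 * \<bar>a - b\<bar> powr m"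
proof -
 have pos: "x powr m - y powr m \<le> 2 * (x - y) powr m" if xy: "0 \<le> y" "y \<le> x" for x y :: real
 proof -
  have "0 \<le> (x - y) powr m" by simp
  moreover have "x powr m \<le> (x - y) powr m + y powr m" using powr_subadd[of "x - y" y m] xy assms by simp
  ultimately show ?thesis by linarith
 qed
 have main: "\<bar>spow x m - spow y m\<bar> \<le> 2 * \<bar>x - y\<bar> powr m" if xy: "y \<le> x" for x y :: real
 proof -
  have "spow y m \<le> spow x m" using assms xy by (intro spow_mono) auto
  moreover consider "0 \<le> y" | "x \<le> 0" | "y < 0" "0 < x" by linarith
  hence "spow x m - spow y m \<le> 2 * (x - y) powr m"
  proof cases
   case 1 thus ?thesis using pos[of y x] xy by (simp add: spow_nonneg)
  next
   case 2 thus ?thesis using pos[of "- x" "- y"] xy spow_nonneg[of "-x" m] spow_nonneg[of "-y" m] by (simp add: spow_minus)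
  next
   case 3
   hence "x powr m \<le> (x - y) powr m" "(- y) powr m \<le> (x - y) powr m"
    using assms by (auto intro!: powr_mono2)
   thus ?thesis using 3 spow_nonneg[of x m] spow_nonneg[of "-y" m] by (simp add: spow_minus)
  qed
  ultimately show ?thesis using xy by simp
 qed
 show ?thesis using main[of a b] main[of b a] by (cases "b \<le> a") (simp_all add: abs_minus_commute)
qed

lemma bfs_mult_cont:
 assumes f: "f \<in> bfs M" and g: "g \<in> bfs M" and P: "continuous_on UNIV P"
 shows "(\<lambda>x. P (f x) * g x) \<in> bfs M"
proof -
 have "(\<lambda>x. P (f x) - P 0) \<in> bfs M"
  using P by (intro bfs_comp_cont[where P = "\<lambda>s. P s - P 0", OF f]) (auto intro!: continuous_intros)
 from bfs_add[OF bfs_cmult[OF g, of "P 0"] bfs_mult[OF g this]] show ?thesis by (simp add: algebra_simps)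
qed

lemma C1_funI:
 assumes "\<And>s. (P has_real_derivative P' s) (at s)" "\<And>s. (P' has_real_derivative P'' s) (at s)" "P 0 = 0"
 shows "C1_fun P P'"
 unfolding C1_fun_def using assms by (meson DERIV_isCont continuous_at_imp_continuous_on)

section \<open>Product rule and chain rule for the weak Laplacian\<close>

context dirichlet_form
begin

text \<open>Polarisation: f g = ((f + g)^2 - (f - g)^2) / 4 turns the chain rule into the product
  rule.\<close>

lemma D_mult:
 assumes f: "f \<in> D" and g: "g \<in> D"
 shows "(\<lambda>x. f x * g x) \<in> D"
  and "h \<in> D ==> \<Gamma> (\<lambda>x. f x * g x) h = (\<lambda>x. f x * \<Gamma> g h x + g x * \<Gamma> f h x)"
proof -
 define P where "P s = s\<^sup>2 / 4" for s :: real
 define P' where "P' s = s / 2" for s :: real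
 have P: "C1_fun P P'" unfolding C1_fun_def P_def[abs_def] P'_def[abs_def]
  by (auto intro!: derivative_eq_intros continuous_intros)
 have e: "(\<lambda>x. f x * g x) = (\<lambda>x. P (f x + g x) - P (f x - g x))"
  by (simp add: P_def power2_eq_square field_simps fun_eq_iff)
 have 1: "(\<lambda>x. P (f x + g x)) \<in> D" "(\<lambda>x. P (f x - g x)) \<in> D"
  by (intro D_comp[OF _ P] D_add D_diff f g)+
 thus "(\<lambda>x. f x * g x) \<in> D" unfolding e by (rule D_diff)
 assume h: "h \<in> D"
 show "\<Gamma> (\<lambda>x. f x * g x) h = (\<lambda>x. f x * \<Gamma> g h x + g x * \<Gamma> f h x)"
  unfolding e \<Gamma>_diff[OF 1 h] \<Gamma>_comp[OF D_add[OF f g] h P] \<Gamma>_comp[OF D_diff[OF f g] h P]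
   \<Gamma>_add[OF f g h] \<Gamma>_diff[OF f g h] P'_def
  by (simp add: fun_eq_iff field_simps)
qed

lemma wl_add:
 assumes "wl f L" "wl g K" shows "wl (\<lambda>x. f x + g x) (\<lambda>x. L x + K x)"
 unfolding wl_def
proof (intro conjI ballI)
 show "(\<lambda>x. f x + g x) \<in> D" "(\<lambda>x. L x + K x) \<in> bfs M"
  using assms by (auto intro!: D_add bfs_add dest: wl_D wl_bfs)
 fix h assume h: "h \<in> D"
 have I: "integrable M (\<lambda>x. h x * L x)" "integrable M (\<lambda>x. h x * K x)"
  using bfs_integrable[OF bfs_mult[OF wl_bfs D_bfs[OF h]]] assms by auto
 thus "E h (\<lambda>x. f x + g x) = - (LINT x|M. h x * (L x + K x))"
  using E_add2[OF wl_D[OF assms(1)] wl_D[OF assms(2)] h] wl_E[OF assms(1) h] wl_E[OF assms(2) h]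
  by (simp add: ring_distribs)
qed

lemma wl_0: "wl (\<lambda>_. 0) (\<lambda>_. 0)"
 unfolding wl_def using D_0 D_bfs[OF D_0] E_cmult2[OF D_0, of _ 0] by simp

lemma wl_cmult:
 assumes "wl f L" shows "wl (\<lambda>x. c * f x) (\<lambda>x. c * L x)"
 unfolding wl_def
 using assms E_cmult2[OF wl_D[OF assms]] wl_E[OF assms]
 by (auto intro!: D_cmult bfs_cmult dest: wl_D wl_bfs simp: mult.left_commute[of _ c])

lemma wl_sum:
 assumes "\<And>i::nat. wl (f i) (L i)" shows "wl (\<lambda>x. \<Sum>i<n. f i x) (\<lambda>x. \<Sum>i<n. L i x)"
 by (induction n) (auto intro: wl_0 wl_add assms)

text \<open>The formula \<Delta>P(f) = P'(f) \<Delta>f + P''(f) |grad f|^2, obtained by testing the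
  equation of f with g P'(f).\<close>

lemma wl_comp:
 assumes w: "wl f L" and P: "\<And>s. (P has_real_derivative P' s) (at s)" "\<And>s. (P' has_real_derivative P'' s) (at s)"
  "continuous_on UNIV P''" "P 0 = 0"
 shows "wl (\<lambda>x. P (f x)) (\<lambda>x. P' (f x) * L x + P'' (f x) * \<Gamma> f f x)"
proof -
 have f: "f \<in> D" and Lb: "L \<in> bfs M" using w wl_D wl_bfs by auto
 have PC: "C1_fun P P'" by (rule C1_funI[OF P(1,2,4)])
 have P'c: "continuous_on UNIV P'" using PC by (simp add: C1_fun_def)
 \<comment> \<open>P' (f) need not vanish off the support of f. It is split into the constant P' 0
   and Q (f), which lies in D.\<close>
 define Q where "Q s = P' s - P' 0" for s
 have Q: "C1_fun Q P''" unfolding C1_fun_def Q_def[abs_def] using P by (auto intro!: derivative_eq_intros)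
 have Qf: "(\<lambda>x. Q (f x)) \<in> D" by (rule D_comp[OF f Q])
 have b: "(\<lambda>x. P' (f x) * L x) \<in> bfs M" "(\<lambda>x. P'' (f x) * \<Gamma> f f x) \<in> bfs M"
  by (intro bfs_mult_cont D_bfs f Lb P'c P(3) \<Gamma>_bfs)+
 have "E g (\<lambda>x. P (f x)) = - (LINT x|M. g x * (P' (f x) * L x + P'' (f x) * \<Gamma> f f x))" if g: "g \<in> D" for g
 proof -
  have gQ: "(\<lambda>x. g x * Q (f x)) \<in> D" by (rule D_mult(1)[OF g Qf])
  have e: "\<Gamma> g (\<lambda>x. P (f x)) x = (P' 0 * \<Gamma> g f x + \<Gamma> (\<lambda>x. g x * Q (f x)) f x) - g x * (P'' (f x) * \<Gamma> f f x)" for x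
   unfolding \<Gamma>_sym[OF g D_comp[OF f PC]] \<Gamma>_comp[OF f g PC] D_mult(2)[OF g Qf f] \<Gamma>_comp[OF f f Q]
   using \<Gamma>_sym[OF f g] by (simp add: Q_def algebra_simps)
  have gb: "g \<in> bfs M" by (rule D_bfs[OF g])
  have "E g (\<lambda>x. P (f x)) = P' 0 * E g f + E (\<lambda>x. g x * Q (f x)) f - (LINT x|M. g x * (P'' (f x) * \<Gamma> f f x))"
   unfolding E_def e
   using bfs_integrable[OF \<Gamma>_bfs[OF g f]] bfs_integrable[OF \<Gamma>_bfs[OF gQ f]] bfs_integrable[OF bfs_mult[OF b(2) gb]]
   by simp
  also have "\<dots> = - (P' 0 * ip g L) - (LINT x|M. g x * Q (f x) * L x) - (LINT x|M. g x * (P'' (f x) * \<Gamma> f f x))"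
   unfolding wl_E[OF w g] wl_E[OF w gQ] by simp
  also have "\<dots> = - (LINT x|M. P' 0 * (g x * L x) + g x * Q (f x) * L x + g x * (P'' (f x) * \<Gamma> f f x))"
   using bfs_integrable[OF bfs_mult[OF Lb gb]] bfs_integrable[OF bfs_mult[OF Lb D_bfs[OF gQ]]] bfs_integrable[OF bfs_mult[OF b(2) gb]]
   by simp
  also have "\<dots> = - (LINT x|M. g x * (P' (f x) * L x + P'' (f x) * \<Gamma> f f x))"
   by (simp add: Q_def algebra_simps)
  finally show ?thesis .
 qed
 thus ?thesis unfolding wl_def using D_comp[OF f PC] bfs_add[OF b] by blast
qed

end

text \<open>The existence theory up to abstract space-time test functions rests on these axioms.
  \<open>bumps\<close> supplies the cut-offs, the exhaustion by compact sets and the dense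
  domain.\<close>

locale dirichlet_space = dirichlet_form M D \<Gamma> m
 for M :: "'a::{t2_space, second_countable_topology} measure" and D \<Gamma> m +
 assumes sets_M: "sets M = sets borel"
  and D_cont: "f \<in> D ==> continuous_on UNIV f"
  and D_supp: "f \<in> D ==> compact (closure {x. f x \<noteq> 0})"
  and bumps: "open U ==> p \<in> U ==>
   \<exists>\<eta> L. wl \<eta> L \<and> (\<forall>x. 0 \<le> \<eta> x) \<and> \<eta> p > 0 \<and> (\<forall>x. x \<notin> U \<longrightarrow> \<eta> x = 0)"
begin

section \<open>Exhaustion and cut-off functions\<close>

lemma space_M [simp]: "space M = UNIV"
 using sets_eq_imp_space_eq[OF sets_M] by simp

lemma borel_M: "borel_measurable M = borel_measurable borel"
 by (rule measurable_cong_sets[OF sets_M refl])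

lemma open_pos: "f \<in> D ==> open {x. f x > 0}"
 using open_Collect_less[OF continuous_on_const D_cont] by blast

lemma bfs_support_finite:
 assumes "f \<in> bfs M" shows "emeasure M {x. f x \<noteq> 0} < \<infinity>"
proof -
 obtain K where K: "K \<in> sets M" "emeasure M K < \<infinity>" "\<And>x. x \<notin> K ==> f x = 0" using assms unfolding bfs_def by blast
 have "emeasure M {x. f x \<noteq> 0} \<le> emeasure M K" using K by (intro emeasure_mono) auto
 thus ?thesis using K(2) by (rule le_less_trans)
qed

text \<open>The sets where bumps vanishing off U are positive cover U; Lindelof's theorem reduces
  them to a sequence.\<close>

lemma open_approx:
 assumes U: "open U" "U \<noteq> {}"
 shows "\<exists>b L. (\<forall>i::nat. wl (b i) (L i) \<and> (\<forall>x. 0 \<le> b i x) \<and> (\<forall>x. x \<notin> U \<longrightarrow> b i x = 0)) \<and> (\<forall>x\<in>U. \<exists>i. b i x > 0)"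
proof -
 define B where "B = {\<eta>. (\<exists>L. wl \<eta> L) \<and> (\<forall>x. 0 \<le> \<eta> x) \<and> (\<forall>x. x \<notin> U \<longrightarrow> \<eta> x = 0)}"
 define F where "F = (\<lambda>\<eta>. {x. \<eta> x > (0::real)}) ` B"
 have "\<And>S. S \<in> F ==> open S" unfolding F_def B_def by (auto intro: open_pos wl_D)
 then obtain F' where F': "F' \<subseteq> F" "countable F'" "\<Union>F' = \<Union>F" by (rule Lindelof)
 have UF: "U \<subseteq> \<Union>F" unfolding F_def B_def using bumps[OF U(1)] by blast
 hence ne: "F' \<noteq> {}" using F'(3) U(2) by auto
 have "\<exists>\<eta>\<in>B. from_nat_into F' i = {x. \<eta> x > 0}" for i
  using from_nat_into[OF ne, of i] F'(1) unfolding F_def by blast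
 then obtain b where b: "\<And>i. b i \<in> B" "\<And>i. from_nat_into F' i = {x. b i x > 0}" by metis
 have "\<exists>L. wl (b i) L" for i using b(1)[of i] unfolding B_def by blast
 then obtain L where L: "\<And>i. wl (b i) (L i)" by metis
 have "\<exists>i. b i x > 0" if x: "x \<in> U" for x
 proof -
  have "x \<in> \<Union>F'" using x UF F'(3) by blast
  then obtain S where S: "S \<in> F'" "x \<in> S" by blast
  then obtain i where "from_nat_into F' i = S" using from_nat_into_surj[OF F'(2)] by blast
  thus ?thesis using b(2)[of i] S by auto
 qed
 thus ?thesis using b(1) L unfolding B_def by blast
qed

text \<open>Finitely many bumps suffice to be positive on K; their sum is divided by a positive
  lower bound on K.\<close>

lemma compact_dominated:
 assumes K: "compact K"
 shows "\<exists>\<psi> L. wl \<psi> L \<and> (\<forall>x. 0 \<le> \<psi> x) \<and> (\<forall>x\<in>K. 1 \<le> \<psi> x)"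
proof -
 obtain b L where b: "\<And>i::nat. wl (b i) (L i)" "\<And>i x. 0 \<le> b i x" "\<And>x. \<exists>i. b i x > 0"
  using open_approx[of UNIV] by (metis UNIV_I empty_not_UNIV open_UNIV)
 have op: "open {x. b i x > 0}" for i by (rule open_pos[OF wl_D[OF b(1)]])
 have cov: "K \<subseteq> (\<Union>i\<in>UNIV. {x. b i x > 0})" using b(3) by auto
 obtain I where I: "finite I" "K \<subseteq> (\<Union>i\<in>I. {x. b i x > 0})"
  by (rule compactE_image[OF K op cov]) auto
 obtain n where n: "I \<subseteq> {..<n}" using I(1) by (metis finite_nat_iff_bounded)
 define s where "s x = (\<Sum>i<n. b i x)" for x
 have s: "wl s (\<lambda>x. \<Sum>i<n. L i x)" unfolding s_def[abs_def] by (rule wl_sum[OF b(1)])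
 have s0: "0 \<le> s x" for x unfolding s_def using b(2) by (simp add: sum_nonneg)
 have spos: "s x > 0" if "x \<in> K" for x
 proof -
  obtain i where i: "i \<in> I" "b i x > 0" using I(2) \<open>x \<in> K\<close> by blast
  thus ?thesis unfolding s_def using n b(2) by (intro sum_pos2[of _ i]) auto
 qed
 have "\<exists>\<delta>>0. \<forall>x\<in>K. \<delta> \<le> s x"
 proof (cases "K = {}")
  case True thus ?thesis by (auto intro!: exI[of _ 1])
 next
  case False
  have "continuous_on K s" using D_cont[OF wl_D[OF s]] continuous_on_subset by blast
  then obtain x0 where "x0 \<in> K" "\<forall>x\<in>K. s x0 \<le> s x" using continuous_attains_inf[OF K False] by blast
  thus ?thesis using spos by blast
 qed
 then obtain \<delta> where d: "\<delta> > 0" "\<And>x. x \<in> K ==> \<delta> \<le> s x" by blast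
 have "wl (\<lambda>x. 1 / \<delta> * s x) (\<lambda>x. 1 / \<delta> * (\<Sum>i<n. L i x))" by (rule wl_cmult[OF s])
 moreover have "\<forall>x. 0 \<le> 1 / \<delta> * s x" using s0 d by simp
 moreover have "\<forall>x\<in>K. 1 \<le> 1 / \<delta> * s x" using d by (simp add: field_simps)
 ultimately show ?thesis by blast
qed

lemma compact_finite_measure:
 assumes "compact K" shows "emeasure M K < \<infinity>"
proof -
 obtain \<psi> L where \<psi>: "wl \<psi> L" "\<And>x. x \<in> K ==> 1 \<le> \<psi> x" using compact_dominated[OF assms] by blast
 have b: "\<psi> \<in> bfs M" using D_bfs[OF wl_D[OF \<psi>(1)]] .
 have [measurable]: "\<psi> \<in> borel_measurable M" using b by (rule bfs_meas)
 have "{x \<in> space M. \<psi> x \<noteq> 0} \<in> sets M" by measurable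
 hence "emeasure M K \<le> emeasure M {x. \<psi> x \<noteq> 0}" using \<psi>(2) by (intro emeasure_mono) force+
 thus ?thesis using bfs_support_finite[OF b] by (rule le_less_trans)
qed

text \<open>The closed supports of countably many bumps cover the space.\<close>

lemma exhaustion:
 "\<exists>K. (\<forall>n::nat. compact (K n :: 'a set)) \<and> incseq K \<and> (\<Union>n. K n) = UNIV"
proof -
 obtain b L where b: "\<And>i::nat. wl (b i) (L i)" "\<And>x. \<exists>i. b i x > 0"
  using open_approx[of UNIV] by (metis UNIV_I empty_not_UNIV open_UNIV)
 define K where "K n = (\<Union>i<n. closure {x. b i x \<noteq> 0})" for n
 have "compact (K n)" for n unfolding K_def using D_supp[OF wl_D[OF b(1)]] by (intro compact_UN) auto
 moreover have "incseq K" unfolding K_def by (intro incseq_SucI UN_mono) auto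
 moreover have "x \<in> (\<Union>n. K n)" for x
 proof -
  obtain i where "b i x > 0" using b(2) by blast
  hence "x \<in> closure {x. b i x \<noteq> 0}" by (intro subsetD[OF closure_subset]) simp
  hence "x \<in> K (Suc i)" unfolding K_def by blast
  thus ?thesis by blast
 qed
 ultimately show ?thesis by blast
qed

text \<open>Powers \<open>\<psi> ^ q\<close> of a bump with \<open>q (1 - m) \<ge> 2\<close> have a Laplacian bounded by \<open>(\<psi> ^ q) powr m\<close>.\<close>

lemma cutoff:
 assumes K: "compact K"
 shows "\<exists>\<eta> L C. wl \<eta> L \<and> (\<forall>x. 0 \<le> \<eta> x) \<and> (\<forall>x\<in>K. 1 \<le> \<eta> x) \<and> C > 0 \<and> (\<forall>x. \<bar>L x\<bar> \<le> C * \<eta> x powr m)"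
proof -
 obtain \<psi> L where \<psi>: "wl \<psi> L" "\<And>x. 0 \<le> \<psi> x" "\<And>x. x \<in> K ==> 1 \<le> \<psi> x" using compact_dominated[OF K] by blast
 obtain k :: nat where k: "2 / (1 - m) < real k" using reals_Archimedean2 by blast
 \<comment> \<open>q \<ge> 3 makes 0 ^ (q - 2) = 0, which settles the points where \<psi>
   vanishes.\<close>
 define q where "q = k + 3"
 have "2 / (1 - m) \<le> real q" using k by (simp add: q_def)
 hence qm: "real q - 2 - real q * m \<ge> 0" using m_less1 by (simp add: field_simps)
 define P' where "P' s = real q * s ^ (q - 1)" for s :: real
 define P'' where "P'' s = real q * (real (q - 1) * s ^ (q - 2))" for s :: real
 have w: "wl (\<lambda>x. \<psi> x ^ q) (\<lambda>x. P' (\<psi> x) * L x + P'' (\<psi> x) * \<Gamma> \<psi> \<psi> x)"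
 proof (rule wl_comp[OF \<psi>(1)])
  show "((\<lambda>s. s ^ q) has_real_derivative P' s) (at s)" for s
   unfolding P'_def by (auto intro!: derivative_eq_intros)
  show "(P' has_real_derivative P'' s) (at s)" for s
   unfolding P'_def[abs_def] P''_def by (rule derivative_eq_intros refl)+ (simp add: q_def)
  show "continuous_on UNIV P''" unfolding P''_def by (intro continuous_intros)
 qed (simp add: q_def)
 obtain C1 where C1: "C1 > 0" "\<And>x. \<bar>\<psi> x\<bar> \<le> C1" using bfs_bounded[OF D_bfs[OF wl_D[OF \<psi>(1)]]] by blast
 obtain C2 where C2: "C2 > 0" "\<And>x. \<bar>L x\<bar> \<le> C2" using bfs_bounded[OF wl_bfs[OF \<psi>(1)]] by blast
 obtain C3 where C3: "C3 > 0" "\<And>x. \<bar>\<Gamma> \<psi> \<psi> x\<bar> \<le> C3"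
  using bfs_bounded[OF \<Gamma>_bfs[OF wl_D[OF \<psi>(1)] wl_D[OF \<psi>(1)]]] by blast
 \<comment> \<open>The first factor bounds what is left of the two terms once \<psi> ^ (q - 2) is
   taken out; the second bounds the surplus of that power over (\<psi> ^ q) powr m.\<close>
 define C where "C = (real q * C1 * C2 + real q * real (q - 1) * C3) * C1 powr (real q - 2 - real q * m)"
 have Cp: "C > 0" unfolding C_def using C1 C2 C3 by (intro mult_pos_pos add_pos_nonneg) (auto simp: q_def)
 have "\<bar>P' (\<psi> x) * L x + P'' (\<psi> x) * \<Gamma> \<psi> \<psi> x\<bar> \<le> C * (\<psi> x ^ q) powr m" for x
 proof -
  let ?s = "\<psi> x"
  have s: "0 \<le> ?s" "?s \<le> C1" using \<psi>(2) C1(2)[of x] by auto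
  have p1: "?s ^ (q - 1) = ?s ^ (q - 2) * ?s" by (simp add: q_def)
  have "\<bar>P' ?s * L x + P'' ?s * \<Gamma> \<psi> \<psi> x\<bar> \<le> \<bar>P' ?s\<bar> * \<bar>L x\<bar> + \<bar>P'' ?s\<bar> * \<bar>\<Gamma> \<psi> \<psi> x\<bar>"
   by (metis abs_mult abs_triangle_ineq)
  also have "\<dots> \<le> \<bar>P' ?s\<bar> * C2 + \<bar>P'' ?s\<bar> * C3"
   using C2(2) C3(2) by (intro add_mono mult_left_mono) auto
  also have "\<dots> = ?s ^ (q - 2) * (real q * ?s * C2 + real q * real (q - 1) * C3)"
   using s unfolding P'_def P''_def p1 by (simp add: abs_mult algebra_simps)
  also have "\<dots> \<le> ?s ^ (q - 2) * (real q * C1 * C2 + real q * real (q - 1) * C3)"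
   using s C2 by (intro mult_left_mono add_mono mult_right_mono) auto
  also have "?s ^ (q - 2) \<le> C1 powr (real q - 2 - real q * m) * (?s ^ q) powr m"
  proof (cases "?s = 0")
   case True thus ?thesis by (simp add: q_def)
  next
   case False
   hence sp: "?s > 0" using s by simp
   have "?s ^ (q - 2) = ?s powr real (q - 2)" using sp by (simp add: powr_realpow)
   also have "real (q - 2) = real q - 2" by (simp add: q_def)
   also have "?s powr (real q - 2) = ?s powr (real q - 2 - real q * m) * ?s powr (real q * m)" by (simp add: powr_add[symmetric])
   also have "?s powr (real q * m) = (?s ^ q) powr m" using sp by (simp add: powr_realpow[symmetric] powr_powr)
   also have "?s powr (real q - 2 - real q * m) * (?s ^ q) powr m \<le> C1 powr (real q - 2 - real q * m) * (?s ^ q) powr m"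
    using s qm by (intro mult_right_mono powr_mono2) auto
   finally show ?thesis .
  qed
  finally show ?thesis using C1 C2 C3 unfolding C_def by (simp add: mult_ac mult_right_mono)
 qed
 thus ?thesis using w Cp \<psi>(2,3) by (intro exI[of _ "\<lambda>x. \<psi> x ^ q"] exI[of _ C] exI) auto
qed

section \<open>Density\<close>

definition apx :: "'a fn \<Rightarrow> bool" where
 "apx f \<longleftrightarrow> integrable M f \<and> (\<forall>e>0. \<exists>w L. wl w L \<and> dst f w < e)"

lemma wl_integrable: "wl w L ==> integrable M w"
 by (intro bfs_integrable D_bfs wl_D)

lemma apx_add:
 assumes "apx f" "apx g" shows "apx (\<lambda>x. f x + g x)"
 unfolding apx_def
proof (intro conjI allI impI)
 have I: "integrable M f" "integrable M g" using assms by (auto simp: apx_def)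
 thus "integrable M (\<lambda>x. f x + g x)" by simp
 fix e :: real assume "e > 0"
 hence e2: "e / 2 > 0" by simp
 obtain v L where v: "wl v L" "dst f v < e / 2" using assms(1) e2 unfolding apx_def by blast
 obtain w K where w: "wl w K" "dst g w < e / 2" using assms(2) e2 unfolding apx_def by blast
 have "nrm (\<lambda>x. (f x + g x) - (v x + w x)) \<le> (LINT x|M. \<bar>f x - v x\<bar> + \<bar>g x - w x\<bar>)"
  unfolding nrm_def using I wl_integrable[OF v(1)] wl_integrable[OF w(1)] by (intro integral_mono) auto
 also have "\<dots> = dst f v + dst g w"
  unfolding nrm_def using I wl_integrable[OF v(1)] wl_integrable[OF w(1)] by (intro Bochner_Integration.integral_add) auto
 finally show "\<exists>w L. wl w L \<and> nrm (\<lambda>x. (f x + g x) - w x) < e"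
  using v w wl_add[OF v(1) w(1)]
  by (intro exI[of _ "\<lambda>x. v x + w x"] exI[of _ "\<lambda>x. L x + K x"] conjI) linarith+
qed

lemma apx_cmult:
 assumes "apx f" shows "apx (\<lambda>x. c * f x)"
 unfolding apx_def
proof (intro conjI allI impI)
 show "integrable M (\<lambda>x. c * f x)" using assms by (auto simp: apx_def)
 fix e :: real assume e: "e > 0"
 hence "e / (\<bar>c\<bar> + 1) > 0" by simp
 then obtain v L where v: "wl v L" "dst f v < e / (\<bar>c\<bar> + 1)" using assms unfolding apx_def by blast
 have "nrm (\<lambda>x. c * f x - c * v x) = \<bar>c\<bar> * dst f v"
  unfolding nrm_def by (simp add: right_diff_distrib[symmetric] abs_mult)
 also have "\<dots> \<le> (\<bar>c\<bar> + 1) * dst f v" by (intro mult_right_mono) auto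
 also have "\<dots> < e" using v(2) by (simp add: field_simps)
 finally show "\<exists>w L. wl w L \<and> nrm (\<lambda>x. c * f x - w x) < e"
  using wl_cmult[OF v(1)] by blast
qed

lemma apx_limit:
 assumes f: "integrable M f" and s: "\<And>i::nat. apx (s i)" and lim: "(\<lambda>i. dst f (s i)) \<longlonglongrightarrow> 0"
 shows "apx f"
 unfolding apx_def
proof (intro conjI allI impI f)
 fix e :: real assume "e > 0"
 hence e2: "e / 2 > 0" by simp
 obtain i where i: "dst f (s i) < e / 2"
  using order_tendstoD(2)[OF lim e2] by (auto simp: eventually_sequentially)
 obtain v L where v: "wl v L" "dst (s i) v < e / 2" using s[of i] e2 unfolding apx_def by blast
 have "dst f v < e"
  using nrm_tri[OF f _ wl_integrable[OF v(1)], of "s i"] s[of i] i v(2) unfolding apx_def by linarith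
 thus "\<exists>w L. wl w L \<and> dst f w < e" using v(1) by blast
qed

lemma apx_wl: "wl w L ==> apx w"
 unfolding apx_def using wl_integrable[of w L]
 by (intro conjI allI impI exI[of _ w] exI[of _ L]) (auto simp: nrm_def)

text \<open>The approximants are P (n S n), with S n a partial sum of bumps whose positivity sets
  cover U. P(s) = s^2 / (1 + s^2) vanishes at 0, has two continuous derivatives and stays in [0, 1],
  so \<open>wl_comp\<close> applies and the indicator of U dominates.\<close>

lemma apx_open:
 assumes U: "open U" "emeasure M U < \<infinity>"
 shows "apx (indicator U)"
proof (cases "U = {}")
 case True
 hence "(indicator U :: 'a \<Rightarrow> real) = (\<lambda>_. 0)" by (simp add: fun_eq_iff)
 thus ?thesis using apx_wl[OF wl_0] by simp
next
 case False
 obtain b L where b: "\<And>i::nat. wl (b i) (L i)" "\<And>i x. 0 \<le> b i x" "\<And>i x. x \<notin> U ==> b i x = 0" "\<And>x. x \<in> U ==> \<exists>i. b i x > 0"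
  using open_approx[OF U(1) False] by metis
 define P where "P s = s\<^sup>2 / (1 + s\<^sup>2)" for s :: real
 define P' where "P' s = 2 * s / (1 + s\<^sup>2)\<^sup>2" for s :: real
 define P'' where "P'' s = (2 - 6 * s\<^sup>2) / (1 + s\<^sup>2) ^ 3" for s :: real
 have p: "1 + s\<^sup>2 \<noteq> 0" for s :: real by (metis add_less_le_mono add.right_neutral less_irrefl zero_le_power2 zero_less_one)
 have P1: "(P has_real_derivative P' s) (at s)" for s
  unfolding P_def[abs_def] P'_def using p[of s]
  by (auto intro!: derivative_eq_intros simp: power2_eq_square field_simps)
 have P2: "(P' has_real_derivative P'' s) (at s)" for s
 proof -
  define q where "q = 1 + s\<^sup>2"
  have q0: "q \<noteq> 0" using p[of s] by (simp add: q_def)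
  have "(P' has_real_derivative (2 * (1 + s\<^sup>2)\<^sup>2 - 2 * s * (2 * (1 + s\<^sup>2) * (2 * s))) / ((1 + s\<^sup>2)\<^sup>2 * (1 + s\<^sup>2)\<^sup>2)) (at s)"
   unfolding P'_def[abs_def] using p[of s] by (auto intro!: derivative_eq_intros)
  moreover have "(2 * (1 + s\<^sup>2)\<^sup>2 - 2 * s * (2 * (1 + s\<^sup>2) * (2 * s))) / ((1 + s\<^sup>2)\<^sup>2 * (1 + s\<^sup>2)\<^sup>2) = P'' s"
  proof -
   have "2 * (1 + s\<^sup>2)\<^sup>2 - 2 * s * (2 * (1 + s\<^sup>2) * (2 * s)) = q * (2 - 6 * s\<^sup>2)"
    unfolding q_def by (simp add: power2_eq_square algebra_simps)
   thus ?thesis unfolding P''_def q_def[symmetric] using q0 by (simp add: power2_eq_square power3_eq_cube)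
  qed
  ultimately show ?thesis by simp
 qed
 have P3: "continuous_on UNIV P''" unfolding P''_def using p by (intro continuous_intros) auto
 have P4: "0 \<le> P s" "P s \<le> 1" "P 0 = 0" for s
  unfolding P_def by (auto simp: divide_le_eq add_pos_nonneg)
 define S where "S n x = (\<Sum>i<n. b i x)" for n x
 define g where "g n x = P (real n * S n x)" for n x
 have wg: "\<exists>L. wl (g n) L" for n
  unfolding g_def[abs_def] S_def[abs_def]
  using wl_comp[OF wl_cmult[OF wl_sum[of b L n, OF b(1)], of "real n"] P1 P2 P3 P4(3)] by blast
 have gm [measurable]: "g n \<in> borel_measurable M" for n using wg[of n] by (meson D_bfs bfs_meas wl_D)
 have [measurable]: "U \<in> sets M" using U sets_M by auto
 have g0: "g n x = 0" if "x \<notin> U" for n x unfolding g_def S_def using b(3)[OF that] P4 by simp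
 have glim: "(\<lambda>n. g n x) \<longlonglongrightarrow> indicator U x" for x
 proof (cases "x \<in> U")
  case False thus ?thesis using g0 by simp
 next
  case True
  obtain i where i: "b i x > 0" using b(4)[OF True] by blast
  have "(\<lambda>n. 1 - 1 / (1 + (real n * S n x)\<^sup>2)) \<longlonglongrightarrow> 1 - 0"
  proof (intro tendsto_diff tendsto_const)
   have 1: "filterlim (\<lambda>n. real n * b i x) at_top sequentially"
    using i by (intro filterlim_at_top_mult_tendsto_pos[of _ "b i x"] filterlim_real_sequentially tendsto_const)
   have "filterlim (\<lambda>n. real n * S n x) at_top sequentially"
   proof (rule filterlim_at_top_mono[OF 1])
    show "\<forall>\<^sub>F n in sequentially. real n * b i x \<le> real n * S n x"
     using eventually_gt_at_top[of i]
    proof eventually_elim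
     case (elim n)
     have "b i x \<le> S n x" unfolding S_def using elim b(2) by (intro member_le_sum) auto
     thus ?case by (intro mult_left_mono) auto
    qed
   qed
   hence "filterlim (\<lambda>n. 1 + (real n * S n x)\<^sup>2) at_top sequentially"
    by (intro filterlim_tendsto_add_at_top[OF tendsto_const] filterlim_pow_at_top) auto
   thus "(\<lambda>n. 1 / (1 + (real n * S n x)\<^sup>2)) \<longlonglongrightarrow> 0"
    by (intro real_tendsto_divide_at_top[OF tendsto_const])
  qed
  moreover have "g n x = 1 - 1 / (1 + (real n * S n x)\<^sup>2)" for n
   unfolding g_def P_def using p[of "real n * S n x"] by (simp add: field_simps)
  ultimately show ?thesis using True by simp
 qed
 have I: "integrable M (indicator U :: 'a \<Rightarrow> real)" using U by (simp add: integrable_indicator_iff)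
 show ?thesis
 proof (rule apx_limit[OF I, of g])
  show "apx (g i)" for i using wg apx_wl by blast
  have "(\<lambda>i. LINT x|M. \<bar>indicator U x - g i x\<bar>) \<longlonglongrightarrow> (LINT x|M. 0)"
  proof (rule integral_dominated_convergence[where w = "\<lambda>x. 2 * indicator U x"])
   show "integrable M (\<lambda>x. 2 * indicator U x :: real)" using I by simp
   show "AE x in M. (\<lambda>i. \<bar>indicator U x - g i x\<bar>) \<longlonglongrightarrow> 0"
   proof (intro AE_I2 tendsto_rabs_zero)
    fix x show "(\<lambda>i. indicator U x - g i x) \<longlonglongrightarrow> 0"
     using tendsto_diff[OF tendsto_const[of "indicator U x"] glim[of x]] by simp
   qed
   show "AE x in M. norm \<bar>indicator U x - g i x\<bar> \<le> 2 * indicator U x" for i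
   proof (intro AE_I2)
    fix x show "norm \<bar>indicator U x - g i x\<bar> \<le> 2 * indicator U x"
     using g0[of x i] P4(1,2)[of "real i * S i x"] by (cases "x \<in> U") (auto simp: g_def)
   qed
  qed measurable
  thus "(\<lambda>i. nrm (\<lambda>x. indicator U x - g i x)) \<longlonglongrightarrow> 0" by (simp add: nrm_def)
 qed
qed

text \<open>Dynkin's argument relative to a fixed open set of finite measure, so that complements
  keep finite measure.\<close>

lemma apx_borel_in_open:
 assumes O: "open O'" "emeasure M O' < \<infinity>" and B: "B \<in> sets borel"
 shows "apx (indicator (B \<inter> O'))"
proof -
 have fin: "emeasure M (B \<inter> O') < \<infinity>" if "B \<in> sets borel" for B
  using emeasure_mono[of "B \<inter> O'" O' M] O sets_M by (metis borel_open inf_le2 le_less_trans)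
 have I: "integrable M (indicator (B \<inter> O') :: 'a \<Rightarrow> real)" if "B \<in> sets borel" for B
  using fin[OF that] that O sets_M by (auto simp: integrable_indicator_iff)
 have "Int_stable {S :: 'a set. open S}" "{S :: 'a set. open S} \<subseteq> Pow UNIV" "B \<in> sigma_sets UNIV {S. open S}"
  using B by (auto simp: Int_stable_def borel_def sets_measure_of)
 thus ?thesis
 proof (induction rule: sigma_sets_induct_disjoint)
  case (basic A)
  hence "open (A \<inter> O')" using O by auto
  moreover have "emeasure M (A \<inter> O') < \<infinity>" using basic by (intro fin) auto
  ultimately show ?case by (rule apx_open)
 next
  case empty
  have "(indicator ({} \<inter> O') :: 'a \<Rightarrow> real) = (\<lambda>_. 0)" by (simp add: fun_eq_iff)
  thus ?case using apx_wl[OF wl_0] by simp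
 next
  case (compl A)
  have "indicator ((UNIV - A) \<inter> O') = (\<lambda>x. indicator O' x + (-1) * indicator (A \<inter> O') x :: real)"
   by (auto simp: fun_eq_iff indicator_def)
  thus ?case using apx_add[OF apx_open[OF O] apx_cmult[OF compl(2), of "-1"]] by simp
 next
  case (union A)
  have A: "A i \<in> sets borel" for i using union(2) by (auto simp: borel_def sets_measure_of)
  have partial: "apx (\<lambda>x. \<Sum>i<n. indicator (A i \<inter> O') x)" for n
   by (induction n) (auto intro: apx_add union(3) apx_wl[OF wl_0])
  have eq: "(\<Sum>i<n. indicator (A i \<inter> O') x) = (indicator ((\<Union>i<n. A i) \<inter> O') x :: real)" for n x
  proof -
   have "(\<Sum>i<n. indicator (A i \<inter> O') x) = (indicator (\<Union>i<n. A i \<inter> O') x :: real)"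
    using union(1) by (intro indicator_UN_disjoint[symmetric]) (auto simp: disjoint_family_on_def)
   thus ?thesis by simp
  qed
  have m: "A i \<inter> O' \<in> sets M" "O' \<in> sets M" for i using A O sets_M by auto
  show ?case
  proof (rule apx_limit[OF I partial])
   show "\<Union> (range A) \<in> sets borel" using A by auto
   have IO: "integrable M (indicator O' :: 'a \<Rightarrow> real)" using O m by (auto simp: integrable_indicator_iff)
   have "(\<lambda>n. LINT x|M. \<bar>indicator (\<Union> (range A) \<inter> O') x - indicator ((\<Union>i<n. A i) \<inter> O') x :: real\<bar>) \<longlonglongrightarrow> (LINT x|M. 0)"
   proof (rule integral_dominated_convergence[OF _ _ IO])
    have mm: "\<Union> (range A) \<inter> O' \<in> sets M" "(\<Union>i<n. A i) \<inter> O' \<in> sets M" for n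
     using A O sets_M by auto
    thus "(\<lambda>x. \<bar>indicator (\<Union> (range A) \<inter> O') x - indicator ((\<Union>i<n. A i) \<inter> O') x :: real\<bar>) \<in> borel_measurable M" for n
     by measurable
    show "AE x in M. (\<lambda>n. \<bar>indicator (\<Union> (range A) \<inter> O') x - indicator ((\<Union>i<n. A i) \<inter> O') x :: real\<bar>) \<longlonglongrightarrow> 0"
    proof (intro AE_I2)
     fix x
     show "(\<lambda>n. \<bar>indicator (\<Union> (range A) \<inter> O') x - indicator ((\<Union>i<n. A i) \<inter> O') x :: real\<bar>) \<longlonglongrightarrow> 0"
     proof (cases "x \<in> \<Union> (range A)")
      case True
      then obtain i where "x \<in> A i" by auto
      hence "\<forall>n>i. \<bar>indicator (\<Union> (range A) \<inter> O') x - indicator ((\<Union>i<n. A i) \<inter> O') x :: real\<bar> = 0"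
       by (auto simp: indicator_def)
      thus ?thesis by (intro tendsto_eventually) (auto simp: eventually_sequentially intro!: exI[of _ "Suc i"])
     next
      case False
      thus ?thesis by (auto simp: indicator_def)
     qed
    qed
    show "AE x in M. norm \<bar>indicator (\<Union> (range A) \<inter> O') x - indicator ((\<Union>i<n. A i) \<inter> O') x :: real\<bar> \<le> (indicator O' x :: real)" for n
     by (intro AE_I2) (auto simp: indicator_def)
   qed auto
   thus "(\<lambda>n. nrm (\<lambda>x. indicator (\<Union> (range A) \<inter> O') x - (\<Sum>i<n. indicator (A i \<inter> O') x))) \<longlonglongrightarrow> 0"
    unfolding nrm_def eq by simp
  qed
 qed
qed

lemma truncation_limit:
 assumes f: "integrable M f" and K: "\<And>n::nat. compact (K n)" "incseq K" "(\<Union>n. K n) = UNIV"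
 shows "(\<lambda>n. nrm (\<lambda>x. f x - (if x \<in> K n \<and> \<bar>f x\<bar> \<le> real n then f x else 0))) \<longlonglongrightarrow> 0"
proof -
 have [measurable]: "K n \<in> sets M" for n using K(1) sets_M by (simp add: borel_closed compact_imp_closed)
 have [measurable]: "f \<in> borel_measurable M" using f by auto
 have "(\<lambda>n. LINT x|M. \<bar>f x - (if x \<in> K n \<and> \<bar>f x\<bar> \<le> real n then f x else 0)\<bar>) \<longlonglongrightarrow> (LINT x|M. 0)"
 proof (rule integral_dominated_convergence[OF _ _ integrable_abs[OF f]])
  show "AE x in M. (\<lambda>n. \<bar>f x - (if x \<in> K n \<and> \<bar>f x\<bar> \<le> real n then f x else 0)\<bar>) \<longlonglongrightarrow> 0"
  proof (intro AE_I2 tendsto_eventually)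
   fix x
   obtain i where i: "x \<in> K i" using K(3) by blast
   obtain j where j: "\<bar>f x\<bar> \<le> real j" using real_arch_simple by blast
   show "\<forall>\<^sub>F n in sequentially. \<bar>f x - (if x \<in> K n \<and> \<bar>f x\<bar> \<le> real n then f x else 0)\<bar> = 0"
    using eventually_ge_at_top[of "max i j"]
   proof eventually_elim
    case (elim n)
    hence "x \<in> K n" using i incseqD[OF K(2), of i n] by auto
    moreover have "\<bar>f x\<bar> \<le> real n" using j elim by (meson max.boundedE of_nat_mono order_trans)
    ultimately show ?case by simp
   qed
  qed
 qed (auto, measurable)
 thus ?thesis by (simp add: nrm_def)
qed

text \<open>Sets of finite measure are reached along the exhaustion, each compact piece lying in an
  open set of finite measure; integrable functions follow by the usual induction.\<close>

lemma apx_integrable: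
 assumes "integrable M f" shows "apx f"
proof -
 obtain K where K: "\<And>n::nat. compact (K n :: 'a set)" "incseq K" "(\<Union>n. K n) = UNIV" using exhaustion by blast
 have base: "apx (indicator A)" if A: "A \<in> sets M" "emeasure M A < \<infinity>" for A
 proof -
  have I: "integrable M (indicator A :: 'a \<Rightarrow> real)" using A by (simp add: integrable_indicator_iff)
  show ?thesis
  proof (rule apx_limit[OF I _ truncation_limit[OF I K]])
   fix n
   show "apx (\<lambda>x. if x \<in> K n \<and> \<bar>indicator A x\<bar> \<le> real n then indicator A x else 0)"
   \<comment> \<open>The bound 0 removes the value 1 of the indicator, so this truncation is
     zero.\<close>
   proof (cases "n = 0")
    case True
    hence "(\<lambda>x. if x \<in> K n \<and> \<bar>indicator A x\<bar> \<le> real n then indicator A x else 0) = (\<lambda>x. 0 :: real)"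
     by (auto simp: fun_eq_iff indicator_def)
    thus ?thesis using apx_wl[OF wl_0] by simp
   next
    case False
    obtain \<psi> L where \<psi>: "wl \<psi> L" "\<And>x. x \<in> K n ==> 1 \<le> \<psi> x" using compact_dominated[OF K(1)] by blast
    have op: "open {x. \<psi> x > 0}" by (rule open_pos[OF wl_D[OF \<psi>(1)]])
    have [measurable]: "\<psi> \<in> borel_measurable M" by (rule bfs_meas[OF D_bfs[OF wl_D[OF \<psi>(1)]]])
    have "{x \<in> space M. \<psi> x \<noteq> 0} \<in> sets M" by measurable
    hence m: "{x. \<psi> x \<noteq> 0} \<in> sets M" by simp
    have "emeasure M {x. \<psi> x > 0} \<le> emeasure M {x. \<psi> x \<noteq> 0}" using m by (intro emeasure_mono) auto
    hence fin: "emeasure M {x. \<psi> x > 0} < \<infinity>" using bfs_support_finite[OF D_bfs[OF wl_D[OF \<psi>(1)]]] by (rule le_less_trans)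
    have "(\<lambda>x. if x \<in> K n \<and> \<bar>indicator A x\<bar> \<le> real n then indicator A x else 0) = (indicator ((A \<inter> K n) \<inter> {x. \<psi> x > 0}) :: 'a \<Rightarrow> real)"
     using \<psi>(2) False by (fastforce simp: fun_eq_iff indicator_def)
    moreover have "A \<inter> K n \<in> sets borel" using A K(1) sets_M by (auto intro: borel_closed compact_imp_closed)
    ultimately show ?thesis using apx_borel_in_open[OF op fin, of "A \<inter> K n"] by simp
   qed
  qed
 qed
 show ?thesis using assms
 proof (induction rule: integrable_induct)
  case (base A c)
  thus ?case using apx_cmult[OF \<open>\<And>A. A \<in> sets M ==> emeasure M A < \<infinity> ==> apx (indicator A)\<close>, of A c]
   by (simp add: mult.commute)
 next
  case (add f g)
  thus ?case by (intro apx_add)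
 next
  case (lim f s)
  have fi: "integrable M f" and sa: "\<And>i. apx (s i)" and sl: "\<And>x. (\<lambda>i. s i x) \<longlonglongrightarrow> f x"
   and sb: "\<And>i x. norm (s i x) \<le> 2 * norm (f x)"
   using lim by auto
  show ?case
  proof (rule apx_limit[OF fi sa])
   have [measurable]: "f \<in> borel_measurable M" "s i \<in> borel_measurable M" for i using lim by auto
   have "(\<lambda>i. LINT x|M. \<bar>f x - s i x\<bar>) \<longlonglongrightarrow> (LINT x|M. 0)"
   proof (rule integral_dominated_convergence[where w = "\<lambda>x. 3 * \<bar>f x\<bar>"])
    show "AE x in M. (\<lambda>i. \<bar>f x - s i x\<bar>) \<longlonglongrightarrow> 0"
    proof (intro AE_I2 tendsto_rabs_zero)
     fix x show "(\<lambda>i. f x - s i x) \<longlonglongrightarrow> 0"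
      using tendsto_diff[OF tendsto_const[of "f x"] sl[of x]] by simp
    qed
    show "AE x in M. norm \<bar>f x - s i x\<bar> \<le> 3 * \<bar>f x\<bar>" for i
    proof (intro AE_I2)
     fix x show "norm \<bar>f x - s i x\<bar> \<le> 3 * \<bar>f x\<bar>" using sb[of i x] by simp
    qed
    show "integrable M (\<lambda>x. 3 * \<bar>f x\<bar>)" using fi by simp
   qed measurable
   thus "(\<lambda>i. dst f (s i)) \<longlonglongrightarrow> 0" by (simp add: nrm_def)
  qed
 qed
qed

text \<open>L^1 approximation of f^m would not control the effect of \<open>bet\<close>, which is
  not globally Lipschitz. So f^m is written as c * arctan w0, and w0 is approximated instead: c *
  arctan w stays bounded whatever w is, and \<open>bet\<close> is Lipschitz on bounded sets.\<close>

lemma dense_bfs: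
 assumes f: "f \<in> bfs M" and e: "e > 0"
 shows "\<exists>w L. wl w L \<and> nrm (\<lambda>x. f x - bet (w x)) < e"
proof -
 obtain C where C: "C > 0" "\<And>x. \<bar>f x\<bar> \<le> C" using bfs_bounded[OF f] by blast
 \<comment> \<open>Scales f^m into [-1, 1], which lies inside the range of arctan.\<close>
 define c where "c = C powr m"
 have c: "c > 0" using C by (simp add: c_def)
 have fc: "\<bar>spow (f x) m / c\<bar> \<le> 1" for x
  using C c m_pos powr_mono2[of m "\<bar>f x\<bar>" C] by (simp add: abs_divide abs_spow c_def)
 have one_less: "(1::real) < pi / 2" using pi_gt3 by simp
 define w0 where "w0 x = tan (spow (f x) m / c)" for x
 have w0b: "\<bar>w0 x\<bar> \<le> tan 1" for x
 proof -
  have t: "tan y \<le> tan 1" if "\<bar>y\<bar> \<le> 1" for y :: real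
   using that one_less by (intro tan_mono_le[unfolded]) auto
  have "tan (spow (f x) m / c) \<le> tan 1" "tan (- (spow (f x) m / c)) \<le> tan 1"
   using fc[of x] by (intro t; simp)+
  thus ?thesis unfolding w0_def tan_minus by linarith
 qed
 have w0bfs: "w0 \<in> bfs M"
 proof -
  obtain Kf where Kf: "Kf \<in> sets M" "emeasure M Kf < \<infinity>" "\<And>x. x \<notin> Kf ==> f x = 0" using f unfolding bfs_def by blast
  have [measurable]: "f \<in> borel_measurable M" by (rule bfs_meas[OF f])
  have "w0 \<in> borel_measurable M" unfolding w0_def[abs_def] tan_def by measurable
  thus ?thesis unfolding bfs_def using w0b Kf by (auto simp: w0_def intro!: exI[of _ "tan 1"] bexI[of _ Kf])
 qed
 define P where "P s = c * arctan s" for s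
 have P0: "P (w0 x) = spow (f x) m" for x
 proof -
  have "\<bar>spow (f x) m / c\<bar> < pi / 2" using fc[of x] one_less by (rule le_less_trans)
  hence "arctan (w0 x) = spow (f x) m / c" unfolding w0_def by (intro arctan_tan) linarith+
  thus ?thesis using c by (simp add: P_def)
 qed
 \<comment> \<open>A Lipschitz constant of bet composed with P, shadowing the space
   \<open>Lp\<close> here: the slope of \<open>bet\<close> at 2 * c times c. The 2 comes from
   |arctan| \<le> 2.\<close>
 define Lp where "Lp = 1 / m * (2 * c) powr (1 / m - 1) * c"
 have Lp: "Lp > 0" using c m_pos by (simp add: Lp_def)
 have lip: "\<bar>bet (P s) - bet (P t)\<bar> \<le> Lp * \<bar>s - t\<bar>" for s t
 proof -
  have b: "\<bar>P s\<bar> \<le> 2 * c" for s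
  proof -
   have "\<bar>arctan s\<bar> \<le> 2" using arctan_bounded[of s] pi_less_4 by (auto simp: abs_le_iff)
   thus ?thesis using c by (simp add: P_def abs_mult)
  qed
  have a: "\<bar>arctan s - arctan t\<bar> \<le> 1 * \<bar>s - t\<bar>"
   unfolding real_norm_def[symmetric]
  proof (rule field_differentiable_bound[of UNIV arctan "\<lambda>s. 1 / (1 + s\<^sup>2)"])
   show "(arctan has_real_derivative 1 / (1 + z\<^sup>2)) (at z)" for z :: real
    using DERIV_arctan[of z] by (simp add: inverse_eq_divide)
   show "norm (1 / (1 + z\<^sup>2)) \<le> 1" for z :: real
   proof -
    have "0 < 1 + z\<^sup>2" by (intro add_pos_nonneg) auto
    thus ?thesis by simp
   qed
  qed auto
  have "1 / m > 1" using m_pos m_less1 by simp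
  hence 1: "\<bar>bet (P s) - bet (P t)\<bar> \<le> 1 / m * (2 * c) powr (1 / m - 1) * \<bar>P s - P t\<bar>"
   by (intro spow_lipschitz b)
  have "\<bar>P s - P t\<bar> = c * \<bar>arctan s - arctan t\<bar>" using c by (simp add: P_def abs_mult right_diff_distrib[symmetric])
  also have "\<dots> \<le> c * \<bar>s - t\<bar>" using a c by simp
  finally have 2: "\<bar>P s - P t\<bar> \<le> c * \<bar>s - t\<bar>" .
  have "0 \<le> 1 / m * (2 * c) powr (1 / m - 1)" using m_pos by simp
  from order_trans[OF 1 mult_left_mono[OF 2 this]] show ?thesis by (simp add: Lp_def mult_ac)
 qed
 have "e / Lp > 0" using e Lp by simp
 then obtain w L where w: "wl w L" "dst w0 w < e / Lp"
  using apx_integrable[OF bfs_integrable[OF w0bfs]] unfolding apx_def by blast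
 have p: "1 + s\<^sup>2 \<noteq> 0" for s :: real by (metis add_less_le_mono add.right_neutral less_irrefl zero_le_power2 zero_less_one)
 have "\<exists>L'. wl (\<lambda>x. P (w x)) L'"
 proof (rule exI, rule wl_comp[OF w(1), where P = P and P' = "\<lambda>s. c / (1 + s\<^sup>2)" and P'' = "\<lambda>s. - (c * (2 * s)) / (1 + s\<^sup>2)\<^sup>2"])
  show "(P has_real_derivative c / (1 + s\<^sup>2)) (at s)" for s
   unfolding P_def by (auto intro!: derivative_eq_intros simp: divide_inverse)
  show "((\<lambda>s. c / (1 + s\<^sup>2)) has_real_derivative - (c * (2 * s)) / (1 + s\<^sup>2)\<^sup>2) (at s)" for s
   using p[of s] by (auto intro!: derivative_eq_intros simp: power2_eq_square)
  show "continuous_on UNIV (\<lambda>s. - (c * (2 * s)) / (1 + s\<^sup>2)\<^sup>2)" using p by (intro continuous_intros) auto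
 qed (simp add: P_def)
 moreover have "nrm (\<lambda>x. f x - bet (P (w x))) < e"
 proof -
  have wI: "integrable M w" by (rule wl_integrable[OF w(1)])
  have fe: "f x = bet (P (w0 x))" for x unfolding P0 using m_pos by (simp add: spow_inverse)
  have [measurable]: "w \<in> borel_measurable M" "f \<in> borel_measurable M" using wI bfs_meas[OF f] by auto
  have "nrm (\<lambda>x. f x - bet (P (w x))) \<le> (LINT x|M. Lp * \<bar>w0 x - w x\<bar>)"
   unfolding nrm_def
  proof (rule integral_mono)
   show *: "integrable M (\<lambda>x. Lp * \<bar>w0 x - w x\<bar>)" using wI bfs_integrable[OF w0bfs] by simp
   show le: "\<bar>f x - bet (P (w x))\<bar> \<le> Lp * \<bar>w0 x - w x\<bar>" for x unfolding fe[of x] by (rule lip)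
   show "integrable M (\<lambda>x. \<bar>f x - bet (P (w x))\<bar>)"
    by (rule Bochner_Integration.integrable_bound[OF *]) (use le Lp in \<open>auto simp: P_def abs_mult\<close>)
  qed
  also have "\<dots> = Lp * dst w0 w" by (simp add: nrm_def)
  also have "\<dots> < e" using w(2) Lp by (simp add: field_simps)
  finally show ?thesis .
 qed
 ultimately show ?thesis by blast
qed

text \<open>Truncation in value and in place reduces the claim to \<open>dense_bfs\<close>.\<close>

theorem dense_domain:
 assumes f: "integrable M f" and e: "e > 0"
 shows "\<exists>w L. wl w L \<and> nrm (\<lambda>x. f x - bet (w x)) < e"
proof -
 obtain K where K: "\<And>n::nat. compact (K n :: 'a set)" "incseq K" "(\<Union>n. K n) = UNIV" using exhaustion by blast
 define t where "t n x = (if x \<in> K n \<and> \<bar>f x\<bar> \<le> real n then f x else 0)" for n x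
 have e2: "e / 2 > 0" using e by simp
 obtain n where n: "dst f (t n) < e / 2"
  using order_tendstoD(2)[OF truncation_limit[OF f K] e2] unfolding t_def by (auto simp: eventually_sequentially)
 have [measurable]: "K n \<in> sets M" "f \<in> borel_measurable M" using K(1) f sets_M by (auto simp: borel_closed compact_imp_closed)
 have "t n \<in> borel_measurable M" unfolding t_def[abs_def] by measurable
 hence tb: "t n \<in> bfs M" unfolding bfs_def using compact_finite_measure[OF K(1)[of n]]
  by (auto intro!: exI[of _ "real n"] bexI[of _ "K n"] simp: t_def)
 obtain w L where w: "wl w L" "nrm (\<lambda>x. t n x - bet (w x)) < e / 2" using dense_bfs[OF tb e2] by blast
 have "nrm (\<lambda>x. f x - bet (w x)) < e"
  using nrm_tri[OF f bfs_integrable[OF tb] X_int[OF D_spow_X[OF wl_D[OF w(1)]]]] n w(2) by linarith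
 thus ?thesis using w(1) by blast
qed

end

section \<open>The Crandall-Liggett limit\<close>

lemma sqrt_concave:
 fixes \<alpha> p q :: real
 assumes "0 \<le> \<alpha>" "\<alpha> \<le> 1" "0 \<le> p" "0 \<le> q"
 shows "\<alpha> * sqrt p + (1 - \<alpha>) * sqrt q \<le> sqrt (\<alpha> * p + (1 - \<alpha>) * q)"
proof (rule real_le_rsqrt)
 have "0 \<le> \<alpha> * (1 - \<alpha>) * (sqrt p - sqrt q)\<^sup>2" using assms by simp
 moreover have "\<alpha> * p + (1 - \<alpha>) * q - (\<alpha> * sqrt p + (1 - \<alpha>) * sqrt q)\<^sup>2
   = \<alpha> * (1 - \<alpha>) * (sqrt p - sqrt q)\<^sup>2"
 proof -
  have *: "\<alpha> * x\<^sup>2 + (1 - \<alpha>) * y\<^sup>2 - (\<alpha> * x + (1 - \<alpha>) * y)\<^sup>2 = \<alpha> * (1 - \<alpha>) * (x - y)\<^sup>2" for x y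
   by (simp add: power2_eq_square algebra_simps)
  show ?thesis using *[of "sqrt p" "sqrt q"] assms by simp
 qed
 ultimately show "(\<alpha> * sqrt p + (1 - \<alpha>) * sqrt q)\<^sup>2 \<le> \<alpha> * p + (1 - \<alpha>) * q" by linarith
qed

text \<open>The radicands satisfy the recursion behind \<open>kobayashi\<close> with a slack of 2
  mu^2; concavity of the square root carries it over to the roots.\<close>

lemma kobayashi_step:
 fixes i j lam mu :: real
 assumes "0 < mu" "mu \<le> lam" "0 \<le> i" "0 \<le> j"
 shows "mu / lam * sqrt ((i * lam - j * mu)\<^sup>2 + i * lam\<^sup>2 + j * mu\<^sup>2)
   + (1 - mu / lam) * sqrt (((i + 1) * lam - j * mu)\<^sup>2 + (i + 1) * lam\<^sup>2 + j * mu\<^sup>2)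
   \<le> sqrt (((i + 1) * lam - (j + 1) * mu)\<^sup>2 + (i + 1) * lam\<^sup>2 + (j + 1) * mu\<^sup>2)"
proof -
 define \<alpha> where "\<alpha> = mu / lam"
 have a: "0 \<le> \<alpha>" "\<alpha> \<le> 1" "\<alpha> * lam = mu" using assms by (auto simp: \<alpha>_def)
 let ?X = "(i * lam - j * mu)\<^sup>2 + i * lam\<^sup>2 + j * mu\<^sup>2"
 let ?Y = "((i + 1) * lam - j * mu)\<^sup>2 + (i + 1) * lam\<^sup>2 + j * mu\<^sup>2"
 define P where "P = (i + 1) * lam - j * mu"
 have X: "?X = ?Y - 2 * P * lam" by (simp add: P_def power2_eq_square algebra_simps)
 have "\<alpha> * ?X + (1 - \<alpha>) * ?Y = ?Y - 2 * P * (\<alpha> * lam)" unfolding X by (simp add: algebra_simps)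
 also have "\<dots> = ?Y - 2 * P * mu" by (simp add: a)
 also have "\<dots> \<le> ((i + 1) * lam - (j + 1) * mu)\<^sup>2 + (i + 1) * lam\<^sup>2 + (j + 1) * mu\<^sup>2"
 proof -
  have "((i + 1) * lam - (j + 1) * mu)\<^sup>2 = P\<^sup>2 - 2 * P * mu + mu\<^sup>2" by (simp add: P_def power2_eq_square algebra_simps)
  moreover have "?Y = P\<^sup>2 + (i + 1) * lam\<^sup>2 + j * mu\<^sup>2" by (simp add: P_def)
  moreover have "(j + 1) * mu\<^sup>2 = j * mu\<^sup>2 + mu\<^sup>2" by (simp add: algebra_simps)
  ultimately show ?thesis by (smt (verit) zero_le_power2)
 qed
 finally have "sqrt (\<alpha> * ?X + (1 - \<alpha>) * ?Y) \<le> sqrt (((i + 1) * lam - (j + 1) * mu)\<^sup>2 + (i + 1) * lam\<^sup>2 + (j + 1) * mu\<^sup>2)"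
  by (rule real_sqrt_le_mono)
 moreover have "\<alpha> * sqrt ?X + (1 - \<alpha>) * sqrt ?Y \<le> sqrt (\<alpha> * ?X + (1 - \<alpha>) * ?Y)"
  using a assms by (intro sqrt_concave) auto
 ultimately show ?thesis unfolding \<alpha>_def by linarith
qed

text \<open>Up to the level \<delta> the first term dominates, above it the second. With \<delta>
  equal to the integral of |z| this stands in for Hoelder's inequality.\<close>

lemma powr_split_le:
 fixes z \<delta> m :: real
 assumes "0 < \<delta>" "0 < m" "m < 1"
 shows "\<bar>z\<bar> powr m \<le> \<delta> powr m + \<delta> powr (m - 1) * \<bar>z\<bar>"
proof (cases "\<bar>z\<bar> \<le> \<delta>")
 case True
 hence "\<bar>z\<bar> powr m \<le> \<delta> powr m" using assms by (intro powr_mono2) auto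
 thus ?thesis by (smt (verit) abs_ge_zero mult_nonneg_nonneg powr_ge_zero)
next
 case False
 hence z: "\<bar>z\<bar> > 0" using assms by linarith
 have "\<bar>z\<bar> powr m = \<bar>z\<bar> powr (m - 1) * \<bar>z\<bar>" using z by (simp add: powr_diff)
 also have "\<dots> \<le> \<delta> powr (m - 1) * \<bar>z\<bar>" using False assms by (intro mult_right_mono powr_mono2') auto
 finally show ?thesis by (smt (verit) powr_ge_zero)
qed

context dirichlet_space
begin

text \<open>A representative is chosen, as \<open>res\<close> fixes the next step only almost
  everywhere.\<close>

primrec it :: "real \<Rightarrow> 'a fn \<Rightarrow> nat \<Rightarrow> 'a \<Rightarrow> real" where
 "it h f 0 = f"
| "it h f (Suc n) = (SOME u. res h (it h f n) u)"

lemma it_X: "h > 0 ==> f \<in> X ==> it h f n \<in> X"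
 and it_res: "h > 0 ==> f \<in> X ==> res h (it h f n) (it h f (Suc n))"
proof -
 assume h: "h > 0" and f: "f \<in> X"
 have *: "it h f n \<in> X ==> res h (it h f n) (it h f (Suc n))" for n
  using someI_ex[OF res_exists[OF h]] by simp
 show X: "it h f n \<in> X" for n
  by (induction n) (use f * res_X[OF h] in \<open>auto simp del: it.simps(2)\<close>)
 show "res h (it h f n) (it h f (Suc n))" using * X by blast
qed

lemma it_int: "h > 0 ==> f \<in> X ==> integrable M (it h f n)"
 using it_X X_int by blast

lemma it_contraction:
 assumes h: "h > 0" and f: "f \<in> X" "g \<in> X"
 shows "dst (it h f n) (it h g n) \<le> dst f g"
proof (induction n)
 case (Suc n)
 show ?case
  using res_contraction[OF h it_X[OF h f(1)] it_X[OF h f(2)] it_res[OF h f(1)] it_res[OF h f(2)], of n n] Suc by linarith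
qed simp

lemma it_mono:
 assumes h: "h > 0" and f: "f \<in> X" "g \<in> X" and le: "AE x in M. f x \<le> g x"
 shows "AE x in M. it h f n x \<le> it h g n x"
proof (induction n)
 case (Suc n)
 show ?case
  by (rule res_mono[OF h it_X[OF h f(1)] it_X[OF h f(2)] it_res[OF h f(1)] it_res[OF h f(2)] Suc])
qed (use le in simp)

text \<open>\<open>bet w\<close> is the resolvent of bet w - h L, a datum that differs from bet w by
  h L. Contraction gives the first step and passes the bound on to the later ones.\<close>

lemma it_step:
 assumes h: "h > 0" and w: "wl w L"
 defines "f \<equiv> \<lambda>x. bet (w x)"
 shows "dst (it h f (Suc n)) (it h f n) \<le> h * nrm L"
proof (induction n)
 case 0
 have f: "f \<in> X" unfolding f_def by (rule D_spow_X[OF wl_D[OF w]])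
 have L: "L \<in> X" by (rule bfs_X[OF wl_bfs[OF w]])
 have g: "(\<lambda>x. f x - h * L x) \<in> X" by (intro X_diff f X_cmult L)
 have r: "res h (\<lambda>x. f x - h * L x) f" using res_of_wl[OF h w] by (simp add: f_def)
 have "dst (it h f (Suc 0)) f \<le> nrm (\<lambda>x. f x - (f x - h * L x))"
  using res_contraction[OF h f g it_res[OF h f, of 0, unfolded it.simps(1)] r] by simp
 also have "\<dots> = h * nrm L" using h by (simp add: nrm_def abs_mult)
 finally show ?case by simp
next
 case (Suc n)
 have f: "f \<in> X" unfolding f_def by (rule D_spow_X[OF wl_D[OF w]])
 show ?case
  using res_contraction[OF h it_X[OF h f] it_X[OF h f] it_res[OF h f] it_res[OF h f], of "Suc n" n] Suc by linarith
qed

lemma it_dist: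
 assumes h: "h > 0" and w: "wl w L"
 defines "f \<equiv> \<lambda>x. bet (w x)"
 shows "dst (it h f (k + n)) (it h f k) \<le> real n * h * nrm L"
proof (induction n)
 case 0 thus ?case by (simp add: nrm_def)
next
 case (Suc n)
 have f: "f \<in> X" unfolding f_def by (rule D_spow_X[OF wl_D[OF w]])
 have "dst (it h f (k + Suc n)) (it h f k)
   \<le> dst (it h f (Suc (k + n))) (it h f (k + n)) + dst (it h f (k + n)) (it h f k)"
  using nrm_tri[OF it_int[OF h f] it_int[OF h f] it_int[OF h f], of "Suc (k + n)" k "k + n"] by simp
 also have "\<dots> \<le> h * nrm L + real n * h * nrm L"
  using it_step[OF h w, of "k + n", folded f_def] Suc by linarith
 finally show ?case by (simp add: algebra_simps)
qed

text \<open>The resolvent identity turns a step of length lam into a step of length mu whose datum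
  is a convex combination. Contraction then gives the recursion treated in
  \<open>kobayashi_step\<close>; on the edges i = 0 and j = 0 the bound is that of
  \<open>it_dist\<close>.\<close>

lemma kobayashi:
 assumes mu: "0 < mu" "mu \<le> lam" and w: "wl w L"
 defines "f \<equiv> \<lambda>x. bet (w x)"
 shows "dst (it lam f i) (it mu f j)
   \<le> nrm L * sqrt ((real i * lam - real j * mu)\<^sup>2 + real i * lam\<^sup>2 + real j * mu\<^sup>2)"
proof (induction j arbitrary: i)
 case 0
 have lam: "lam > 0" using mu by linarith
 have "real i * lam = sqrt ((real i * lam)\<^sup>2)" using lam by simp
 also have "\<dots> \<le> sqrt ((real i * lam)\<^sup>2 + real i * lam\<^sup>2)" by (intro real_sqrt_le_mono) simp
 finally have "nrm L * (real i * lam) \<le> nrm L * sqrt ((real i * lam)\<^sup>2 + real i * lam\<^sup>2)" by (intro mult_left_mono) auto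
 thus ?case using it_dist[OF lam w, of 0 i, folded f_def] by (simp add: mult_ac)
next
 case (Suc j)
 have lam: "lam > 0" using mu by linarith
 have f: "f \<in> X" unfolding f_def by (rule D_spow_X[OF wl_D[OF w]])
 show ?case
 proof (cases i)
  case 0
  have "real (Suc j) * mu = sqrt ((real (Suc j) * mu)\<^sup>2)" using mu by (simp del: of_nat_Suc)
  also have "\<dots> \<le> sqrt ((real (Suc j) * mu)\<^sup>2 + real (Suc j) * mu\<^sup>2)" by (intro real_sqrt_le_mono) simp
  finally have "nrm L * (real (Suc j) * mu) \<le> nrm L * sqrt ((real (Suc j) * mu)\<^sup>2 + real (Suc j) * mu\<^sup>2)" by (intro mult_left_mono) auto
  thus ?thesis using it_dist[OF mu(1) w, of 0 "Suc j", folded f_def] 0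
   by (simp add: mult_ac nrm_diff_sym[of f] del: it.simps(2) of_nat_Suc)
 next
  case (Suc i')
  let ?\<alpha> = "mu / lam"
  have a: "0 \<le> ?\<alpha>" "?\<alpha> \<le> 1" using mu lam by auto
  let ?u = "it lam f i" and ?u' = "it lam f i'" and ?v = "it mu f j"
  have uX: "?u \<in> X" "?u' \<in> X" "?v \<in> X" using it_X f lam mu by auto
  have r: "res mu (\<lambda>x. ?\<alpha> * ?u' x + (1 - ?\<alpha>) * ?u x) ?u"
   using res_identity[OF lam mu(1) uX(2) it_res[OF lam f, of i', folded Suc]] .
  have "dst ?u (it mu f (Suc j)) \<le> nrm (\<lambda>x. (?\<alpha> * ?u' x + (1 - ?\<alpha>) * ?u x) - ?v x)"
   by (intro res_contraction[OF mu(1) _ uX(3) r it_res[OF mu(1) f]] X_add X_cmult uX)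
  also have "\<dots> \<le> (LINT x|M. ?\<alpha> * \<bar>?u' x - ?v x\<bar> + (1 - ?\<alpha>) * \<bar>?u x - ?v x\<bar>)"
   unfolding nrm_def
  proof (rule integral_mono)
   show "integrable M (\<lambda>x. \<bar>?\<alpha> * ?u' x + (1 - ?\<alpha>) * ?u x - ?v x\<bar>)"
    "integrable M (\<lambda>x. ?\<alpha> * \<bar>?u' x - ?v x\<bar> + (1 - ?\<alpha>) * \<bar>?u x - ?v x\<bar>)"
    using uX X_int by auto
   fix x
   have "?\<alpha> * ?u' x + (1 - ?\<alpha>) * ?u x - ?v x = ?\<alpha> * (?u' x - ?v x) + (1 - ?\<alpha>) * (?u x - ?v x)" by (simp add: algebra_simps)
   thus "\<bar>?\<alpha> * ?u' x + (1 - ?\<alpha>) * ?u x - ?v x\<bar> \<le> ?\<alpha> * \<bar>?u' x - ?v x\<bar> + (1 - ?\<alpha>) * \<bar>?u x - ?v x\<bar>"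
    using a by (metis abs_mult abs_of_nonneg abs_triangle_ineq diff_ge_0_iff_ge)
  qed
  also have "\<dots> = ?\<alpha> * nrm (\<lambda>x. ?u' x - ?v x) + (1 - ?\<alpha>) * dst ?u ?v"
   unfolding nrm_def using uX X_int by simp
  also have "\<dots> \<le> ?\<alpha> * (nrm L * sqrt ((real i' * lam - real j * mu)\<^sup>2 + real i' * lam\<^sup>2 + real j * mu\<^sup>2))
    + (1 - ?\<alpha>) * (nrm L * sqrt ((real i * lam - real j * mu)\<^sup>2 + real i * lam\<^sup>2 + real j * mu\<^sup>2))"
   using a by (intro add_mono mult_left_mono Suc.IH) auto
  also have "\<dots> = nrm L * (?\<alpha> * sqrt ((real i' * lam - real j * mu)\<^sup>2 + real i' * lam\<^sup>2 + real j * mu\<^sup>2)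
    + (1 - ?\<alpha>) * sqrt (((real i' + 1) * lam - real j * mu)\<^sup>2 + (real i' + 1) * lam\<^sup>2 + real j * mu\<^sup>2))"
   by (simp add: Suc algebra_simps)
  also have "\<dots> \<le> nrm L * sqrt (((real i' + 1) * lam - (real j + 1) * mu)\<^sup>2 + (real i' + 1) * lam\<^sup>2 + (real j + 1) * mu\<^sup>2)"
   using mu by (intro mult_left_mono kobayashi_step) auto
  finally show ?thesis by (simp add: Suc add.commute)
 qed
qed

definition U :: "'a fn \<Rightarrow> nat \<Rightarrow> real \<Rightarrow> 'a \<Rightarrow> real" where
 "U f n t = it (1 / 2 ^ n) f (nat \<lfloor>t * 2 ^ n\<rfloor>)"

lemma grid:
 assumes "t \<ge> 0"
 shows "real (nat \<lfloor>t * 2 ^ n\<rfloor>) * (1 / 2 ^ n) \<le> t" "t < real (nat \<lfloor>t * 2 ^ n\<rfloor>) * (1 / 2 ^ n) + 1 / 2 ^ n"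
proof -
 have "t * 2 ^ n \<ge> 0" using assms by simp
 hence "real (nat \<lfloor>t * 2 ^ n\<rfloor>) \<le> t * 2 ^ n" "t * 2 ^ n < real (nat \<lfloor>t * 2 ^ n\<rfloor>) + 1"
  by linarith+
 thus "real (nat \<lfloor>t * 2 ^ n\<rfloor>) * (1 / 2 ^ n) \<le> t" "t < real (nat \<lfloor>t * 2 ^ n\<rfloor>) * (1 / 2 ^ n) + 1 / 2 ^ n"
  by (simp_all add: field_simps)
qed

lemma U_X: "f \<in> X ==> U f n t \<in> X"
 unfolding U_def by (intro it_X) auto

lemma U_int: "f \<in> X ==> integrable M (U f n t)"
 using U_X X_int by blast

lemma U_contraction: "f \<in> X ==> g \<in> X ==> dst (U f n t) (U g n t) \<le> dst f g"
 unfolding U_def by (intro it_contraction) auto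

lemma U_0 [simp]: "U f n 0 = f"
 by (simp add: U_def)

lemma U_cauchy_domain:
 assumes w: "wl w L" and t: "0 \<le> t" "t \<le> T" and nk: "n \<le> k"
 defines "f \<equiv> \<lambda>x. bet (w x)"
 shows "dst (U f n t) (U f k t) \<le> nrm L * sqrt ((1 / 2 ^ n) * (1 + 2 * T))"
proof -
 let ?l = "1 / 2 ^ n :: real" and ?m = "1 / 2 ^ k :: real"
 define i where "i = real (nat \<lfloor>t * 2 ^ n\<rfloor>)"
 define j where "j = real (nat \<lfloor>t * 2 ^ k\<rfloor>)"
 have lm: "0 < ?m" "?m \<le> ?l" "?l \<le> 1" using nk by (auto simp: field_simps power_increasing)
 have i: "0 \<le> i" "i * ?l \<le> t" "t < i * ?l + ?l" and j: "0 \<le> j" "j * ?m \<le> t" "t < j * ?m + ?m"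
  using grid[OF t(1), of n] grid[OF t(1), of k] by (auto simp: i_def j_def)
 \<comment> \<open>Both grid times lie within one coarse step ?l below t, so each of the three terms
   under the root is at most a multiple of ?l.\<close>
 have "\<bar>i * ?l - j * ?m\<bar> \<le> ?l" using i j lm by linarith
 hence "(i * ?l - j * ?m)\<^sup>2 \<le> ?l\<^sup>2" using lm by (subst power2_le_iff_abs_le) auto
 also have "?l\<^sup>2 \<le> ?l * 1" unfolding power2_eq_square using lm by (intro mult_left_mono) auto
 finally have 1: "(i * ?l - j * ?m)\<^sup>2 \<le> ?l" by simp
 have 2: "i * ?l\<^sup>2 \<le> T * ?l" unfolding power2_eq_square mult.assoc[symmetric] using i t by (intro mult_right_mono) auto
 have "j * ?m\<^sup>2 \<le> T * ?m" unfolding power2_eq_square mult.assoc[symmetric] using j t by (intro mult_right_mono) auto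
 also have "\<dots> \<le> T * ?l" using lm t by (intro mult_left_mono) auto
 finally have 3: "j * ?m\<^sup>2 \<le> T * ?l" .
 have "sqrt ((i * ?l - j * ?m)\<^sup>2 + i * ?l\<^sup>2 + j * ?m\<^sup>2) \<le> sqrt (?l * (1 + 2 * T))"
 proof (rule real_sqrt_le_mono)
  have "A + B + C \<le> l * (1 + 2 * T)" if "A \<le> l" "B \<le> T * l" "C \<le> T * l" for A B C l :: real
   using that by (simp add: algebra_simps)
  from this[OF 1 2 3] show "(i * ?l - j * ?m)\<^sup>2 + i * ?l\<^sup>2 + j * ?m\<^sup>2 \<le> ?l * (1 + 2 * T)" .
 qed
 hence "nrm L * sqrt ((i * ?l - j * ?m)\<^sup>2 + i * ?l\<^sup>2 + j * ?m\<^sup>2) \<le> nrm L * sqrt (?l * (1 + 2 * T))"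
  by (intro mult_left_mono) auto
 thus ?thesis using kobayashi[OF lm(1,2) w, of "nat \<lfloor>t * 2 ^ n\<rfloor>" "nat \<lfloor>t * 2 ^ k\<rfloor>", folded f_def]
  unfolding U_def i_def j_def by linarith
qed

text \<open>For data in the domain this is Kobayashi's estimate; contraction carries it over to X,
  uniformly in the step and in time.\<close>

lemma U_cauchy:
 assumes f: "f \<in> X" and e: "e > 0" and T: "T \<ge> 0"
 shows "\<exists>N. \<forall>n\<ge>N. \<forall>k\<ge>N. \<forall>t. 0 \<le> t \<and> t \<le> T \<longrightarrow> dst (U f n t) (U f k t) < e"
proof -
 have e4: "e / 4 > 0" using e by simp
 obtain w L where w: "wl w L" "nrm (\<lambda>x. f x - bet (w x)) < e / 4" using dense_domain[OF X_int[OF f] e4] by blast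
 define g where "g = (\<lambda>x. bet (w x))"
 have g: "g \<in> X" unfolding g_def by (rule D_spow_X[OF wl_D[OF w(1)]])
 have fg: "dst f g < e / 4" using w(2) by (simp add: g_def)
 have "(\<lambda>n. nrm L * sqrt ((1 / 2 ^ n) * (1 + 2 * T))) \<longlonglongrightarrow> nrm L * sqrt (0 * (1 + 2 * T))"
  by (intro tendsto_intros) (use LIMSEQ_realpow_zero[of "1/2::real"] in \<open>simp add: power_one_over\<close>)
 hence "eventually (\<lambda>n. nrm L * sqrt ((1 / 2 ^ n) * (1 + 2 * T)) < e / 2) sequentially"
  using e by (intro order_tendstoD(2)) auto
 then obtain N where N: "\<And>n. n \<ge> N ==> nrm L * sqrt ((1 / 2 ^ n) * (1 + 2 * T)) < e / 2" by (auto simp: eventually_sequentially)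
 have g1: "dst (U g n t) (U g k t) < e / 2" if "n \<ge> N" "k \<ge> N" "0 \<le> t" "t \<le> T" for n k t
 proof (cases "n \<le> k")
  case True
  thus ?thesis using U_cauchy_domain[OF w(1) that(3,4), folded g_def] N[OF that(1)] by fastforce
 next
  case False
  hence "dst (U g k t) (U g n t) < e / 2"
   using U_cauchy_domain[OF w(1) that(3,4), of k n, folded g_def] N[OF that(2)] by fastforce
  thus ?thesis by (subst nrm_diff_sym)
 qed
 have "dst (U f n t) (U f k t) < e" if "n \<ge> N" "k \<ge> N" "0 \<le> t" "t \<le> T" for n k t
 proof -
  have 1: "dst (U f n t) (U f k t) \<le> dst (U f n t) (U g n t) + dst (U g n t) (U f k t)"
   by (intro nrm_tri U_int f g)
  have 2: "dst (U g n t) (U f k t) \<le> dst (U g n t) (U g k t) + dst (U g k t) (U f k t)"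
   by (intro nrm_tri U_int f g)
  have 3: "dst (U g k t) (U f k t) < e / 4" using U_contraction[OF f g, of k t] fg nrm_diff_sym[of "U g k t" "U f k t"] by linarith
  show ?thesis using 1 2 3 U_contraction[OF f g, of n t] fg g1[OF that] by linarith
 qed
 thus ?thesis by blast
qed

lemma U_equicont:
 assumes f: "f \<in> X" and e: "e > 0"
 shows "\<exists>d>0. \<exists>N. \<forall>n\<ge>N. \<forall>t s. 0 \<le> t \<and> 0 \<le> s \<and> \<bar>t - s\<bar> < d \<longrightarrow> dst (U f n t) (U f n s) < e"
proof -
 have e4: "e / 4 > 0" using e by simp
 obtain w L where w: "wl w L" "nrm (\<lambda>x. f x - bet (w x)) < e / 4" using dense_domain[OF X_int[OF f] e4] by blast
 define g where "g = (\<lambda>x. bet (w x))"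
 have g: "g \<in> X" unfolding g_def by (rule D_spow_X[OF wl_D[OF w(1)]])
 have fg: "dst f g < e / 4" using w(2) by (simp add: g_def)
 \<comment> \<open>The grid points of two times closer than d are less than d + 1 / 2 ^ n < 2 * d
   apart, and 2 * d * (nrm L + 1) = e / 2.\<close>
 define d where "d = e / 4 / (nrm L + 1)"
 have "nrm L + 1 > 0" using nrm_nonneg[of L] by linarith
 hence c: "nrm L + 1 \<noteq> 0" and d0: "d > 0" using e unfolding d_def by (auto intro: divide_pos_pos)
 have d: "d > 0" "d * (nrm L + 1) = e / 4" using d0 iffD1[OF nonzero_eq_divide_eq[OF c] d_def] by auto
 obtain N where N: "(1 / 2 :: real) ^ N < d" using real_arch_pow_inv[of d "1/2"] d by auto
 have g0: "dst (U g n t) (U g n s) < e / 2" if n: "n \<ge> N" and s: "0 \<le> s" "s \<le> t" "t - s < d" for n t s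
 proof -
  let ?h = "1 / 2 ^ n :: real"
  define i where "i = nat \<lfloor>t * 2 ^ n\<rfloor>"
  define j where "j = nat \<lfloor>s * 2 ^ n\<rfloor>"
  have "t \<ge> 0" using s by simp
  have ji: "j \<le> i" unfolding i_def j_def using s by (intro nat_mono floor_mono mult_right_mono) auto
  have "?h \<le> (1/2) ^ N" using n by (simp add: power_one_over field_simps power_increasing)
  hence h: "?h < d" using N by linarith
  have "real i * ?h - real j * ?h < d + d"
   using grid[OF \<open>t \<ge> 0\<close>, of n] grid[OF s(1), of n] s h unfolding i_def j_def by linarith
  hence 1: "real (i - j) * ?h < d + d" using ji by (simp add: of_nat_diff left_diff_distrib diff_divide_distrib)
  have "dst (U g n t) (U g n s) \<le> real (i - j) * ?h * nrm L"
   using it_dist[of ?h w L j "i - j", folded g_def] w(1) ji unfolding U_def i_def[symmetric] j_def[symmetric] by simp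
  also have "\<dots> \<le> real (i - j) * ?h * (nrm L + 1)" by (intro mult_left_mono) auto
  also have "\<dots> < (d + d) * (nrm L + 1)" using 1 nrm_nonneg[of L] by (intro mult_strict_right_mono) (auto simp: add_nonneg_pos)
  also have "\<dots> = e / 2" using d(2) by (simp add: distrib_right)
  finally show ?thesis .
 qed
 have g1: "dst (U g n t) (U g n s) < e / 2" if n: "n \<ge> N" and s: "0 \<le> t" "0 \<le> s" "\<bar>t - s\<bar> < d" for n t s
 proof (cases "s \<le> t")
  case True thus ?thesis using g0[OF n, of s t] s by simp
 next
  case False thus ?thesis using g0[OF n, of t s] s nrm_diff_sym[of "U g n t" "U g n s"] by simp
 qed
 have "dst (U f n t) (U f n s) < e" if n: "n \<ge> N" and s: "0 \<le> t" "0 \<le> s" "\<bar>t - s\<bar> < d" for n t s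
 proof -
  have 1: "dst (U f n t) (U f n s) \<le> dst (U f n t) (U g n t) + dst (U g n t) (U f n s)"
   by (intro nrm_tri U_int f g)
  have 2: "dst (U g n t) (U f n s) \<le> dst (U g n t) (U g n s) + dst (U g n s) (U f n s)"
   by (intro nrm_tri U_int f g)
  have 3: "dst (U g n s) (U f n s) < e / 4" using U_contraction[OF f g, of n s] fg nrm_diff_sym[of "U g n s" "U f n s"] by linarith
  show ?thesis using 1 2 3 U_contraction[OF f g, of n t] fg g1[OF n s] by linarith
 qed
 thus ?thesis using d(1) by blast
qed

text \<open>\<open>V\<close> is the Crandall--Liggett limit of implicit time steps of length \<open>1 / 2 ^ n\<close>.\<close>

definition sg :: "'a fn \<Rightarrow> (real \<Rightarrow> 'a \<Rightarrow> real) \<Rightarrow> bool" where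
 "sg f V \<longleftrightarrow> (\<forall>t\<ge>0. integrable M (V t) \<and> (\<lambda>n. dst (U f n t) (V t)) \<longlonglongrightarrow> 0)"

lemma sg_exists:
 assumes f: "f \<in> X" shows "\<exists>V. sg f V"
proof -
 have "\<exists>v. integrable M v \<and> (\<lambda>n. dst (U f n t) v) \<longlonglongrightarrow> 0" if t: "t \<ge> 0" for t
 proof -
  have "\<exists>g\<in>Lp M 1. (\<lambda>k. LINT x|M. \<bar>U f k t x - g x\<bar> powr 1) \<longlonglongrightarrow> 0"
  proof (rule Lp_complete)
   show "U f k t \<in> Lp M 1" for k using U_int[OF f] by (simp add: Lp_1_iff)
   fix e :: real assume "e > 0"
   from U_cauchy[OF f this t] t
   show "\<exists>N. \<forall>k\<ge>N. \<forall>l\<ge>N. (LINT x|M. \<bar>U f k t x - U f l t x\<bar> powr 1) < e"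
    unfolding nrm_def by auto
  qed simp
  thus ?thesis by (auto simp: Lp_1_iff nrm_def)
 qed
 thus ?thesis unfolding sg_def by metis
qed

lemma sg_int: "sg f V ==> t \<ge> 0 ==> integrable M (V t)"
 by (simp add: sg_def)

lemma nrm_limit_le:
 assumes "integrable M u" "integrable M v" "\<And>n::nat. integrable M (p n)" "\<And>n. integrable M (q n)"
  and "(\<lambda>n. dst (p n) u) \<longlonglongrightarrow> 0" "(\<lambda>n. dst (q n) v) \<longlonglongrightarrow> 0"
  and "\<exists>N. \<forall>n\<ge>N. dst (p n) (q n) \<le> e"
 shows "dst u v \<le> e"
proof -
 have "dst u v \<le> dst (p n) u + dst (p n) (q n) + dst (q n) v" for n
  using nrm_tri[OF assms(1,3,2), of n] nrm_tri[OF assms(3,4,2), of n n] nrm_diff_sym[of u "p n"] by linarith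
 hence "\<exists>N. \<forall>n\<ge>N. dst u v \<le> dst (p n) u + e + dst (q n) v"
  using assms(7) by (smt (verit))
 moreover have "(\<lambda>n. dst (p n) u + e + dst (q n) v) \<longlonglongrightarrow> 0 + e + 0"
  by (intro tendsto_intros assms)
 hence "(\<lambda>n. dst (p n) u + e + dst (q n) v) \<longlonglongrightarrow> e" by simp
 ultimately show ?thesis by (rule LIMSEQ_le_const[rotated])
qed

lemma nrm_zero [simp]: "nrm (\<lambda>x. 0) = 0"
 by (simp add: nrm_def)

lemma sg_uniform:
 assumes f: "f \<in> X" and V: "sg f V" and e: "e > 0" and T: "T \<ge> 0"
 shows "\<exists>N. \<forall>n\<ge>N. \<forall>t. 0 \<le> t \<and> t \<le> T \<longrightarrow> dst (U f n t) (V t) \<le> e"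
proof -
 obtain N where N: "\<And>n k t. n \<ge> N ==> k \<ge> N ==> 0 \<le> t ==> t \<le> T ==> dst (U f n t) (U f k t) < e"
  using U_cauchy[OF f e T] by blast
 have "dst (U f n t) (V t) \<le> e" if "n \<ge> N" "0 \<le> t" "t \<le> T" for n t
 proof (rule nrm_limit_le[where p = "\<lambda>_. U f n t" and q = "\<lambda>k. U f k t"])
  show "\<exists>N. \<forall>k\<ge>N. dst (U f n t) (U f k t) \<le> e" using N that by (meson less_imp_le)
 qed (use U_int[OF f] V that in \<open>auto simp: sg_def\<close>)
 thus ?thesis by blast
qed

lemma sg_cont:
 assumes f: "f \<in> X" and V: "sg f V" and e: "e > 0"
 shows "\<exists>d>0. \<forall>t s. 0 \<le> t \<and> 0 \<le> s \<and> \<bar>t - s\<bar> < d \<longrightarrow> dst (V t) (V s) \<le> e"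
proof -
 obtain d N where d: "d > 0" "\<And>n t s. n \<ge> N ==> 0 \<le> t ==> 0 \<le> s ==> \<bar>t - s\<bar> < d ==> dst (U f n t) (U f n s) < e"
  using U_equicont[OF f e] by blast
 have "dst (V t) (V s) \<le> e" if "0 \<le> t" "0 \<le> s" "\<bar>t - s\<bar> < d" for t s
 proof (rule nrm_limit_le[where p = "\<lambda>n. U f n t" and q = "\<lambda>n. U f n s"])
  show "\<exists>N. \<forall>n\<ge>N. dst (U f n t) (U f n s) \<le> e" using d that by (meson less_imp_le)
 qed (use U_int[OF f] V that in \<open>auto simp: sg_def\<close>)
 thus ?thesis using d by blast
qed

lemma sg_initial:
 assumes f: "f \<in> X" and V: "sg f V" shows "AE x in M. V 0 x = f x"
proof -
 have "dst f (V 0) = 0"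
  using V unfolding sg_def by (auto simp: LIMSEQ_const_iff dest!: spec[of _ 0])
 hence "AE x in M. \<bar>f x - V 0 x\<bar> = 0"
  unfolding nrm_def using X_int[OF f] sg_int[OF V, of 0]
  by (subst (asm) integral_nonneg_eq_0_iff_AE) auto
 thus ?thesis by eventually_elim simp
qed

text \<open>Since p n \<le> q n, the positive part of u - v is bounded by the sum of the two
  errors.\<close>

lemma nrm_limit_mono:
 assumes "integrable M u" "integrable M v" "\<And>n::nat. integrable M (p n)" "\<And>n. integrable M (q n)"
  and "(\<lambda>n. dst (p n) u) \<longlonglongrightarrow> 0" "(\<lambda>n. dst (q n) v) \<longlonglongrightarrow> 0"
  and le: "\<And>n. AE x in M. p n x \<le> q n x"
 shows "AE x in M. u x \<le> v x"
proof -
 define P where "P w = (LINT x|M. max 0 (w x))" for w :: "'a \<Rightarrow> real"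
 have "P (\<lambda>x. u x - v x) \<le> dst (p n) u + dst (q n) v" for n
 proof -
  have "P (\<lambda>x. u x - v x) \<le> (LINT x|M. \<bar>p n x - u x\<bar> + \<bar>q n x - v x\<bar>)"
   unfolding P_def
  proof (rule integral_mono_AE)
   show "AE x in M. max 0 (u x - v x) \<le> \<bar>p n x - u x\<bar> + \<bar>q n x - v x\<bar>" using le[of n] by eventually_elim auto
  qed (use assms in auto)
  also have "\<dots> = dst (p n) u + dst (q n) v"
   unfolding nrm_def using assms by (intro Bochner_Integration.integral_add) auto
  finally show ?thesis .
 qed
 hence "P (\<lambda>x. u x - v x) \<le> 0 + 0"
  by (intro LIMSEQ_le_const[OF tendsto_add[OF assms(5,6)]]) auto
 moreover have "0 \<le> P (\<lambda>x. u x - v x)" unfolding P_def by (intro Bochner_Integration.integral_nonneg) auto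
 ultimately have "P (\<lambda>x. u x - v x) = 0" by simp
 hence "AE x in M. max 0 (u x - v x) = 0"
  unfolding P_def using assms(1,2) by (subst (asm) integral_nonneg_eq_0_iff_AE) auto
 thus ?thesis by eventually_elim auto
qed

lemma sg_mono:
 assumes f: "f \<in> X" "g \<in> X" and V: "sg f V" "sg g W" and le: "AE x in M. f x \<le> g x" and t: "t \<ge> 0"
 shows "AE x in M. V t x \<le> W t x"
proof (rule nrm_limit_mono[where p = "\<lambda>n. U f n t" and q = "\<lambda>n. U g n t"])
 show "AE x in M. U f n t x \<le> U g n t x" for n unfolding U_def by (intro it_mono f le) auto
qed (use U_int f V t in \<open>auto simp: sg_def\<close>)

section \<open>The weak form of the evolution\<close>

text \<open>|u|^m \<le> 1 + |u|, and L is both integrable and bounded.\<close>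

lemma phi_int:
 assumes u: "integrable M u" and L: "L \<in> bfs M"
 shows "integrable M (\<lambda>x. spow (u x) m * L x)"
proof -
 have [measurable]: "u \<in> borel_measurable M" "L \<in> borel_measurable M" using u bfs_meas[OF L] by auto
 obtain C where C: "C > 0" "\<And>x. \<bar>L x\<bar> \<le> C" using bfs_bounded[OF L] by blast
 have "integrable M (\<lambda>x. \<bar>L x\<bar> + C * \<bar>u x\<bar>)" using u bfs_integrable[OF L] by auto
 thus ?thesis
 proof (rule Bochner_Integration.integrable_bound)
  show "AE x in M. norm (spow (u x) m * L x) \<le> norm (\<bar>L x\<bar> + C * \<bar>u x\<bar>)"
  proof (intro AE_I2)
   fix x
   have "\<bar>spow (u x) m * L x\<bar> \<le> (1 + \<bar>u x\<bar>) * \<bar>L x\<bar>"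
    unfolding abs_mult abs_spow using powr_split_le[of 1 m "u x"] m_pos m_less1 by (intro mult_right_mono) auto
   also have "\<dots> \<le> \<bar>L x\<bar> + C * \<bar>u x\<bar>" using mult_left_mono[OF C(2)[of x], of "\<bar>u x\<bar>"] by (simp add: algebra_simps)
   finally show "norm (spow (u x) m * L x) \<le> norm (\<bar>L x\<bar> + C * \<bar>u x\<bar>)" by simp
  qed
 qed measurable
qed

lemma phi_cont:
 assumes L: "L \<in> bfs M" and e: "e > 0"
 shows "\<exists>d>0. \<forall>u v. integrable M u \<and> integrable M v \<and> dst u v < d \<longrightarrow>
   \<bar>sip u L - sip v L\<bar> < e"
proof -
 obtain C where C: "C > 0" "\<And>x. \<bar>L x\<bar> \<le> C" using bfs_bounded[OF L] by blast
 have "((\<lambda>\<delta>. 2 * (\<delta> powr m * nrm L)) \<longlongrightarrow> 2 * (0 powr m * nrm L)) (at_right (0::real))"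
  using m_pos by (intro tendsto_intros tendsto_powr') (auto simp: eventually_at_right_less eventually_at_filter)
 hence "eventually (\<lambda>\<delta>. 2 * (\<delta> powr m * nrm L) < e / 2) (at_right (0::real))"
  using e by (intro order_tendstoD(2)) auto
 then obtain \<delta> where dl: "0 < \<delta>" "2 * (\<delta> powr m * nrm L) < e / 2"
  unfolding eventually_at_right_field by (metis dense)
 \<comment> \<open>\<delta> has made the part without u - v small; d does the same for the part
   linear in |u - v|, whose coefficient grows as \<delta> shrinks.\<close>
 define d where "d = e / 2 / (2 * \<delta> powr (m - 1) * C)"
 have d: "d > 0" using e dl C by (simp add: d_def)
 have "\<bar>sip u L - sip v L\<bar> < e"
  if u: "integrable M u" and v: "integrable M v" and uv: "dst u v < d" for u v
 proof -
  have "sip u L - sip v L = (LINT x|M. spow (u x) m * L x - spow (v x) m * L x)"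
   using phi_int[OF u L] phi_int[OF v L] by simp
  also have "\<bar>\<dots>\<bar> \<le> (LINT x|M. \<bar>spow (u x) m * L x - spow (v x) m * L x\<bar>)" by (rule integral_abs_bound)
  also have "\<dots> \<le> (LINT x|M. 2 * (\<delta> powr m * \<bar>L x\<bar>) + 2 * \<delta> powr (m - 1) * C * \<bar>u x - v x\<bar>)"
  proof (rule integral_mono)
   show "integrable M (\<lambda>x. \<bar>spow (u x) m * L x - spow (v x) m * L x\<bar>)" using phi_int[OF u L] phi_int[OF v L] by auto
   show "integrable M (\<lambda>x. 2 * (\<delta> powr m * \<bar>L x\<bar>) + 2 * \<delta> powr (m - 1) * C * \<bar>u x - v x\<bar>)"
    using u v bfs_integrable[OF L] by auto
   fix x
   have "\<bar>spow (u x) m * L x - spow (v x) m * L x\<bar> = \<bar>spow (u x) m - spow (v x) m\<bar> * \<bar>L x\<bar>"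
    by (simp add: abs_mult left_diff_distrib[symmetric])
   also have "\<dots> \<le> (2 * (\<delta> powr m + \<delta> powr (m - 1) * \<bar>u x - v x\<bar>)) * \<bar>L x\<bar>"
    using spow_holder[of m "u x" "v x"] powr_split_le[OF dl(1) m_pos m_less1, of "u x - v x"] m_pos m_less1
    by (intro mult_right_mono) auto
   also have "\<dots> \<le> 2 * (\<delta> powr m * \<bar>L x\<bar>) + 2 * \<delta> powr (m - 1) * C * \<bar>u x - v x\<bar>"
    using mult_left_mono[OF C(2)[of x], of "2 * \<delta> powr (m - 1) * \<bar>u x - v x\<bar>"] by (simp add: algebra_simps)
   finally show "\<bar>spow (u x) m * L x - spow (v x) m * L x\<bar> \<le> 2 * (\<delta> powr m * \<bar>L x\<bar>) + 2 * \<delta> powr (m - 1) * C * \<bar>u x - v x\<bar>" .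
  qed
  also have "\<dots> = 2 * (\<delta> powr m * nrm L) + 2 * \<delta> powr (m - 1) * C * dst u v"
   using u v bfs_integrable[OF L] by (simp add: nrm_def)
  also have "\<dots> < e / 2 + 2 * \<delta> powr (m - 1) * C * d"
   using dl uv C by (intro add_strict_mono mult_strict_left_mono) auto
  also have "\<dots> = e" using dl C by (simp add: d_def)
  finally show ?thesis .
 qed
 thus ?thesis using d by blast
qed

lemma it_weak:
 assumes h: "h > 0" and f: "f \<in> X" and \<eta>: "wl \<eta> L"
 shows "(ip (it h f (k + n)) \<eta>) - ip (it h f k) \<eta>
   = (\<Sum>j<n. h * (LINT x|M. spow (it h f (Suc (k + j)) x) m * L x))"
proof (induction n)
 case (Suc n)
 thus ?case using res_weak[OF h it_X[OF h f] it_res[OF h f] \<eta>, of "k + n"] by (simp del: it.simps(2))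
qed simp

lemma bfs_pair_int: "integrable M u ==> \<eta> \<in> bfs M ==> integrable M (\<lambda>x. u x * \<eta> x)"
proof -
 assume u: "integrable M u" and \<eta>: "\<eta> \<in> bfs M"
 obtain C where C: "C > 0" "\<And>x. \<bar>\<eta> x\<bar> \<le> C" using bfs_bounded[OF \<eta>] by blast
 have "integrable M (\<lambda>x. C * u x)" using u by simp
 thus ?thesis
 proof (rule Bochner_Integration.integrable_bound)
  show "AE x in M. norm (u x * \<eta> x) \<le> norm (C * u x)"
   using C mult_left_mono[OF C(2), of "\<bar>u _\<bar>"] by (intro AE_I2) (simp add: abs_mult mult.commute)
 qed (use u bfs_meas[OF \<eta>] in measurable)
qed

lemma bfs_pair_cont:
 assumes u: "integrable M u" "\<And>n::nat. integrable M (p n)" and lim: "(\<lambda>n. dst (p n) u) \<longlonglongrightarrow> 0" and \<eta>: "\<eta> \<in> bfs M"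
 shows "(\<lambda>n. ip (p n) \<eta>) \<longlonglongrightarrow> ip u \<eta>"
proof -
 obtain C where C: "C > 0" "\<And>x. \<bar>\<eta> x\<bar> \<le> C" using bfs_bounded[OF \<eta>] by blast
 have le: "norm (ip (p n) \<eta> - ip u \<eta>) \<le> C * dst (p n) u" for n
 proof -
  have "norm (ip (p n) \<eta> - ip u \<eta>) = \<bar>\<integral>x. p n x * \<eta> x - u x * \<eta> x \<partial>M\<bar>"
   using bfs_pair_int[OF u(1) \<eta>] bfs_pair_int[OF u(2) \<eta>] by simp
  also have "\<dots> \<le> (LINT x|M. \<bar>p n x * \<eta> x - u x * \<eta> x\<bar>)" by (rule integral_abs_bound)
  also have "\<dots> \<le> (LINT x|M. C * \<bar>p n x - u x\<bar>)"
  proof (rule integral_mono)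
   fix x
   have "\<bar>p n x * \<eta> x - u x * \<eta> x\<bar> = \<bar>\<eta> x\<bar> * \<bar>p n x - u x\<bar>" by (simp add: abs_mult[symmetric] algebra_simps)
   also have "\<dots> \<le> C * \<bar>p n x - u x\<bar>" using C by (intro mult_right_mono) auto
   finally show "\<bar>p n x * \<eta> x - u x * \<eta> x\<bar> \<le> C * \<bar>p n x - u x\<bar>" .
  qed (use u bfs_pair_int[OF u(1) \<eta>] bfs_pair_int[OF u(2) \<eta>] in auto)
  finally show ?thesis by (simp add: nrm_def)
 qed
 have "(\<lambda>n. C * dst (p n) u) \<longlonglongrightarrow> 0" using tendsto_mult_left[OF lim, of C] by simp
 hence "(\<lambda>n. (ip (p n) \<eta>) - ip u \<eta>) \<longlonglongrightarrow> 0"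
  by (rule Lim_null_comparison[rotated]) (use le in \<open>auto intro!: always_eventually\<close>)
 thus ?thesis by (simp add: LIM_zero_iff)
qed

text \<open>Identifies the derivative of ip (V t) \<eta> at s. On the grid the increment is a
  Riemann sum whose values all lie within e of sip (V s) L, by uniform convergence of the steps and
  continuity of V in L^1.\<close>

lemma sg_increment:
 assumes f: "f \<in> X" and V: "sg f V" and \<eta>: "wl \<eta> L" and s: "s \<ge> 0" and e: "e > 0"
 shows "\<exists>d>0. \<forall>a b. 0 \<le> a \<and> a \<le> b \<and> \<bar>a - s\<bar> < d \<and> \<bar>b - s\<bar> < d \<longrightarrow>
  \<bar>ip (V b) \<eta> - ip (V a) \<eta> - (b - a) * sip (V s) L\<bar> \<le> e * (b - a)"
proof -
 define G where "G = sip (V s) L"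
 obtain d1 where d1: "d1 > 0" "\<And>u v. integrable M u ==> integrable M v ==> dst u v < d1 ==>
   \<bar>sip u L - sip v L\<bar> < e"
  using phi_cont[OF wl_bfs[OF \<eta>] e] by blast
 have d13: "d1 / 3 > 0" using d1 by simp
 obtain d2 where d2: "d2 > 0" "\<And>t. 0 \<le> t ==> \<bar>t - s\<bar> < d2 ==> dst (V t) (V s) \<le> d1 / 3"
  using sg_cont[OF f V d13] s by blast
 have s1: "s + d2 \<ge> 0" using s d2 by simp
 obtain N where N: "\<And>n t. n \<ge> N ==> 0 \<le> t ==> t \<le> s + d2 ==> dst (U f n t) (V t) \<le> d1 / 3"
  using sg_uniform[OF f V d13 s1] by blast
 have close: "\<bar>sip (U f n t) L - G\<bar> \<le> e" if "n \<ge> N" "0 \<le> t" "\<bar>t - s\<bar> < d2" for n t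
 proof -
  have "dst (U f n t) (V s) \<le> dst (U f n t) (V t) + dst (V t) (V s)"
   using that s V by (intro nrm_tri U_int f sg_int)
  hence "dst (U f n t) (V s) < d1" using N[of n t] d2(2)[of t] that d1 by linarith
  thus ?thesis unfolding G_def using d1(2)[OF U_int[OF f] sg_int[OF V s]] by (simp add: less_imp_le)
 qed
 have "\<bar>ip (V b) \<eta> - ip (V a) \<eta> - (b - a) * G\<bar> \<le> e * (b - a)"
  if ab: "0 \<le> a" "a \<le> b" "\<bar>a - s\<bar> < d2" "\<bar>b - s\<bar> < d2" for a b
 proof -
  let ?g = "\<lambda>v. ip v \<eta>"
  have \<eta>b: "\<eta> \<in> bfs M" by (rule D_bfs[OF wl_D[OF \<eta>]])
  have b0: "0 \<le> b" using ab by simp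
  define h where "h n = (1 / 2 ^ n :: real)" for n :: nat
  have h0: "h \<longlonglongrightarrow> 0" unfolding h_def using LIMSEQ_realpow_zero[of "1/2::real"] by (simp add: power_one_over)
  have hp: "h n > 0" for n by (simp add: h_def)
  \<comment> \<open>The last term pays for the mismatch of at most one grid step between b - a and
    the length covered by grid points.\<close>
  have ev: "eventually (\<lambda>n. \<bar>?g (U f n b) - ?g (U f n a) - (b - a) * G\<bar> \<le> e * (b - a) + (e + \<bar>G\<bar>) * h n) sequentially"
   using eventually_ge_at_top[of N]
  proof eventually_elim
   case (elim n)
   define i where "i = nat \<lfloor>a * 2 ^ n\<rfloor>"
   define k where "k = nat \<lfloor>b * 2 ^ n\<rfloor>"
   have ik: "i \<le> k" unfolding i_def k_def using ab by (intro nat_mono floor_mono mult_right_mono) auto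
   have gi: "real i * h n \<le> a" "a < real i * h n + h n" "real k * h n \<le> b" "b < real k * h n + h n"
    using grid[OF ab(1), of n] grid[OF b0, of n] by (auto simp: i_def k_def h_def)
   define g where "g j = (LINT x|M. spow (it (h n) f (Suc (i + j)) x) m * L x)" for j
   have gj: "\<bar>g j - G\<bar> \<le> e" if j: "j < k - i" for j
   proof -
    define t where "t = real (Suc (i + j)) * h n"
    have "t * 2 ^ n = real (Suc (i + j))" by (simp add: t_def h_def)
    hence "nat \<lfloor>t * 2 ^ n\<rfloor> = Suc (i + j)" by (simp only: floor_of_nat nat_int)
    hence "g j = sip (U f n t) L" unfolding g_def U_def h_def by simp
    moreover have "t \<ge> a" using gi(2) hp[of n] by (simp add: t_def algebra_simps) (smt (verit) hp mult_nonneg_nonneg of_nat_0_le_iff)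
    moreover have "real (Suc (i + j)) \<le> real k" using j by simp
    hence "t \<le> b" using gi(3) hp[of n] unfolding t_def by (meson less_imp_le mult_right_mono order_trans)
    ultimately show ?thesis using close[OF elim, of t] ab by auto
   qed
   have "?g (U f n b) - ?g (U f n a) = (\<Sum>j<k - i. h n * g j)"
    using it_weak[OF hp f \<eta>, of n i "k - i"] ik unfolding U_def g_def i_def[symmetric] k_def[symmetric] h_def[symmetric] by simp
   hence "?g (U f n b) - ?g (U f n a) - real (k - i) * h n * G = (\<Sum>j<k - i. h n * (g j - G))"
    by (simp add: sum_subtractf right_diff_distrib)
   also have "\<bar>\<dots>\<bar> \<le> (\<Sum>j<k - i. h n * e)"
    using gj hp[of n] by (intro order_trans[OF sum_abs] sum_mono) (auto simp: abs_mult)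
   also have "\<dots> = e * (real (k - i) * h n)" by simp
   finally have 1: "\<bar>?g (U f n b) - ?g (U f n a) - real (k - i) * h n * G\<bar> \<le> e * (real (k - i) * h n)" .
   have 2: "\<bar>real (k - i) * h n - (b - a)\<bar> \<le> h n"
    using gi ik by (simp add: of_nat_diff left_diff_distrib abs_le_iff)
   have 3: "e * (real (k - i) * h n) \<le> e * (b - a + h n)" using 2 e by (intro mult_left_mono) auto
   have 4: "\<bar>(real (k - i) * h n - (b - a)) * G\<bar> \<le> h n * \<bar>G\<bar>" unfolding abs_mult using 2 by (intro mult_right_mono) auto
   have 5: "?g (U f n b) - ?g (U f n a) - (b - a) * G = (?g (U f n b) - ?g (U f n a) - real (k - i) * h n * G) + (real (k - i) * h n - (b - a)) * G"
    by (simp add: algebra_simps)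
   show ?case unfolding 5 using 1 3 4 by (intro order_trans[OF abs_triangle_ineq]) (simp add: algebra_simps)
  qed
  have l1: "(\<lambda>n. \<bar>?g (U f n b) - ?g (U f n a) - (b - a) * G\<bar>) \<longlonglongrightarrow> \<bar>?g (V b) - ?g (V a) - (b - a) * G\<bar>"
   using V ab(1) b0 unfolding sg_def by (intro tendsto_intros bfs_pair_cont U_int f \<eta>b) auto
  have l2: "(\<lambda>n. e * (b - a) + (e + \<bar>G\<bar>) * h n) \<longlonglongrightarrow> e * (b - a) + (e + \<bar>G\<bar>) * 0"
   by (intro tendsto_intros h0)
  from tendsto_le[OF _ l2 l1 ev] show ?thesis by simp
 qed
 thus ?thesis using d2(1) unfolding G_def by blast
qed

end

section \<open>The Herrero-Pierre estimate and monotone limits\<close>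

lemma ode_bound:
 fixes Y H :: "real \<Rightarrow> real"
 assumes der: "\<And>t. t \<ge> 0 ==> (Y has_real_derivative H t) (at t within {0..})"
  and Y0: "\<And>t. t \<ge> 0 ==> 0 \<le> Y t" and m: "0 < m" "m < 1" and B: "B \<ge> 0"
  and HB: "\<And>t. t \<ge> 0 ==> \<bar>H t\<bar> \<le> B * Y t powr m"
  and st: "s \<ge> 0" "t \<ge> 0"
 shows "\<bar>Y t powr (1 - m) - Y s powr (1 - m)\<bar> \<le> (1 - m) * B * \<bar>t - s\<bar>"
proof -
 \<comment> \<open>Where Y vanishes, Y powr (1 - m) need not be differentiable. The shift by
   \<delta> removes this and is sent to 0 at the end.\<close>
 have d: "\<bar>(Y t + \<delta>) powr (1 - m) - (Y s + \<delta>) powr (1 - m)\<bar> \<le> (1 - m) * B * \<bar>t - s\<bar>" if \<delta>: "\<delta> > 0" for \<delta>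
 proof -
  have "norm ((Y t + \<delta>) powr (1 - m) - (Y s + \<delta>) powr (1 - m)) \<le> ((1 - m) * B) * norm (t - s)"
  proof (rule field_differentiable_bound[of "{0..}" _ "\<lambda>z. (1 - m) * (Y z + \<delta>) powr (- m) * H z"])
   fix z :: real assume z: "z \<in> {0..}"
   hence p: "Y z + \<delta> > 0" using Y0[of z] \<delta> by simp
   have "((\<lambda>x. Y x + \<delta>) has_real_derivative H z) (at z within {0..})"
    using der[of z] z by (auto intro!: derivative_eq_intros)
   from DERIV_chain2[OF has_real_derivative_powr[OF p, of "1 - m"] this]
   show "((\<lambda>x. (Y x + \<delta>) powr (1 - m)) has_real_derivative (1 - m) * (Y z + \<delta>) powr (- m) * H z) (at z within {0..})"
    by simp
   have "(Y z + \<delta>) powr (- m) * \<bar>H z\<bar> \<le> (Y z + \<delta>) powr (- m) * (B * Y z powr m)"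
    using z by (intro mult_left_mono HB) auto
   also have "\<dots> \<le> (Y z + \<delta>) powr (- m) * (B * (Y z + \<delta>) powr m)"
    using Y0[of z] z \<delta> m B by (intro mult_left_mono powr_mono2) auto
   also have "\<dots> = B" using p by (simp add: powr_minus_divide)
   finally have "(1 - m) * ((Y z + \<delta>) powr (- m) * \<bar>H z\<bar>) \<le> (1 - m) * B" using m by (intro mult_left_mono) auto
   thus "norm ((1 - m) * (Y z + \<delta>) powr (- m) * H z) \<le> (1 - m) * B"
    using m by (simp add: abs_mult mult.assoc)
  qed (use st in auto)
  thus ?thesis by simp
 qed
 define \<delta> where "\<delta> k = 1 / real (Suc k)" for k
 have d0: "\<delta> \<longlonglongrightarrow> 0" unfolding \<delta>_def using LIMSEQ_inverse_real_of_nat by (simp add: inverse_eq_divide)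
 have lim: "(\<lambda>k. (Y u + \<delta> k) powr (1 - m)) \<longlonglongrightarrow> Y u powr (1 - m)" if "u \<ge> 0" for u
 proof -
  have "(\<lambda>k. (Y u + \<delta> k) powr (1 - m)) \<longlonglongrightarrow> (Y u + 0) powr (1 - m)"
   using Y0[OF that] m by (intro tendsto_powr2 tendsto_intros d0) (auto simp: \<delta>_def)
  thus ?thesis by simp
 qed
 have "(\<lambda>k. \<bar>(Y t + \<delta> k) powr (1 - m) - (Y s + \<delta> k) powr (1 - m)\<bar>) \<longlonglongrightarrow> \<bar>Y t powr (1 - m) - Y s powr (1 - m)\<bar>"
  by (intro tendsto_rabs tendsto_diff lim st)
 thus ?thesis
  by (rule LIMSEQ_le_const2) (use d in \<open>auto simp: \<delta>_def\<close>)
qed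

text \<open>Fatou's lemma makes such a liminf finite almost everywhere, which is how monotone
  sequences of solutions obtain pointwise limits.\<close>

lemma convergent_of_liminf_finite:
 fixes a :: "nat \<Rightarrow> real"
 assumes inc: "\<And>k. a k \<le> a (Suc k)" and fin: "liminf (\<lambda>k. ennreal \<bar>a k\<bar>) \<noteq> \<infinity>"
 shows "convergent a"
proof -
 have mono: "incseq a" using inc by (rule incseq_SucI)
 have "\<exists>B. \<forall>k. a k \<le> B"
 proof (rule ccontr)
  assume "\<not> (\<exists>B. \<forall>k. a k \<le> B)"
  hence nb: "\<And>B. \<exists>k. a k > B" by (meson not_le)
  have "filterlim a at_top sequentially"
   unfolding filterlim_at_top
  proof
   fix Z
   obtain k where "a k > Z" using nb by blast
   hence "\<forall>n\<ge>k. a n \<ge> Z" using incseqD[OF mono] by (meson less_imp_le order_trans)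
   thus "eventually (\<lambda>n. Z \<le> a n) sequentially" by (auto simp: eventually_sequentially)
  qed
  hence "filterlim (\<lambda>k. \<bar>a k\<bar>) at_top sequentially" by (rule filterlim_at_top_mono) (auto intro: always_eventually)
  hence ge: "ennreal Z \<le> liminf (\<lambda>k. ennreal \<bar>a k\<bar>)" for Z
   unfolding filterlim_at_top by (intro Liminf_bounded) (auto elim!: allE[of _ Z] eventually_mono intro: ennreal_leI)
  obtain r where r: "liminf (\<lambda>k. ennreal \<bar>a k\<bar>) = ennreal r" "r \<ge> 0"
   using fin by (cases "liminf (\<lambda>k. ennreal \<bar>a k\<bar>)") auto
  have "r + 1 \<le> r" using ge[of "r + 1"] r by (simp add: ennreal_le_iff del: ennreal_plus)
  thus False by simp
 qed
 then obtain B where "\<And>k. a k \<le> B" by blast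
 thus ?thesis using incseq_convergent[OF mono] by (metis convergent_def)
qed

section \<open>Locally integrable solutions\<close>

context dirichlet_space
begin

definition loc :: "'a fn \<Rightarrow> bool" where
 "loc u \<longleftrightarrow> u \<in> borel_measurable M \<and> (\<forall>K. compact K \<longrightarrow> integrable M (\<lambda>x. indicator K x * u x))"

text \<open>A test function with its Laplacian. The second clause is added because
  \<open>bfs\<close> confines L only to a set of finite measure, while solutions are integrable over
  compact sets.\<close>

definition tp :: "'a fn \<Rightarrow> 'a fn \<Rightarrow> bool" where
 "tp \<eta> L \<longleftrightarrow> wl \<eta> L \<and> (\<exists>K. compact K \<and> (\<forall>x. x \<notin> K \<longrightarrow> \<eta> x = 0 \<and> L x = 0))"

definition cut :: "'a fn \<Rightarrow> 'a fn \<Rightarrow> real \<Rightarrow> bool" where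
 "cut \<eta> L C \<longleftrightarrow> wl \<eta> L \<and> (\<forall>x. 0 \<le> \<eta> x) \<and> C > 0 \<and> (\<forall>x. \<bar>L x\<bar> \<le> C * \<eta> x powr m)"

text \<open>Continuity in L^1_loc is expressed with cut-offs: they dominate the indicators of
  compact sets and are what the estimates speak of. The equation is kept in integrated form, which
  passes to monotone limits by dominated convergence.\<close>

definition sol :: "(real \<Rightarrow> 'a \<Rightarrow> real) \<Rightarrow> bool" where
 "sol V \<longleftrightarrow> (\<forall>t\<ge>0. loc (V t)) \<and>
   (\<forall>\<eta> L C. cut \<eta> L C \<longrightarrow> (\<forall>s\<ge>0. ((\<lambda>t. LINT x|M. \<bar>V t x - V s x\<bar> * \<eta> x) \<longlongrightarrow> 0) (at s within {0..}))) \<and>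
   (\<forall>\<eta> L. tp \<eta> L \<longrightarrow> (\<forall>t\<ge>0. ((\<lambda>\<tau>. sip (V \<tau>) L) has_integral
    (ip (V t) \<eta>) - ip (V 0) \<eta>) {0..t}))"

lemma loc_meas: "loc u ==> u \<in> borel_measurable M"
 by (simp add: loc_def)

lemma loc_ind: "loc u ==> compact K ==> integrable M (\<lambda>x. indicator K x * u x)"
 by (simp add: loc_def)

lemma cut_wl: "cut \<eta> L C ==> wl \<eta> L" and cut_nonneg: "cut \<eta> L C ==> 0 \<le> \<eta> x"
 by (auto simp: cut_def)

lemma cut_bfs: "cut \<eta> L C ==> \<eta> \<in> bfs M"
 using D_bfs wl_D cut_wl by blast

lemma cut_exists: "compact K ==> \<exists>\<eta> L C. cut \<eta> L C \<and> (\<forall>x\<in>K. 1 \<le> \<eta> x)"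
 using cutoff[of K] unfolding cut_def by blast

text \<open>The bound |L| \<le> C * \<eta> powr m forces L to vanish wherever \<eta> does.\<close>

lemma cut_tp: "cut \<eta> L C ==> tp \<eta> L"
proof -
 assume c: "cut \<eta> L C"
 have "compact (closure {x. \<eta> x \<noteq> 0})" by (rule D_supp[OF wl_D[OF cut_wl[OF c]]])
 moreover have "\<eta> x = 0 \<and> L x = 0" if "x \<notin> closure {x. \<eta> x \<noteq> 0}" for x
 proof -
  have "\<eta> x = 0" using that closure_subset[of "{x. \<eta> x \<noteq> 0}"] by blast
  moreover have "\<bar>L x\<bar> \<le> C * \<eta> x powr m" using c by (auto simp: cut_def)
  ultimately show ?thesis by simp
 qed
 ultimately show ?thesis unfolding tp_def using cut_wl[OF c] by blast
qed

lemma loc_pair_int: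
 assumes u: "loc u" and g: "g \<in> bfs M" and K: "compact K" "\<And>x. x \<notin> K ==> g x = 0"
 shows "integrable M (\<lambda>x. u x * g x)"
proof -
 have "integrable M (\<lambda>x. (indicator K x * u x) * g x)" by (intro bfs_pair_int loc_ind u K g)
 moreover have "(\<lambda>x. (indicator K x * u x) * g x) = (\<lambda>x. u x * g x)" using K(2) by (auto simp: fun_eq_iff indicator_def)
 ultimately show ?thesis by simp
qed

lemma loc_phi_int:
 assumes u: "loc u" and g: "g \<in> bfs M" and K: "compact K" "\<And>x. x \<notin> K ==> g x = 0"
 shows "integrable M (\<lambda>x. spow (u x) m * g x)"
proof -
 have "integrable M (\<lambda>x. spow (indicator K x * u x) m * g x)" by (intro phi_int loc_ind u K g)
 moreover have "(\<lambda>x. spow (indicator K x * u x) m * g x) = (\<lambda>x. spow (u x) m * g x)"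
  using K(2) by (auto simp: fun_eq_iff indicator_def)
 ultimately show ?thesis by simp
qed

lemma tp_int:
 assumes "tp \<eta> L" "loc u"
 shows "integrable M (\<lambda>x. u x * \<eta> x)" "integrable M (\<lambda>x. spow (u x) m * L x)" "integrable M (\<lambda>x. u x * L x)"
proof -
 obtain K where K: "compact K" "\<And>x. x \<notin> K ==> \<eta> x = 0 \<and> L x = 0" and w: "wl \<eta> L" using assms(1) unfolding tp_def by blast
 show "integrable M (\<lambda>x. u x * \<eta> x)" "integrable M (\<lambda>x. spow (u x) m * L x)" "integrable M (\<lambda>x. u x * L x)"
  using loc_pair_int[OF assms(2) D_bfs[OF wl_D[OF w]] K(1)] loc_phi_int[OF assms(2) wl_bfs[OF w] K(1)]
   loc_pair_int[OF assms(2) wl_bfs[OF w] K(1)] K(2) by auto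
qed

lemma loc_diff: "loc u ==> loc v ==> loc (\<lambda>x. u x - v x)"
 unfolding loc_def by (auto simp: right_diff_distrib)

lemma loc_abs: "loc u ==> loc (\<lambda>x. \<bar>u x\<bar>)"
proof -
 assume u: "loc u"
 have "integrable M (\<lambda>x. indicator K x * \<bar>u x\<bar>)" if "compact K" for K
  using integrable_abs[OF loc_ind[OF u that]] by (simp add: abs_mult)
 thus ?thesis using loc_meas[OF u] unfolding loc_def by auto
qed

lemma loc_minus: "loc u ==> loc (\<lambda>x. - u x)"
 unfolding loc_def by auto

lemma integrable_loc: "integrable M u ==> loc u"
 unfolding loc_def
 using sets_M by (auto intro!: integrable_mult_indicator[where 'b = real, simplified] borel_closed compact_imp_closed)

lemma cut_int: "cut \<eta> L C ==> loc u ==> integrable M (\<lambda>x. u x * \<eta> x)"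
 using tp_int(1)[OF cut_tp] .

definition lnrm :: "'a fn \<Rightarrow> 'a fn \<Rightarrow> real" where
 "lnrm \<eta> u = (LINT x|M. \<bar>u x\<bar> * \<eta> x)"

abbreviation "ldst \<eta> f g \<equiv> lnrm \<eta> (\<lambda>x. f x - g x)"

lemma lnrm_int: "cut \<eta> L C ==> loc u ==> integrable M (\<lambda>x. \<bar>u x\<bar> * \<eta> x)"
 using cut_int loc_abs by blast

lemma lnrm_nonneg: "cut \<eta> L C ==> lnrm \<eta> u \<ge> 0"
 unfolding lnrm_def by (auto intro!: Bochner_Integration.integral_nonneg simp: cut_def)

lemma lnrm_tri:
 assumes c: "cut \<eta> L C" and u: "loc u" "loc v" "loc w"
 shows "ldst \<eta> u w \<le> ldst \<eta> u v + ldst \<eta> v w"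
proof -
 note I = lnrm_int[OF c loc_diff]
 have "ldst \<eta> u w \<le> (LINT x|M. \<bar>u x - v x\<bar> * \<eta> x + \<bar>v x - w x\<bar> * \<eta> x)"
  unfolding lnrm_def
 proof (rule integral_mono)
  show "\<bar>u x - w x\<bar> * \<eta> x \<le> \<bar>u x - v x\<bar> * \<eta> x + \<bar>v x - w x\<bar> * \<eta> x" for x
   unfolding distrib_right[symmetric] using cut_nonneg[OF c, of x] by (intro mult_right_mono) auto
 qed (use I u in auto)
 also have "\<dots> = ldst \<eta> u v + ldst \<eta> v w"
  unfolding lnrm_def using I u by (intro Bochner_Integration.integral_add) auto
 finally show ?thesis .
qed

lemma lnrm_sym: "ldst \<eta> u v = ldst \<eta> v u"
 by (simp add: lnrm_def abs_minus_commute)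

text \<open>|u^m - v^m| |L| is at most 2 C (|u - v| \<eta>) powr m, and \<open>powr_split_le\<close>
  at the level Y, the weighted distance, integrates this over the support of \<eta>. B depends on
  neither u nor v.\<close>

lemma phi_holder:
 assumes c: "cut \<eta> L0 C0" and L: "L \<in> bfs M" "\<And>x. \<bar>L x\<bar> \<le> C * \<eta> x powr m" and C: "C \<ge> 0"
 shows "\<exists>B\<ge>0. \<forall>u v. loc u \<and> loc v \<longrightarrow>
   \<bar>sip u L - sip v L\<bar> \<le> B * ldst \<eta> u v powr m"
proof -
 define S where "S = {x. \<eta> x \<noteq> 0}"
 have \<eta>b: "\<eta> \<in> bfs M" by (rule cut_bfs[OF c])
 have [measurable]: "\<eta> \<in> borel_measurable M" "L \<in> borel_measurable M" using bfs_meas \<eta>b L by auto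
 have "{x \<in> space M. \<eta> x \<noteq> 0} \<in> sets M" by measurable
 hence S: "S \<in> sets M" by (simp add: S_def)
 have Sf: "emeasure M S < \<infinity>" unfolding S_def by (rule bfs_support_finite[OF \<eta>b])
 have SI: "integrable M (indicator S :: 'a \<Rightarrow> real)" using S Sf by (simp add: integrable_indicator_iff)
 define K where "K = closure S"
 have K: "compact K" unfolding K_def S_def by (rule D_supp[OF wl_D[OF cut_wl[OF c]]])
 have LS: "L x = 0" if "x \<notin> S" for x using L(2)[of x] that by (simp add: S_def)
 have LK: "L x = 0" if "x \<notin> K" for x using LS[of x] that closure_subset[of S] by (auto simp: K_def)
 define B where "B = 2 * C * (measure M S + 1)"
 have B: "B \<ge> 0" using C by (simp add: B_def)
 have "\<bar>sip u L - sip v L\<bar> \<le> B * ldst \<eta> u v powr m"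
  if u: "loc u" and v: "loc v" for u v
 proof -
  define Y where "Y = ldst \<eta> u v"
  have Y0: "Y \<ge> 0" unfolding Y_def by (rule lnrm_nonneg[OF c])
  have [measurable]: "u \<in> borel_measurable M" "v \<in> borel_measurable M" using u v loc_meas by auto
  have iY: "integrable M (\<lambda>x. \<bar>u x - v x\<bar> * \<eta> x)" by (rule lnrm_int[OF c loc_diff[OF u v]])
  have I: "integrable M (\<lambda>x. spow (u x) m * L x)" "integrable M (\<lambda>x. spow (v x) m * L x)"
   using loc_phi_int[OF u L(1) K LK] loc_phi_int[OF v L(1) K LK] by auto
  have pw: "\<bar>spow (u x) m * L x - spow (v x) m * L x\<bar> \<le> 2 * C * (\<bar>u x - v x\<bar> * \<eta> x) powr m" for x
  proof -
   have "\<bar>spow (u x) m * L x - spow (v x) m * L x\<bar> = \<bar>spow (u x) m - spow (v x) m\<bar> * \<bar>L x\<bar>"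
    by (simp add: abs_mult left_diff_distrib[symmetric])
   also have "\<dots> \<le> (2 * \<bar>u x - v x\<bar> powr m) * (C * \<eta> x powr m)"
    using spow_holder[of m "u x" "v x"] m_pos m_less1 L(2)[of x] by (intro mult_mono) auto
   also have "\<dots> = 2 * C * (\<bar>u x - v x\<bar> * \<eta> x) powr m" using cut_nonneg[OF c, of x] by (simp add: powr_mult)
   finally show ?thesis .
  qed
  have "sip u L - sip v L = (LINT x|M. spow (u x) m * L x - spow (v x) m * L x)"
   using I by simp
  also have "\<bar>\<dots>\<bar> \<le> (LINT x|M. \<bar>spow (u x) m * L x - spow (v x) m * L x\<bar>)" by (rule integral_abs_bound)
  also have "\<dots> \<le> B * Y powr m"
  \<comment> \<open>The splitting needs a positive level, hence the separate case.\<close>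
  proof (cases "Y = 0")
   case True
   hence "AE x in M. \<bar>u x - v x\<bar> * \<eta> x = 0"
    using iY cut_nonneg[OF c] unfolding Y_def lnrm_def by (subst (asm) integral_nonneg_eq_0_iff_AE) auto
   hence "AE x in M. \<bar>spow (u x) m * L x - spow (v x) m * L x\<bar> = 0"
   proof eventually_elim
    case (elim x)
    show ?case using pw[of x] unfolding elim by simp
   qed
   hence "(LINT x|M. \<bar>spow (u x) m * L x - spow (v x) m * L x\<bar>) = (LINT x|M. 0)"
    by (intro integral_cong_AE) auto
   thus ?thesis using True by simp
  next
   case False
   hence Yp: "Y > 0" using Y0 by simp
   have "(LINT x|M. \<bar>spow (u x) m * L x - spow (v x) m * L x\<bar>)
     \<le> (LINT x|M. 2 * C * (Y powr m * indicator S x + Y powr (m - 1) * (\<bar>u x - v x\<bar> * \<eta> x)))"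
   proof (rule integral_mono)
    show "integrable M (\<lambda>x. \<bar>spow (u x) m * L x - spow (v x) m * L x\<bar>)" using I by auto
    show "integrable M (\<lambda>x. 2 * C * (Y powr m * indicator S x + Y powr (m - 1) * (\<bar>u x - v x\<bar> * \<eta> x)))"
     using SI iY by auto
    fix x
    show "\<bar>spow (u x) m * L x - spow (v x) m * L x\<bar> \<le> 2 * C * (Y powr m * indicator S x + Y powr (m - 1) * (\<bar>u x - v x\<bar> * \<eta> x))"
    proof (cases "x \<in> S")
     case True
     have "(\<bar>u x - v x\<bar> * \<eta> x) powr m \<le> Y powr m + Y powr (m - 1) * (\<bar>u x - v x\<bar> * \<eta> x)"
      using powr_split_le[OF Yp m_pos m_less1, of "\<bar>u x - v x\<bar> * \<eta> x"] cut_nonneg[OF c, of x] by simp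
     hence "2 * C * (\<bar>u x - v x\<bar> * \<eta> x) powr m \<le> 2 * C * (Y powr m + Y powr (m - 1) * (\<bar>u x - v x\<bar> * \<eta> x))"
      using C by (intro mult_left_mono) auto
     thus ?thesis using pw[of x] True by simp
    next
     case False
     hence "L x = 0" "\<eta> x = 0" using LS by (auto simp: S_def)
     thus ?thesis using C by simp
    qed
   qed
   also have "\<dots> = 2 * C * (Y powr m * measure M S + Y powr (m - 1) * Y)"
    using SI iY S by (simp add: Y_def lnrm_def)
   also have "Y powr (m - 1) * Y = Y powr m" using Yp by (simp add: powr_diff)
   also have "2 * C * (Y powr m * measure M S + Y powr m) = B * Y powr m" by (simp add: B_def algebra_simps)
   finally show ?thesis .
  qed
  finally show ?thesis unfolding Y_def .
 qed
 thus ?thesis using B by blast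
qed

text \<open>Reduces arbitrary test pairs to cut-offs: a cut-off that is at least 1 on the support
  dominates both \<eta> and L.\<close>

lemma tp_cut:
 assumes t: "tp \<eta> L"
 shows "\<exists>\<kappa> L0 C0 C. cut \<kappa> L0 C0 \<and> C \<ge> 0 \<and> (\<forall>x. \<bar>L x\<bar> \<le> C * \<kappa> x powr m) \<and> (\<forall>x. \<bar>\<eta> x\<bar> \<le> C * \<kappa> x)"
proof -
 obtain K where K: "compact K" "\<And>x. x \<notin> K ==> \<eta> x = 0 \<and> L x = 0" and w: "wl \<eta> L" using t unfolding tp_def by blast
 obtain \<kappa> L0 C0 where c: "cut \<kappa> L0 C0" "\<And>x. x \<in> K ==> 1 \<le> \<kappa> x" using cut_exists[OF K(1)] by blast
 obtain A where A: "A > 0" "\<And>x. \<bar>L x\<bar> \<le> A" using bfs_bounded[OF wl_bfs[OF w]] by blast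
 obtain B where B: "B > 0" "\<And>x. \<bar>\<eta> x\<bar> \<le> B" using bfs_bounded[OF D_bfs[OF wl_D[OF w]]] by blast
 have "\<bar>L x\<bar> \<le> (A + B) * \<kappa> x powr m \<and> \<bar>\<eta> x\<bar> \<le> (A + B) * \<kappa> x" for x
 proof (cases "x \<in> K")
  case True
  have 1: "1 \<le> \<kappa> x powr m" using c(2)[OF True] m_pos ge_one_powr_ge_zero by auto
  have "\<bar>L x\<bar> \<le> (A + B) * 1" "\<bar>\<eta> x\<bar> \<le> (A + B) * 1" using A(2)[of x] B(2)[of x] A(1) B(1) by auto
  moreover have "(A + B) * 1 \<le> (A + B) * \<kappa> x powr m" "(A + B) * 1 \<le> (A + B) * \<kappa> x"
   using A B 1 c(2)[OF True] by (auto intro!: mult_left_mono simp del: mult_1_right)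
  ultimately show ?thesis by linarith
 next
  case False
  thus ?thesis using K(2)[OF False] A B cut_nonneg[OF c(1)] by simp
 qed
 thus ?thesis using c(1) A B by (intro exI[of _ \<kappa>] exI[of _ L0] exI[of _ C0] exI[of _ "A + B"]) auto
qed

lemma sol_loc: "sol V ==> t \<ge> 0 ==> loc (V t)"
 by (simp add: sol_def)

lemma sol_cont: "sol V ==> cut \<eta> L C ==> s \<ge> 0 ==> ((\<lambda>t. ldst \<eta> (V t) (V s)) \<longlongrightarrow> 0) (at s within {0..})"
 unfolding sol_def lnrm_def by blast

lemma sol_weak: "sol V ==> tp \<eta> L ==> t \<ge> 0 ==> ((\<lambda>\<tau>. sip (V \<tau>) L) has_integral
    (ip (V t) \<eta>) - ip (V 0) \<eta>) {0..t}"
 unfolding sol_def by blast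

text \<open>By \<open>tp_cut\<close> and \<open>phi_holder\<close> the pairing is Hoelder continuous
  with respect to a weighted norm.\<close>

lemma phi_continuous:
 fixes V :: "real \<Rightarrow> 'a \<Rightarrow> real"
 assumes loc: "\<And>t. t \<ge> 0 ==> loc (V t)"
  and ct: "\<And>\<eta> L C s. cut \<eta> L C ==> s \<ge> 0 ==> ((\<lambda>t. ldst \<eta> (V t) (V s)) \<longlongrightarrow> 0) (at s within {0..})"
  and t: "tp \<eta> L"
 shows "continuous_on {0..} (\<lambda>t. sip (V t) L)"
 unfolding continuous_on_def
proof
 fix s :: real assume s: "s \<in> {0..}"
 obtain \<kappa> L0 C0 C where c: "cut \<kappa> L0 C0" "C \<ge> 0" "\<And>x. \<bar>L x\<bar> \<le> C * \<kappa> x powr m" using tp_cut[OF t] by blast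
 have Lb: "L \<in> bfs M" using t by (auto simp: tp_def dest: wl_bfs)
 obtain B where B: "B \<ge> 0" "\<And>u v. loc u ==> loc v ==>
   \<bar>sip u L - sip v L\<bar> \<le> B * ldst \<kappa> u v powr m"
  using phi_holder[OF c(1) Lb c(3,2)] by blast
 have "((\<lambda>t. B * ldst \<kappa> (V t) (V s) powr m) \<longlongrightarrow> B * 0 powr m) (at s within {0..})"
  using m_pos s lnrm_nonneg[OF c(1)] by (intro tendsto_intros tendsto_powr2 ct[OF c(1)]) auto
 hence "((\<lambda>t. B * ldst \<kappa> (V t) (V s) powr m) \<longlongrightarrow> 0) (at s within {0..})" by simp
 moreover have "eventually (\<lambda>t. norm (sip (V t) L - sip (V s) L)
   \<le> B * ldst \<kappa> (V t) (V s) powr m) (at s within {0..})"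
  unfolding eventually_at_filter using B(2)[OF loc loc] s by (auto intro!: always_eventually)
 ultimately have "((\<lambda>t. (sip (V t) L) - sip (V s) L) \<longlongrightarrow> 0) (at s within {0..})"
  by (rule Lim_null_comparison[rotated])
 thus "((\<lambda>t. sip (V t) L) \<longlongrightarrow> sip (V s) L) (at s within {0..})"
  by (simp add: LIM_zero_iff)
qed

text \<open>The integrand is continuous, so the integrated equation can be differentiated. Near s
  the interval {0..s + 1} agrees with {0..}.\<close>

lemma sol_deriv:
 assumes V: "sol V" and t: "tp \<eta> L" and s: "s \<ge> 0"
 shows "((\<lambda>t. ip (V t) \<eta>) has_real_derivative (sip (V s) L)) (at s within {0..})"
proof -
 let ?G = "\<lambda>t. sip (V t) L"
 let ?g = "\<lambda>t. ip (V t) \<eta>"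
 have c: "continuous_on {0..s + 1} ?G"
  by (rule continuous_on_subset[OF phi_continuous[OF sol_loc[OF V] sol_cont[OF V] t]]) auto
 have "((\<lambda>u. integral {0..u} ?G) has_real_derivative ?G s) (at s within {0..s + 1})"
  by (rule integral_has_real_derivative[OF c]) (use s in auto)
 hence "((\<lambda>u. integral {0..u} ?G + ?g 0) has_real_derivative ?G s) (at s within {0..s + 1})"
  by (auto intro!: derivative_eq_intros)
 hence "(?g has_real_derivative ?G s) (at s within {0..s + 1})"
 proof (rule has_field_derivative_transform_within[where d = 1])
  show "integral {0..u} ?G + ?g 0 = ?g u" if "u \<in> {0..s + 1}" "dist u s < 1" for u
   using integral_unique[OF sol_weak[OF V t, of u]] that by simp
 qed (use s in auto)
 moreover have "at s within {0..s + 1} = at s within {0..}"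
  by (rule at_within_nhd[of s "{..<s + 1}"]) (use s in auto)
 ultimately show ?thesis by simp
qed

lemma sol_zero: "sol (\<lambda>t x. 0)"
 unfolding sol_def loc_def by auto

lemma sol_minus:
 assumes "sol V" shows "sol (\<lambda>t x. - V t x)"
proof -
 have e: "\<bar>- a - - b\<bar> = \<bar>a - b\<bar>" for a b :: real by simp
 show ?thesis unfolding sol_def e spow_minus
 proof (intro conjI allI impI)
  show "loc (\<lambda>x. - V t x)" if "t \<ge> 0" for t using loc_minus[OF sol_loc[OF assms that]] .
  show "((\<lambda>t. LINT x|M. \<bar>V t x - V s x\<bar> * \<eta> x) \<longlongrightarrow> 0) (at s within {0..})" if "cut \<eta> L C" "s \<ge> 0" for \<eta> L C s
   using sol_cont[OF assms that] unfolding lnrm_def .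
  show "((\<lambda>\<tau>. LINT x|M. - spow (V \<tau> x) m * L x) has_integral (LINT x|M. - V t x * \<eta> x) - (LINT x|M. - V 0 x * \<eta> x)) {0..t}"
   if "tp \<eta> L" "t \<ge> 0" for \<eta> L t
   using has_integral_neg[OF sol_weak[OF assms that]] by simp
 qed
qed

text \<open>\<open>sg_increment\<close> gives a derivative of ip (V t) \<eta> at every time, and the
  fundamental theorem of calculus integrates it.\<close>

theorem sg_sol:
 assumes f: "f \<in> X" and V: "sg f V" shows "sol V"
 unfolding sol_def
proof (intro conjI allI impI)
 show "loc (V t)" if "t \<ge> 0" for t by (intro integrable_loc sg_int[OF V that])
 show "((\<lambda>t. LINT x|M. \<bar>V t x - V s x\<bar> * \<eta> x) \<longlongrightarrow> 0) (at s within {0..})" if c: "cut \<eta> L C" and s: "s \<ge> 0" for \<eta> L C s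
 proof (rule tendstoI)
  fix e :: real assume e: "e > 0"
  obtain A where A: "A > 0" "\<And>x. \<bar>\<eta> x\<bar> \<le> A" using bfs_bounded[OF cut_bfs[OF c]] by blast
  have e2: "e / (2 * A) > 0" using e A by simp
  obtain d where d: "d > 0" "\<And>t. 0 \<le> t ==> \<bar>t - s\<bar> < d ==> dst (V t) (V s) \<le> e / (2 * A)"
   using sg_cont[OF f V e2] s by blast
  have "dist (LINT x|M. \<bar>V t x - V s x\<bar> * \<eta> x) 0 < e" if t: "0 \<le> t" "\<bar>t - s\<bar> < d" for t
  proof -
   have "(LINT x|M. \<bar>V t x - V s x\<bar> * \<eta> x) \<le> (LINT x|M. A * \<bar>V t x - V s x\<bar>)"
   proof (rule integral_mono)
    show "integrable M (\<lambda>x. \<bar>V t x - V s x\<bar> * \<eta> x)"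
     using sg_int[OF V] t s by (intro lnrm_int[OF c] loc_diff integrable_loc) auto
    show "integrable M (\<lambda>x. A * \<bar>V t x - V s x\<bar>)" using sg_int[OF V] t s by auto
    show "\<bar>V t x - V s x\<bar> * \<eta> x \<le> A * \<bar>V t x - V s x\<bar>" for x
     using mult_left_mono[of "\<eta> x" A "\<bar>V t x - V s x\<bar>"] A(2)[of x] by (simp add: mult.commute)
   qed
   also have "\<dots> = A * dst (V t) (V s)" by (simp add: nrm_def)
   also have "\<dots> \<le> A * (e / (2 * A))" using d(2)[OF t] A by (intro mult_left_mono) auto
   also have "\<dots> < e" using A e by simp
   finally have "(LINT x|M. \<bar>V t x - V s x\<bar> * \<eta> x) < e" .
   moreover have "0 \<le> (LINT x|M. \<bar>V t x - V s x\<bar> * \<eta> x)" using lnrm_nonneg[OF c] unfolding lnrm_def .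
   ultimately show ?thesis by simp
  qed
  thus "\<forall>\<^sub>F t in at s within {0..}. dist (LINT x|M. \<bar>V t x - V s x\<bar> * \<eta> x) 0 < e"
   unfolding eventually_at using d(1) by (auto intro!: exI[of _ d] simp: dist_real_def)
 qed
 show "((\<lambda>\<tau>. sip (V \<tau>) L) has_integral (ip (V t) \<eta>) - ip (V 0) \<eta>) {0..t}"
  if tp: "tp \<eta> L" and t: "t \<ge> 0" for \<eta> L t
 proof (rule fundamental_theorem_of_calculus[OF t])
  fix s assume s: "s \<in> {0..t}"
  let ?g = "\<lambda>t. ip (V t) \<eta>" and ?G = "sip (V s) L"
  have w: "wl \<eta> L" using tp by (simp add: tp_def)
  have "((\<lambda>y. (?g y - ?g s) / (y - s)) \<longlongrightarrow> ?G) (at s within {0..t})"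
  proof (rule tendstoI)
   fix e :: real assume e: "e > 0"
   hence e2: "e / 2 > 0" by simp
   have s0: "0 \<le> s" using s by simp
   obtain d where d: "d > 0" "\<And>a b. 0 \<le> a ==> a \<le> b ==> \<bar>a - s\<bar> < d ==> \<bar>b - s\<bar> < d ==>
     \<bar>?g b - ?g a - (b - a) * ?G\<bar> \<le> e / 2 * (b - a)"
    using sg_increment[OF f V w s0 e2] by blast
   have "dist ((?g y - ?g s) / (y - s)) ?G < e" if y: "y \<in> {0..t}" "y \<noteq> s" "dist y s < d" for y
   proof -
    have "\<bar>?g y - ?g s - (y - s) * ?G\<bar> \<le> e / 2 * \<bar>y - s\<bar>"
    proof (cases "s \<le> y")
     case True thus ?thesis using d(2)[of s y] s y d(1) by (simp add: dist_real_def)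
    next
     case False
     hence "\<bar>?g s - ?g y - (s - y) * ?G\<bar> \<le> e / 2 * (s - y)" using d(2)[of y s] s y d(1) by (simp add: dist_real_def)
     moreover have "?g y - ?g s - (y - s) * ?G = - (?g s - ?g y - (s - y) * ?G)" by (simp add: algebra_simps)
     ultimately show ?thesis using False by (simp only: abs_minus_cancel) simp
    qed
    moreover have "(?g y - ?g s) / (y - s) - ?G = (?g y - ?g s - (y - s) * ?G) / (y - s)"
     using y(2) by (simp add: field_simps)
    ultimately have "\<bar>(?g y - ?g s) / (y - s) - ?G\<bar> \<le> e / 2" using y(2) by (simp add: abs_divide divide_le_eq)
    thus ?thesis using e by (simp add: dist_real_def)
   qed
   thus "\<forall>\<^sub>F y in at s within {0..t}. dist ((?g y - ?g s) / (y - s)) ?G < e"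
    unfolding eventually_at using d(1) by (auto intro!: exI[of _ d])
  qed
  hence "(?g has_real_derivative ?G) (at s within {0..t})" by (simp add: has_field_derivative_iff)
  thus "(?g has_vector_derivative ?G) (at s within {0..t})" by (simp add: has_real_derivative_iff_has_vector_derivative)
 qed
qed

text \<open>The order V \<le> W makes the weighted norm of W - V equal to ip W \<eta> - ip V \<eta>,
  which is differentiable in time. B is obtained before V and W; the later limits use this
  uniformity.\<close>

lemma herrero_pierre:
 assumes c: "cut \<eta> L C"
 obtains B where "B \<ge> 0" "\<And>V W s t. sol V ==> sol W ==> (\<forall>t\<ge>0. AE x in M. V t x \<le> W t x) ==> s \<ge> 0 ==> t \<ge> 0 ==>
   \<bar>ldst \<eta> (W t) (V t) powr (1 - m) - ldst \<eta> (W s) (V s) powr (1 - m)\<bar> \<le> B * \<bar>t - s\<bar>"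
proof -
 have Lb: "L \<in> bfs M" using c by (auto simp: cut_def dest: wl_bfs)
 have C: "C \<ge> 0" "\<And>x. \<bar>L x\<bar> \<le> C * \<eta> x powr m" using c by (auto simp: cut_def)
 obtain B where B: "B \<ge> 0" "\<And>u v. loc u ==> loc v ==>
   \<bar>sip u L - sip v L\<bar> \<le> B * ldst \<eta> u v powr m"
  using phi_holder[OF c Lb C(2,1)] by blast
 have "\<bar>ldst \<eta> (W t) (V t) powr (1 - m) - ldst \<eta> (W s) (V s) powr (1 - m)\<bar> \<le> (1 - m) * B * \<bar>t - s\<bar>"
  if V: "sol V" and W: "sol W" and le: "\<And>t. t \<ge> 0 ==> AE x in M. V t x \<le> W t x" and st: "s \<ge> 0" "t \<ge> 0" for V W s t
 proof (rule ode_bound[where H = "\<lambda>t. (sip (W t) L) - sip (V t) L", OF _ _ m_pos m_less1 B(1) _ st])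
  fix u :: real assume u: "u \<ge> 0"
  have e: "ldst \<eta> (W t) (V t) = ip (W t) \<eta> - ip (V t) \<eta>" if t: "t \<ge> 0" for t
  proof -
   have [measurable]: "W t \<in> borel_measurable M" "V t \<in> borel_measurable M" "\<eta> \<in> borel_measurable M"
    using loc_meas[OF sol_loc[OF V t]] loc_meas[OF sol_loc[OF W t]] bfs_meas[OF cut_bfs[OF c]] by auto
   have "ldst \<eta> (W t) (V t) = (LINT x|M. W t x * \<eta> x - V t x * \<eta> x)"
    unfolding lnrm_def
   proof (rule integral_cong_AE)
    show "AE x in M. \<bar>W t x - V t x\<bar> * \<eta> x = W t x * \<eta> x - V t x * \<eta> x"
     using le[OF t] by eventually_elim (simp add: left_diff_distrib)
   qed measurable
   thus ?thesis using cut_int[OF c sol_loc[OF V t]] cut_int[OF c sol_loc[OF W t]] by simp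
  qed
  have "((\<lambda>t. (ip (W t) \<eta>) - ip (V t) \<eta>) has_real_derivative
    (sip (W u) L) - sip (V u) L) (at u within {0..})"
   by (intro DERIV_diff sol_deriv V W cut_tp[OF c] u)
  thus "((\<lambda>t. ldst \<eta> (W t) (V t)) has_real_derivative
    (sip (W u) L) - sip (V u) L) (at u within {0..})"
   by (rule has_field_derivative_transform_within[where d = 1]) (use u e in auto)
  show "0 \<le> ldst \<eta> (W u) (V u)" by (rule lnrm_nonneg[OF c])
  show "\<bar>sip (W u) L - sip (V u) L\<bar> \<le> B * ldst \<eta> (W u) (V u) powr m"
   by (intro B(2) sol_loc V W u)
 qed
 moreover have "(1 - m) * B \<ge> 0" using B(1) m_less1 by simp
 ultimately show ?thesis using that by blast
qed

lemma tp_pair_le: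
 assumes c: "cut \<kappa> L0 C0" and t: "tp \<eta> L" and le: "\<And>x. \<bar>\<eta> x\<bar> \<le> C * \<kappa> x" and u: "loc u" "loc v"
 shows "\<bar>ip u \<eta> - ip v \<eta>\<bar> \<le> C * ldst \<kappa> u v"
proof -
 have "ip u \<eta> - ip v \<eta> = (LINT x|M. u x * \<eta> x - v x * \<eta> x)"
  using tp_int(1)[OF t] u by simp
 also have "\<bar>\<dots>\<bar> \<le> (LINT x|M. \<bar>u x * \<eta> x - v x * \<eta> x\<bar>)" by (rule integral_abs_bound)
 also have "\<dots> \<le> (LINT x|M. C * (\<bar>u x - v x\<bar> * \<kappa> x))"
 proof (rule integral_mono)
  show "integrable M (\<lambda>x. \<bar>u x * \<eta> x - v x * \<eta> x\<bar>)" using tp_int(1)[OF t] u by auto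
  show "integrable M (\<lambda>x. C * (\<bar>u x - v x\<bar> * \<kappa> x))" using lnrm_int[OF c loc_diff[OF u]] by simp
  fix x
  have "\<bar>u x * \<eta> x - v x * \<eta> x\<bar> = \<bar>u x - v x\<bar> * \<bar>\<eta> x\<bar>" by (simp add: abs_mult left_diff_distrib[symmetric])
  also have "\<dots> \<le> \<bar>u x - v x\<bar> * (C * \<kappa> x)" using le by (intro mult_left_mono) auto
  finally show "\<bar>u x * \<eta> x - v x * \<eta> x\<bar> \<le> C * (\<bar>u x - v x\<bar> * \<kappa> x)" by (simp add: mult_ac)
 qed
 also have "\<dots> = C * ldst \<kappa> u v" by (simp add: lnrm_def)
 finally show ?thesis .
qed

text \<open>Monotone convergence for functions of either sign: Fatou's lemma, applied along an
  exhaustion, shows that the limit is finite almost everywhere.\<close>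

lemma loc_limit:
 assumes V: "\<And>k::nat. loc (V k)" and inc: "\<And>k. AE x in M. V k x \<le> V (Suc k) x"
  and bd: "\<And>\<eta> L C. cut \<eta> L C ==> \<exists>B. \<forall>k. lnrm \<eta> (V k) \<le> B"
 defines "W \<equiv> \<lambda>x. lim (\<lambda>k. V k x)"
 shows "AE x in M. (\<lambda>k. V k x) \<longlonglongrightarrow> W x" "loc W" "\<And>k. AE x in M. V k x \<le> W x"
  "\<And>\<eta> L C. cut \<eta> L C ==> (\<lambda>k. ldst \<eta> W (V k)) \<longlonglongrightarrow> 0"
proof -
 note [measurable] = loc_meas[OF V]
 have [measurable]: "W \<in> borel_measurable M" unfolding W_def by measurable
 have AEinc: "AE x in M. \<forall>k. V k x \<le> V (Suc k) x" using inc by (simp add: AE_all_countable)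
 have fatou: "(\<integral>\<^sup>+x. liminf (\<lambda>k. ennreal (\<bar>V k x\<bar> * \<eta> x)) \<partial>M) < \<infinity>" if c: "cut \<eta> L C" for \<eta> L C
 proof -
  obtain B where B: "\<And>k. lnrm \<eta> (V k) \<le> B" using bd[OF c] by blast
  have [measurable]: "\<eta> \<in> borel_measurable M" by (rule bfs_meas[OF cut_bfs[OF c]])
  have "(\<integral>\<^sup>+x. liminf (\<lambda>k. ennreal (\<bar>V k x\<bar> * \<eta> x)) \<partial>M) \<le> liminf (\<lambda>k. nnint M (\<lambda>x. \<bar>V k x\<bar> * \<eta> x))"
   by (intro nn_integral_liminf) measurable
  also have "\<dots> \<le> ennreal B"
  proof (rule Liminf_le)
   have "nnint M (\<lambda>x. \<bar>V k x\<bar> * \<eta> x) = ennreal (lnrm \<eta> (V k))" for k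
    unfolding lnrm_def using cut_nonneg[OF c] by (intro nn_integral_eq_integral lnrm_int[OF c V]) auto
   thus "\<forall>\<^sub>F k in sequentially. (nnint M (\<lambda>x. \<bar>V k x\<bar> * \<eta> x)) \<le> ennreal B"
    using B by (intro always_eventually) (auto intro: ennreal_leI)
  qed simp
  also have "\<dots> < \<infinity>" by simp
  finally show ?thesis .
 qed
 obtain K where K: "\<And>n::nat. compact (K n :: 'a set)" "(\<Union>n. K n) = UNIV" using exhaustion by blast
 have "AE x in M. x \<in> K i \<longrightarrow> liminf (\<lambda>k. ennreal \<bar>V k x\<bar>) \<noteq> \<infinity>" for i
 proof -
  obtain \<eta> L C where c: "cut \<eta> L C" "\<And>x. x \<in> K i ==> 1 \<le> \<eta> x" using cut_exists[OF K(1)] by blast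
  have [measurable]: "\<eta> \<in> borel_measurable M" by (rule bfs_meas[OF cut_bfs[OF c(1)]])
  have "AE x in M. liminf (\<lambda>k. ennreal (\<bar>V k x\<bar> * \<eta> x)) \<noteq> \<infinity>"
   using fatou[OF c(1)] by (intro nn_integral_noteq_infinite) auto
  thus ?thesis
  proof eventually_elim
   case (elim x)
   show ?case
   proof
    assume x: "x \<in> K i"
    have "liminf (\<lambda>k. ennreal \<bar>V k x\<bar>) \<le> liminf (\<lambda>k. ennreal (\<bar>V k x\<bar> * \<eta> x))"
    proof (intro Liminf_mono always_eventually allI ennreal_leI)
     show "\<bar>V k x\<bar> \<le> \<bar>V k x\<bar> * \<eta> x" for k
      using mult_left_mono[OF c(2)[OF x], of "\<bar>V k x\<bar>"] by simp
    qed
    thus "liminf (\<lambda>k. ennreal \<bar>V k x\<bar>) \<noteq> \<infinity>" using elim by (auto simp: top_unique)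
   qed
  qed
 qed
 hence "AE x in M. \<forall>i. x \<in> K i \<longrightarrow> liminf (\<lambda>k. ennreal \<bar>V k x\<bar>) \<noteq> \<infinity>"
  unfolding AE_all_countable by blast
 thus lim: "AE x in M. (\<lambda>k. V k x) \<longlonglongrightarrow> W x"
  using AEinc
 proof eventually_elim
  case (elim x)
  obtain i where "x \<in> K i" using K(2) by blast
  hence "convergent (\<lambda>k. V k x)" using elim by (intro convergent_of_liminf_finite) auto
  thus ?case by (simp add: W_def convergent_LIMSEQ_iff)
 qed
 have IW: "integrable M (\<lambda>x. \<bar>W x\<bar> * \<eta> x)" if c: "cut \<eta> L C" for \<eta> L C
 proof (rule integrableI_bounded)
  have [measurable]: "\<eta> \<in> borel_measurable M" by (rule bfs_meas[OF cut_bfs[OF c]])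
  show "(\<lambda>x. \<bar>W x\<bar> * \<eta> x) \<in> borel_measurable M" by measurable
  have "nnint M (\<lambda>x. norm (\<bar>W x\<bar> * \<eta> x)) = (\<integral>\<^sup>+x. liminf (\<lambda>k. ennreal (\<bar>V k x\<bar> * \<eta> x)) \<partial>M)"
  proof (intro nn_integral_cong_AE)
   show "AE x in M. ennreal (norm (\<bar>W x\<bar> * \<eta> x)) = liminf (\<lambda>k. ennreal (\<bar>V k x\<bar> * \<eta> x))"
    using lim
   proof eventually_elim
    case (elim x)
    have "(\<lambda>k. \<bar>V k x\<bar> * \<eta> x) \<longlonglongrightarrow> \<bar>W x\<bar> * \<eta> x" by (intro tendsto_intros elim)
    hence "liminf (\<lambda>k. ennreal (\<bar>V k x\<bar> * \<eta> x)) = ennreal (\<bar>W x\<bar> * \<eta> x)"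
     by (intro lim_imp_Liminf tendsto_ennrealI) auto
    thus ?case using cut_nonneg[OF c, of x] by simp
   qed
  qed
  thus "nnint M (\<lambda>x. norm (\<bar>W x\<bar> * \<eta> x)) < \<infinity>" using fatou[OF c] by simp
 qed
 show Wl: "loc W" unfolding loc_def
 proof (intro conjI allI impI)
  fix K :: "'a set" assume K: "compact K"
  hence [measurable]: "K \<in> sets M" using sets_M by (simp add: borel_closed compact_imp_closed)
  obtain \<eta> L C where c: "cut \<eta> L C" "\<And>x. x \<in> K ==> 1 \<le> \<eta> x" using cut_exists[OF K] by blast
  show "integrable M (\<lambda>x. indicator K x * W x)"
  proof (rule Bochner_Integration.integrable_bound[OF IW[OF c(1)]])
   show "AE x in M. norm (indicator K x * W x) \<le> norm (\<bar>W x\<bar> * \<eta> x)"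
   proof (intro AE_I2)
    fix x show "norm (indicator K x * W x) \<le> norm (\<bar>W x\<bar> * \<eta> x)"
     using c(2)[of x] mult_left_mono[of 1 "\<eta> x" "\<bar>W x\<bar>"] cut_nonneg[OF c(1), of x]
     by (cases "x \<in> K") (auto simp: abs_mult)
   qed
  qed measurable
 qed measurable
 show le: "AE x in M. V k x \<le> W x" for k
  using lim AEinc
 proof eventually_elim
  case (elim x)
  have "incseq (\<lambda>k. V k x)" using elim(2) by (intro incseq_SucI) auto
  thus ?case using elim(1) by (rule incseq_le)
 qed
 show "(\<lambda>k. ldst \<eta> W (V k)) \<longlonglongrightarrow> 0" if c: "cut \<eta> L C" for \<eta> L C
 proof -
  have [measurable]: "\<eta> \<in> borel_measurable M" by (rule bfs_meas[OF cut_bfs[OF c]])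
  have "(\<lambda>k. LINT x|M. \<bar>W x - V k x\<bar> * \<eta> x) \<longlonglongrightarrow> (LINT x|M. 0)"
  proof (rule integral_dominated_convergence[where w = "\<lambda>x. \<bar>W x - V 0 x\<bar> * \<eta> x"])
   show "integrable M (\<lambda>x. \<bar>W x - V 0 x\<bar> * \<eta> x)" by (intro lnrm_int[OF c] loc_diff Wl V)
   show "AE x in M. (\<lambda>k. \<bar>W x - V k x\<bar> * \<eta> x) \<longlonglongrightarrow> 0"
    using lim
   proof eventually_elim
    case (elim x)
    have "(\<lambda>k. \<bar>W x - V k x\<bar> * \<eta> x) \<longlonglongrightarrow> \<bar>W x - W x\<bar> * \<eta> x" by (intro tendsto_intros elim)
    thus ?case by simp
   qed
   show "AE x in M. norm (\<bar>W x - V k x\<bar> * \<eta> x) \<le> \<bar>W x - V 0 x\<bar> * \<eta> x" for k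
    using AEinc le[of k]
   proof eventually_elim
    case (elim x)
    have "V 0 x \<le> V k x" by (rule lift_Suc_mono_le[of "\<lambda>k. V k x"]) (use elim(1) in auto)
    hence "\<bar>W x - V k x\<bar> * \<eta> x \<le> \<bar>W x - V 0 x\<bar> * \<eta> x"
     using elim(2) cut_nonneg[OF c, of x] by (intro mult_right_mono) auto
    thus ?case using cut_nonneg[OF c, of x] by simp
   qed
  qed measurable
  thus ?thesis by (simp add: lnrm_def)
 qed
qed

text \<open>Letting l grow in the estimate for V l - V k shows that W - V k obeys the same bound,
  with one constant for all k. Hence W - V k stays small near s once it is small at s, and W
  inherits continuity from V k.\<close>

theorem sol_monotone_limit:
 assumes V: "\<And>k::nat. sol (V k)" and inc: "\<And>k t. t \<ge> 0 ==> AE x in M. V k t x \<le> V (Suc k) t x"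
  and bd: "\<And>\<eta> L C t. cut \<eta> L C ==> t \<ge> 0 ==> \<exists>B. \<forall>k. lnrm \<eta> (V k t) \<le> B"
 shows "\<exists>W. sol W \<and> (\<forall>t\<ge>0. AE x in M. (\<lambda>k. V k t x) \<longlonglongrightarrow> W t x)"
proof -
 define W where "W t x = lim (\<lambda>k. V k t x)" for t x
 have Weq: "W t = (\<lambda>x. lim (\<lambda>k. V k t x))" for t by (simp add: W_def fun_eq_iff)
 have lim: "AE x in M. (\<lambda>k. V k t x) \<longlonglongrightarrow> W t x" if t: "t \<ge> 0" for t
  unfolding Weq by (rule loc_limit(1)[OF sol_loc[OF V t] inc[OF t] bd[OF _ t]])
 have Wl: "loc (W t)" if t: "t \<ge> 0" for t
  unfolding Weq by (rule loc_limit(2)[OF sol_loc[OF V t] inc[OF t] bd[OF _ t]])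
 have le: "AE x in M. V k t x \<le> W t x" if t: "t \<ge> 0" for k t
  unfolding Weq by (rule loc_limit(3)[OF sol_loc[OF V t] inc[OF t] bd[OF _ t]])
 have Wlim: "(\<lambda>k. ldst \<eta> (W t) (V k t)) \<longlonglongrightarrow> 0" if t: "t \<ge> 0" and c: "cut \<eta> L C" for t \<eta> L C
  unfolding Weq by (rule loc_limit(4)[OF sol_loc[OF V t] inc[OF t] bd[OF _ t] c])
 have incle: "AE x in M. V k t x \<le> V l t x" if "k \<le> l" "t \<ge> 0" for k l t
 proof -
  have "AE x in M. \<forall>k. V k t x \<le> V (Suc k) t x" using inc[OF that(2)] by (simp add: AE_all_countable)
  thus ?thesis by eventually_elim (rule lift_Suc_mono_le[of "\<lambda>k. V k t _", OF _ that(1)], blast)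
 qed
 have hp: "\<exists>B\<ge>0. \<forall>k. \<forall>s\<ge>0. \<forall>t\<ge>0. \<bar>ldst \<eta> (W t) (V k t) powr (1 - m) - ldst \<eta> (W s) (V k s) powr (1 - m)\<bar> \<le> B * \<bar>t - s\<bar>"
  if c: "cut \<eta> L C" for \<eta> L C
 proof -
  obtain B where B: "B \<ge> 0" "\<And>V W s t. sol V ==> sol W ==> (\<forall>t\<ge>0. AE x in M. V t x \<le> W t x) ==> s \<ge> 0 ==> t \<ge> 0 ==>
   \<bar>ldst \<eta> (W t) (V t) powr (1 - m) - ldst \<eta> (W s) (V s) powr (1 - m)\<bar> \<le> B * \<bar>t - s\<bar>"
   by (rule herrero_pierre[OF c]) (rule that)
  have "\<bar>ldst \<eta> (W t) (V k t) powr (1 - m) - ldst \<eta> (W s) (V k s) powr (1 - m)\<bar> \<le> B * \<bar>t - s\<bar>"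
   if s: "s \<ge> 0" and t: "t \<ge> 0" for k s t
  proof -
   have cv: "(\<lambda>l. ldst \<eta> (V l u) (V k u)) \<longlonglongrightarrow> ldst \<eta> (W u) (V k u)" if u: "u \<ge> 0" for u
   proof -
    note ll = sol_loc[OF V u] Wl[OF u]
    have "norm (ldst \<eta> (V l u) (V k u) - ldst \<eta> (W u) (V k u)) \<le> ldst \<eta> (W u) (V l u)" for l
     using lnrm_tri[OF c ll(1) ll(2) ll(1), of l k] lnrm_tri[OF c ll(2) ll(1)[of l] ll(1)[of k]] lnrm_sym[of \<eta> "V l u" "W u"]
     by (simp add: abs_le_iff)
    hence "(\<lambda>l. ldst \<eta> (V l u) (V k u) - ldst \<eta> (W u) (V k u)) \<longlonglongrightarrow> 0"
     by (intro Lim_null_comparison[OF _ Wlim[OF u c]] always_eventually) auto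
    thus ?thesis by (simp add: LIM_zero_iff)
   qed
   have cp: "(\<lambda>l. ldst \<eta> (V l u) (V k u) powr (1 - m)) \<longlonglongrightarrow> ldst \<eta> (W u) (V k u) powr (1 - m)" if u: "u \<ge> 0" for u
    using m_less1 lnrm_nonneg[OF c] by (intro tendsto_powr2[OF cv[OF u]] tendsto_const) auto
   have "(\<lambda>l. \<bar>ldst \<eta> (V l t) (V k t) powr (1 - m) - ldst \<eta> (V l s) (V k s) powr (1 - m)\<bar>)
     \<longlonglongrightarrow> \<bar>ldst \<eta> (W t) (V k t) powr (1 - m) - ldst \<eta> (W s) (V k s) powr (1 - m)\<bar>"
    by (intro tendsto_rabs tendsto_diff cp s t)
   thus ?thesis
   proof (rule LIMSEQ_le_const2)
    show "\<exists>N. \<forall>l\<ge>N. \<bar>ldst \<eta> (V l t) (V k t) powr (1 - m) - ldst \<eta> (V l s) (V k s) powr (1 - m)\<bar> \<le> B * \<bar>t - s\<bar>"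
     using B(2)[OF V V _ s t] incle by blast
   qed
  qed
  thus ?thesis using B(1) by blast
 qed
 have Wcont: "((\<lambda>t. ldst \<eta> (W t) (W s)) \<longlongrightarrow> 0) (at s within {0..})" if c: "cut \<eta> L C" and s: "s \<ge> 0" for \<eta> L C s
 proof (rule tendstoI)
  fix e :: real assume "e > 0"
  hence e3: "e / 3 > 0" by simp
  obtain B where B: "B \<ge> 0" "\<And>k s t. s \<ge> 0 ==> t \<ge> 0 ==> \<bar>ldst \<eta> (W t) (V k t) powr (1 - m) - ldst \<eta> (W s) (V k s) powr (1 - m)\<bar> \<le> B * \<bar>t - s\<bar>"
   using hp[OF c] by blast
  define E' where "E' = (e / 3) powr (1 - m)"
  have E': "E' > 0" using e3 unfolding E'_def by (metis powr_gt_zero less_irrefl)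
  have "(\<lambda>k. ldst \<eta> (W s) (V k s) powr (1 - m)) \<longlonglongrightarrow> 0 powr (1 - m)"
   using m_less1 lnrm_nonneg[OF c] by (intro tendsto_powr2[OF Wlim[OF s c]] tendsto_const) auto
  hence "eventually (\<lambda>k. ldst \<eta> (W s) (V k s) powr (1 - m) < E' / 2) sequentially"
   using E' by (intro order_tendstoD(2)) auto
  then obtain k where k: "ldst \<eta> (W s) (V k s) powr (1 - m) < E' / 2" by (auto simp: eventually_sequentially)
  have small: "ldst \<eta> (W t) (V k t) < e / 3" if "ldst \<eta> (W t) (V k t) powr (1 - m) < E'" for t
  proof (rule ccontr)
   assume "\<not> ?thesis"
   hence "(e / 3) powr (1 - m) \<le> ldst \<eta> (W t) (V k t) powr (1 - m)"
    using e3 m_less1 by (intro powr_mono2) auto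
   thus False using that by (simp add: E'_def)
  qed
  \<comment> \<open>B * d \<le> E' / 2 accounts for one half of E'; the choice of k has taken care
    of the other half.\<close>
  define d where "d = E' / 2 / (B + 1)"
  have d: "d > 0" unfolding d_def using E' B by (intro divide_pos_pos) auto
  have ev1: "eventually (\<lambda>t. ldst \<eta> (V k t) (V k s) < e / 3) (at s within {0..})"
   using e3 by (intro order_tendstoD(2)[OF sol_cont[OF V c s]])
  have ev2: "eventually (\<lambda>t. 0 \<le> t \<and> \<bar>t - s\<bar> < d) (at s within {0..})"
   unfolding eventually_at using d by (auto simp: dist_real_def)
  show "\<forall>\<^sub>F t in at s within {0..}. dist (ldst \<eta> (W t) (W s)) 0 < e"
   using ev1 ev2
  proof eventually_elim
   case (elim t)
   hence t: "t \<ge> 0" "\<bar>t - s\<bar> < d" by auto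
   have "B * \<bar>t - s\<bar> \<le> (B + 1) * \<bar>t - s\<bar>" by (intro mult_right_mono) auto
   also have "\<dots> \<le> (B + 1) * d" using t B by (intro mult_left_mono) auto
   also have "\<dots> = E' / 2"
   proof -
    have "B + 1 \<noteq> 0" using B(1) by linarith
    from iffD1[OF nonzero_eq_divide_eq[OF this] d_def] show ?thesis by (simp only: mult.commute)
   qed
   finally have "ldst \<eta> (W t) (V k t) powr (1 - m) < E'"
    using B(2)[OF s t(1), of k] k by linarith
   hence 1: "ldst \<eta> (W t) (V k t) < e / 3" by (rule small)
   have 2: "ldst \<eta> (W s) (V k s) < e / 3" using k E' by (intro small) linarith
   have "ldst \<eta> (W t) (W s) \<le> ldst \<eta> (W t) (V k t) + ldst \<eta> (V k t) (W s)"
    by (intro lnrm_tri[OF c] Wl sol_loc[OF V] t s)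
   also have "ldst \<eta> (V k t) (W s) \<le> ldst \<eta> (V k t) (V k s) + ldst \<eta> (V k s) (W s)"
    by (intro lnrm_tri[OF c] Wl sol_loc[OF V] t s)
   finally have "ldst \<eta> (W t) (W s) < e" using 1 2 elim(1) lnrm_sym[of \<eta> "V k s" "W s"] by linarith
   thus ?case using lnrm_nonneg[OF c, of "\<lambda>x. W t x - W s x"] by simp
  qed
 qed
 have Wweak: "((\<lambda>\<tau>. sip (W \<tau>) L) has_integral (ip (W t) \<eta>) - ip (W 0) \<eta>) {0..t}"
  if tp: "tp \<eta> L" and t: "t \<ge> 0" for \<eta> L t
 proof -
  obtain \<kappa> L0 C0 C where c: "cut \<kappa> L0 C0" "C \<ge> 0" "\<And>x. \<bar>L x\<bar> \<le> C * \<kappa> x powr m" "\<And>x. \<bar>\<eta> x\<bar> \<le> C * \<kappa> x"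
   using tp_cut[OF tp] by blast
  have Lb: "L \<in> bfs M" using tp by (auto simp: tp_def dest: wl_bfs)
  obtain B where B: "B \<ge> 0" "\<And>u v. loc u ==> loc v ==>
    \<bar>sip u L - sip v L\<bar> \<le> B * ldst \<kappa> u v powr m"
   using phi_holder[OF c(1) Lb c(3,2)] by blast
  obtain A where A: "A \<ge> 0" "\<And>k s t. s \<ge> 0 ==> t \<ge> 0 ==> \<bar>ldst \<kappa> (W t) (V k t) powr (1 - m) - ldst \<kappa> (W s) (V k s) powr (1 - m)\<bar> \<le> A * \<bar>t - s\<bar>"
   using hp[OF c(1)] by blast
  have gl: "(\<lambda>k. ip (V k u) \<eta>) \<longlonglongrightarrow> ip (W u) \<eta>" if u: "u \<ge> 0" for u
  proof -
   have "(\<lambda>k. C * ldst \<kappa> (W u) (V k u)) \<longlonglongrightarrow> C * 0" by (intro tendsto_intros Wlim[OF u c(1)])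
   hence z: "(\<lambda>k. C * ldst \<kappa> (W u) (V k u)) \<longlonglongrightarrow> 0" by simp
   have "norm (ip (V k u) \<eta> - ip (W u) \<eta>) \<le> C * ldst \<kappa> (W u) (V k u)" for k
    using tp_pair_le[OF c(1) tp c(4) sol_loc[OF V u] Wl[OF u], of k] lnrm_sym[of \<kappa> "V k u" "W u"] by simp
   hence "(\<lambda>k. (ip (V k u) \<eta>) - ip (W u) \<eta>) \<longlonglongrightarrow> 0"
    by (intro Lim_null_comparison[OF _ z] always_eventually) auto
   thus ?thesis by (simp add: LIM_zero_iff)
  qed
  have Gl: "(\<lambda>k. sip (V k u) L) \<longlonglongrightarrow> sip (W u) L" if u: "u \<ge> 0" for u
  proof -
   have "(\<lambda>k. B * ldst \<kappa> (W u) (V k u) powr m) \<longlonglongrightarrow> B * 0 powr m"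
    using m_pos lnrm_nonneg[OF c(1)] by (intro tendsto_intros tendsto_powr2 Wlim[OF u c(1)]) auto
   hence z: "(\<lambda>k. B * ldst \<kappa> (W u) (V k u) powr m) \<longlonglongrightarrow> 0" by simp
   have "norm (sip (V k u) L - sip (W u) L) \<le> B * ldst \<kappa> (W u) (V k u) powr m" for k
    using B(2)[OF sol_loc[OF V u] Wl[OF u], of k] lnrm_sym[of \<kappa> "V k u" "W u"] by simp
   hence "(\<lambda>k. (sip (V k u) L) - sip (W u) L) \<longlonglongrightarrow> 0"
    by (intro Lim_null_comparison[OF _ z] always_eventually) auto
   thus ?thesis by (simp add: LIM_zero_iff)
  qed
  have "continuous_on {0..t} (\<lambda>t. sip (W t) L)"
   by (rule continuous_on_subset[OF phi_continuous[OF Wl Wcont tp]]) auto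
  hence "compact ((\<lambda>t. sip (W t) L) ` {0..t})" by (intro compact_continuous_image) auto
  hence "bounded ((\<lambda>t. sip (W t) L) ` {0..t})" by (rule compact_imp_bounded)
  then obtain Q where "\<forall>y\<in>(\<lambda>t. sip (W t) L) ` {0..t}. norm y \<le> Q"
   unfolding bounded_iff by blast
  hence Q: "\<bar>\<integral>x. spow (W u x) m * L x \<partial>M\<bar> \<le> Q" if "u \<in> {0..t}" for u using that by simp
  \<comment> \<open>Bounds the weighted norm of W - V k, raised to the power m, for all k and all
    times up to t: by monotonicity k = 0 is the worst case, and the exponent m / (1 - m) turns powr
    (1 - m) into powr m.\<close>
  define R where "R = (ldst \<kappa> (W 0) (V 0 0) powr (1 - m) + A * t) powr (m / (1 - m))"
  have dom: "\<bar>\<integral>x. spow (V k u x) m * L x \<partial>M\<bar> \<le> Q + B * R" if u: "u \<in> {0..t}" for k u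
  proof -
   have u0: "u \<ge> 0" using u by simp
   have "ldst \<kappa> (W u) (V k u) \<le> ldst \<kappa> (W u) (V 0 u)"
    unfolding lnrm_def
   proof (rule integral_mono_AE)
    show "integrable M (\<lambda>x. \<bar>W u x - V k u x\<bar> * \<kappa> x)" "integrable M (\<lambda>x. \<bar>W u x - V 0 u x\<bar> * \<kappa> x)"
     using lnrm_int[OF c(1) loc_diff] Wl sol_loc[OF V] u0 by auto
    show "AE x in M. \<bar>W u x - V k u x\<bar> * \<kappa> x \<le> \<bar>W u x - V 0 u x\<bar> * \<kappa> x"
     using incle[of 0 k, OF le0 u0] le[OF u0, of k]
    proof eventually_elim
     case (elim x)
     show ?case using elim cut_nonneg[OF c(1), of x] by (intro mult_right_mono) auto
    qed
   qed
   hence "ldst \<kappa> (W u) (V k u) powr (1 - m) \<le> ldst \<kappa> (W u) (V 0 u) powr (1 - m)"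
    using m_less1 lnrm_nonneg[OF c(1)] by (intro powr_mono2) auto
   also have "\<dots> \<le> ldst \<kappa> (W 0) (V 0 0) powr (1 - m) + A * t"
    using A(2)[of 0 u 0] mult_left_mono[of u t A] A(1) u by auto
   finally have "(ldst \<kappa> (W u) (V k u) powr (1 - m)) powr (m / (1 - m)) \<le> R"
    unfolding R_def using m_pos m_less1 by (intro powr_mono2) auto
   hence "ldst \<kappa> (W u) (V k u) powr m \<le> R" using m_less1 by (simp add: powr_powr)
   hence "B * ldst \<kappa> (W u) (V k u) powr m \<le> B * R" using B(1) by (intro mult_left_mono)
   thus ?thesis
    using B(2)[OF sol_loc[OF V u0] Wl[OF u0], of k] lnrm_sym[of \<kappa> "V k u" "W u"] Q[OF u] by simp
  qed
  show ?thesis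
  proof (rule has_integral_dominated_convergence[where h = "\<lambda>_. Q + B * R"])
   show "((\<lambda>\<tau>. sip (V k \<tau>) L) has_integral (ip (V k t) \<eta>) - ip (V k 0) \<eta>) {0..t}" for k
    by (rule sol_weak[OF V tp t])
   show "(\<lambda>_. Q + B * R) integrable_on {0..t}" by (rule integrable_const_ivl)
   show "\<forall>u\<in>{0..t}. norm (sip (V k u) L) \<le> Q + B * R" for k using dom by simp
   show "\<forall>u\<in>{0..t}. (\<lambda>k. sip (V k u) L) \<longlonglongrightarrow> sip (W u) L" using Gl by simp
   show "(\<lambda>k. (ip (V k t) \<eta>) - ip (V k 0) \<eta>) \<longlonglongrightarrow> ip (W t) \<eta> - ip (W 0) \<eta>"
    by (intro tendsto_diff gl t order_refl)
  qed
 qed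
 have "sol W" unfolding sol_def using Wl Wcont Wweak unfolding lnrm_def by blast
 thus ?thesis using lim by blast
qed

section \<open>Locally integrable data\<close>

lemma sg_zero: "sg (\<lambda>_. 0) (\<lambda>_ _. 0)"
proof -
 have it0: "nrm (it h (\<lambda>_. 0) n) = 0" if h: "h > 0" for h n
 proof (induction n)
  case (Suc n)
  have "nrm (\<lambda>x. it h (\<lambda>_. 0) (Suc n) x - 0) \<le> nrm (\<lambda>x. it h (\<lambda>_. 0) n x - 0)"
   by (rule res_contraction[OF h it_X[OF h zero_X] zero_X it_res[OF h zero_X] res_0[OF h]])
  thus ?case using Suc nrm_nonneg[of "it h (\<lambda>_. 0) (Suc n)"] by (simp del: it.simps(2) nrm_nonneg)
 qed (simp add: nrm_def)
 show ?thesis unfolding sg_def U_def using it0 by simp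
qed

text \<open>Data of one sign keep the solution on one side of 0, so the Herrero-Pierre estimate
  applies with the zero solution as partner.\<close>

lemma sg_bound:
 assumes c: "cut \<eta> L C" and u0: "loc u0" and t: "t \<ge> 0"
 shows "\<exists>B. \<forall>f V. f \<in> X \<and> sg f V \<and> (AE x in M. \<bar>f x\<bar> \<le> \<bar>u0 x\<bar>) \<and> ((AE x in M. 0 \<le> f x) \<or> (AE x in M. f x \<le> 0)) \<longrightarrow> lnrm \<eta> (V t) \<le> B"
proof -
 obtain B where B: "B \<ge> 0" "\<And>V W s t. sol V ==> sol W ==> (\<forall>t\<ge>0. AE x in M. V t x \<le> W t x) ==> s \<ge> 0 ==> t \<ge> 0 ==>
   \<bar>ldst \<eta> (W t) (V t) powr (1 - m) - ldst \<eta> (W s) (V s) powr (1 - m)\<bar> \<le> B * \<bar>t - s\<bar>"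
  by (rule herrero_pierre[OF c]) (rule that)
 define Q where "Q = (lnrm \<eta> u0 powr (1 - m) + B * t) powr (1 / (1 - m))"
 have "lnrm \<eta> (V t) \<le> Q" if f: "f \<in> X" and V: "sg f V" and le: "AE x in M. \<bar>f x\<bar> \<le> \<bar>u0 x\<bar>"
  and sgn: "(AE x in M. 0 \<le> f x) \<or> (AE x in M. f x \<le> 0)" for f V
 proof -
  have "\<bar>lnrm \<eta> (V t) powr (1 - m) - lnrm \<eta> (V 0) powr (1 - m)\<bar> \<le> B * \<bar>t - 0\<bar>"
   using sgn
  proof
   assume "AE x in M. 0 \<le> f x"
   hence "\<forall>t\<ge>0. AE x in M. 0 \<le> V t x" using sg_mono[OF zero_X f sg_zero V] by blast
   from B(2)[OF sol_zero sg_sol[OF f V] this order_refl t] show ?thesis by simp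
  next
   assume "AE x in M. f x \<le> 0"
   hence "\<forall>t\<ge>0. AE x in M. V t x \<le> 0" using sg_mono[OF f zero_X V sg_zero] by blast
   from B(2)[OF sg_sol[OF f V] sol_zero this order_refl t] show ?thesis by (simp add: lnrm_def)
  qed
  moreover have "lnrm \<eta> (V 0) \<le> lnrm \<eta> u0"
   unfolding lnrm_def
  proof (rule integral_mono_AE)
   show "integrable M (\<lambda>x. \<bar>V 0 x\<bar> * \<eta> x)" "integrable M (\<lambda>x. \<bar>u0 x\<bar> * \<eta> x)"
    using lnrm_int[OF c] sol_loc[OF sg_sol[OF f V]] u0 by auto
   show "AE x in M. \<bar>V 0 x\<bar> * \<eta> x \<le> \<bar>u0 x\<bar> * \<eta> x"
    using sg_initial[OF f V] le
   proof eventually_elim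
    case (elim x) thus ?case using cut_nonneg[OF c, of x] by (intro mult_right_mono) auto
   qed
  qed
  hence "lnrm \<eta> (V 0) powr (1 - m) \<le> lnrm \<eta> u0 powr (1 - m)"
   using m_less1 lnrm_nonneg[OF c] by (intro powr_mono2) auto
  ultimately have "lnrm \<eta> (V t) powr (1 - m) \<le> lnrm \<eta> u0 powr (1 - m) + B * t" using t by (simp add: abs_le_iff)
  hence "(lnrm \<eta> (V t) powr (1 - m)) powr (1 / (1 - m)) \<le> Q"
   unfolding Q_def using m_less1 by (intro powr_mono2) auto
  thus ?thesis using m_less1 lnrm_nonneg[OF c] by (simp add: powr_powr)
 qed
 thus ?thesis by blast
qed

text \<open>p k and q l truncate the positive and the negative part of u0. V k l lies between the
  solutions from - q l and from p k, which \<open>sg_bound\<close> controls; k is sent to infinity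
  first, then l.\<close>

theorem sol_exists:
 assumes u0: "loc u0"
 shows "\<exists>V. sol V \<and> (AE x in M. V 0 x = u0 x)"
proof -
 obtain K where K: "\<And>n::nat. compact (K n :: 'a set)" "incseq K" "(\<Union>n. K n) = UNIV" using exhaustion by blast
 have [measurable]: "K n \<in> sets M" "u0 \<in> borel_measurable M" for n
  using K(1) sets_M loc_meas[OF u0] by (auto simp: borel_closed compact_imp_closed)
 define p where "p k x = indicator (K k) x * min (max (u0 x) 0) (real k)" for k x
 define q where "q k x = indicator (K k) x * min (max (- u0 x) 0) (real k)" for k x
 have pq: "0 \<le> p k x" "0 \<le> q k x" "p k x \<le> max (u0 x) 0" "q k x \<le> max (- u0 x) 0" for k x
  by (auto simp: p_def q_def indicator_def)
 have inc: "p k x \<le> p (Suc k) x" "q k x \<le> q (Suc k) x" for k x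
  using incseqD[OF K(2), of k "Suc k"] by (auto simp: p_def q_def indicator_def)
 have pX: "p k \<in> X" "q k \<in> X" for k
 proof -
  have [measurable]: "p k \<in> borel_measurable M" "q k \<in> borel_measurable M" unfolding p_def[abs_def] q_def[abs_def] by measurable
  have "\<bar>p k x\<bar> \<le> real k" "\<bar>q k x\<bar> \<le> real k" for x by (auto simp: p_def q_def indicator_def)
  moreover have "p k x = 0" "q k x = 0" if "x \<notin> K k" for x using that by (auto simp: p_def q_def)
  ultimately have "p k \<in> bfs M" "q k \<in> bfs M"
   unfolding bfs_def using compact_finite_measure[OF K(1)[of k]] by (auto intro!: exI[of _ "real k"] bexI[of _ "K k"])
  thus "p k \<in> X" "q k \<in> X" by (auto intro: bfs_X)
 qed
 have plim: "(\<lambda>k. p k x) \<longlonglongrightarrow> max (u0 x) 0" "(\<lambda>k. q k x) \<longlonglongrightarrow> max (- u0 x) 0" for x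
 proof -
  obtain i where i: "x \<in> K i" using K(3) by blast
  obtain j where j: "\<bar>u0 x\<bar> \<le> real j" using real_arch_simple by blast
  have "\<forall>\<^sub>F n in sequentially. p n x = max (u0 x) 0 \<and> q n x = max (- u0 x) 0"
   using eventually_ge_at_top[of "max i j"]
  proof eventually_elim
   case (elim n)
   hence "x \<in> K n" using i incseqD[OF K(2), of i n] by auto
   moreover have "\<bar>u0 x\<bar> \<le> real n" using j elim by (meson max.boundedE of_nat_mono order_trans)
   ultimately show ?case by (auto simp: p_def q_def)
  qed
  thus "(\<lambda>k. p k x) \<longlonglongrightarrow> max (u0 x) 0" "(\<lambda>k. q k x) \<longlonglongrightarrow> max (- u0 x) 0"
   by (auto intro!: tendsto_eventually elim: eventually_mono)
 qed
 define dat where "dat k l x = p k x - q l x" for k l x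
 have dX: "dat k l \<in> X" for k l unfolding dat_def[abs_def] by (intro X_diff pX)
 have nX: "(\<lambda>x. - q l x) \<in> X" for l using X_cmult[OF pX(2), of "-1" l] by simp
 obtain S where S: "\<And>f. f \<in> X ==> sg f (S f)" using sg_exists by metis
 define V where "V k l = S (dat k l)" for k l
 have Vs: "sg (dat k l) (V k l)" for k l unfolding V_def by (rule S[OF dX])
 have Vsol: "sol (V k l)" for k l by (rule sg_sol[OF dX Vs])
 have up: "AE x in M. V k l t x \<le> S (p k) t x" if "t \<ge> 0" for k l t
  by (rule sg_mono[OF dX pX(1) Vs S[OF pX(1)] _ that]) (use pq in \<open>auto simp: dat_def\<close>)
 have low: "AE x in M. S (\<lambda>x. - q l x) t x \<le> V k l t x" if "t \<ge> 0" for k l t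
  by (rule sg_mono[OF nX dX S[OF nX] Vs _ that]) (use pq in \<open>auto simp: dat_def\<close>)
 have incV: "AE x in M. V k l t x \<le> V (Suc k) l t x" if "t \<ge> 0" for k l t
  by (rule sg_mono[OF dX dX Vs Vs _ that]) (use inc in \<open>auto simp: dat_def\<close>)
 have decV: "AE x in M. V k (Suc l) t x \<le> V k l t x" if "t \<ge> 0" for k l t
  by (rule sg_mono[OF dX dX Vs Vs _ that]) (use inc in \<open>auto simp: dat_def\<close>)
 have bound: "\<exists>B. \<forall>k l. lnrm \<eta> (V k l t) \<le> B" if c: "cut \<eta> L C" and t: "t \<ge> 0" for \<eta> L C t
 proof -
  obtain B where B: "\<And>f V. f \<in> X ==> sg f V ==> (AE x in M. \<bar>f x\<bar> \<le> \<bar>u0 x\<bar>) ==>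
    (AE x in M. 0 \<le> f x) \<or> (AE x in M. f x \<le> 0) ==> lnrm \<eta> (V t) \<le> B"
   using sg_bound[OF c u0 t] by blast
  have a: "\<bar>p k x\<bar> \<le> \<bar>u0 x\<bar>" "\<bar>- q k x\<bar> \<le> \<bar>u0 x\<bar>" for k x using pq[of k x] by auto
  have b1: "lnrm \<eta> (S (p k) t) \<le> B" for k by (rule B[OF pX(1) S[OF pX(1)]]) (use a pq in auto)
  have b2: "lnrm \<eta> (S (\<lambda>x. - q l x) t) \<le> B" for l by (rule B[OF nX S[OF nX]]) (use a pq in auto)
  have "lnrm \<eta> (V k l t) \<le> B + B" for k l
  proof -
   have I: "integrable M (\<lambda>x. \<bar>S (p k) t x\<bar> * \<eta> x)" "integrable M (\<lambda>x. \<bar>S (\<lambda>x. - q l x) t x\<bar> * \<eta> x)"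
    "integrable M (\<lambda>x. \<bar>V k l t x\<bar> * \<eta> x)"
    using lnrm_int[OF c] sol_loc[OF sg_sol[OF pX(1) S[OF pX(1)]] t] sol_loc[OF sg_sol[OF nX S[OF nX]] t] sol_loc[OF Vsol t] by auto
   have "lnrm \<eta> (V k l t) \<le> (LINT x|M. \<bar>S (p k) t x\<bar> * \<eta> x + \<bar>S (\<lambda>x. - q l x) t x\<bar> * \<eta> x)"
    unfolding lnrm_def
   proof (rule integral_mono_AE)
    show "AE x in M. \<bar>V k l t x\<bar> * \<eta> x \<le> \<bar>S (p k) t x\<bar> * \<eta> x + \<bar>S (\<lambda>x. - q l x) t x\<bar> * \<eta> x"
     using up[OF t, of k l] low[OF t, of l k]
    proof eventually_elim
     case (elim x)
     have "\<bar>V k l t x\<bar> \<le> \<bar>S (p k) t x\<bar> + \<bar>S (\<lambda>x. - q l x) t x\<bar>" using elim by linarith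
     thus ?case unfolding distrib_right[symmetric] using cut_nonneg[OF c, of x] by (intro mult_right_mono)
    qed
   qed (use I in auto)
   also have "\<dots> = lnrm \<eta> (S (p k) t) + lnrm \<eta> (S (\<lambda>x. - q l x) t)" unfolding lnrm_def using I by simp
   finally show ?thesis using b1[of k] b2[of l] by linarith
  qed
  thus ?thesis by blast
 qed
 have "\<exists>W. sol W \<and> (\<forall>t\<ge>0. AE x in M. (\<lambda>k. V k l t x) \<longlonglongrightarrow> W t x)" for l
  by (rule sol_monotone_limit[of "\<lambda>k. V k l", OF Vsol incV]) (use bound in blast)+
 then obtain W where W: "\<And>l. sol (W l)" "\<And>l t. t \<ge> 0 ==> AE x in M. (\<lambda>k. V k l t x) \<longlonglongrightarrow> W l t x" by metis
 have decW: "AE x in M. - W l t x \<le> - W (Suc l) t x" if t: "t \<ge> 0" for l t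
 proof -
  have "AE x in M. \<forall>k. V k (Suc l) t x \<le> V k l t x" using decV[OF t] by (simp add: AE_all_countable)
  thus ?thesis using W(2)[OF t, of l] W(2)[OF t, of "Suc l"]
  proof eventually_elim
   case (elim x)
   have "W (Suc l) t x \<le> W l t x" by (rule LIMSEQ_le[OF elim(3,2)]) (use elim(1) in auto)
   thus ?case by simp
  qed
 qed
 have bdW: "\<exists>B. \<forall>l. lnrm \<eta> (\<lambda>x. - W l t x) \<le> B" if c: "cut \<eta> L C" and t: "t \<ge> 0" for \<eta> L C t
 proof -
  obtain B where B: "\<And>k l. lnrm \<eta> (V k l t) \<le> B" using bound[OF c t] by blast
  have B0: "B \<ge> 0" using B[of 0 0] lnrm_nonneg[OF c, of "V 0 0 t"] by linarith
  have [measurable]: "\<eta> \<in> borel_measurable M" "V k l t \<in> borel_measurable M" for k l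
   using bfs_meas[OF cut_bfs[OF c]] loc_meas[OF sol_loc[OF Vsol t]] by auto
  have "lnrm \<eta> (W l t) \<le> B" for l
  proof -
   have "ennreal (lnrm \<eta> (W l t)) = nnint M (\<lambda>x. \<bar>W l t x\<bar> * \<eta> x)"
    unfolding lnrm_def using cut_nonneg[OF c]
    by (intro nn_integral_eq_integral[symmetric] lnrm_int[OF c sol_loc[OF W(1) t]]) auto
   also have "\<dots> = (\<integral>\<^sup>+x. liminf (\<lambda>k. ennreal (\<bar>V k l t x\<bar> * \<eta> x)) \<partial>M)"
   proof (intro nn_integral_cong_AE)
    show "AE x in M. ennreal (\<bar>W l t x\<bar> * \<eta> x) = liminf (\<lambda>k. ennreal (\<bar>V k l t x\<bar> * \<eta> x))"
     using W(2)[OF t, of l]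
    proof eventually_elim
     case (elim x)
     have "(\<lambda>k. \<bar>V k l t x\<bar> * \<eta> x) \<longlonglongrightarrow> \<bar>W l t x\<bar> * \<eta> x" by (intro tendsto_intros elim)
     thus ?case by (intro lim_imp_Liminf[symmetric] tendsto_ennrealI) auto
    qed
   qed
   also have "\<dots> \<le> liminf (\<lambda>k. nnint M (\<lambda>x. \<bar>V k l t x\<bar> * \<eta> x))" by (intro nn_integral_liminf) measurable
   also have "\<dots> \<le> ennreal B"
   proof (rule Liminf_le)
    have "nnint M (\<lambda>x. \<bar>V k l t x\<bar> * \<eta> x) = ennreal (lnrm \<eta> (V k l t))" for k
     unfolding lnrm_def using cut_nonneg[OF c] by (intro nn_integral_eq_integral lnrm_int[OF c sol_loc[OF Vsol t]]) auto
    thus "\<forall>\<^sub>F k in sequentially. (nnint M (\<lambda>x. \<bar>V k l t x\<bar> * \<eta> x)) \<le> ennreal B"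
     using B by (intro always_eventually) (auto intro: ennreal_leI)
   qed simp
   finally show ?thesis using B0 by (simp add: ennreal_le_iff)
  qed
  thus ?thesis by (auto simp: lnrm_def)
 qed
 \<comment> \<open>The W l decrease, so the monotone limit is taken of their negatives;
   \<open>sol_minus\<close> restores the sign at the end.\<close>
 have "\<exists>Z. sol Z \<and> (\<forall>t\<ge>0. AE x in M. (\<lambda>l. - W l t x) \<longlonglongrightarrow> Z t x)"
  by (rule sol_monotone_limit[of "\<lambda>l t x. - W l t x", OF sol_minus[OF W(1)] decW]) (use bdW in blast)+
 then obtain Z where Z: "sol Z" "\<And>t. t \<ge> 0 ==> AE x in M. (\<lambda>l. - W l t x) \<longlonglongrightarrow> Z t x" by blast
 have "AE x in M. - Z 0 x = u0 x"
 proof -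
  have "AE x in M. \<forall>k l. V k l 0 x = dat k l x" using sg_initial[OF dX Vs] by (simp add: AE_all_countable)
  moreover have "AE x in M. \<forall>l. (\<lambda>k. V k l 0 x) \<longlonglongrightarrow> W l 0 x" using W(2)[of 0] by (simp add: AE_all_countable)
  ultimately show ?thesis using Z(2)[OF order_refl]
  proof eventually_elim
   case (elim x)
   have "W l 0 x = max (u0 x) 0 - q l x" for l
   proof -
    have "(\<lambda>k. V k l 0 x) \<longlonglongrightarrow> max (u0 x) 0 - q l x"
     using elim(1) unfolding dat_def by (auto intro!: tendsto_intros plim)
    thus ?thesis using elim(2) LIMSEQ_unique by blast
   qed
   hence "(\<lambda>l. - (max (u0 x) 0 - q l x)) \<longlonglongrightarrow> Z 0 x" using elim(3) by simp
   moreover have "(\<lambda>l. - (max (u0 x) 0 - q l x)) \<longlonglongrightarrow> - (max (u0 x) 0 - max (- u0 x) 0)"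
    by (intro tendsto_intros plim)
   ultimately have "Z 0 x = - (max (u0 x) 0 - max (- u0 x) 0)" by (rule LIMSEQ_unique)
   thus ?case by auto
  qed
 qed
 thus ?thesis using sol_minus[OF Z(1)] by blast
qed

section \<open>A jointly measurable version\<close>

lemma lnrm_diff_le:
 assumes c: "cut \<eta> L C" and u: "loc u" "loc v" "loc w"
 shows "\<bar>ldst \<eta> u w - ldst \<eta> v w\<bar> \<le> ldst \<eta> u v"
 using lnrm_tri[OF c u(1,2,3)] lnrm_tri[OF c u(2,1,3)] lnrm_sym[of \<eta> u v] by (simp add: abs_le_iff)

text \<open>Compactness of {0..T}: pairs of times that violate uniformity would have a common limit
  l, where continuity fails.\<close>

lemma sol_uniformly_continuous:
 assumes V: "sol V" and c: "cut \<eta> L C" and e: "e > 0"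
 shows "\<exists>d>0. \<forall>s t. 0 \<le> s \<and> s \<le> T \<and> 0 \<le> t \<and> t \<le> T \<and> \<bar>t - s\<bar> < d \<longrightarrow> ldst \<eta> (V t) (V s) < e"
proof (rule ccontr)
 assume "\<not> ?thesis"
 hence "\<forall>k::nat. \<exists>s t. 0 \<le> s \<and> s \<le> T \<and> 0 \<le> t \<and> t \<le> T \<and> \<bar>t - s\<bar> < 1 / real (Suc k) \<and> \<not> ldst \<eta> (V t) (V s) < e"
  by (metis of_nat_0_less_iff zero_less_Suc zero_less_divide_1_iff)
 then obtain s t where st: "\<And>k::nat. 0 \<le> s k" "\<And>k. s k \<le> T" "\<And>k. 0 \<le> t k" "\<And>k. t k \<le> T"
   "\<And>k. \<bar>t k - s k\<bar> < 1 / real (Suc k)" "\<And>k. \<not> ldst \<eta> (V (t k)) (V (s k)) < e"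
  by metis
 have "seq_compact {0..T}" by (intro compact_imp_seq_compact) simp
 moreover have "\<forall>k. s k \<in> {0..T}" using st by simp
 ultimately obtain l r where lr: "l \<in> {0..T}" "strict_mono r" "(s \<circ> r) \<longlonglongrightarrow> l" unfolding seq_compact_def by blast
 have l0: "l \<ge> 0" using lr by simp
 have "(\<lambda>k. t (r k) - s (r k)) \<longlonglongrightarrow> 0"
 proof (rule Lim_null_comparison)
  show "\<forall>\<^sub>F k in sequentially. norm (t (r k) - s (r k)) \<le> 1 / real (Suc k)"
  proof (intro always_eventually allI)
   fix k
   have "k \<le> r k" using lr(2) by (rule seq_suble)
   hence "1 / real (Suc (r k)) \<le> 1 / real (Suc k)" by (simp add: frac_le)
   thus "norm (t (r k) - s (r k)) \<le> 1 / real (Suc k)" using st(5)[of "r k"] by simp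
  qed
  show "(\<lambda>k. 1 / real (Suc k)) \<longlonglongrightarrow> 0" using LIMSEQ_inverse_real_of_nat by (simp add: inverse_eq_divide)
 qed
 from tendsto_add[OF this lr(3)] have tl: "(\<lambda>k. t (r k)) \<longlonglongrightarrow> l" by (simp add: o_def)
 have sl: "(\<lambda>k. s (r k)) \<longlonglongrightarrow> l" using lr(3) by (simp add: o_def)
 have lim: "(\<lambda>k. ldst \<eta> (V (y k)) (V l)) \<longlonglongrightarrow> 0" if y: "y \<longlonglongrightarrow> l" "\<And>k. y k \<ge> 0" for y
 proof -
  have "continuous (at l within {0..}) (\<lambda>t. ldst \<eta> (V t) (V l))"
   using sol_cont[OF V c l0] by (simp add: continuous_within lnrm_def)
  hence "(\<lambda>k. ldst \<eta> (V (y k)) (V l)) \<longlonglongrightarrow> ldst \<eta> (V l) (V l)"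
   using y unfolding continuous_within_sequentially by (auto simp: o_def)
  thus ?thesis by (simp add: lnrm_def)
 qed
 have "(\<lambda>k. ldst \<eta> (V (t (r k))) (V l) + ldst \<eta> (V (s (r k))) (V l)) \<longlonglongrightarrow> 0 + 0"
  by (intro tendsto_add lim tl sl st)
 hence "(\<lambda>k. ldst \<eta> (V (t (r k))) (V l) + ldst \<eta> (V (s (r k))) (V l)) \<longlonglongrightarrow> 0" by simp
 hence "eventually (\<lambda>k. ldst \<eta> (V (t (r k))) (V l) + ldst \<eta> (V (s (r k))) (V l) < e) sequentially"
  using e by (intro order_tendstoD(2))
 then obtain k where k: "ldst \<eta> (V (t (r k))) (V l) + ldst \<eta> (V (s (r k))) (V l) < e"
  by (auto simp: eventually_sequentially)
 have "ldst \<eta> (V (t (r k))) (V (s (r k))) \<le> ldst \<eta> (V (t (r k))) (V l) + ldst \<eta> (V l) (V (s (r k)))"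
  by (intro lnrm_tri[OF c] sol_loc[OF V] st l0)
 thus False using k st(6)[of "r k"] lnrm_sym[of \<eta> "V l" "V (s (r k))"] by linarith
qed

text \<open>A solution is so far one function for each time, and the null sets of different times
  are unrelated. Step functions in time are jointly measurable, and a mesh fine enough for an error
  below (1/2) ^ n makes them converge almost everywhere at each time.\<close>

lemma sol_measurable_version:
 assumes V: "sol V"
 shows "\<exists>u. u \<in> borel_measurable (M \<Otimes>\<^sub>M lborel) \<and> (\<forall>t\<ge>0. AE x in M. u (x, t) = V t x)"
proof -
 obtain K where K: "\<And>n::nat. compact (K n :: 'a set)" "incseq K" "(\<Union>n. K n) = UNIV" using exhaustion by blast
 have "\<exists>\<eta> L C. cut \<eta> L C \<and> (\<forall>x\<in>K n. 1 \<le> \<eta> x)" for n by (rule cut_exists[OF K(1)])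
 then obtain \<eta> L C where c: "\<And>n. cut (\<eta> n) (L n) (C n)" "\<And>n x. x \<in> K n ==> 1 \<le> \<eta> n x" by metis
 have "\<exists>d>0. \<forall>s t. 0 \<le> s \<and> s \<le> real n \<and> 0 \<le> t \<and> t \<le> real n \<and> \<bar>t - s\<bar> < d \<longrightarrow> lnrm (\<eta> n) (\<lambda>x. V t x - V s x) < (1/2) ^ n" for n
  by (rule sol_uniformly_continuous[OF V c(1)]) simp
 then obtain d where d: "\<And>n. d n > 0" "\<And>n s t. 0 \<le> s ==> s \<le> real n ==> 0 \<le> t ==> t \<le> real n ==> \<bar>t - s\<bar> < d n ==> lnrm (\<eta> n) (\<lambda>x. V t x - V s x) < (1/2) ^ n"
  by metis
 define h where "h n = d n / 2" for n
 have h: "h n > 0" "h n < d n" for n using d(1)[of n] by (auto simp: h_def)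
 define g where "g n t = nat \<lfloor>t / h n\<rfloor>" for n t
 have g: "real (g n t) * h n \<le> t" "t < real (g n t) * h n + h n" if "t \<ge> 0" for n t
 proof -
  have "t / h n \<ge> 0" using that h(1)[of n] by simp
  hence "real (g n t) \<le> t / h n" "t / h n < real (g n t) + 1" unfolding g_def by linarith+
  thus "real (g n t) * h n \<le> t" "t < real (g n t) * h n + h n" using h(1)[of n] by (auto simp: field_simps)
 qed
 define un where "un n z = V (real (g n (snd z)) * h n) (fst z)" for n and z :: "'a \<times> real"
 have unm [measurable]: "un n \<in> borel_measurable (M \<Otimes>\<^sub>M lborel)" for n
  unfolding un_def[abs_def]
 proof (rule measurable_compose_countable[where f = "\<lambda>i z. V (real i * h n) (fst z)" and g = "\<lambda>z. g n (snd z)"])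
  show "(\<lambda>z. V (real i * h n) (fst z)) \<in> borel_measurable (M \<Otimes>\<^sub>M lborel)" for i
  proof -
   have [measurable]: "V (real i * h n) \<in> borel_measurable M"
    using loc_meas[OF sol_loc[OF V, of "real i * h n"]] h(1)[of n] by simp
   show ?thesis by measurable
  qed
  show "(\<lambda>z. g n (snd z)) \<in> measurable (M \<Otimes>\<^sub>M lborel) (count_space UNIV)" unfolding g_def by measurable
 qed
 define u where "u z = lim (\<lambda>n. un n z)" for z
 have "u \<in> borel_measurable (M \<Otimes>\<^sub>M lborel)" unfolding u_def[abs_def] by measurable
 moreover have "AE x in M. u (x, t) = V t x" if t: "t \<ge> 0" for t
 proof -
  \<comment> \<open>For n \<ge> N the time t lies in [0, n], where d n controls the error; the sums
    below therefore start at N.\<close>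
  obtain N where N: "t \<le> real N" using real_arch_simple by blast
  have Vl: "loc (V t)" "loc (V (real (g n t) * h n))" for n using sol_loc[OF V] t h(1)[of n] by auto
  have [measurable]: "V t \<in> borel_measurable M" "V (real (g n t) * h n) \<in> borel_measurable M" "\<eta> n \<in> borel_measurable M" for n
   using loc_meas[OF Vl(1)] loc_meas[OF Vl(2)] bfs_meas[OF cut_bfs[OF c(1)]] by auto
  define a where "a n x = \<bar>V t x - V (real (g n t) * h n) x\<bar> * \<eta> n x" for n x
  have am [measurable]: "a n \<in> borel_measurable M" for n unfolding a_def[abs_def] by measurable
  have "(\<integral>\<^sup>+x. (\<Sum>j. ennreal (a (j + N) x)) \<partial>M) = (\<Sum>j. nnint M (\<lambda>x. a (j + N) x))"
   by (intro nn_integral_suminf) measurable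
  also have "\<dots> \<le> (\<Sum>j. ennreal ((1/2)^j))"
  proof (intro suminf_le)
   fix j
   have "nnint M (\<lambda>x. a (j + N) x) = ennreal (lnrm (\<eta> (j + N)) (\<lambda>x. V t x - V (real (g (j + N) t) * h (j + N)) x))"
    unfolding a_def lnrm_def using cut_nonneg[OF c(1)] Vl
    by (intro nn_integral_eq_integral lnrm_int[OF c(1)] loc_diff) auto
   also have "\<dots> \<le> ennreal ((1/2) ^ (j + N))"
   proof (rule ennreal_leI, rule less_imp_le, rule d(2))
    have tn: "t \<le> real (j + N)" using N by simp
    thus "t \<le> real (j + N)" .
    show "0 \<le> t" by (rule t)
    show "real (g (j + N) t) * h (j + N) \<le> real (j + N)" using g(1)[OF t, of "j + N"] tn by linarith
    show "0 \<le> real (g (j + N) t) * h (j + N)" using h(1)[of "j + N"] by simp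
    show "\<bar>t - real (g (j + N) t) * h (j + N)\<bar> < d (j + N)"
     using g[OF t, of "j + N"] h(2)[of "j + N"] by linarith
   qed
   also have "\<dots> \<le> ennreal ((1/2) ^ j)" by (intro ennreal_leI power_decreasing) auto
   finally show "nnint M (\<lambda>x. a (j + N) x) \<le> ennreal ((1/2)^j)" .
  qed auto
  also have "\<dots> < \<infinity>" by (simp add: summable_geometric suminf_ennreal2)
  finally have "(\<integral>\<^sup>+x. (\<Sum>j. ennreal (a (j + N) x)) \<partial>M) \<noteq> \<infinity>" by simp
  hence "AE x in M. (\<Sum>j. ennreal (a (j + N) x)) \<noteq> \<infinity>"
   by (intro nn_integral_noteq_infinite) auto
  thus ?thesis
  proof eventually_elim
   case (elim x)
   have a0: "0 \<le> a n x" for n unfolding a_def using cut_nonneg[OF c(1)] by simp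
   have "summable (\<lambda>j. a (j + N) x)" using elim a0 by (intro summable_suminf_not_top) auto
   hence "(\<lambda>j. a (j + N) x) \<longlonglongrightarrow> 0" by (rule summable_LIMSEQ_zero)
   hence al: "(\<lambda>n. a n x) \<longlonglongrightarrow> 0" by (rule LIMSEQ_offset)
   obtain i where i: "x \<in> K i" using K(3) by blast
   have "(\<lambda>n. V t x - un n (x, t)) \<longlonglongrightarrow> 0"
   proof (rule Lim_null_comparison[OF _ al])
    show "\<forall>\<^sub>F n in sequentially. norm (V t x - un n (x, t)) \<le> a n x"
     using eventually_ge_at_top[of i]
    proof eventually_elim
     case (elim n)
     hence "x \<in> K n" using i incseqD[OF K(2), of i n] by auto
     hence "1 \<le> \<eta> n x" by (rule c(2))
     thus ?case using mult_left_mono[of 1 "\<eta> n x" "\<bar>V t x - un n (x, t)\<bar>"] by (simp add: a_def un_def)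
    qed
   qed
   hence "(\<lambda>n. V t x - (V t x - un n (x, t))) \<longlonglongrightarrow> V t x - 0" by (intro tendsto_intros)
   hence "(\<lambda>n. un n (x, t)) \<longlonglongrightarrow> V t x" by simp
   thus ?case unfolding u_def by (rule limI)
  qed
 qed
 ultimately show ?thesis by blast
qed

text \<open>Changing the functions on a null set at each time changes none of the integrals in
  \<open>sol\<close>.\<close>

lemma sol_cong:
 assumes V: "sol V" and m: "\<And>t. t \<ge> 0 ==> W t \<in> borel_measurable M" and eq: "\<And>t. t \<ge> 0 ==> AE x in M. W t x = V t x"
 shows "sol W"
proof -
 have [measurable]: "V t \<in> borel_measurable M" "W t \<in> borel_measurable M" if "t \<ge> 0" for t
  using loc_meas[OF sol_loc[OF V that]] m[OF that] by auto
 have 1: "loc (W t)" if t: "t \<ge> 0" for t unfolding loc_def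
 proof (intro conjI allI impI m[OF t])
  fix K :: "'a set" assume K: "compact K"
  hence [measurable]: "K \<in> sets M" using sets_M by (simp add: borel_closed compact_imp_closed)
  note [measurable] = m[OF t] loc_meas[OF sol_loc[OF V t]]
  have "integrable M (\<lambda>x. indicator K x * V t x)" by (rule loc_ind[OF sol_loc[OF V t] K])
  moreover have "integrable M (\<lambda>x. indicator K x * W t x) \<longleftrightarrow> integrable M (\<lambda>x. indicator K x * V t x)"
   using eq[OF t] by (intro integrable_cong_AE) (measurable, auto elim: eventually_mono)
  ultimately show "integrable M (\<lambda>x. indicator K x * W t x)" by simp
 qed
 have 2: "(LINT x|M. \<bar>W t x - W s x\<bar> * \<eta> x) = (LINT x|M. \<bar>V t x - V s x\<bar> * \<eta> x)"
  if "t \<ge> 0" "s \<ge> 0" "\<eta> \<in> borel_measurable M" for t s \<eta>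
 proof (rule integral_cong_AE)
  note [measurable] = m[OF that(1)] m[OF that(2)] loc_meas[OF sol_loc[OF V that(1)]] loc_meas[OF sol_loc[OF V that(2)]] that(3)
  show "(\<lambda>x. \<bar>W t x - W s x\<bar> * \<eta> x) \<in> borel_measurable M" "(\<lambda>x. \<bar>V t x - V s x\<bar> * \<eta> x) \<in> borel_measurable M" by measurable
  show "AE x in M. \<bar>W t x - W s x\<bar> * \<eta> x = \<bar>V t x - V s x\<bar> * \<eta> x"
   using eq[OF that(1)] eq[OF that(2)] by eventually_elim simp
 qed
 have 3: "(LINT x|M. F (W t x) * \<eta> x) = (LINT x|M. F (V t x) * \<eta> x)"
  if "t \<ge> 0" "\<eta> \<in> borel_measurable M" and F: "F \<in> borel_measurable borel" for t \<eta> and F :: "real \<Rightarrow> real"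
 proof (rule integral_cong_AE)
  note [measurable] = m[OF that(1)] loc_meas[OF sol_loc[OF V that(1)]] that(2) F
  show "(\<lambda>x. F (W t x) * \<eta> x) \<in> borel_measurable M" "(\<lambda>x. F (V t x) * \<eta> x) \<in> borel_measurable M" by measurable
  show "AE x in M. F (W t x) * \<eta> x = F (V t x) * \<eta> x" using eq[OF that(1)] by eventually_elim simp
 qed
 show ?thesis unfolding sol_def
 proof (intro conjI allI impI 1)
  fix \<eta> L C and s :: real assume c: "cut \<eta> L C" and s: "s \<ge> 0"
  have "eventually (\<lambda>t. (LINT x|M. \<bar>V t x - V s x\<bar> * \<eta> x) = (LINT x|M. \<bar>W t x - W s x\<bar> * \<eta> x)) (at s within {0..})"
   unfolding eventually_at_filter using 2[OF _ s bfs_meas[OF cut_bfs[OF c]]] by (auto intro!: always_eventually)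
  thus "((\<lambda>t. LINT x|M. \<bar>W t x - W s x\<bar> * \<eta> x) \<longlongrightarrow> 0) (at s within {0..})"
   using sol_cont[OF V c s] unfolding lnrm_def by (rule Lim_transform_eventually[rotated])
 next
  fix \<eta> L and t :: real assume tp: "tp \<eta> L" and t: "t \<ge> 0"
  have m\<eta>: "\<eta> \<in> borel_measurable M" "L \<in> borel_measurable M"
   using tp bfs_meas[OF D_bfs[OF wl_D]] bfs_meas[OF wl_bfs] unfolding tp_def by blast+
  have e: "ip (W s) \<eta> = ip (V s) \<eta>" if "s \<ge> 0" for s using 3[OF that m\<eta>(1), of "\<lambda>x. x"] by simp
  show "((\<lambda>\<tau>. sip (W \<tau>) L) has_integral (ip (W t) \<eta>) - ip (W 0) \<eta>) {0..t}"
   unfolding e[OF t] e[OF order_refl]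
   by (rule has_integral_eq[OF _ sol_weak[OF V tp t]])
     (use 3[OF _ m\<eta>(2) borel_measurable_spow] in simp)
 qed
qed

section \<open>Space-time test functions\<close>

abbreviation "MT \<equiv> M \<Otimes>\<^sub>M (lborel :: real measure)"

text \<open>Z is the time derivative of \<zeta> and L its Laplacian at fixed time. The support stays
  above a > 0, so initial values do not enter.\<close>

definition stt :: "('a \<times> real \<Rightarrow> real) \<Rightarrow> ('a \<times> real \<Rightarrow> real) \<Rightarrow> ('a \<times> real \<Rightarrow> real) \<Rightarrow> bool" where
 "stt \<zeta> Z L \<longleftrightarrow> (\<forall>t. tp (\<lambda>x. \<zeta> (x, t)) (\<lambda>x. L (x, t))) \<and>
   (\<forall>x t. ((\<lambda>s. \<zeta> (x, s)) has_real_derivative Z (x, t)) (at t)) \<and>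
   continuous_on UNIV Z \<and> continuous_on UNIV L \<and>
   (\<exists>K a b. compact K \<and> 0 < a \<and> a \<le> b \<and> (\<forall>x t. (x, t) \<notin> K \<times> {a..b} \<longrightarrow> \<zeta> (x, t) = 0 \<and> Z (x, t) = 0 \<and> L (x, t) = 0))"

lemma sigma_finite_M: "sigma_finite_measure M"
proof
 obtain K where K: "\<And>n::nat. compact (K n :: 'a set)" "(\<Union>n. K n) = UNIV" using exhaustion by blast
 show "\<exists>A. countable A \<and> A \<subseteq> sets M \<and> \<Union>A = space M \<and> (\<forall>a\<in>A. emeasure M a \<noteq> \<infinity>)"
  using K compact_finite_measure[OF K(1)] sets_M
  by (intro exI[of _ "range K"]) (auto simp: borel_closed compact_imp_closed less_top[symmetric])
qed

lemma sets_prod: "sets MT = sets borel"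
proof -
 have "sets MT = sets (borel \<Otimes>\<^sub>M (borel :: real measure))"
  by (rule sets_pair_measure_cong[OF sets_M sets_lborel])
 also have "borel \<Otimes>\<^sub>M (borel :: real measure) = (borel :: ('a \<times> real) measure)" by (rule borel_prod)
 finally show ?thesis .
qed

lemma compact_bounded_continuous:
 assumes f: "continuous_on UNIV f" and K: "compact K" and z: "\<And>x. x \<notin> K ==> f x = (0::real)"
 shows "\<exists>C>0. \<forall>x. \<bar>f x\<bar> \<le> C"
proof -
 have "bounded (f ` K)" using f K by (intro compact_imp_bounded compact_continuous_image continuous_on_subset[OF f]) auto
 then obtain C where C: "\<forall>y\<in>f ` K. norm y \<le> C" unfolding bounded_iff by blast
 have "\<bar>f x\<bar> \<le> \<bar>C\<bar> + 1" for x using C z[of x] by (cases "x \<in> K") force+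
 thus ?thesis by (intro exI[of _ "\<bar>C\<bar> + 1"]) auto
qed

text \<open>Continuity in time bounds the weighted norm on [0, b], and Tonelli's theorem integrates
  the bound.\<close>

lemma integrable_box:
 assumes u: "u \<in> borel_measurable MT" and s: "sol (\<lambda>t x. u (x, t))" and K: "compact K" and b: "0 \<le> b"
 shows "integrable MT (\<lambda>z. indicator (K \<times> {0..b}) z * u z)"
  and "integrable MT (indicator (K \<times> {0..b}) :: 'a \<times> real \<Rightarrow> real)"
proof -
 interpret sigma_finite_measure M by (rule sigma_finite_M)
 interpret P: pair_sigma_finite M lborel by unfold_locales
 have Km [measurable]: "K \<in> sets M" using K sets_M by (simp add: borel_closed compact_imp_closed)
 have KB: "K \<times> {0..b} \<in> sets MT" by measurable
 note [measurable] = u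
 obtain \<eta> L C where c: "cut \<eta> L C" "\<And>x. x \<in> K ==> 1 \<le> \<eta> x" using cut_exists[OF K] by blast
 obtain B where B: "\<And>t. 0 \<le> t ==> t \<le> b ==> lnrm \<eta> (\<lambda>x. u (x, t)) \<le> B"
 proof -
  have "continuous_on {0..b} (\<lambda>t. lnrm \<eta> (\<lambda>x. u (x, t)))"
   unfolding continuous_on_def
  proof
   fix s' assume s': "s' \<in> {0..b}"
   have z: "loc (\<lambda>x. 0)" by (simp add: loc_def)
   have "((\<lambda>t. lnrm \<eta> (\<lambda>x. u (x, t)) - lnrm \<eta> (\<lambda>x. u (x, s'))) \<longlongrightarrow> 0) (at s' within {0..b})"
   proof (rule Lim_null_comparison)
    show "\<forall>\<^sub>F t in at s' within {0..b}. norm (lnrm \<eta> (\<lambda>x. u (x, t)) - lnrm \<eta> (\<lambda>x. u (x, s'))) \<le> lnrm \<eta> (\<lambda>x. u (x, t) - u (x, s'))"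
     unfolding eventually_at_filter
     using lnrm_diff_le[OF c(1) sol_loc[OF s] sol_loc[OF s, of s'] z] s' by (auto intro!: always_eventually)
    show "((\<lambda>t. lnrm \<eta> (\<lambda>x. u (x, t) - u (x, s'))) \<longlongrightarrow> 0) (at s' within {0..b})"
     by (rule tendsto_within_subset[OF sol_cont[OF s c(1)]]) (use s' in auto)
   qed
   thus "((\<lambda>t. lnrm \<eta> (\<lambda>x. u (x, t))) \<longlongrightarrow> lnrm \<eta> (\<lambda>x. u (x, s'))) (at s' within {0..b})" by (simp add: LIM_zero_iff)
  qed
  hence "bounded ((\<lambda>t. lnrm \<eta> (\<lambda>x. u (x, t))) ` {0..b})" by (intro compact_imp_bounded compact_continuous_image) auto
  then obtain B where "\<forall>y\<in>(\<lambda>t. lnrm \<eta> (\<lambda>x. u (x, t))) ` {0..b}. norm y \<le> B" unfolding bounded_iff by blast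
  thus thesis using that[of B] by force
 qed
 show "integrable MT (\<lambda>z. indicator (K \<times> {0..b}) z * u z)"
 proof (rule integrableI_bounded)
  show "(\<lambda>z. indicator (K \<times> {0..b}) z * u z) \<in> borel_measurable MT" using KB by measurable
  have "(\<integral>\<^sup>+z. ennreal (norm (indicator (K \<times> {0..b}) z * u z)) \<partial>MT)
    = (\<integral>\<^sup>+t. nnint M (\<lambda>x. norm (indicator (K \<times> {0..b}) (x, t) * u (x, t))) \<partial>lborel)"
   using KB by (intro P.nn_integral_snd[symmetric]) measurable
  also have "\<dots> \<le> (\<integral>\<^sup>+t. ennreal B * indicator {0..b} t \<partial>lborel)"
  proof (intro nn_integral_mono)
   fix t :: real
   show "nnint M (\<lambda>x. norm (indicator (K \<times> {0..b}) (x, t) * u (x, t))) \<le> ennreal B * indicator {0..b} t"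
   proof (cases "t \<in> {0..b}")
    case False
    hence "indicat_real (K \<times> {0..b}) (x, t) = 0" for x by auto
    thus ?thesis by simp
   next
    case True
    hence t: "0 \<le> t" "t \<le> b" by auto
    have "nnint M (\<lambda>x. norm (indicator (K \<times> {0..b}) (x, t) * u (x, t))) \<le> nnint M (\<lambda>x. \<bar>u (x, t)\<bar> * \<eta> x)"
    proof (intro nn_integral_mono ennreal_leI)
     fix x show "norm (indicator (K \<times> {0..b}) (x, t) * u (x, t)) \<le> \<bar>u (x, t)\<bar> * \<eta> x"
      using c(2)[of x] cut_nonneg[OF c(1), of x] mult_left_mono[of 1 "\<eta> x" "\<bar>u (x, t)\<bar>"]
      by (auto simp: indicator_def)
    qed
    also have "\<dots> = ennreal (lnrm \<eta> (\<lambda>x. u (x, t)))"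
     unfolding lnrm_def using cut_nonneg[OF c(1)] by (intro nn_integral_eq_integral lnrm_int[OF c(1) sol_loc[OF s t(1)]]) auto
    also have "\<dots> \<le> ennreal B" using B[OF t] by (rule ennreal_leI)
    finally show ?thesis using True by simp
   qed
  qed
  also have "\<dots> = ennreal B * ennreal b" using b by (simp add: nn_integral_cmult)
  also have "\<dots> < \<infinity>" by (simp add: ennreal_mult_less_top)
  finally show "(\<integral>\<^sup>+z. ennreal (norm (indicator (K \<times> {0..b}) z * u z)) \<partial>MT) < \<infinity>" .
 qed
 have "emeasure MT (K \<times> {0..b}) = emeasure M K * emeasure lborel {0..b}"
  by (intro lborel.emeasure_pair_measure_Times) auto
 also have "\<dots> < \<infinity>" using compact_finite_measure[OF K] b by (simp add: ennreal_mult_less_top)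
 finally show "integrable MT (indicator (K \<times> {0..b}) :: 'a \<times> real \<Rightarrow> real)"
  using KB by (simp add: integrable_indicator_iff)
qed

text \<open>A product rule. The difference quotient splits into the pairing of V s with the quotient
  of \<zeta> in time, and the quotient with \<zeta> frozen at t, which \<open>sol_deriv\<close>
  handles.\<close>

lemma spacetime_derivative:
 assumes V: "sol V" and Z: "stt \<zeta> Z L" and t: "t \<ge> 0"
 shows "((\<lambda>s. LINT x|M. V s x * \<zeta> (x, s)) has_real_derivative
   (LINT x|M. V t x * Z (x, t)) + (LINT x|M. spow (V t x) m * L (x, t))) (at t within {0..})"
proof -
 obtain K a b where K: "compact K" "0 < a" "a \<le> b" "\<And>x t. (x, t) \<notin> K \<times> {a..b} ==> \<zeta> (x, t) = 0 \<and> Z (x, t) = 0 \<and> L (x, t) = 0"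
  and tpz: "\<And>t. tp (\<lambda>x. \<zeta> (x, t)) (\<lambda>x. L (x, t))"
  and der: "\<And>x t. ((\<lambda>s. \<zeta> (x, s)) has_real_derivative Z (x, t)) (at t)"
  and Zc: "continuous_on UNIV Z"
  using Z unfolding stt_def by blast
 obtain C where C: "C > 0" "\<And>z. \<bar>Z z\<bar> \<le> C"
  using compact_bounded_continuous[OF Zc compact_Times[OF K(1) compact_Icc, of a b]] K(4) by (metis prod.collapse)
 define q where "q s x = (\<zeta> (x, s) - \<zeta> (x, t)) / (s - t)" for s x
 obtain \<eta> L0 C0 where c: "cut \<eta> L0 C0" "\<And>x. x \<in> K ==> 1 \<le> \<eta> x" using cut_exists[OF K(1)] by blast
 have qC: "\<bar>q s x\<bar> \<le> C * \<eta> x" if "s \<noteq> t" for s x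
 proof (cases "x \<in> K")
  case True
  have "norm (\<zeta> (x, s) - \<zeta> (x, t)) \<le> C * norm (s - t)"
   by (rule field_differentiable_bound[of UNIV _ "\<lambda>s. Z (x, s)"]) (use der C in auto)
  hence "\<bar>q s x\<bar> \<le> C" using that by (simp add: q_def abs_divide divide_le_eq)
  also have "\<dots> \<le> C * \<eta> x" using c(2)[OF True] C(1) by simp
  finally show ?thesis .
 next
  case False
  hence "q s x = 0" using K(4) by (simp add: q_def)
  thus ?thesis using C(1) cut_nonneg[OF c(1), of x] by simp
 qed
 have ZC: "\<bar>Z (x, t)\<bar> \<le> C * \<eta> x" for x
 proof (cases "x \<in> K")
  case True
  have "C \<le> C * \<eta> x" using c(2)[OF True] C(1) by simp
  thus ?thesis using C(2)[of "(x, t)"] by linarith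
 next
  case False
  thus ?thesis using K(4) C(1) cut_nonneg[OF c(1), of x] by simp
 qed
 have \<eta>m [measurable]: "\<eta> \<in> borel_measurable M" by (rule bfs_meas[OF cut_bfs[OF c(1)]])
 have zm [measurable]: "(\<lambda>x. \<zeta> (x, s)) \<in> borel_measurable M" for s
  using tpz[of s] bfs_meas[OF D_bfs[OF wl_D]] unfolding tp_def by blast
 have qm [measurable]: "q s \<in> borel_measurable M" for s unfolding q_def[abs_def] by measurable
 have Zm [measurable]: "(\<lambda>x. Z (x, t)) \<in> borel_measurable M" unfolding borel_M
  by (intro borel_measurable_continuous_onI continuous_on_compose2[OF Zc] continuous_intros) auto
 let ?F = "\<lambda>s. LINT x|M. V s x * \<zeta> (x, s)"
 let ?g = "\<lambda>s. LINT x|M. V s x * \<zeta> (x, t)"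
 let ?G = "LINT x|M. spow (V t x) m * L (x, t)"
 let ?A = "LINT x|M. V t x * Z (x, t)"
 have g: "((\<lambda>s. (?g s - ?g t) / (s - t)) \<longlongrightarrow> ?G) (at t within {0..})"
  using sol_deriv[OF V tpz t, of t] by (simp add: has_field_derivative_iff)
 have A: "((\<lambda>s. ip (V s) (q s)) \<longlongrightarrow> ?A) (at t within {0..})"
  unfolding tendsto_at_iff_sequentially
 proof (intro allI impI)
  fix X assume X: "\<forall>i. X i \<in> {0..} - {t}" "X \<longlonglongrightarrow> t"
  have X0: "X i \<ge> 0" "X i \<noteq> t" for i using X(1) by auto
  have l: "loc (V (X i))" "loc (V t)" for i using sol_loc[OF V] X0 t by auto
  have [measurable]: "V t \<in> borel_measurable M" "V (X i) \<in> borel_measurable M" for i using loc_meas[OF l(2)] loc_meas[OF l(1)] by auto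
  have I: "integrable M (\<lambda>x. v x * q (X i) x)" if "loc v" for v i
  proof (rule Bochner_Integration.integrable_bound)
   show "integrable M (\<lambda>x. C * (\<bar>v x\<bar> * \<eta> x))" using lnrm_int[OF c(1) that] by simp
   show "(\<lambda>x. v x * q (X i) x) \<in> borel_measurable M" using loc_meas[OF that] by measurable
   show "AE x in M. norm (v x * q (X i) x) \<le> norm (C * (\<bar>v x\<bar> * \<eta> x))"
   proof (intro AE_I2)
    fix x
    have "\<bar>v x\<bar> * \<bar>q (X i) x\<bar> \<le> \<bar>v x\<bar> * (C * \<eta> x)" by (intro mult_left_mono qC X0) auto
    thus "norm (v x * q (X i) x) \<le> norm (C * (\<bar>v x\<bar> * \<eta> x))"
     using cut_nonneg[OF c(1), of x] C(1) by (simp add: abs_mult mult_ac)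
   qed
  qed
  have 1: "(\<lambda>i. (ip (V (X i)) (q (X i))) - (ip (V t) (q (X i)))) \<longlonglongrightarrow> 0"
  proof (rule Lim_null_comparison)
   show "\<forall>\<^sub>F i in sequentially. norm ((ip (V (X i)) (q (X i))) - (ip (V t) (q (X i)))) \<le> C * ldst \<eta> (V (X i)) (V t)"
   proof (intro always_eventually allI)
    fix i
    have "(ip (V (X i)) (q (X i))) - (ip (V t) (q (X i))) = (LINT x|M. V (X i) x * q (X i) x - V t x * q (X i) x)"
     using I l by simp
    also have "norm \<dots> \<le> (LINT x|M. \<bar>V (X i) x * q (X i) x - V t x * q (X i) x\<bar>)" using integral_abs_bound by simp
    also have "\<dots> \<le> (LINT x|M. C * (\<bar>V (X i) x - V t x\<bar> * \<eta> x))"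
    proof (rule integral_mono)
     show "integrable M (\<lambda>x. \<bar>V (X i) x * q (X i) x - V t x * q (X i) x\<bar>)" using I l by auto
     show "integrable M (\<lambda>x. C * (\<bar>V (X i) x - V t x\<bar> * \<eta> x))" using lnrm_int[OF c(1) loc_diff[OF l]] by simp
     fix x
     have "\<bar>V (X i) x * q (X i) x - V t x * q (X i) x\<bar> = \<bar>V (X i) x - V t x\<bar> * \<bar>q (X i) x\<bar>" by (simp add: abs_mult left_diff_distrib[symmetric])
     also have "\<dots> \<le> \<bar>V (X i) x - V t x\<bar> * (C * \<eta> x)" by (intro mult_left_mono qC X0) auto
     finally show "\<bar>V (X i) x * q (X i) x - V t x * q (X i) x\<bar> \<le> C * (\<bar>V (X i) x - V t x\<bar> * \<eta> x)" by (simp add: mult_ac)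
    qed
    finally show "norm ((ip (V (X i)) (q (X i))) - (ip (V t) (q (X i)))) \<le> C * ldst \<eta> (V (X i)) (V t)"
     by (simp add: lnrm_def)
   qed
   have "((\<lambda>s. ldst \<eta> (V s) (V t)) \<circ> X) \<longlonglongrightarrow> 0"
    using sol_cont[OF V c(1) t] X unfolding tendsto_at_iff_sequentially by blast
   thus "(\<lambda>i. C * ldst \<eta> (V (X i)) (V t)) \<longlonglongrightarrow> 0" by (simp add: o_def tendsto_mult_right_zero)
  qed
  have 2: "(\<lambda>i. ip (V t) (q (X i))) \<longlonglongrightarrow> ?A"
  proof (rule integral_dominated_convergence[where w = "\<lambda>x. C * (\<bar>V t x\<bar> * \<eta> x)"])
   show "integrable M (\<lambda>x. C * (\<bar>V t x\<bar> * \<eta> x))" using lnrm_int[OF c(1) l(2)] by simp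
   show "AE x in M. (\<lambda>i. V t x * q (X i) x) \<longlonglongrightarrow> V t x * Z (x, t)"
   proof (intro AE_I2 tendsto_mult tendsto_const)
    fix x
    have "((\<lambda>s. q s x) \<longlongrightarrow> Z (x, t)) (at t)" using der[of x t] unfolding has_field_derivative_iff q_def .
    thus "(\<lambda>i. q (X i) x) \<longlonglongrightarrow> Z (x, t)"
     unfolding tendsto_at_iff_sequentially using X by (auto simp: o_def)
   qed
   show "AE x in M. norm (V t x * q (X i) x) \<le> C * (\<bar>V t x\<bar> * \<eta> x)" for i
   proof (intro AE_I2)
    fix x
    have "\<bar>V t x\<bar> * \<bar>q (X i) x\<bar> \<le> \<bar>V t x\<bar> * (C * \<eta> x)" by (intro mult_left_mono qC X0) auto
    thus "norm (V t x * q (X i) x) \<le> C * (\<bar>V t x\<bar> * \<eta> x)" by (simp add: abs_mult mult_ac)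
   qed
  qed measurable
  show "((\<lambda>s. ip (V s) (q s)) \<circ> X) \<longlonglongrightarrow> ?A" using tendsto_add[OF 1 2] by (simp add: o_def)
 qed
 have "((\<lambda>s. (ip (V s) (q s)) + (?g s - ?g t) / (s - t)) \<longlongrightarrow> ?A + ?G) (at t within {0..})"
  by (intro tendsto_add A g)
 moreover have "eventually (\<lambda>s. (ip (V s) (q s)) + (?g s - ?g t) / (s - t) = (?F s - ?F t) / (s - t)) (at t within {0..})"
  unfolding eventually_at_filter
 proof (intro always_eventually allI impI)
  fix s :: real assume s: "s \<noteq> t" "s \<in> {0..}"
  have "ip (V s) (q s) = (LINT x|M. (V s x * \<zeta> (x, s) - V s x * \<zeta> (x, t)) / (s - t))"
   by (simp add: q_def right_diff_distrib)
  also have "\<dots> = (?F s - ?g s) / (s - t)"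
   using tp_int(1)[OF tpz sol_loc[OF V]] s by simp
  finally show "ip (V s) (q s) + (?g s - ?g t) / (s - t) = (?F s - ?F t) / (s - t)"
   by (simp add: add_divide_distrib[symmetric])
 qed
 ultimately have "((\<lambda>s. (?F s - ?F t) / (s - t)) \<longlongrightarrow> ?A + ?G) (at t within {0..})"
  by (rule Lim_transform_eventually)
 thus ?thesis by (simp add: has_field_derivative_iff)
qed

text \<open>After integration over M the integrand is the time derivative of the pairing of u with
  \<zeta>, which vanishes at both ends of [0, b + 1]. Fubini's theorem connects this with the
  product measure.\<close>

lemma spacetime_identity:
 assumes u: "u \<in> borel_measurable MT" and s: "sol (\<lambda>t x. u (x, t))" and Z: "stt \<zeta> Z L"
 shows "(LINT z|MT. u z * Z z) + (LINT z|MT. spow (u z) m * L z) = 0"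
proof -
 interpret sigma_finite_measure M by (rule sigma_finite_M)
 interpret P: pair_sigma_finite M lborel by unfold_locales
 obtain K a b where K: "compact K" "0 < a" "a \<le> b" "\<And>x t. (x, t) \<notin> K \<times> {a..b} ==> \<zeta> (x, t) = 0 \<and> Z (x, t) = 0 \<and> L (x, t) = 0"
  and Zc: "continuous_on UNIV Z" and Lc: "continuous_on UNIV L"
  using Z unfolding stt_def by blast
 have b0: "0 \<le> b" using K by linarith
 let ?B = "K \<times> {0..b}"
 have Km [measurable]: "K \<in> sets M" using K sets_M by (simp add: borel_closed compact_imp_closed)
 have KB [measurable]: "?B \<in> sets MT" by measurable
 have z0: "Z z = 0" "L z = 0" if "z \<notin> ?B" for z using K(4)[of "fst z" "snd z"] K(2) that by (auto simp: mem_Times_iff)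
 note [measurable] = u
 have [measurable]: "Z \<in> borel_measurable MT" "L \<in> borel_measurable MT"
  using borel_measurable_continuous_onI[OF Zc] borel_measurable_continuous_onI[OF Lc] measurable_cong_sets[OF sets_prod refl] by auto
 obtain C where C: "C > 0" "\<And>z. \<bar>Z z\<bar> \<le> C"
  using compact_bounded_continuous[OF Zc compact_Times[OF K(1) compact_Icc, of a b]] K(4) by (metis prod.collapse)
 obtain C' where C': "C' > 0" "\<And>z. \<bar>L z\<bar> \<le> C'"
  using compact_bounded_continuous[OF Lc compact_Times[OF K(1) compact_Icc, of a b]] K(4) by (metis prod.collapse)
 note I = integrable_box[OF u s K(1) b0]
 have I1: "integrable MT (\<lambda>z. u z * Z z)"
 proof (rule Bochner_Integration.integrable_bound)
  show "integrable MT (\<lambda>z. C * (indicator ?B z * u z))" using I(1) by simp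
  show "AE z in MT. norm (u z * Z z) \<le> norm (C * (indicator ?B z * u z))"
  proof (intro AE_I2)
   fix z show "norm (u z * Z z) \<le> norm (C * (indicator ?B z * u z))"
    using z0[of z] mult_right_mono[OF C(2)[of z], of "\<bar>u z\<bar>"] C(1) by (cases "z \<in> ?B") (auto simp: abs_mult mult_ac)
  qed
 qed measurable
 have I2: "integrable MT (\<lambda>z. spow (u z) m * L z)"
 proof (rule Bochner_Integration.integrable_bound)
  show "integrable MT (\<lambda>z. C' * (indicator ?B z + \<bar>indicator ?B z * u z\<bar>))" using I by simp
  show "AE z in MT. norm (spow (u z) m * L z) \<le> norm (C' * (indicator ?B z + \<bar>indicator ?B z * u z\<bar>))"
  proof (intro AE_I2)
   fix z
   have "\<bar>spow (u z) m\<bar> \<le> 1 + \<bar>u z\<bar>" unfolding abs_spow using powr_split_le[of 1 m "u z"] m_pos m_less1 by simp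
   hence "\<bar>spow (u z) m\<bar> * \<bar>L z\<bar> \<le> (1 + \<bar>u z\<bar>) * C'" using C'(2)[of z] by (intro mult_mono) auto
   thus "norm (spow (u z) m * L z) \<le> norm (C' * (indicator ?B z + \<bar>indicator ?B z * u z\<bar>))"
    using z0[of z] C'(1) by (cases "z \<in> ?B") (auto simp: abs_mult mult_ac)
  qed
 qed measurable
 let ?A = "\<lambda>t. LINT x|M. u (x, t) * Z (x, t)"
 let ?G = "\<lambda>t. LINT x|M. spow (u (x, t)) m * L (x, t)"
 have iA: "integrable lborel ?A" "(LBINT t. ?A t) = (LINT z|MT. u z * Z z)"
  using P.integrable_snd[of "\<lambda>x t. u (x, t) * Z (x, t)"] P.integral_snd[of "\<lambda>x t. u (x, t) * Z (x, t)"] I1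
  unfolding split_beta prod.collapse by blast+
 have iG: "integrable lborel ?G" "(LBINT t. ?G t) = (LINT z|MT. spow (u z) m * L z)"
  using P.integrable_snd[of "\<lambda>x t. spow (u (x, t)) m * L (x, t)"] P.integral_snd[of "\<lambda>x t. spow (u (x, t)) m * L (x, t)"] I2
  unfolding split_beta prod.collapse by blast+
 have "((\<lambda>t. ?A t + ?G t) has_integral (LBINT t. ?A t + ?G t)) UNIV"
  using iA(1) iG(1) by (intro has_integral_integral_lborel) auto
 moreover have "((\<lambda>t. ?A t + ?G t) has_integral 0) UNIV"
 proof -
  let ?F = "\<lambda>t. LINT x|M. u (x, t) * \<zeta> (x, t)"
  have "((\<lambda>t. ?A t + ?G t) has_integral (?F (b + 1) - ?F 0)) {0..b + 1}"
  proof (rule fundamental_theorem_of_calculus)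
   fix t assume t: "t \<in> {0..b + 1}"
   have "(?F has_real_derivative (?A t + ?G t)) (at t within {0..b + 1})"
    by (rule has_field_derivative_subset[OF spacetime_derivative[OF s Z]]) (use t in auto)
   thus "(?F has_vector_derivative (?A t + ?G t)) (at t within {0..b + 1})"
    by (simp add: has_real_derivative_iff_has_vector_derivative)
  qed (use b0 in simp)
  moreover have "?F (b + 1) = 0" "?F 0 = 0" using K(2,4) by auto
  ultimately have "((\<lambda>t. ?A t + ?G t) has_integral 0) {0..b + 1}" by simp
  thus ?thesis
  proof (rule has_integral_on_superset)
   fix t assume "t \<notin> {0..b + 1}"
   hence "Z (x, t) = 0" "L (x, t) = 0" for x using z0[of "(x, t)"] by auto
   thus "?A t + ?G t = 0" by simp
  qed simp
 qed
 ultimately have "(LBINT t. ?A t + ?G t) = 0" by (rule has_integral_unique)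
 thus ?thesis using iA iG by simp
qed

theorem weak_solution_exists:
 assumes u0: "loc u0"
 shows "\<exists>u. u \<in> L1_loc MT (UNIV \<times> {0..}) \<and> u \<in> C_L1_loc M \<and>
   (\<forall>\<eta> L. tp \<eta> L \<longrightarrow> ((\<lambda>t. LINT x|M. u (x, t) * \<eta> x) \<longlongrightarrow> ip u0 \<eta>) (at 0 within {0..})) \<and>
   (\<forall>\<zeta> Z L. stt \<zeta> Z L \<longrightarrow>
    (LINT z|MT. u z * Z z) + (LINT z|MT. spow (u z) m * L z) = 0)"
proof -
 obtain V where V: "sol V" "AE x in M. V 0 x = u0 x" using sol_exists[OF u0] by blast
 obtain u where u: "u \<in> borel_measurable MT" "\<And>t. t \<ge> 0 ==> AE x in M. u (x, t) = V t x"
  using sol_measurable_version[OF V(1)] by blast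
 have um: "(\<lambda>x. u (x, t)) \<in> borel_measurable M" for t using u(1) by measurable
 have s: "sol (\<lambda>t x. u (x, t))" by (rule sol_cong[OF V(1) um u(2)])
 have 1: "u \<in> L1_loc MT (UNIV \<times> {0..})"
  unfolding L1_loc_def
 proof (intro CollectI allI impI)
  fix K :: "('a \<times> real) set" assume K: "compact K \<and> K \<subseteq> UNIV \<times> {0..}"
  have Kf: "compact (fst ` K)" "compact (snd ` K)" using K by (auto intro!: compact_continuous_image continuous_intros)
  have "bounded (snd ` K)" by (rule compact_imp_bounded[OF Kf(2)])
  then obtain b where b: "\<forall>t\<in>snd ` K. norm t \<le> b" unfolding bounded_iff by blast
  have sub: "K \<subseteq> fst ` K \<times> {0..\<bar>b\<bar>}"
  proof
   fix z assume z: "z \<in> K"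
   hence "norm (snd z) \<le> b" "snd z \<ge> 0" using b K by auto
   thus "z \<in> fst ` K \<times> {0..\<bar>b\<bar>}" using z by (auto simp: mem_Times_iff)
  qed
  have Km: "K \<in> sets MT" using K unfolding sets_prod by (intro borel_closed compact_imp_closed) auto
  show "set_integrable MT K u" unfolding set_integrable_def
  proof (rule Bochner_Integration.integrable_bound[OF integrable_box(1)[OF u(1) s Kf(1), of "\<bar>b\<bar>"]])
   show "(\<lambda>x. indicat_real K x *\<^sub>R u x) \<in> borel_measurable MT" using Km u(1) by measurable
   show "AE z in MT. norm (indicat_real K z *\<^sub>R u z) \<le> norm (indicator (fst ` K \<times> {0..\<bar>b\<bar>}) z * u z)"
    using sub by (intro AE_I2) (auto simp: indicator_def)
  qed simp
 qed
 have 2: "u \<in> C_L1_loc M" unfolding C_L1_loc_def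
 proof (intro CollectI conjI allI impI)
  show "(\<lambda>x. u (x, t)) \<in> L1_loc M UNIV" if "0 \<le> t" for t
   using sol_loc[OF s that] unfolding L1_loc_def loc_def set_integrable_def by simp
  fix r :: real and K :: "'a set" assume r: "r \<ge> 0" and K: "compact K"
  obtain \<eta> L C where c: "cut \<eta> L C" "\<And>x. x \<in> K ==> 1 \<le> \<eta> x" using cut_exists[OF K] by blast
  have Km: "K \<in> sets M" using K sets_M by (simp add: borel_closed compact_imp_closed)
  show "((\<lambda>t. \<integral>x\<in>K. \<bar>u (x, t) - u (x, r)\<bar> \<partial>M) \<longlongrightarrow> 0) (at r within {0..})"
  proof (rule Lim_null_comparison[OF _ sol_cont[OF s c(1) r]])
   show "\<forall>\<^sub>F t in at r within {0..}. norm (\<integral>x\<in>K. \<bar>u (x, t) - u (x, r)\<bar> \<partial>M) \<le> lnrm \<eta> (\<lambda>x. u (x, t) - u (x, r))"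
    unfolding eventually_at_filter
   proof (intro always_eventually allI impI)
    fix t :: real assume "t \<in> {0..}"
    hence t: "t \<ge> 0" by simp
    have l: "loc (\<lambda>x. u (x, t) - u (x, r))" by (intro loc_diff sol_loc[OF s] t r)
    have "0 \<le> (\<integral>x\<in>K. \<bar>u (x, t) - u (x, r)\<bar> \<partial>M)" unfolding set_lebesgue_integral_def by (intro Bochner_Integration.integral_nonneg) auto
    moreover have "(\<integral>x\<in>K. \<bar>u (x, t) - u (x, r)\<bar> \<partial>M) \<le> lnrm \<eta> (\<lambda>x. u (x, t) - u (x, r))"
     unfolding set_lebesgue_integral_def lnrm_def
    proof (rule integral_mono)
     show "integrable M (\<lambda>x. indicat_real K x *\<^sub>R \<bar>u (x, t) - u (x, r)\<bar>)" using loc_ind[OF loc_abs[OF l] K] by simp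
     show "integrable M (\<lambda>x. \<bar>u (x, t) - u (x, r)\<bar> * \<eta> x)" by (rule lnrm_int[OF c(1) l])
     fix x show "indicat_real K x *\<^sub>R \<bar>u (x, t) - u (x, r)\<bar> \<le> \<bar>u (x, t) - u (x, r)\<bar> * \<eta> x"
      using c(2)[of x] cut_nonneg[OF c(1), of x] mult_left_mono[of 1 "\<eta> x" "\<bar>u (x, t) - u (x, r)\<bar>"]
      by (cases "x \<in> K") auto
    qed
    ultimately show "norm (\<integral>x\<in>K. \<bar>u (x, t) - u (x, r)\<bar> \<partial>M) \<le> lnrm \<eta> (\<lambda>x. u (x, t) - u (x, r))" by simp
   qed
  qed
 qed
 have 3: "((\<lambda>t. LINT x|M. u (x, t) * \<eta> x) \<longlongrightarrow> ip u0 \<eta>) (at 0 within {0..})" if tp: "tp \<eta> L" for \<eta> L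
 proof -
  have "((\<lambda>t. LINT x|M. u (x, t) * \<eta> x) \<longlongrightarrow> (LINT x|M. u (x, 0) * \<eta> x)) (at 0 within {0..})"
   using DERIV_continuous[OF sol_deriv[OF s tp order_refl]] by (simp add: continuous_within)
  moreover have "(LINT x|M. u (x, 0) * \<eta> x) = ip u0 \<eta>"
  proof (rule integral_cong_AE)
   have [measurable]: "\<eta> \<in> borel_measurable M" using tp bfs_meas[OF D_bfs[OF wl_D]] unfolding tp_def by blast
   note [measurable] = um[of 0] loc_meas[OF u0]
   show "(\<lambda>x. u (x, 0) * \<eta> x) \<in> borel_measurable M" "(\<lambda>x. u0 x * \<eta> x) \<in> borel_measurable M" by measurable
   show "AE x in M. u (x, 0) * \<eta> x = u0 x * \<eta> x" using u(2)[OF order_refl] V(2) by eventually_elim simp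
  qed
  ultimately show ?thesis by simp
 qed
 show ?thesis using 1 2 3 spacetime_identity[OF u(1) s] by blast
qed

end

section \<open>Change of variables\<close>

text \<open>The library states the change of variables formula for wellordered index types only.\<close>

typedef (overloaded) 'n wo = "{..<CARD('n::finite)}"
 by (rule exI[of _ 0]) simp

instantiation wo :: (finite) wellorder
begin
definition "x \<le> y \<longleftrightarrow> Rep_wo x \<le> Rep_wo y"
definition "x < y \<longleftrightarrow> Rep_wo x < Rep_wo y"
instance
proof
 fix P :: "'a wo \<Rightarrow> bool" and a :: "'a wo"
 assume s: "\<And>x. (\<And>y. y < x ==> P y) ==> P x"
 show "P a"
  by (induction a rule: measure_induct_rule[of Rep_wo]) (auto intro: s simp: less_wo_def)
qed (auto simp: less_eq_wo_def less_wo_def Rep_wo_inject)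
end

lemma card_wo: "CARD('n::finite wo) = CARD('n)" and finite_wo: "finite (UNIV :: 'n wo set)"
proof -
 have "(UNIV :: 'n wo set) = Abs_wo ` {..<CARD('n)}"
  using type_definition.Abs_image[OF type_definition_wo] by metis
 thus "finite (UNIV :: 'n wo set)" by (metis finite_imageI finite_lessThan)
 show "CARD('n wo) = CARD('n)"
  using type_definition.card[OF type_definition_wo] by simp
qed

instance wo :: (finite) finite by standard (rule finite_wo)

lemma det_reindex:
 fixes A :: "real^'a::finite^'a" and h :: "'b::finite \<Rightarrow> 'a"
 assumes h: "bij h"
 shows "det (\<chi> i j. A $ h i $ h j) = det A"
proof -
 let ?m = "map_permutation UNIV"
 have hi: "bij (inv h)" using h by (rule bij_imp_bij_inv)
 note I = bij_is_inj[OF h] bij_is_inj[OF hi]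
 have "det A = (\<Sum>p | p permutes (UNIV :: 'b set). of_int (sign p) * (\<Prod>i\<in>UNIV. A $ h i $ h (p i)))"
  unfolding det_def
 proof (rule sum.reindex_bij_witness[of _ "?m h" "?m (inv h)"])
  fix p assume "p \<in> {p. p permutes (UNIV :: 'a set)}"
  hence p: "p permutes UNIV" by simp
  have ap: "?m (inv h) p i = inv h (p (h i))" for i
   using map_permutation_apply[OF I(2), of "h i" p] by (simp add: inv_f_f[OF I(1)])
  show "?m (inv h) p \<in> {p. p permutes UNIV}"
   using map_permutation_permutes[OF hi p] by simp
  show "?m h (?m (inv h) p) = p"
  proof
   fix a
   show "?m h (?m (inv h) p) a = p a"
    using map_permutation_apply[OF I(1), of "inv h a" "?m (inv h) p"]
    by (simp add: ap surj_f_inv_f[OF bij_is_surj[OF h]])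
  qed
  have "(\<Prod>i\<in>UNIV. A $ i $ p i) = (\<Prod>i\<in>UNIV. A $ h i $ p (h i))"
   using prod.reindex_bij_betw[OF h, of "\<lambda>i. A $ i $ p i"] by simp
  thus "of_int (sign (?m (inv h) p)) * (\<Prod>i\<in>UNIV. A $ h i $ h (?m (inv h) p i)) =
    of_int (sign p) * (\<Prod>i\<in>UNIV. A $ i $ p i)"
   using sign_map_permutation[OF I(2) p]
   by (simp add: ap surj_f_inv_f[OF bij_is_surj[OF h]])
 next
  fix p assume "p \<in> {p. p permutes (UNIV :: 'b set)}"
  hence p: "p permutes UNIV" by simp
  have ap: "?m h p (h i) = h (p i)" for i by (rule map_permutation_apply[OF I(1)]) simp
  show "?m h p \<in> {p. p permutes UNIV}"
   using map_permutation_permutes[OF h p] by simp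
  show "?m (inv h) (?m h p) = p"
  proof
   fix a
   show "?m (inv h) (?m h p) a = p a"
    using map_permutation_apply[OF I(2), of "h a" "?m h p"] ap[of a] by (simp add: inv_f_f[OF I(1)])
  qed
 qed
 thus ?thesis by (simp add: det_def)
qed

text \<open>Transports vectors between the index type \<open>'n\<close> and its wellordered copy
  \<open>'n wo\<close>. Lebesgue measure is preserved by \<open>lborel_rdx\<close>, determinants by
  \<open>det_reindex\<close>.\<close>

definition rdx :: "('b \<Rightarrow> 'a) \<Rightarrow> real^'a::finite \<Rightarrow> real^'b::finite" where
 "rdx h x = (\<chi> i. x $ h i)"

lemma rdx_nth: "rdx h x $ i = x $ h i"
 by (simp add: rdx_def)

lemma linear_rdx: "linear (rdx h)"
 by (rule linearI) (auto simp: rdx_def vec_eq_iff)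

lemma rdx_inv: "bij h ==> rdx (inv h) (rdx h x) = x" "bij h ==> rdx h (rdx (inv h) z) = z"
 by (auto simp: rdx_def vec_eq_iff surj_f_inv_f bij_is_surj inv_f_f bij_is_inj)

lemma prod_Basis_cart: "(\<Prod>b\<in>Basis. f b) = (\<Prod>i\<in>UNIV. f (axis i 1 :: real^'a))"
proof -
 have B: "(Basis :: (real^'a) set) = (\<lambda>i. axis i 1) ` UNIV" by (auto simp: Basis_vec_def)
 show ?thesis unfolding B by (subst prod.reindex) (auto simp: inj_on_def axis_eq_axis)
qed

lemma lborel_rdx:
 assumes h: "bij (h :: 'b::finite \<Rightarrow> 'a::finite)"
 shows "distr lborel lborel (rdx h) = (lborel :: (real^'b) measure)"
proof (rule lborel_eqI[symmetric])
 have m: "rdx h \<in> borel_measurable borel"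
  by (intro borel_measurable_continuous_onI linear_continuous_on linear_conv_bounded_linear[THEN iffD1] linear_rdx)
 fix l u :: "real^'b" assume lu: "\<And>b. b \<in> Basis ==> l \<bullet> b \<le> u \<bullet> b"
 have lu': "l $ i \<le> u $ i" for i using lu[of "axis i 1"] by (simp add: inner_axis)
 have "rdx h -` box l u = box (rdx (inv h) l) (rdx (inv h) u)"
 proof (rule set_eqI)
  fix x
  have "x $ i = rdx h x $ inv h i" for i by (simp add: rdx_def surj_f_inv_f bij_is_surj[OF h])
  thus "x \<in> rdx h -` box l u \<longleftrightarrow> x \<in> box (rdx (inv h) l) (rdx (inv h) u)"
   by (auto simp: mem_box_cart rdx_def surj_f_inv_f bij_is_surj[OF h])
    (metis bij_inv_eq_iff h)+
 qed
 moreover have "emeasure lborel (box (rdx (inv h) l) (rdx (inv h) u)) = (\<Prod>b\<in>Basis. (u - l) \<bullet> b)"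
 proof (subst emeasure_lborel_box)
  show "rdx (inv h) l \<bullet> b \<le> rdx (inv h) u \<bullet> b" if "b \<in> Basis" for b
   using that lu' by (auto simp: Basis_vec_def inner_axis rdx_def)
  show "ennreal (prod ((\<bullet>) (rdx (inv h) u - rdx (inv h) l)) Basis) = ennreal (\<Prod>b\<in>Basis. (u - l) \<bullet> b)"
   using prod.reindex_bij_betw[OF bij_imp_bij_inv[OF h], of "\<lambda>i. u $ i - l $ i"]
   by (simp add: prod_Basis_cart inner_axis rdx_def)
 qed
 ultimately show "emeasure (distr lborel lborel (rdx h)) (box l u) = (\<Prod>b\<in>Basis. (u - l) \<bullet> b)"
  using m by (subst emeasure_distr) auto
qed simp

text \<open>The equivalence \<open>key\<close> speaks of finite values r only. If the right side is
  infinite, \<open>key\<close> excludes a finite measure of the image.\<close>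

lemma emeasure_image_wo:
 fixes T :: "real^'n::{finite,wellorder} \<Rightarrow> real^'n::_"
 assumes B: "B \<in> sets borel" "T ` B \<in> sets borel" "inj_on T B"
  and D: "\<And>x. x \<in> B ==> (T has_derivative T' x) (at x)"
  and C: "continuous_on B (\<lambda>x. det (matrix (T' x)))"
 shows "emeasure lborel (T ` B) = (\<integral>\<^sup>+x\<in>B. ennreal \<bar>det (matrix (T' x))\<bar> \<partial>lborel)"
proof -
 let ?J = "\<lambda>x. \<bar>det (matrix (T' x))\<bar>"
 have m: "(\<lambda>x. indicator B x * ?J x) \<in> borel_measurable borel"
  using borel_measurable_continuous_on_indicator[OF B(1) continuous_on_rabs[OF C]] by simp
 have eq: "(\<integral>\<^sup>+x\<in>B. ennreal (?J x) \<partial>lborel) = (\<integral>\<^sup>+x. ennreal (indicator B x * ?J x) \<partial>lborel)"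
  by (intro nn_integral_cong) (auto simp: indicator_def)
 have "T ` B \<in> lmeasurable \<and> measure lebesgue (T ` B) = r \<longleftrightarrow> (?J has_integral r) B" for r
  using B D by (intro has_measure_differentiable_image) (auto intro: has_derivative_at_withinI)
 also have "(?J has_integral r) B \<longleftrightarrow> ((\<lambda>x. indicator B x * ?J x) has_integral r) UNIV" for r
  by (subst has_integral_restrict_UNIV[symmetric]) (intro arg_cong[where f="\<lambda>f. (f has_integral r) UNIV"], auto simp: fun_eq_iff indicator_def)
 also have "((\<lambda>x. indicator B x * ?J x) has_integral r) UNIV \<longleftrightarrow>
   (\<integral>\<^sup>+x\<in>B. ennreal (?J x) \<partial>lborel) = ennreal r \<and> 0 \<le> r" for r
  using m by (subst has_integral_iff_nn_integral_lebesgue) (auto simp: nn_integral_completion eq measurable_completion)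
 finally have key: "T ` B \<in> lmeasurable \<and> measure lebesgue (T ` B) = r \<longleftrightarrow>
   (\<integral>\<^sup>+x\<in>B. ennreal (?J x) \<partial>lborel) = ennreal r \<and> 0 \<le> r" for r .
 have e: "emeasure lborel (T ` B) = emeasure lebesgue (T ` B)" using B by simp
 show ?thesis
 proof (cases "(\<integral>\<^sup>+x\<in>B. ennreal (?J x) \<partial>lborel)")
  case (real r)
  hence "T ` B \<in> lmeasurable" "measure lebesgue (T ` B) = r" using key[of r] by blast+
  thus ?thesis using e real by (simp add: emeasure_eq_measure2)
 next
  case top
  hence "T ` B \<notin> lmeasurable" using key[of "measure lebesgue (T ` B)"] by auto
  moreover have "T ` B \<in> sets lebesgue" using B by auto
  ultimately have "emeasure lebesgue (T ` B) = \<infinity>"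
   unfolding fmeasurable_def infinity_ennreal_def using top.not_eq_extremum by blast
  thus ?thesis using top e by simp
 qed
qed

text \<open>Conjugation with \<open>rdx\<close> moves T to the wellordered index type and affects
  neither the measure nor the determinant.\<close>

lemma emeasure_image:
 fixes T :: "real^'n::finite \<Rightarrow> real^'n"
 assumes B: "B \<in> sets borel" "T ` B \<in> sets borel" "inj_on T B"
  and D: "\<And>x. x \<in> B ==> (T has_derivative T' x) (at x)"
  and C: "continuous_on B (\<lambda>x. det (matrix (T' x)))"
 shows "emeasure lborel (T ` B) = (\<integral>\<^sup>+x\<in>B. ennreal \<bar>det (matrix (T' x))\<bar> \<partial>lborel)"
proof -
 obtain h :: "'n wo \<Rightarrow> 'n" where h: "bij h"
  using finite_same_card_bij[OF finite_wo finite card_wo] by blast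
 let ?R = "rdx h" and ?S = "rdx (inv h)"
 have hi: "bij (inv h)" using h by (rule bij_imp_bij_inv)
 have cont: "continuous_on X (rdx k)" for X and k :: "'c::finite \<Rightarrow> 'd::finite"
  by (intro linear_continuous_on linear_conv_bounded_linear[THEN iffD1] linear_rdx)
 have mR: "rdx k \<in> borel_measurable borel" for k :: "'c::finite \<Rightarrow> 'd::finite"
  by (intro borel_measurable_continuous_onI cont)
 have vR: "?R ` X = ?S -` X" for X by (auto simp: rdx_inv[OF h]) (metis rdx_inv(2)[OF h] image_eqI)
 have bR: "?R ` X \<in> sets borel" if "X \<in> sets borel" for X
  unfolding vR using measurable_sets[OF mR, of X "inv h"] that by simp
 have lR: "emeasure lborel (?R ` X) = emeasure lborel X" if X: "X \<in> sets borel" for X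
 proof -
  have "emeasure lborel (?R ` X) = emeasure (distr lborel lborel ?R) (?R ` X)" by (simp add: lborel_rdx[OF h])
  also have "\<dots> = emeasure lborel (?R -` ?R ` X)" using mR bR[OF X] by (subst emeasure_distr) auto
  also have "?R -` ?R ` X = X" using rdx_inv(1)[OF h] by (auto simp: image_iff) metis
  finally show ?thesis .
 qed
 define U where "U = ?R \<circ> T \<circ> ?S"
 define U' where "U' y = ?R \<circ> T' (?S y) \<circ> ?S" for y
 have im: "U ` ?R ` B = ?R ` T ` B" by (auto simp: U_def image_image rdx_inv[OF h])
 have der: "(rdx k has_derivative rdx k) F" for F and k :: "'c::finite \<Rightarrow> 'd::finite"
  by (intro bounded_linear_imp_has_derivative linear_conv_bounded_linear[THEN iffD1] linear_rdx)
 have UD: "(U has_derivative U' y) (at y)" if y: "y \<in> ?R ` B" for y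
  unfolding U_def U'_def
 proof (rule diff_chain_at[OF der])
  have "?S y \<in> B" using y rdx_inv(1)[OF h] by auto
  hence "(?R \<circ> T has_derivative ?R \<circ> T' (?S y)) (at (?S y))" by (intro diff_chain_at D der)
  thus "(?R \<circ> T has_derivative ?R \<circ> T' (?S y)) (at (?S y))" .
 qed
 have dt: "det (matrix (U' y)) = det (matrix (T' (?S y)))" for y
 proof -
  have S: "?S (axis j 1) = axis (h j) 1" for j
   by (auto simp: rdx_def vec_eq_iff axis_def bij_inv_eq_iff[OF h])
    (auto simp: surj_f_inv_f bij_is_surj[OF h] inv_f_f bij_is_inj[OF h])
  have "matrix (U' y) = (\<chi> i j. matrix (T' (?S y)) $ h i $ h j)"
   by (simp add: matrix_def U'_def S rdx_nth vec_eq_iff)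
  thus ?thesis using det_reindex[OF h] by simp
 qed
 have "emeasure lborel (T ` B) = emeasure lborel (U ` ?R ` B)" using lR[OF B(2)] im by simp
 also have "\<dots> = (\<integral>\<^sup>+y\<in>?R ` B. ennreal \<bar>det (matrix (U' y))\<bar> \<partial>lborel)"
 proof (rule emeasure_image_wo)
  show "?R ` B \<in> sets borel" "U ` ?R ` B \<in> sets borel" using bR B im by auto
  show "inj_on U (?R ` B)" using B(3) rdx_inv[OF h] rdx_inv(1)[OF h]
   by (auto simp: inj_on_def U_def) metis
  show "continuous_on (?R ` B) (\<lambda>x. det (matrix (U' x)))" unfolding dt
   by (rule continuous_on_compose2[OF C cont]) (auto simp: rdx_inv[OF h])
 qed (rule UD)
 also have "\<dots> = (\<integral>\<^sup>+y. ennreal \<bar>det (matrix (U' y))\<bar> * indicator (?R ` B) y \<partial>distr lborel lborel ?R)"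
  by (simp add: lborel_rdx[OF h])
 also have "\<dots> = (\<integral>\<^sup>+x. ennreal \<bar>det (matrix (U' (?R x)))\<bar> * indicator (?R ` B) (?R x) \<partial>lborel)"
 proof -
  have "continuous_on (?R ` B) (\<lambda>x. \<bar>det (matrix (U' x))\<bar>)" unfolding dt
   by (intro continuous_on_rabs continuous_on_compose2[OF C cont]) (auto simp: rdx_inv[OF h])
  from borel_measurable_continuous_on_indicator[OF bR[OF B(1)] this]
  have "(\<lambda>y. ennreal (indicator (?R ` B) y *\<^sub>R \<bar>det (matrix (U' y))\<bar>)) \<in> borel_measurable borel" by simp
  also have "(\<lambda>y. ennreal (indicator (?R ` B) y *\<^sub>R \<bar>det (matrix (U' y))\<bar>)) = (\<lambda>y. ennreal \<bar>det (matrix (U' y))\<bar> * indicator (?R ` B) y)"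
   by (auto simp: fun_eq_iff indicator_def)
  finally show ?thesis using mR by (subst nn_integral_distr) auto
 qed
 also have "\<dots> = (\<integral>\<^sup>+x\<in>B. ennreal \<bar>det (matrix (T' x))\<bar> \<partial>lborel)"
 proof (intro nn_integral_cong)
  fix x
  have "?R x \<in> ?R ` B \<longleftrightarrow> x \<in> B" using rdx_inv(1)[OF h] by (auto simp: image_iff) metis
  thus "ennreal \<bar>det (matrix (U' (?R x)))\<bar> * indicator (?R ` B) (?R x) = ennreal \<bar>det (matrix (T' x))\<bar> * indicator B x"
   by (auto simp: indicator_def dt rdx_inv[OF h])
 qed
 finally show ?thesis .
qed

section \<open>Charts and the volume measure\<close>

text \<open>Continuity of the derivative is required for each fixed direction, as in
  \<open>Ck_on\<close>.\<close>

definition C1 :: "'v set \<Rightarrow> ('v::real_normed_vector \<Rightarrow> 'w::real_normed_vector) \<Rightarrow> bool" where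
 "C1 S f \<longleftrightarrow> (\<forall>x\<in>S. f differentiable (at x)) \<and> (\<forall>v. continuous_on S (\<lambda>x. frechet_derivative f (at x) v))"

lemma C1_has_derivative: "C1 S f ==> x \<in> S ==> (f has_derivative frechet_derivative f (at x)) (at x)"
 by (simp add: C1_def frechet_derivative_works[symmetric])

lemma C1_continuous: "C1 S f ==> continuous_on S f"
 by (auto simp: C1_def intro!: continuous_at_imp_continuous_on differentiable_imp_continuous_within)

lemma C1_I:
 assumes "\<And>x. x \<in> S ==> (f has_derivative f' x) (at x)" "\<And>v. continuous_on S (\<lambda>x. f' x v)"
 shows "C1 S f"
proof -
 have "frechet_derivative f (at x) = f' x" if "x \<in> S" for x
  using frechet_derivative_at[OF assms(1)[OF that]] by simp
 thus ?thesis using assms unfolding C1_def differentiable_def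
  by (auto cong: continuous_on_cong)
qed

lemma frechet_derivative_eqI: "(f has_derivative f') (at x) ==> frechet_derivative f (at x) = f'"
 using frechet_derivative_at by metis

lemma smooth_C1:
 assumes "open S" "smooth_on S f"
 shows "C1 S f" "smooth_on S (\<lambda>x. frechet_derivative f (at x) v)"
proof -
 have k: "Ck_on (Suc k) S f" for k using assms(2) by (simp add: smooth_on_def)
 show "C1 S f" using k[of 0] assms(1) by (auto simp: C1_def differentiable_on_eq_differentiable_at)
 show "smooth_on S (\<lambda>x. frechet_derivative f (at x) v)" using k by (auto simp: smooth_on_def)
qed

lemma C1_cong:
 assumes "open S" "C1 S f" "\<And>x. x \<in> S ==> f x = h x"
 shows "C1 S h"
proof (rule C1_I)
 show "(h has_derivative frechet_derivative f (at x)) (at x)" if "x \<in> S" for x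
  using has_derivative_transform_within_open[OF C1_has_derivative[OF assms(2) that] assms(1) that] assms(3) by blast
 show "continuous_on S (\<lambda>x. frechet_derivative f (at x) v)" for v using assms(2) by (simp add: C1_def)
qed

lemma C1_subset: "C1 S f ==> T \<subseteq> S ==> C1 T f"
 by (auto simp: C1_def intro: continuous_on_subset)

lemma C1_union: "open S ==> open T ==> C1 S f ==> C1 T f ==> C1 (S \<union> T) f"
 by (auto simp: C1_def intro: continuous_on_open_Un)

lemma C1_const: "C1 S (\<lambda>_. c)"
 by (rule C1_I[of _ _ "\<lambda>_ _. 0"]) (auto intro!: derivative_eq_intros)

lemma C1_add: "C1 S f ==> C1 S h ==> C1 S (\<lambda>x. f x + h x)"
 by (rule C1_I[of _ _ "\<lambda>x v. frechet_derivative f (at x) v + frechet_derivative h (at x) v"])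
  (auto intro!: derivative_eq_intros C1_has_derivative continuous_intros simp: C1_def)

lemma C1_mult:
 fixes f h :: "'v::real_normed_vector \<Rightarrow> real"
 assumes "C1 S f" "C1 S h"
 shows "C1 S (\<lambda>x. f x * h x)"
 by (rule C1_I[of _ _ "\<lambda>x v. f x * frechet_derivative h (at x) v + frechet_derivative f (at x) v * h x"])
  (use assms C1_continuous[OF assms(1)] C1_continuous[OF assms(2)] in
   \<open>auto intro!: has_derivative_mult C1_has_derivative continuous_intros simp: C1_def\<close>)

lemma C1_comp:
 fixes f :: "'v::real_normed_vector \<Rightarrow> real"
 assumes "C1 S f" "\<And>x. x \<in> S ==> (P has_real_derivative P' (f x)) (at (f x))" "continuous_on (f ` S) P'"
 shows "C1 S (\<lambda>x. P (f x))"
proof (rule C1_I)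
 show "((\<lambda>x. P (f x)) has_derivative (\<lambda>v. P' (f x) * frechet_derivative f (at x) v)) (at x)" if "x \<in> S" for x
  using diff_chain_at[OF C1_has_derivative[OF assms(1) that] has_field_derivative_imp_has_derivative[OF assms(2)[OF that]]]
  by (simp add: o_def)
 show "continuous_on S (\<lambda>x. P' (f x) * frechet_derivative f (at x) v)" for v
  using assms(1) C1_continuous[OF assms(1)]
  by (intro continuous_intros continuous_on_compose2[OF assms(3)]) (auto simp: C1_def)
qed

lemma C1_compose:
 fixes T :: "real^'n::finite \<Rightarrow> real^'n" and f :: "real^'n \<Rightarrow> real"
 assumes "C1 S f" "C1 W T" "T ` W \<subseteq> S"
 shows "C1 W (\<lambda>x. f (T x))"
proof (rule C1_I)
 let ?f = "\<lambda>y. frechet_derivative f (at y)" and ?T = "\<lambda>x. frechet_derivative T (at x)"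
 show D: "((\<lambda>x. f (T x)) has_derivative (\<lambda>v. ?f (T x) (?T x v))) (at x)" if "x \<in> W" for x
  using diff_chain_at[OF C1_has_derivative[OF assms(2) that] C1_has_derivative[OF assms(1)]] that assms(3)
  by (auto simp: o_def)
 \<comment> \<open>The direction \<open>?T x v\<close> moves with x, while \<open>C1\<close> speaks
   of fixed directions; hence the expansion in basis vectors.\<close>
 have "?f (T x) (?T x v) = (\<Sum>i\<in>UNIV. (?T x v $ i) * ?f (T x) (axis i 1))" if "x \<in> W" for x v
 proof -
  have l: "linear (?f (T x))" using C1_has_derivative[OF assms(1), of "T x"] that assms(3)
   by (auto intro: has_derivative_linear)
  have "?f (T x) (?T x v) = ?f (T x) (\<Sum>i\<in>UNIV. (?T x v $ i) *\<^sub>R axis i 1)"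
   using basis_expansion[of "?T x v"] by (simp add: scalar_mult_eq_scaleR)
  thus ?thesis by (simp add: linear_sum[OF l] linear_scale[OF l])
 qed
 moreover have "continuous_on W (\<lambda>x. \<Sum>i\<in>UNIV. (?T x v $ i) * ?f (T x) (axis i 1))" for v
 proof (intro continuous_on_sum continuous_on_mult)
  show "continuous_on W (\<lambda>x. ?T x v $ i)" for i
   using assms(2) unfolding C1_def by (intro bounded_linear.continuous_on[OF bounded_linear_vec_nth]) blast
  have "continuous_on S (\<lambda>y. ?f y (axis i 1))" for i using assms(1) unfolding C1_def by blast
  thus "continuous_on W (\<lambda>x. ?f (T x) (axis i 1))" for i
   by (rule continuous_on_compose2[OF _ C1_continuous[OF assms(2)] assms(3)])
 qed
 ultimately show "continuous_on W (\<lambda>x. ?f (T x) (?T x v))" for v by (simp cong: continuous_on_cong)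
qed

lemma C1_sum: "finite I ==> (\<And>i. i \<in> I ==> C1 S (f i)) ==> C1 S (\<lambda>x. \<Sum>i\<in>I. f i x)"
proof (induction I rule: finite_induct)
 case (insert i I)
 hence "C1 S (\<lambda>x. f i x + (\<Sum>i\<in>I. f i x))" by (intro C1_add[where f="f i"]) blast+
 thus ?case using insert by simp
qed (simp add: C1_const)

lemma C1_prod:
 fixes f :: "'i \<Rightarrow> 'v::real_normed_vector \<Rightarrow> real"
 shows "finite I ==> (\<And>i. i \<in> I ==> C1 S (f i)) ==> C1 S (\<lambda>x. \<Prod>i\<in>I. f i x)"
proof (induction I rule: finite_induct)
 case (insert i I)
 hence "C1 S (\<lambda>x. f i x * (\<Prod>i\<in>I. f i x))" by (intro C1_mult[where f="f i"]) blast+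
 thus ?case using insert by simp
qed (simp add: C1_const)

lemma C1_det:
 fixes F :: "'v::real_normed_vector \<Rightarrow> real^'n^'n::finite"
 assumes "\<And>i j. C1 S (\<lambda>x. F x $ i $ j)"
 shows "C1 S (\<lambda>x. det (F x))"
 unfolding det_def
 by (rule C1_sum[OF finite_permutations[OF finite]])
  (rule C1_mult[OF C1_const C1_prod[OF finite assms]])

lemma C1_nth:
 assumes "C1 S f"
 shows "C1 S (\<lambda>x. f x $ i)"
proof (rule C1_I)
 show "((\<lambda>x. f x $ i) has_derivative (\<lambda>v. frechet_derivative f (at x) v $ i)) (at x)" if "x \<in> S" for x
  by (rule bounded_linear.has_derivative[OF bounded_linear_vec_nth C1_has_derivative[OF assms that]])
 show "continuous_on S (\<lambda>x. frechet_derivative f (at x) v $ i)" for v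
  using assms unfolding C1_def by (intro bounded_linear.continuous_on[OF bounded_linear_vec_nth]) blast
qed

text \<open>If det B were not positive, the determinant would vanish somewhere on the segment from
  the identity to B, and a kernel vector there contradicts positivity.\<close>

lemma positive_definite_det:
 fixes B :: "real^'n^'n::finite"
 assumes "\<And>v. v \<noteq> 0 ==> v \<bullet> (B *v v) > 0"
 shows "det B > 0"
proof (rule ccontr)
 assume n: "\<not> det B > 0"
 let ?B = "\<lambda>t. (1 - t) *\<^sub>R mat 1 + t *\<^sub>R B"
 have "continuous_on {0..1} (\<lambda>t. det (?B t))"
  unfolding det_def by (intro continuous_intros)
 then obtain t where t: "0 \<le> t" "t \<le> 1" "det (?B t) = 0"
  using IVT2'[of "\<lambda>t. det (?B t)" 1 0 0] n by auto
 then obtain v where v: "v \<noteq> 0" "?B t *v v = 0" by (metis invertible_det_nz invertible_left_inverse matrix_left_invertible_ker)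
 have "v \<bullet> (?B t *v v) = (1 - t) * (v \<bullet> v) + t * (v \<bullet> (B *v v))"
  by (simp add: matrix_vector_mult_add_rdistrib scaleR_matrix_vector_assoc[symmetric] inner_add_right)
 moreover have "(1 - t) * (v \<bullet> v) + t * (v \<bullet> (B *v v)) > 0"
  using t v assms[OF v(1)] by (cases "t = 1") (auto intro!: add_pos_nonneg mult_pos_pos)
 ultimately show False using v by simp
qed

section \<open>Charts, transition maps and the volume density\<close>

locale riemannian =
 fixes A :: "('a::{t2_space,second_countable_topology}, 'n::finite) chart set"
  and g :: "('a, 'n) metric_tensor"
 assumes rm: "riemannian_manifold A g"
begin

lemma atlas: "smooth_atlas A" using rm by (simp add: riemannian_manifold_def)

lemma chart_ex: "\<exists>c\<in>A. p \<in> dom_of c" using atlas unfolding smooth_atlas_def by blast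

lemma chart_at: "chart_at A p \<in> A" "p \<in> dom_of (chart_at A p)"
 using someI_ex[of "\<lambda>c. c \<in> A \<and> p \<in> dom_of c"] chart_ex[of p] unfolding chart_at_def by blast+

lemma chart:
 assumes "c \<in> A"
 shows "open (dom_of c)" "open (img_of c)" "continuous_on (dom_of c) (snd c)" "continuous_on (img_of c) (inv_of c)"
  "p \<in> dom_of c ==> inv_of c (snd c p) = p" "y \<in> img_of c ==> snd c (inv_of c y) = y"
  "y \<in> img_of c ==> inv_of c y \<in> dom_of c"
proof -
 have h: "homeomorphism (dom_of c) (img_of c) (snd c) (inv_of c)"
  using assms atlas unfolding smooth_atlas_def by blast
 thus "continuous_on (dom_of c) (snd c)" "continuous_on (img_of c) (inv_of c)"
  "p \<in> dom_of c ==> inv_of c (snd c p) = p" by (auto simp: homeomorphism_def)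
 show "open (dom_of c)" "open (img_of c)" using assms atlas unfolding smooth_atlas_def by blast+
qed (rule f_inv_into_f, assumption, rule inv_into_into, assumption)

lemma open_image: "c \<in> A ==> open U ==> U \<subseteq> dom_of c ==> open (snd c ` U)"
 and image_vimage: "c \<in> A ==> B \<subseteq> dom_of c ==> snd c ` B = {y \<in> img_of c. inv_of c y \<in> B}"
proof -
 show e: "snd c ` B = {y \<in> img_of c. inv_of c y \<in> B}" if "c \<in> A" "B \<subseteq> dom_of c" for B
  using that chart[OF that(1)] by (force simp: image_iff subset_iff)
 show "c \<in> A ==> open U ==> U \<subseteq> dom_of c ==> open (snd c ` U)"
  using continuous_open_preimage[OF chart(4,2), of c U] by (subst e) (auto simp: vimage_def Int_def)
qed

definition J where "J c d y = matrix (frechet_derivative (snd d \<circ> inv_of c) (at y))"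

lemma transition:
 assumes "c \<in> A" "d \<in> A"
 shows "C1 (snd c ` (dom_of c \<inter> dom_of d)) (snd d \<circ> inv_of c)"
 using atlas assms open_image[OF assms(1) open_Int[OF chart(1)[OF assms(1)] chart(1)[OF assms(2)]]]
 unfolding smooth_atlas_def by (intro smooth_C1) blast+

lemma J_continuous:
 assumes "c \<in> A" "d \<in> A"
 shows "continuous_on (snd c ` (dom_of c \<inter> dom_of d)) (\<lambda>y. J c d y $ i $ j)"
 using transition[OF assms] by (auto simp: J_def matrix_def C1_def intro!: continuous_intros)

text \<open>Near snd c p the two coordinate changes compose to the identity; the chain rule gives
  the matrices.\<close>

lemma transition_inv:
 assumes "c \<in> A" "d \<in> A" "p \<in> dom_of c \<inter> dom_of d"
 shows "J d c (snd d p) ** J c d (snd c p) = mat 1"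
proof -
 let ?U = "dom_of c \<inter> dom_of d"
 let ?T = "snd d \<circ> inv_of c" and ?S = "snd c \<circ> inv_of d"
 have o: "open (snd c ` ?U)" by (rule open_image[OF assms(1) open_Int[OF chart(1)[OF assms(1)] chart(1)[OF assms(2)]]]) blast
 have T: "(?T has_derivative frechet_derivative ?T (at (snd c p))) (at (snd c p))"
  using C1_has_derivative[OF transition[OF assms(1,2)]] assms(3) by blast
 have S: "(?S has_derivative frechet_derivative ?S (at (snd d p))) (at (snd d p))"
  using C1_has_derivative[OF transition[OF assms(2,1)], of "snd d p"] assms(3) by blast
 have e: "?T (snd c p) = snd d p" using assms chart(5) by auto
 have "(?S \<circ> ?T has_derivative frechet_derivative ?S (at (snd d p)) \<circ> frechet_derivative ?T (at (snd c p))) (at (snd c p))"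
  using diff_chain_at[OF T] S unfolding e by blast
 moreover have "(?S \<circ> ?T has_derivative id) (at (snd c p))"
  using has_derivative_transform_within_open[OF has_derivative_ident o] assms(3)
  by (rule_tac has_derivative_transform_within_open[OF _ o, of "\<lambda>x. x"])
   (auto simp: chart(5)[OF assms(1)] chart(5)[OF assms(2)] id_def)
 ultimately have "frechet_derivative ?S (at (snd d p)) \<circ> frechet_derivative ?T (at (snd c p)) = id"
  by (rule has_derivative_unique)
 thus ?thesis unfolding J_def
  using matrix_compose[OF has_derivative_linear[OF T] has_derivative_linear[OF S]] by (simp add: matrix_id_mat_1)
qed

lemma metric_change:
 assumes "c \<in> A" "d \<in> A" "p \<in> dom_of c \<inter> dom_of d"
 shows "g c p = transpose (J c d (snd c p)) ** g d p ** J c d (snd c p)"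
 using rm assms unfolding riemannian_manifold_def Let_def J_def by blast

lemma metric_sym: "c \<in> A ==> p \<in> dom_of c ==> transpose (g c p) = g c p"
 and metric_pos: "c \<in> A ==> p \<in> dom_of c ==> v \<noteq> 0 ==> v \<bullet> (g c p *v v) > 0"
 using rm unfolding riemannian_manifold_def by blast+

lemma metric_det: "c \<in> A ==> p \<in> dom_of c ==> det (g c p) > 0"
 by (rule positive_definite_det) (rule metric_pos)

abbreviation "\<rho> \<equiv> volume_density g"

lemma density_pos: "c \<in> A ==> y \<in> img_of c ==> \<rho> c y > 0"
 using metric_det chart(7) by (auto simp: volume_density_def)

lemma metric_C1: "c \<in> A ==> C1 (img_of c) (\<lambda>y. g c (inv_of c y) $ i $ j)"
 using rm unfolding riemannian_manifold_def by (intro C1_nth smooth_C1 chart) auto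

lemma density_C1:
 assumes "c \<in> A"
 shows "C1 (img_of c) (\<rho> c)"
proof -
 have p: "det (g c (inv_of c y)) > 0" if "y \<in> img_of c" for y
  using metric_det[OF assms chart(7)[OF assms that]] .
 have z: "\<forall>s\<in>(\<lambda>y. det (g c (inv_of c y))) ` img_of c. sqrt s \<noteq> 0" using p by fastforce
 show ?thesis unfolding volume_density_def
  by (rule C1_comp[OF C1_det[OF metric_C1[OF assms]], where P' = "\<lambda>s. inverse (sqrt s) / 2"])
   (auto intro!: DERIV_real_sqrt continuous_intros p z)
qed

lemma density_change:
 assumes "c \<in> A" "d \<in> A" "p \<in> dom_of c \<inter> dom_of d"
 shows "\<rho> c (snd c p) = \<rho> d (snd d p) * \<bar>det (J c d (snd c p))\<bar>"
 using assms chart(5)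
 by (simp add: volume_density_def metric_change[OF assms] det_mul det_transpose real_sqrt_mult mult.commute mult.left_commute)

text \<open>A total Borel function: it is constant outside the image of the chart, where
  \<open>inv_of c\<close> is unspecified.\<close>

definition invx :: "('a, 'n) chart \<Rightarrow> real^'n \<Rightarrow> 'a" where
 "invx c y = (if y \<in> img_of c then inv_of c y else undefined)"

lemma invx_measurable: "c \<in> A ==> invx c \<in> borel \<rightarrow>\<^sub>M borel"
 unfolding invx_def
 by (subst measurable_If_restrict_space_iff)
  (auto intro!: borel_measurable_continuous_on_restrict chart borel_open)

lemma image_borel: "c \<in> A ==> B \<in> sets borel ==> B \<subseteq> dom_of c ==> snd c ` B \<in> sets borel"
proof -
 assume c: "c \<in> A" and B: "B \<in> sets borel" "B \<subseteq> dom_of c"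
 have "snd c ` B = invx c -` B \<inter> img_of c"
  unfolding image_vimage[OF c B(2)] by (auto simp: invx_def)
 thus ?thesis
  using measurable_sets[OF invx_measurable[OF c] B(1)] borel_open[OF chart(2)[OF c]] by auto
qed

text \<open>Lebesgue measure on the chart image of U, carried back to the manifold, so that two
  charts can be compared on one space.\<close>

definition pull :: "('a, 'n) chart \<Rightarrow> 'a set \<Rightarrow> 'a measure" where
 "pull c U = distr (density lborel (indicator (snd c ` U))) borel (invx c)"

lemma sets_pull [simp]: "sets (pull c U) = sets borel" "space (pull c U) = UNIV"
 by (simp_all add: pull_def)

lemma nn_integral_pull:
 assumes c: "c \<in> A" "open U" "U \<subseteq> dom_of c" and f: "f \<in> borel_measurable borel"
 shows "(\<integral>\<^sup>+p. f p \<partial>pull c U) = (\<integral>\<^sup>+y\<in>snd c ` U. f (inv_of c y) \<partial>lborel)"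
proof -
 have o: "snd c ` U \<in> sets borel" using open_image[OF c] by simp
 note m = invx_measurable[OF c(1)] measurable_compose[OF invx_measurable[OF c(1)] f]
 have "(\<integral>\<^sup>+p. f p \<partial>pull c U) = (\<integral>\<^sup>+y. indicator (snd c ` U) y * f (invx c y) \<partial>lborel)"
  unfolding pull_def using m f o by (subst nn_integral_distr) (auto simp: nn_integral_density)
 also have "\<dots> = (\<integral>\<^sup>+y\<in>snd c ` U. f (inv_of c y) \<partial>lborel)"
  using c by (intro nn_integral_cong) (auto simp: indicator_def invx_def)
 finally show ?thesis .
qed

lemma emeasure_pull:
 assumes c: "c \<in> A" "open U" "U \<subseteq> dom_of c" and B: "B \<in> sets borel"
 shows "emeasure (pull c U) B = emeasure lborel (snd c ` (U \<inter> B))"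
proof -
 have UB: "U \<inter> B \<in> sets borel" "U \<inter> B \<subseteq> dom_of c" using c B by auto
 have "emeasure (pull c U) B = (\<integral>\<^sup>+p. indicator B p \<partial>pull c U)" using B by simp
 also have "\<dots> = (\<integral>\<^sup>+y\<in>snd c ` U. indicator B (inv_of c y) \<partial>lborel)"
  by (rule nn_integral_pull[OF c]) (use B in simp)
 also have "\<dots> = (\<integral>\<^sup>+y. indicator (snd c ` (U \<inter> B)) y \<partial>lborel)"
  using image_vimage[OF c(1,3)] image_vimage[OF c(1) UB(2)]
  by (intro nn_integral_cong) (auto simp: indicator_def)
 also have "\<dots> = emeasure lborel (snd c ` (U \<inter> B))" using image_borel[OF c(1) UB] by simp
 finally show ?thesis .
qed

lemma density_nn_measurable:
 assumes "c \<in> A" "open U" "U \<subseteq> dom_of c" "continuous_on (snd c ` U) f"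
 shows "(\<lambda>p. ennreal (indicator U p * f (snd c p))) \<in> borel_measurable borel"
proof -
 have "continuous_on U (\<lambda>p. f (snd c p))"
  by (rule continuous_on_compose2[OF assms(4) continuous_on_subset[OF chart(3)[OF assms(1)] assms(3)]]) simp
 hence "(\<lambda>p. indicator U p *\<^sub>R f (snd c p)) \<in> borel_measurable borel"
  using assms(2) by (intro borel_measurable_continuous_on_indicator) auto
 thus ?thesis by simp
qed

text \<open>The change of variables formula in the form of a density on the manifold; integrands
  given there need no substitution.\<close>

lemma pull_change:
 assumes c: "c \<in> A" and d: "d \<in> A" and U: "U = dom_of c \<inter> dom_of d"
 shows "pull d U = density (pull c U) (\<lambda>p. ennreal (indicator U p * \<bar>det (J c d (snd c p))\<bar>))"
proof (rule measure_eqI)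
 have o: "open U" "U \<subseteq> dom_of c" "U \<subseteq> dom_of d" using chart(1)[OF c] chart(1)[OF d] U by auto
 have Jc: "continuous_on (snd c ` U) (\<lambda>y. \<bar>det (J c d y)\<bar>)"
  unfolding U det_def by (intro continuous_intros J_continuous[OF c d])
 note m = density_nn_measurable[OF c o(1,2) Jc]
 fix B assume "B \<in> sets (pull d U)"
 hence B: "B \<in> sets borel" by simp
 hence UB: "U \<inter> B \<in> sets borel" using o by auto
 let ?T = "snd d \<circ> inv_of c"
 have im: "?T ` snd c ` (U \<inter> B) = snd d ` (U \<inter> B)"
  using chart(5)[OF c] o unfolding image_image by (intro image_cong) auto
 have "emeasure (pull d U) B = emeasure lborel (?T ` snd c ` (U \<inter> B))"
  unfolding im by (rule emeasure_pull[OF d o(1,3) B])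
 also have "\<dots> = (\<integral>\<^sup>+y\<in>snd c ` (U \<inter> B). ennreal \<bar>det (matrix (frechet_derivative ?T (at y)))\<bar> \<partial>lborel)"
 proof (rule emeasure_image)
  show "snd c ` (U \<inter> B) \<in> sets borel" "?T ` snd c ` (U \<inter> B) \<in> sets borel"
   unfolding im using image_borel[OF c UB] image_borel[OF d UB] o by auto
  show "inj_on ?T (snd c ` (U \<inter> B))"
  proof (rule inj_onI, elim imageE)
   fix x y p q assume "?T x = ?T y" "x = snd c p" "y = snd c q" and "p \<in> U \<inter> B" "q \<in> U \<inter> B"
   moreover from this o have pq: "p \<in> dom_of c" "q \<in> dom_of c" "p \<in> dom_of d" "q \<in> dom_of d" by blast+
   ultimately have "snd d p = snd d q" using chart(5)[OF c pq(1)] chart(5)[OF c pq(2)] by simp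
   hence "p = q" using chart(5)[OF d pq(3)] chart(5)[OF d pq(4)] by metis
   thus "x = y" using \<open>x = snd c p\<close> \<open>y = snd c q\<close> by simp
  qed
  show "(?T has_derivative frechet_derivative ?T (at y)) (at y)" if "y \<in> snd c ` (U \<inter> B)" for y
   using C1_has_derivative[OF transition[OF c d]] that U by blast
  show "continuous_on (snd c ` (U \<inter> B)) (\<lambda>y. det (matrix (frechet_derivative ?T (at y))))"
   unfolding det_def J_def[symmetric]
   by (intro continuous_intros continuous_on_subset[OF J_continuous[OF c d]]) (use U in auto)
 qed
 also have "\<dots> = (\<integral>\<^sup>+y\<in>snd c ` U. ennreal (indicator U (inv_of c y) * \<bar>det (J c d (snd c (inv_of c y)))\<bar>) * indicator B (inv_of c y) \<partial>lborel)"
 proof (rule nn_integral_cong)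
  fix y
  have UBc: "U \<inter> B \<subseteq> dom_of c" using o by auto
  have "y \<in> snd c ` (U \<inter> B) \<longleftrightarrow> y \<in> snd c ` U \<and> inv_of c y \<in> B"
   unfolding image_vimage[OF c o(2)] image_vimage[OF c UBc] by blast
  moreover have "inv_of c y \<in> U" "snd c (inv_of c y) = y" if "y \<in> snd c ` U"
   using that chart(6)[OF c, of y] o(2) unfolding image_vimage[OF c o(2)] by auto
  ultimately show "ennreal \<bar>det (matrix (frechet_derivative ?T (at y)))\<bar> * indicator (snd c ` (U \<inter> B)) y =
    ennreal (indicator U (inv_of c y) * \<bar>det (J c d (snd c (inv_of c y)))\<bar>) * indicator B (inv_of c y) * indicator (snd c ` U) y"
   unfolding J_def by (cases "y \<in> snd c ` U") (simp_all add: indicator_def)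
 qed
 also have "\<dots> = (\<integral>\<^sup>+p\<in>B. ennreal (indicator U p * \<bar>det (J c d (snd c p))\<bar>) \<partial>pull c U)"
  using m B by (subst nn_integral_pull[OF c o(1,2)]) auto
 also have "\<dots> = emeasure (density (pull c U) (\<lambda>p. ennreal (indicator U p * \<bar>det (J c d (snd c p))\<bar>))) B"
  using m B by (subst emeasure_density) (auto simp: measurable_cong_sets[OF sets_pull(1) refl])
 finally show "emeasure (pull d U) B = emeasure (density (pull c U) (\<lambda>p. ennreal (indicator U p * \<bar>det (J c d (snd c p))\<bar>))) B" .
qed simp

text \<open>The part of the volume measure seen by one chart; it vanishes off
  \<open>dom_of c\<close>.\<close>

definition vol :: "('a, 'n) chart \<Rightarrow> 'a measure" where
 "vol c = distr (density lborel (\<lambda>y. ennreal (indicator (img_of c) y * \<rho> c y))) borel (invx c)"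

lemma vol_measurable: "c \<in> A ==> (\<lambda>y. indicator (img_of c) y * \<rho> c y) \<in> borel_measurable borel"
 using borel_measurable_continuous_on_indicator[OF borel_open[OF chart(2)] C1_continuous[OF density_C1]] by simp

lemma emeasure_vol:
 assumes c: "c \<in> A" and B: "B \<in> sets borel"
 shows "emeasure (vol c) B = (\<integral>\<^sup>+y\<in>snd c ` (dom_of c \<inter> B). ennreal (\<rho> c y) \<partial>lborel)"
proof -
 have v: "snd c ` (dom_of c \<inter> B) = {y \<in> img_of c. inv_of c y \<in> B}"
  using image_vimage[OF c, of "dom_of c \<inter> B"] chart(7)[OF c] by auto
 have "emeasure (vol c) B = (\<integral>\<^sup>+y\<in>invx c -` B. ennreal (indicator (img_of c) y * \<rho> c y) \<partial>lborel)"
  unfolding vol_def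
  using invx_measurable[OF c] vol_measurable[OF c] B measurable_sets[OF invx_measurable[OF c] B]
  by (subst emeasure_distr) (auto simp: emeasure_density)
 also have "\<dots> = (\<integral>\<^sup>+y\<in>snd c ` (dom_of c \<inter> B). ennreal (\<rho> c y) \<partial>lborel)"
  unfolding v by (intro nn_integral_cong) (auto simp: indicator_def invx_def)
 finally show ?thesis .
qed

text \<open>The factor |det J| produced by \<open>pull_change\<close> is the one in
  \<open>density_change\<close>.\<close>

lemma emeasure_vol_eq:
 assumes c: "c \<in> A" and d: "d \<in> A" and B: "B \<in> sets borel" "B \<subseteq> dom_of c \<inter> dom_of d"
 shows "emeasure (vol c) B = emeasure (vol d) B"
proof -
 define U where "U = dom_of c \<inter> dom_of d"
 have o: "open U" "U \<subseteq> dom_of c" "U \<subseteq> dom_of d" using chart(1)[OF c] chart(1)[OF d] U_def by auto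
 have vp: "emeasure (vol e) B = (\<integral>\<^sup>+p\<in>B. ennreal (indicator U p * \<rho> e (snd e p)) \<partial>pull e U)"
  if e: "e \<in> A" "U \<subseteq> dom_of e" for e
 proof -
  have m: "(\<lambda>p. ennreal (indicator U p * \<rho> e (snd e p))) \<in> borel_measurable borel"
   by (rule density_nn_measurable[OF e(1) o(1) e(2) continuous_on_subset[OF C1_continuous[OF density_C1[OF e(1)]]]])
    (use e in auto)
  have "B \<subseteq> dom_of e" "dom_of e \<inter> B = B" using B e U_def by auto
  hence "emeasure (vol e) B = (\<integral>\<^sup>+y\<in>snd e ` B. ennreal (\<rho> e y) \<partial>lborel)"
   using emeasure_vol[OF e(1) B(1)] by simp
  also have "\<dots> = (\<integral>\<^sup>+y\<in>snd e ` U. ennreal (indicator U (inv_of e y) * \<rho> e (snd e (inv_of e y))) * indicator B (inv_of e y) \<partial>lborel)"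
   using B(2) image_vimage[OF e(1) \<open>B \<subseteq> dom_of e\<close>] image_vimage[OF e] chart(6)[OF e(1)]
   by (intro nn_integral_cong) (auto simp: indicator_def U_def)
  also have "\<dots> = (\<integral>\<^sup>+p\<in>B. ennreal (indicator U p * \<rho> e (snd e p)) \<partial>pull e U)"
   using m B by (subst nn_integral_pull[OF e(1) o(1) e(2)]) auto
  finally show ?thesis .
 qed
 have m: "(\<lambda>p. ennreal (indicator U p * \<rho> d (snd d p))) \<in> borel_measurable borel"
  by (rule density_nn_measurable[OF d o(1,3) continuous_on_subset[OF C1_continuous[OF density_C1[OF d]]]])
   (use o in auto)
 have Jm: "(\<lambda>p. ennreal (indicator U p * \<bar>det (J c d (snd c p))\<bar>)) \<in> borel_measurable borel"
  by (rule density_nn_measurable[OF c o(1,2)], unfold det_def U_def)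
   (intro continuous_intros J_continuous[OF c d])
 have "emeasure (vol d) B = (\<integral>\<^sup>+p. ennreal (indicator U p * \<bar>det (J c d (snd c p))\<bar>) *
   (ennreal (indicator U p * \<rho> d (snd d p)) * indicator B p) \<partial>pull c U)"
  unfolding vp[OF d o(3)] pull_change[OF c d U_def]
  using m Jm B by (subst nn_integral_density) (auto simp: measurable_cong_sets[OF sets_pull(1) refl])
 also have "\<dots> = emeasure (vol c) B"
  unfolding vp[OF c o(2)]
  using density_change[OF c d] B(2)
  by (intro nn_integral_cong)
   (auto simp: indicator_def U_def ennreal_mult'[symmetric] mult.commute volume_density_def)
 finally show ?thesis by simp
qed

text \<open>Second countability gives countably many charts, and \<open>disjointed\<close> turns
  their domains into a Borel partition.\<close>

lemma chart_cover: "\<exists>e P. (\<forall>n::nat. e n \<in> A \<and> P n \<in> sets borel \<and> P n \<subseteq> dom_of (e n)) \<and> disjoint_family P \<and> (\<Union>n. P n) = UNIV"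
proof -
 obtain F where F: "F \<subseteq> dom_of ` A" "countable F" "\<Union>F = \<Union>(dom_of ` A)"
  by (rule Lindelof[of "dom_of ` A"]) (use chart(1) in blast)+
 have U: "\<Union>F = UNIV" using F(3) chart_ex by blast
 hence "F \<noteq> {}" by auto
 define D where "D = from_nat_into F"
 have D: "range D = F" unfolding D_def using F(2) \<open>F \<noteq> {}\<close> by (rule range_from_nat_into[rotated])
 have "\<exists>c\<in>A. D n = dom_of c" for n using D F(1) by blast
 then obtain e where e: "\<And>n. e n \<in> A" "\<And>n. D n = dom_of (e n)" by metis
 have "disjointed D n \<in> sets borel" for n
  by (rule sets.range_disjointed_sets[THEN subsetD, of D]) (use chart(1)[OF e(1)] e(2) in auto)
 moreover have "disjointed D n \<subseteq> dom_of (e n)" for n using disjointed_subset[of D n] e(2) by auto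
 moreover have "(\<Union>n. disjointed D n) = UNIV" using UN_disjointed_eq[of D] D U by auto
 ultimately show ?thesis using e(1) disjoint_family_disjointed[of D] by blast
qed

text \<open>\<open>volume_measure\<close> is a definite description, so existence and uniqueness
  come first. Along a countable Borel partition subordinate to charts every candidate equals f, and
  f itself defines a candidate by \<open>emeasure_vol_eq\<close>.\<close>

lemma volume_measure_props:
 shows "sets (volume_measure A g) = sets borel"
  "c \<in> A ==> B \<in> sets borel ==> B \<subseteq> dom_of c ==> emeasure (volume_measure A g) B = emeasure (vol c) B"
proof -
 obtain e P where e: "\<And>n::nat. e n \<in> A" "\<And>n. P n \<in> sets borel" "\<And>n. P n \<subseteq> dom_of (e n)"
  "disjoint_family P" "(\<Union>n. P n) = UNIV" using chart_cover by metis
 let ?Q = "\<lambda>\<mu>. sets \<mu> = sets borel \<and> (\<forall>c\<in>A. \<forall>B\<in>sets borel. B \<subseteq> dom_of c \<longrightarrow>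
      emeasure \<mu> B = (\<integral>\<^sup>+y\<in>snd c ` B. ennreal (\<rho> c y) \<partial>lborel))"
 have vol_sub: "emeasure (vol c) B = (\<integral>\<^sup>+y\<in>snd c ` B. ennreal (\<rho> c y) \<partial>lborel)"
  if "c \<in> A" "B \<in> sets borel" "B \<subseteq> dom_of c" for c B
  using emeasure_vol[OF that(1,2)] that(3) by (simp add: Int_absorb1)
 have Q: "?Q \<mu> \<longleftrightarrow> sets \<mu> = sets borel \<and> (\<forall>c\<in>A. \<forall>B\<in>sets borel. B \<subseteq> dom_of c \<longrightarrow> emeasure \<mu> B = emeasure (vol c) B)" for \<mu>
  by (intro conj_cong refl ball_cong imp_cong) (simp add: vol_sub)
 have split: "emeasure N B = (\<Sum>n. emeasure N (B \<inter> P n))" if "sets N = sets borel" "B \<in> sets borel" for N :: "'a measure" and B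
 proof -
  have "(\<Sum>n. emeasure N (B \<inter> P n)) = emeasure N (\<Union>n. B \<inter> P n)"
   using e(2,4) that by (intro suminf_emeasure) (auto simp: disjoint_family_on_def disjoint_iff)
  also have "(\<Union>n. B \<inter> P n) = B" using e(5) by auto
  finally show ?thesis by simp
 qed
 define f where "f B = (\<Sum>n. emeasure (vol (e n)) (B \<inter> P n))" for B
 have uniq: "emeasure \<mu> B = f B" if "?Q \<mu>" "B \<in> sets borel" for \<mu> B
 proof -
  have s: "sets \<mu> = sets borel" and q: "\<And>c C. c \<in> A ==> C \<in> sets borel ==> C \<subseteq> dom_of c ==> emeasure \<mu> C = emeasure (vol c) C"
   using that(1) unfolding Q by blast+
  have "emeasure \<mu> (B \<inter> P n) = emeasure (vol (e n)) (B \<inter> P n)" for n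
   using e(1-3)[of n] that(2) by (intro q) auto
  thus ?thesis unfolding f_def by (subst split[OF s that(2)]) simp
 qed
 define V where "V = measure_of UNIV (sets borel) f"
 have sV: "sets V = sets borel" unfolding V_def
  by (metis sets.sigma_sets_eq sets_measure_of space_borel top_greatest Pow_UNIV)
 have eV: "emeasure V B = f B" if B: "B \<in> sets borel" for B
  unfolding V_def
 proof (rule emeasure_measure_of_sigma)
  show "sigma_algebra UNIV (sets borel :: 'a set set)" by (metis sets.sigma_algebra_axioms space_borel)
  show "positive (sets borel) f" by (simp add: positive_def f_def)
  show "countably_additive (sets borel) f"
  proof (rule countably_additiveI)
   fix X :: "nat \<Rightarrow> 'a set" assume X: "range X \<subseteq> sets borel" "disjoint_family X"
   have "(\<Sum>i. f (X i)) = (\<Sum>i. \<integral>\<^sup>+n. emeasure (vol (e n)) (X i \<inter> P n) \<partial>count_space UNIV)"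
    by (simp add: f_def nn_integral_count_space_nat)
   also have "\<dots> = (\<integral>\<^sup>+n. (\<Sum>i. emeasure (vol (e n)) (X i \<inter> P n)) \<partial>count_space UNIV)"
    by (rule nn_integral_suminf[symmetric]) simp
   also have "(\<lambda>n. \<Sum>i. emeasure (vol (e n)) (X i \<inter> P n)) = (\<lambda>n. emeasure (vol (e n)) ((\<Union>i. X i) \<inter> P n))"
   proof
    fix n
    have "(\<Sum>i. emeasure (vol (e n)) (X i \<inter> P n)) = emeasure (vol (e n)) (\<Union>i. X i \<inter> P n)"
     using X e(2) by (intro suminf_emeasure) (auto simp: vol_def disjoint_family_on_def)
    thus "(\<Sum>i. emeasure (vol (e n)) (X i \<inter> P n)) = emeasure (vol (e n)) ((\<Union>i. X i) \<inter> P n)" by simp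
   qed
   finally show "(\<Sum>i. f (X i)) = f (\<Union>i. X i)" by (simp add: f_def nn_integral_count_space_nat)
  qed
 qed (use B in auto)
 have QV: "?Q V"
  unfolding Q
 proof (intro conjI ballI impI sV)
  fix c B assume c: "c \<in> A" and B: "B \<in> sets borel" "B \<subseteq> dom_of c"
  have "emeasure (vol (e n)) (B \<inter> P n) = emeasure (vol c) (B \<inter> P n)" for n
   using e B c by (intro emeasure_vol_eq) auto
  thus "emeasure V B = emeasure (vol c) B"
   using eV[OF B(1)] split[of "vol c", OF _ B(1)] by (simp add: f_def vol_def)
 qed
 have "volume_measure A g = V" unfolding volume_measure_def
 proof (rule the_equality)
  show "?Q V" by (rule QV)
  fix \<mu> assume "?Q \<mu>"
  thus "\<mu> = V" using uniq[OF \<open>?Q \<mu>\<close>] uniq[OF QV] QV by (intro measure_eqI) auto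
 qed
 thus "sets (volume_measure A g) = sets borel"
  "c \<in> A ==> B \<in> sets borel ==> B \<subseteq> dom_of c ==> emeasure (volume_measure A g) B = emeasure (vol c) B"
  using QV unfolding Q by auto
qed

abbreviation "M \<equiv> volume_measure A g"

lemmas sets_vol = volume_measure_props(1)
lemmas meas_M = measurable_cong_sets[OF sets_vol refl]

lemma space_M [simp]: "space M = UNIV"
 using sets_eq_imp_space_eq[OF sets_vol] by simp

text \<open>The volume measure restricted to the chart domain is \<open>vol c\<close>, whose
  integrals are taken in coordinates.\<close>

lemma chart_integral:
 fixes f :: "'a \<Rightarrow> real"
 assumes c: "c \<in> A" and f: "f \<in> borel_measurable borel" "\<And>p. p \<notin> dom_of c ==> f p = 0"
 shows "(LINT p|M. f p) = (LBINT y. indicator (img_of c) y * (f (inv_of c y) * \<rho> c y))"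
proof -
 have d: "dom_of c \<in> sets borel" using chart(1)[OF c] by simp
 have eq: "density M (indicator (dom_of c)) = vol c"
 proof (rule measure_eqI)
  fix B assume "B \<in> sets (density M (indicator (dom_of c)))"
  hence B: "B \<in> sets borel" by (simp add: sets_vol)
  have "emeasure (density M (indicator (dom_of c))) B = emeasure M (dom_of c \<inter> B)"
   using B d by (subst emeasure_density) (auto simp: sets_vol meas_M nn_integral_indicator[symmetric] indicator_inter_arith simp del: nn_integral_indicator intro!: nn_integral_cong)
  also have "\<dots> = emeasure (vol c) (dom_of c \<inter> B)" using B d by (intro volume_measure_props(2)[OF c]) auto
  also have "\<dots> = emeasure (vol c) B" using B d by (simp add: emeasure_vol[OF c])
  finally show "emeasure (density M (indicator (dom_of c))) B = emeasure (vol c) B" .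
 qed (simp add: sets_vol vol_def)
 have fM: "f \<in> borel_measurable M" using f(1) by (simp add: meas_M)
 have nn: "AE y in lborel. 0 \<le> indicator (img_of c) y * \<rho> c y"
  using density_pos[OF c] by (intro AE_I2) (auto simp: indicator_def intro: less_imp_le)
 have fi: "(\<lambda>y. f (invx c y)) \<in> borel_measurable lborel"
  using measurable_compose[OF invx_measurable[OF c] f(1)] by simp
 have vm: "(\<lambda>y. indicator (img_of c) y * \<rho> c y) \<in> borel_measurable lborel"
  using vol_measurable[OF c] by simp
 have "(LINT p|M. f p) = (LINT p|M. indicator (dom_of c) p *\<^sub>R f p)"
  using f(2) by (intro Bochner_Integration.integral_cong) (auto simp: indicator_def)
 also have "\<dots> = (\<integral>p. f p \<partial>density M (\<lambda>p. ennreal (indicator (dom_of c) p)))"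
  using fM d by (intro integral_density[symmetric]) (auto simp: meas_M)
 also have "\<dots> = (\<integral>p. f p \<partial>vol c)" by (simp add: eq ennreal_indicator)
 also have "\<dots> = (LBINT y. (indicator (img_of c) y * \<rho> c y) *\<^sub>R f (invx c y))"
  unfolding vol_def integral_density[OF fi vm nn, symmetric]
  using f(1) invx_measurable[OF c] by (intro integral_distr) auto
 also have "\<dots> = (LBINT y. indicator (img_of c) y * (f (inv_of c y) * \<rho> c y))"
  by (intro Bochner_Integration.integral_cong) (auto simp: indicator_def invx_def)
 finally show ?thesis .
qed

text \<open>Every point has a neighbourhood that is a small coordinate ball on which the density is
  bounded.\<close>

lemma compact_finite:
 assumes "compact K"
 shows "emeasure M K < \<infinity>"
proof -
 have "\<exists>N. open N \<and> p \<in> N \<and> emeasure M N < \<infinity>" for p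
 proof -
  obtain c where c: "c \<in> A" "p \<in> dom_of c" using chart_ex by blast
  then obtain r where r: "r > 0" "cball (snd c p) r \<subseteq> img_of c"
   using chart(2)[OF c(1), unfolded open_contains_cball] by blast
  define N where "N = inv_of c ` ball (snd c p) r"
  let ?B = "ball (snd c p) r"
  have B: "?B \<subseteq> img_of c" using r by (meson ball_subset_cball subset_trans)
  have N: "N = {q \<in> dom_of c. snd c q \<in> ?B}"
   unfolding N_def using B chart(5,6,7)[OF c(1)] by (force simp: image_iff)
  have oN: "open N" unfolding N
   using continuous_open_preimage[OF chart(3,1)[OF c(1)] open_ball, of "snd c p" r] by (simp add: vimage_def Int_def)
  have "(\<lambda>y. snd c (inv_of c y)) ` ?B = (\<lambda>y. y) ` ?B" using B chart(6)[OF c(1)] by (intro image_cong) blast+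
  moreover have "dom_of c \<inter> N = N" using N by blast
  ultimately have im: "snd c ` (dom_of c \<inter> N) = ?B" by (simp add: N_def image_image)
  have "compact (\<rho> c ` cball (snd c p) r)"
   by (intro compact_continuous_image continuous_on_subset[OF C1_continuous[OF density_C1[OF c(1)]] r(2)]) simp
  then obtain C where C: "\<And>y. y \<in> cball (snd c p) r ==> \<rho> c y \<le> C"
   by (metis bounded_imp_bdd_above bdd_above.E compact_imp_bounded imageI)
  have "emeasure M N = emeasure (vol c) N" using oN N by (intro volume_measure_props(2)[OF c(1)]) auto
  also have "\<dots> = (\<integral>\<^sup>+y\<in>?B. ennreal (\<rho> c y) \<partial>lborel)" using emeasure_vol[OF c(1), of N] oN by (simp add: im)
  also have "\<dots> \<le> (\<integral>\<^sup>+y\<in>?B. ennreal C \<partial>lborel)"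
   using C by (intro nn_integral_mono) (auto simp: indicator_def intro!: ennreal_leI)
  also have "\<dots> = ennreal C * emeasure lborel ?B" by (simp add: nn_integral_cmult_indicator)
  also have "\<dots> < \<infinity>" using emeasure_bounded_finite[of ?B] by (auto simp: ennreal_mult_less_top)
  finally show ?thesis using oN N c r by auto
 qed
 then obtain N where N: "\<And>p. open (N p) \<and> p \<in> N p \<and> emeasure M (N p) < \<infinity>" by metis
 obtain I where I: "finite I" "K \<subseteq> (\<Union>p\<in>I. N p)"
  by (rule compactE_image[OF assms, of UNIV N]) (use N in blast)+
 have "emeasure M K \<le> emeasure M (\<Union>p\<in>I. N p)"
  using I N by (intro emeasure_mono) (auto simp: sets_vol)
 also have "\<dots> \<le> (\<Sum>p\<in>I. emeasure M (N p))"
  using I N by (intro emeasure_subadditive_finite) (auto simp: sets_vol)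
 also have "\<dots> < \<infinity>" using N I(1) by (auto simp: less_top[symmetric])
 finally show ?thesis .
qed

end

section \<open>The Dirichlet form of a Riemannian manifold\<close>

context riemannian begin

text \<open>The components of the differential in the chart c. They form a covector, hence the
  inverse metric \<open>Gi\<close> in \<Gamma>.\<close>

definition gr :: "('a, 'n) chart \<Rightarrow> 'a fn \<Rightarrow> 'a \<Rightarrow> real^'n" where
 "gr c f p = (\<chi> i. partial i (f \<circ> inv_of c) (snd c p))"

definition Gi :: "('a, 'n) chart \<Rightarrow> 'a \<Rightarrow> real^'n^'n" where "Gi c p = matrix_inv (g c p)"

definition \<Gamma> :: "'a fn \<Rightarrow> 'a fn \<Rightarrow> 'a \<Rightarrow> real" where
 "\<Gamma> f h p = gr (chart_at A p) f p \<bullet> (Gi (chart_at A p) p *v gr (chart_at A p) h p)"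

definition D1 :: "'a fn set" where "D1 = {f. \<forall>c\<in>A. C1 (img_of c) (f \<circ> inv_of c)}"

definition DD :: "'a fn set" where "DD = {f \<in> D1. compact (closure {x. f x \<noteq> 0})}"

lemma D1_C1: "f \<in> D1 ==> c \<in> A ==> C1 (img_of c) (f \<circ> inv_of c)" by (simp add: D1_def)

lemma DD_D1: "f \<in> DD ==> f \<in> D1" by (simp add: DD_def)

lemma continuous_charts:
 assumes "\<And>c. c \<in> A ==> continuous_on (img_of c) (f \<circ> inv_of c)"
 shows "continuous_on UNIV (f :: 'a \<Rightarrow> 'b::topological_space)"
proof -
 have "continuous_on (dom_of c) f" if c: "c \<in> A" for c
 proof -
  have "continuous_on (dom_of c) (\<lambda>p. (f \<circ> inv_of c) (snd c p))"
   by (rule continuous_on_compose2[OF assms[OF c] chart(3)[OF c]]) simp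
  thus ?thesis by (rule continuous_on_eq) (simp add: chart(5)[OF c])
 qed
 hence "continuous_on (\<Union>c\<in>A. dom_of c) f" using chart(1) by (intro continuous_on_open_UN) blast+
 thus ?thesis using atlas by (simp add: smooth_atlas_def)
qed

lemma D1_continuous: "f \<in> D1 ==> continuous_on UNIV f"
 by (intro continuous_charts C1_continuous D1_C1)

lemma cont_bfs:
 fixes f :: "'a \<Rightarrow> real"
 assumes f: "continuous_on UNIV f" and K: "compact K" "\<And>x. x \<notin> K ==> f x = 0"
 shows "f \<in> bfs M"
proof -
 have "compact (f ` K)" by (intro compact_continuous_image continuous_on_subset[OF f] K) simp
 then obtain C where C: "\<forall>y\<in>f ` K. norm y \<le> C" using compact_imp_bounded bounded_iff by metis
 hence "\<bar>f x\<bar> \<le> \<bar>C\<bar>" for x using K(2)[of x] by (cases "x \<in> K") (auto intro: order_trans)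
 moreover have "f \<in> borel_measurable M"
  using borel_measurable_continuous_onI[OF f] by (simp add: meas_M)
 moreover have "K \<in> sets M" using compact_imp_closed[OF K(1)] by (simp add: sets_vol)
 ultimately show ?thesis unfolding bfs_def using compact_finite[OF K(1)] K(2) by blast
qed

lemma support_outside: "x \<notin> closure {x. f x \<noteq> 0} ==> f x = (0::real)"
 using closure_subset[of "{x. f x \<noteq> 0}"] by blast

lemma DD_bfs: "f \<in> DD ==> f \<in> bfs M"
 by (rule cont_bfs[OF D1_continuous]) (auto simp: DD_def intro: support_outside)

lemma compact_support_subset:
 assumes "compact (closure S)" "T \<subseteq> S" shows "compact (closure T)"
proof -
 have "closure T \<inter> closure S = closure T" using closure_mono[OF assms(2)] by blast
 thus ?thesis using compact_Int_closed[OF assms(1) closed_closure[of T]] by (simp add: Int_commute)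
qed

lemma D1_add: "f \<in> D1 ==> h \<in> D1 ==> (\<lambda>x. f x + h x) \<in> D1"
 by (simp add: D1_def o_def C1_add)

lemma DD_add:
 assumes "f \<in> DD" "h \<in> DD" shows "(\<lambda>x. f x + h x) \<in> DD"
proof -
 have "compact (closure ({x. f x \<noteq> 0} \<union> {x. h x \<noteq> 0}))"
  using assms by (auto simp: DD_def closure_Un intro: compact_Un)
 hence "compact (closure {x. f x + h x \<noteq> 0})" by (rule compact_support_subset) auto
 thus ?thesis using assms D1_add by (simp add: DD_def)
qed

lemma DD_comp:
 assumes f: "f \<in> DD" and P: "C1_fun P P'" shows "(\<lambda>x. P (f x)) \<in> DD"
proof -
 have "C1 (img_of c) ((\<lambda>x. P (f x)) \<circ> inv_of c)" if "c \<in> A" for c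
  using C1_comp[OF D1_C1[OF DD_D1[OF f] that], of P P'] P
  by (auto simp: C1_fun_def o_def intro: continuous_on_subset)
 moreover have "compact (closure {x. P (f x) \<noteq> 0})"
  by (rule compact_support_subset[of "{x. f x \<noteq> 0}"]) (use f P in \<open>auto simp: DD_def C1_fun_def\<close>)
 ultimately show ?thesis by (auto simp: DD_def D1_def)
qed

lemma DD_0: "(\<lambda>_. 0) \<in> DD"
 by (auto simp: DD_def D1_def o_def intro: C1_const)

lemma gr_inner:
 assumes "((f \<circ> inv_of c) has_derivative F) (at (snd c p))"
 shows "F v = gr c f p \<bullet> v"
proof -
 note l = has_derivative_linear[OF assms]
 have "F v = F (\<Sum>i\<in>UNIV. (v $ i) *\<^sub>R axis i 1)" using basis_expansion[of v] by (simp add: scalar_mult_eq_scaleR)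
 also have "\<dots> = (\<Sum>i\<in>UNIV. v $ i * F (axis i 1))" by (simp add: linear_sum[OF l] linear_scale[OF l])
 finally show ?thesis
  by (simp add: gr_def partial_def frechet_derivative_eqI[OF assms] inner_vec_def mult.commute)
qed

lemma chart_derivative:
 assumes "f \<in> D1" "c \<in> A" "p \<in> dom_of c"
 shows "((f \<circ> inv_of c) has_derivative (\<lambda>v. gr c f p \<bullet> v)) (at (snd c p))"
proof -
 have "((f \<circ> inv_of c) has_derivative frechet_derivative (f \<circ> inv_of c) (at (snd c p))) (at (snd c p))"
  by (rule C1_has_derivative[OF D1_C1[OF assms(1,2)]]) (use assms(3) in blast)
 moreover from gr_inner[OF this] have "frechet_derivative (f \<circ> inv_of c) (at (snd c p)) = (\<lambda>v. gr c f p \<bullet> v)" by auto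
 ultimately show ?thesis by simp
qed

lemma gr_eqI:
 assumes "((f \<circ> inv_of c) has_derivative (\<lambda>v. w \<bullet> v)) (at (snd c p))"
 shows "gr c f p = w"
proof -
 have "gr c f p \<bullet> v = w \<bullet> v" for v using gr_inner[OF assms, of v] by simp
 thus ?thesis by (metis vector_eq_rdot)
qed

lemma gr_change:
 assumes c: "c \<in> A" and d: "d \<in> A" and p: "p \<in> dom_of c \<inter> dom_of d" and f: "f \<in> D1"
 shows "gr c f p = transpose (J c d (snd c p)) *v gr d f p"
proof (rule gr_eqI)
 let ?W = "snd c ` (dom_of c \<inter> dom_of d)" and ?T = "snd d \<circ> inv_of c"
 have o: "open ?W" by (rule open_image[OF c open_Int[OF chart(1)[OF c] chart(1)[OF d]]]) blast
 have T: "(?T has_derivative frechet_derivative ?T (at (snd c p))) (at (snd c p))"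
  using C1_has_derivative[OF transition[OF c d]] p by blast
 have e: "?T (snd c p) = snd d p" using p chart(5)[OF c] by simp
 have "((f \<circ> inv_of d) \<circ> ?T has_derivative (\<lambda>v. gr d f p \<bullet> v) \<circ> frechet_derivative ?T (at (snd c p))) (at (snd c p))"
  by (rule diff_chain_at[OF T]) (unfold e, rule chart_derivative[OF f d], use p in blast)
 hence "((f \<circ> inv_of c) has_derivative (\<lambda>v. gr d f p \<bullet> v) \<circ> frechet_derivative ?T (at (snd c p))) (at (snd c p))"
  by (rule has_derivative_transform_within_open[OF _ o]) (use p chart(5)[OF c] chart(5)[OF d] in auto)
 moreover have "frechet_derivative ?T (at (snd c p)) v = J c d (snd c p) *v v" for v
  unfolding J_def using matrix_works has_derivative_linear[OF T] by (simp add: linear_matrix_vector_mul_eq)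
 ultimately show "((f \<circ> inv_of c) has_derivative (\<lambda>v. (transpose (J c d (snd c p)) *v gr d f p) \<bullet> v)) (at (snd c p))"
  by (simp add: o_def dot_lmul_matrix[symmetric] inner_commute)
qed

lemma metric_inv:
 assumes "c \<in> A" "p \<in> dom_of c"
 shows "g c p ** Gi c p = mat 1" "Gi c p ** g c p = mat 1"
proof -
 have "invertible (g c p)" using metric_det[OF assms] by (simp add: invertible_det_nz)
 thus "g c p ** Gi c p = mat 1" "Gi c p ** g c p = mat 1"
  unfolding Gi_def invertible_def matrix_inv_def by (rule someI2_ex, blast)+
qed

text \<open>Covectors change by the transposed Jacobian j. For the gradient vector v in the chart e,
  the transformation law of the metric gives g c (j v) = gr c h once the transpose of j is
  cancelled, so j v is the gradient vector in the chart c.\<close>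

lemma \<Gamma>_chart:
 assumes c: "c \<in> A" "p \<in> dom_of c" and f: "f \<in> D1" "h \<in> D1"
 shows "\<Gamma> f h p = gr c f p \<bullet> (Gi c p *v gr c h p)"
proof -
 define e where "e = chart_at A p"
 have e: "e \<in> A" "p \<in> dom_of e" unfolding e_def by (rule chart_at)+
 have p: "p \<in> dom_of e \<inter> dom_of c" using e c by blast
 define j where "j = J e c (snd e p)"
 define v where "v = Gi e p *v gr e h p"
 have ch: "gr e k p = transpose j *v gr c k p" if "k \<in> D1" for k
  unfolding j_def by (rule gr_change[OF e(1) c(1) p that])
 have "J c e (snd c p) ** j = mat 1" unfolding j_def by (rule transition_inv[OF e(1) c(1) p])
 hence "transpose j ** transpose (J c e (snd c p)) = mat 1" by (metis matrix_transpose_mul transpose_mat)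
 hence tj: "transpose (J c e (snd c p)) ** transpose j = mat 1" using matrix_left_right_inverse by blast
 have "g e p *v v = gr e h p"
  unfolding v_def by (simp add: matrix_vector_mul_assoc metric_inv[OF e])
 hence "transpose j *v (g c p *v (j *v v)) = transpose j *v gr c h p"
  unfolding metric_change[OF e(1) c(1) p] j_def[symmetric] ch[OF f(2)]
  by (simp add: matrix_vector_mul_assoc matrix_mul_assoc)
 hence "g c p *v (j *v v) = gr c h p"
  by (metis tj matrix_vector_mul_assoc matrix_vector_mul_lid)
 hence "j *v v = Gi c p *v gr c h p"
  by (metis metric_inv(2)[OF c] matrix_vector_mul_assoc matrix_vector_mul_lid)
 moreover have "\<Gamma> f h p = gr c f p \<bullet> (j *v v)"
  unfolding \<Gamma>_def e_def[symmetric] v_def[symmetric] ch[OF f(1)] by (simp add: dot_lmul_matrix)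
 ultimately show ?thesis by simp
qed

lemma metric_inv_sym:
 assumes "c \<in> A" "p \<in> dom_of c"
 shows "v \<bullet> (Gi c p *v w) = w \<bullet> (Gi c p *v v)" "v \<bullet> (Gi c p *v v) \<ge> 0"
proof -
 have g: "x \<bullet> (g c p *v y) = y \<bullet> (g c p *v x)" for x y
  using metric_sym[OF assms] by (metis dot_lmul_matrix inner_commute transpose_matrix_vector)
 have gi: "g c p *v (Gi c p *v x) = x" for x by (simp add: matrix_vector_mul_assoc metric_inv[OF assms])
 show "v \<bullet> (Gi c p *v w) = w \<bullet> (Gi c p *v v)" using g[of "Gi c p *v w" "Gi c p *v v"] by (simp add: gi inner_commute)
 show "v \<bullet> (Gi c p *v v) \<ge> 0"
  using metric_pos[OF assms, of "Gi c p *v v"] by (cases "Gi c p *v v = 0") (auto simp: gi inner_commute less_imp_le)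
qed

text \<open>Cramer's rule: the entry is det N / det G, where N is G with column i replaced by the
  j-th unit vector.\<close>

lemma Gi_C1:
 assumes c: "c \<in> A"
 shows "C1 (img_of c) (\<lambda>y. Gi c (inv_of c y) $ i $ j)"
proof -
 let ?G = "\<lambda>y. g c (inv_of c y)"
 let ?N = "\<lambda>y. (\<chi> a b. if b = i then axis j 1 $ a else ?G y $ a $ b) :: real^'n^'n"
 have pos: "det (?G y) > 0" if "y \<in> img_of c" for y using metric_det[OF c chart(7)[OF c that]] .
 have N: "C1 (img_of c) (\<lambda>y. ?N y $ a $ b)" for a b
  by (cases "b = i") (simp_all add: C1_const metric_C1[OF c])
 have z: "\<forall>s\<in>(\<lambda>y. det (?G y)) ` img_of c. s \<noteq> 0" using pos by fastforce
 have "C1 (img_of c) (\<lambda>y. inverse (det (?G y)))"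
 proof (rule C1_comp[OF C1_det[OF metric_C1[OF c]]])
  show "(inverse has_real_derivative - (inverse (det (?G y)) ^ Suc (Suc 0))) (at (det (?G y)))" if "y \<in> img_of c" for y
   using pos[OF that] by (intro DERIV_inverse) simp
  show "continuous_on ((\<lambda>y. det (?G y)) ` img_of c) (\<lambda>s. - (inverse s ^ Suc (Suc 0)))"
   using z by (intro continuous_intros)
 qed
 hence "C1 (img_of c) (\<lambda>y. det (?N y) * inverse (det (?G y)))" by (intro C1_mult C1_det N)
 thus ?thesis
 proof (rule C1_cong[OF chart(2)[OF c]])
  fix y assume y: "y \<in> img_of c"
  have "?G y *v (Gi c (inv_of c y) *v axis j 1) = axis j 1"
   by (simp add: matrix_vector_mul_assoc metric_inv[OF c chart(7)[OF c y]])
  hence "Gi c (inv_of c y) *v axis j 1 = (\<chi> k. det (\<chi> a b. if b = k then axis j 1 $ a else ?G y $ a $ b) / det (?G y))"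
   using cramer[of "?G y"] pos[OF y] by simp
  from arg_cong[OF this, of "\<lambda>v. v $ i"] show "det (?N y) * inverse (det (?G y)) = Gi c (inv_of c y) $ i $ j"
   by (simp add: matrix_vector_mul_component inner_axis divide_inverse)
 qed
qed

lemma \<Gamma>_continuous:
 assumes f: "f \<in> D1" "h \<in> D1"
 shows "continuous_on UNIV (\<Gamma> f h)"
proof (rule continuous_charts)
 fix c assume c: "c \<in> A"
 have gc: "continuous_on (img_of c) (\<lambda>y. gr c k (inv_of c y) $ i)" if "k \<in> D1" for k i
 proof -
  have "continuous_on (img_of c) (\<lambda>y. partial i (k \<circ> inv_of c) y)"
   using D1_C1[OF that c] unfolding C1_def partial_def by blast
  thus ?thesis by (rule continuous_on_eq) (simp add: gr_def chart(6)[OF c])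
 qed
 have "continuous_on (img_of c) (\<lambda>y. \<Sum>i\<in>UNIV. gr c f (inv_of c y) $ i * (\<Sum>j\<in>UNIV. Gi c (inv_of c y) $ i $ j * gr c h (inv_of c y) $ j))"
  by (intro continuous_on_sum continuous_on_mult gc f C1_continuous[OF Gi_C1[OF c]])
 thus "continuous_on (img_of c) (\<Gamma> f h \<circ> inv_of c)"
 proof (rule continuous_on_eq)
  fix y assume y: "y \<in> img_of c"
  show "(\<Sum>i\<in>UNIV. gr c f (inv_of c y) $ i * (\<Sum>j\<in>UNIV. Gi c (inv_of c y) $ i $ j * gr c h (inv_of c y) $ j)) = (\<Gamma> f h \<circ> inv_of c) y"
   by (simp add: \<Gamma>_chart[OF c chart(7)[OF c y] f] inner_vec_def matrix_vector_mult_def)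
 qed
qed

lemma carre_sym: "f \<in> D1 ==> h \<in> D1 ==> \<Gamma> f h = \<Gamma> h f"
 using metric_inv_sym(1)[OF chart_at] by (auto simp: fun_eq_iff \<Gamma>_def)

lemma \<Gamma>_support:
 assumes "f \<in> D1" "h \<in> D1" "x \<notin> closure {x. f x \<noteq> 0}"
 shows "\<Gamma> f h x = 0"
proof -
 define c where "c = chart_at A x"
 have c: "c \<in> A" "x \<in> dom_of c" unfolding c_def by (rule chart_at)+
 let ?U = "dom_of c - closure {x. f x \<noteq> 0}"
 have o: "open (snd c ` ?U)" by (rule open_image[OF c(1)]) (use chart(1)[OF c(1)] in auto)
 have "((f \<circ> inv_of c) has_derivative (\<lambda>v. 0 \<bullet> v)) (at (snd c x))"
 proof (rule has_derivative_transform_within_open[OF _ o])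
  show "((\<lambda>_. 0) has_derivative (\<lambda>v. 0 \<bullet> v)) (at (snd c x))" by simp
  show "snd c x \<in> snd c ` ?U" using c assms(3) by blast
  fix y assume "y \<in> snd c ` ?U"
  then obtain q where q: "y = snd c q" "q \<in> dom_of c" "q \<notin> closure {x. f x \<noteq> 0}" by blast
  thus "0 = (f \<circ> inv_of c) y" using support_outside[OF q(3)] chart(5)[OF c(1) q(2)] by simp
 qed
 from gr_eqI[OF this] show ?thesis by (simp add: \<Gamma>_def c_def)
qed

lemma carre_bfs: "f \<in> DD ==> h \<in> D1 ==> \<Gamma> f h \<in> bfs M"
 by (rule cont_bfs[OF \<Gamma>_continuous, of _ _ "closure {x. f x \<noteq> 0}"])
  (auto simp: DD_def intro: \<Gamma>_support)

lemma carre_add: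
 assumes "f \<in> D1" "f' \<in> D1"
 shows "\<Gamma> (\<lambda>x. f x + f' x) h = (\<lambda>x. \<Gamma> f h x + \<Gamma> f' h x)"
proof
 fix p
 let ?c = "chart_at A p"
 have "gr ?c (\<lambda>x. f x + f' x) p = gr ?c f p + gr ?c f' p"
  using has_derivative_add[OF chart_derivative[OF assms(1) chart_at] chart_derivative[OF assms(2) chart_at], of p]
  by (intro gr_eqI) (simp add: o_def inner_add_left)
 thus "\<Gamma> (\<lambda>x. f x + f' x) h p = \<Gamma> f h p + \<Gamma> f' h p" by (simp add: \<Gamma>_def inner_add_left)
qed

lemma carre_comp:
 assumes "f \<in> D1" "C1_fun P P'"
 shows "\<Gamma> (\<lambda>x. P (f x)) h = (\<lambda>x. P' (f x) * \<Gamma> f h x)"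
proof
 fix p
 let ?c = "chart_at A p"
 have d: "(P has_derivative (*) (P' (f p))) (at (f p))" using assms(2) unfolding C1_fun_def has_field_derivative_def by blast
 have e: "(f \<circ> inv_of ?c) (snd ?c p) = f p" using chart(5)[OF chart_at, of p] by simp
 have "gr ?c (\<lambda>x. P (f x)) p = P' (f p) *\<^sub>R gr ?c f p"
  using diff_chain_at[OF chart_derivative[OF assms(1) chart_at], of P "(*) (P' (f p))" p, unfolded e, OF d]
  by (intro gr_eqI) (simp add: o_def)
 thus "\<Gamma> (\<lambda>x. P (f x)) h p = P' (f p) * \<Gamma> f h p" by (simp add: \<Gamma>_def)
qed

end

locale fast_diffusion = riemannian A g
 for A :: "('a::{t2_space,second_countable_topology}, 'n::finite) chart set" and g :: "('a, 'n) metric_tensor" +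
 fixes m :: real
 assumes m: "0 < m" "m < 1"

sublocale fast_diffusion \<subseteq> dirichlet_form "volume_measure A g" DD \<Gamma> m
proof
 show "0 \<le> \<Gamma> f f x" if "f \<in> DD" for f x
  using metric_inv_sym(2)[OF chart_at] by (simp add: \<Gamma>_def)
qed (auto intro: m DD_bfs DD_0 DD_add DD_comp carre_bfs carre_sym carre_add carre_comp DD_D1)

section \<open>Green's formula and the Laplace--Beltrami operator\<close>

lemma partial_cong:
 assumes "open S" "y \<in> S" "\<And>z. z \<in> S ==> f z = h z"
 shows "partial i f y = partial i h y"
proof -
 have "(f has_derivative D) (at y) \<longleftrightarrow> (h has_derivative D) (at y)" for D
  using has_derivative_transform_within_open[of f D y UNIV S h] has_derivative_transform_within_open[of h D y UNIV S f] assms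
  by (metis (no_types, lifting))
 thus ?thesis by (simp add: partial_def frechet_derivative_def)
qed

lemma partial_const: "partial i (\<lambda>_. c) y = 0"
 by (simp add: partial_def frechet_derivative_const)

lemma C1_partial: "C1 S f ==> continuous_on S (partial i f)"
 unfolding C1_def partial_def by blast

lemma partial_mult:
 assumes "C1 S f" "C1 S h" "y \<in> S"
 shows "partial i (\<lambda>y. f y * h y) y = f y * partial i h y + partial i f y * h y"
 unfolding partial_def
 using frechet_derivative_eqI[OF has_derivative_mult[OF C1_has_derivative[OF assms(1,3)] C1_has_derivative[OF assms(2,3)]]]
 by simp

lemma partial_sum:
 assumes "\<And>j. j \<in> I ==> C1 S (f j)" "y \<in> S"
 shows "partial i (\<lambda>y. \<Sum>j\<in>I. f j y) y = (\<Sum>j\<in>I. partial i (f j) y)"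
 unfolding partial_def
 using frechet_derivative_eqI[OF has_derivative_sum[of I f "\<lambda>j. frechet_derivative (f j) (at y)" "at y"]]
  C1_has_derivative[OF assms] by simp

text \<open>Difference quotients integrate to 0 by translation invariance. They are bounded and
  supported in one compact set, so dominated convergence passes this on to the derivative.\<close>

lemma integral_partial_zero:
 fixes H :: "real^'n::finite \<Rightarrow> real"
 assumes H: "C1 UNIV H" and K: "compact K" "\<And>y. y \<notin> K ==> H y = 0"
 shows "integrable lborel (partial i H)" "(LBINT y. partial i H y) = 0"
proof -
 let ?v = "axis i 1 :: real^'n"
 let ?H = "partial i H"
 define a where "a n = inverse (real (Suc n))" for n
 have a: "0 < a n" "a n \<le> 1" for n by (simp_all add: a_def field_simps)
 \<comment> \<open>Contains every point that some shift by s ?v with 0 \<le> s \<le> 1 moves into K;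
   since a n \<le> 1, each D n vanishes outside.\<close>
 define K' where "K' = (\<lambda>(x, s). x - s *\<^sub>R ?v) ` (K \<times> {0..1::real})"
 have K': "compact K'" unfolding K'_def split_def
  by (intro compact_continuous_image compact_Times K continuous_intros) simp
 have Ho: "?H y = 0" if "y \<notin> K" for y
  using partial_cong[of "- K" y H "\<lambda>_. 0" i] that K(2) open_Compl[OF compact_imp_closed[OF K(1)]] partial_const[of i 0 y] by simp
 have cH: "continuous_on UNIV ?H" by (rule C1_partial[OF H])
 have "bounded (?H ` K)" by (intro compact_imp_bounded compact_continuous_image continuous_on_subset[OF cH] K) simp
 then obtain C where C: "\<forall>x\<in>?H ` K. norm x \<le> C" unfolding bounded_iff by blast
 have b: "\<bar>?H y\<bar> \<le> \<bar>C\<bar>" for y using C Ho[of y] by (cases "y \<in> K") (auto intro: order_trans)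
 have d: "((\<lambda>s. H (y + s *\<^sub>R ?v)) has_real_derivative ?H (y + s *\<^sub>R ?v)) (at s)" for y s
 proof -
  let ?F = "frechet_derivative H (at (y + s *\<^sub>R ?v))"
  have F: "(H has_derivative ?F) (at (y + s *\<^sub>R ?v))" using C1_has_derivative[OF H] by simp
  have "((\<lambda>s. y + s *\<^sub>R ?v) has_derivative (\<lambda>r. r *\<^sub>R ?v)) (at s)" by (auto intro!: derivative_eq_intros)
  from diff_chain_at[OF this F] have "((\<lambda>s. H (y + s *\<^sub>R ?v)) has_derivative (\<lambda>r. ?F (r *\<^sub>R ?v))) (at s)" by (simp add: o_def)
  moreover have "(\<lambda>r. ?F (r *\<^sub>R ?v)) = (*) (?H (y + s *\<^sub>R ?v))"
   using linear_scale[OF has_derivative_linear[OF F]] by (simp add: fun_eq_iff partial_def mult.commute)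
  ultimately show ?thesis by (simp add: has_field_derivative_def)
 qed
 define D where "D n y = (H (y + a n *\<^sub>R ?v) - H y) / a n" for n y
 have Db: "\<bar>D n y\<bar> \<le> \<bar>C\<bar> * indicator K' y" for n y
 proof (cases "y \<in> K'")
  case True
  obtain z where "H (y + a n *\<^sub>R ?v) - H (y + 0 *\<^sub>R ?v) = (a n - 0) * ?H (y + z *\<^sub>R ?v)"
   using MVT2[OF a(1)[of n], of "\<lambda>s. H (y + s *\<^sub>R ?v)" "\<lambda>s. ?H (y + s *\<^sub>R ?v)"] d by blast
  hence "D n y = ?H (y + z *\<^sub>R ?v)" using a(1)[of n] by (simp add: D_def field_simps)
  thus ?thesis using b True by simp
 next
  case False
  have "y - 0 *\<^sub>R ?v \<in> K'" if "y \<in> K" unfolding K'_def using that by force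
  moreover have "(y + a n *\<^sub>R ?v) - a n *\<^sub>R ?v \<in> K'" if "y + a n *\<^sub>R ?v \<in> K"
   unfolding K'_def using that a[of n] by (intro image_eqI[of _ _ "(y + a n *\<^sub>R ?v, a n)"]) auto
  ultimately have "y \<notin> K" "y + a n *\<^sub>R ?v \<notin> K" using False by auto
  thus ?thesis by (simp add: D_def K(2))
 qed
 have mH: "H \<in> borel_measurable borel" by (rule borel_measurable_continuous_onI[OF C1_continuous[OF H]])
 have iH: "integrable lborel H"
 proof -
  have "integrable lborel (\<lambda>y. indicator K y *\<^sub>R H y)"
   by (rule borel_integrable_compact[OF K(1) continuous_on_subset[OF C1_continuous[OF H]]]) simp
  also have "(\<lambda>y. indicator K y *\<^sub>R H y) = H"
  proof
   show "indicator K y *\<^sub>R H y = H y" for y using K(2)[of y] by (cases "y \<in> K") simp_all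
  qed
  finally show ?thesis .
 qed
 have tr: "integrable lborel (\<lambda>y. H (y + w))" "(LBINT y. H (y + w)) = (LBINT y. H y)" for w
 proof -
  have i: "integrable (distr lborel borel ((+) w)) H" using iH by (simp add: lborel_distr_plus)
  show "integrable lborel (\<lambda>y. H (y + w))"
   using integrable_distr[OF _ i] by (simp add: add.commute)
  have "(\<integral>y. H y \<partial>distr lborel borel ((+) w)) = (LBINT y. H (w + y))" using mH by (intro integral_distr) auto
  thus "(LBINT y. H (y + w)) = (LBINT y. H y)" by (simp add: lborel_distr_plus add.commute)
 qed
 have "(LBINT y. D n y) = 0" for n
  unfolding D_def using tr iH by simp
 moreover have lim: "(\<lambda>n. D n y) \<longlonglongrightarrow> ?H y" for y
 proof -
  have "((\<lambda>s. (H (y + s *\<^sub>R ?v) - H y) / s) \<longlongrightarrow> ?H y) (at 0)"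
   using d[of y 0] by (simp add: has_field_derivative_iff)
  moreover have "filterlim a (at 0) sequentially"
   unfolding filterlim_at using a(1) LIMSEQ_inverse_real_of_nat by (auto simp: a_def[abs_def])
  ultimately show ?thesis unfolding D_def by (rule filterlim_compose)
 qed
 have iK: "integrable lborel (\<lambda>y. \<bar>C\<bar> * indicator K' y)"
  using borel_integrable_compact[OF K', of "\<lambda>_. \<bar>C\<bar>"] by (simp add: mult.commute)
 have dm: "D n \<in> borel_measurable lborel" for n
  unfolding D_def using measurable_compose[OF _ mH] by measurable
 have hm: "?H \<in> borel_measurable lborel" using borel_measurable_continuous_onI[OF cH] by simp
 have ae: "AE y in lborel. (\<lambda>n. D n y) \<longlonglongrightarrow> ?H y" "\<And>n. AE y in lborel. norm (D n y) \<le> \<bar>C\<bar> * indicator K' y"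
  using lim Db by auto
 show "integrable lborel ?H" by (rule integrable_dominated_convergence[OF hm dm iK ae])
 have "(\<lambda>n. LBINT y. D n y) \<longlonglongrightarrow> (LBINT y. ?H y)"
  by (rule integral_dominated_convergence[OF hm dm iK ae])
 thus "(LBINT y. ?H y) = 0" using calculation LIMSEQ_unique[OF _ tendsto_const, of _ "LBINT y. ?H y"] by simp
qed

context fast_diffusion begin

definition flux :: "('a, 'n) chart \<Rightarrow> (real^'n \<Rightarrow> real) \<Rightarrow> 'n \<Rightarrow> real^'n \<Rightarrow> real" where
 "flux c F i y = \<rho> c y * (\<Sum>j\<in>UNIV. Gi c (inv_of c y) $ i $ j * partial j F y)"

definition Lap :: "('a, 'n) chart \<Rightarrow> (real^'n \<Rightarrow> real) \<Rightarrow> real^'n \<Rightarrow> real" where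
 "Lap c F y = (\<Sum>i\<in>UNIV. partial i (flux c F i) y) / \<rho> c y"

text \<open>Second derivatives are asked for in the single chart c and only over U; otherwise \<eta>
  is merely C^1.\<close>

definition C2 :: "('a, 'n) chart \<Rightarrow> 'a set \<Rightarrow> 'a fn \<Rightarrow> bool" where
 "C2 c U \<eta> \<longleftrightarrow> c \<in> A \<and> open U \<and> U \<subseteq> dom_of c \<and> \<eta> \<in> D1 \<and> (\<forall>j. C1 (snd c ` U) (partial j (\<eta> \<circ> inv_of c)))"

abbreviation "LL c \<eta> p \<equiv> Lap c (\<eta> \<circ> inv_of c) (snd c p)"

lemma laplace_beltrami_LL: "laplace_beltrami A g \<eta> p = LL (chart_at A p) \<eta> p"
 by (simp add: laplace_beltrami_def Lap_def flux_def[abs_def] Gi_def Let_def)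

lemma flux_C1:
 assumes "C2 c U \<eta>" shows "C1 (snd c ` U) (flux c (\<eta> \<circ> inv_of c) i)"
proof -
 have c: "c \<in> A" "snd c ` U \<subseteq> img_of c" and p: "\<And>j. C1 (snd c ` U) (partial j (\<eta> \<circ> inv_of c))"
  using assms by (auto simp: C2_def)
 show ?thesis unfolding flux_def
  by (intro C1_mult[OF C1_subset[OF density_C1[OF c(1)] c(2)]] C1_sum C1_mult[OF C1_subset[OF Gi_C1[OF c(1)] c(2)]] p finite)
qed

lemma LL_continuous:
 assumes "C2 c U \<eta>" shows "continuous_on U (LL c \<eta>)"
proof -
 have c: "c \<in> A" "snd c ` U \<subseteq> img_of c" "U \<subseteq> dom_of c" using assms by (auto simp: C2_def)
 have "continuous_on (snd c ` U) (Lap c (\<eta> \<circ> inv_of c))" unfolding Lap_def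
  using C1_partial[OF flux_C1[OF assms]] continuous_on_subset[OF C1_continuous[OF density_C1[OF c(1)]] c(2)] density_pos[OF c(1)] c(2)
  by (intro continuous_on_divide continuous_on_sum) (auto simp: less_imp_neq[symmetric])
 thus ?thesis by (rule continuous_on_compose2[OF _ continuous_on_subset[OF chart(3)[OF c(1)] c(3)]]) simp
qed

lemma Lap_zero:
 assumes "open S" "y \<in> S" "\<And>z. z \<in> S ==> F z = 0" shows "Lap c F y = 0"
proof -
 have "partial j F z = 0" if "z \<in> S" for j z
  using partial_cong[OF assms(1) that, of F "\<lambda>_. 0" j] assms(3) partial_const[of j 0 z] by simp
 hence "partial i (flux c F i) y = 0" for i
  using partial_cong[OF assms(1,2), of "flux c F i" "\<lambda>_. 0" i] partial_const[of i 0 y] by (simp add: flux_def)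
 thus ?thesis by (simp add: Lap_def)
qed

lemma LL_zero:
 assumes c: "c \<in> A" "q \<in> dom_of c" and q: "q \<notin> closure {x. \<eta> x \<noteq> 0}"
 shows "LL c \<eta> q = 0"
proof (rule Lap_zero)
 let ?V = "dom_of c - closure {x. \<eta> x \<noteq> 0}"
 show "open (snd c ` ?V)" by (rule open_image[OF c(1)]) (use chart(1)[OF c(1)] in auto)
 show "snd c q \<in> snd c ` ?V" using c q by blast
 fix z assume "z \<in> snd c ` ?V"
 then obtain q' where "q' \<in> dom_of c" "q' \<notin> closure {x. \<eta> x \<noteq> 0}" "z = snd c q'" by blast
 thus "(\<eta> \<circ> inv_of c) z = 0" using support_outside[of q' \<eta>] chart(5)[OF c(1), of q'] by simp
qed

text \<open>Integration by parts in one chart. The field f times flux is extended by 0 to the whole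
  Euclidean space, where its divergence integrates to 0; the extension is C^1 because f has compact
  support in U.\<close>

lemma green:
 assumes \<eta>: "C2 c U \<eta>" and f: "f \<in> DD" "closure {x. f x \<noteq> 0} \<subseteq> U"
 shows "(\<lambda>p. f p * LL c \<eta> p) \<in> bfs M" "(LINT p|M. \<Gamma> f \<eta> p + f p * LL c \<eta> p) = 0"
proof -
 let ?S = "closure {x. f x \<noteq> 0}"
 have c: "c \<in> A" "open U" "U \<subseteq> dom_of c" "\<eta> \<in> D1" and fD: "f \<in> D1" "compact ?S"
  using \<eta> f by (auto simp: C2_def DD_def)
 have sd: "?S \<subseteq> dom_of c" using f(2) c(3) by blast
 let ?h = "\<lambda>p. f p * LL c \<eta> p"
 have "continuous_on (U \<union> - ?S) ?h"
 proof (rule continuous_on_open_Un[OF c(2) open_Compl[OF closed_closure]])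
  show "continuous_on U ?h"
   by (intro continuous_on_mult LL_continuous[OF \<eta>] continuous_on_subset[OF D1_continuous[OF fD(1)]]) simp
  show "continuous_on (- ?S) ?h"
  proof (rule continuous_on_eq[OF continuous_on_const[of _ 0]])
   show "0 = ?h x" if "x \<in> - ?S" for x using support_outside[of x f] that by (metis ComplD mult_zero_left)
  qed
 qed
 moreover have "U \<union> - ?S = UNIV" using f(2) by blast
 ultimately have ch: "continuous_on UNIV ?h" by simp
 have h0: "?h x = 0" if "x \<notin> ?S" for x using support_outside[OF that] by simp
 show "?h \<in> bfs M" by (rule cont_bfs[OF ch fD(2) h0])
 let ?f = "f \<circ> inv_of c" and ?F = "flux c (\<eta> \<circ> inv_of c)"
 define K where "K = snd c ` ?S"
 have K: "compact K" unfolding K_def by (rule compact_continuous_image[OF continuous_on_subset[OF chart(3)[OF c(1)] sd] fD(2)])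
 have Ko: "open (- K)" by (rule open_Compl[OF compact_imp_closed[OF K]])
 have Uo: "open (snd c ` U)" by (rule open_image[OF c(1,2,3)])
 have UK: "snd c ` U \<union> - K = UNIV" using f(2) unfolding K_def by blast
 have Ui: "snd c ` U \<subseteq> img_of c" using c(3) by blast
 have ns: "inv_of c y \<notin> ?S" if "y \<in> img_of c" "y \<notin> K" for y
  proof
  assume "inv_of c y \<in> ?S"
  hence "snd c (inv_of c y) \<in> K" unfolding K_def by blast
  thus False using that chart(6)[OF c(1) that(1)] by simp
 qed
 define H where "H i y = (if y \<in> img_of c then ?f y * ?F i y else 0)" for i y
 have HK: "H i y = 0" if "y \<notin> K" for i y using ns[OF _ that] support_outside[of "inv_of c y" f] by (auto simp: H_def)
 have fC: "C1 (snd c ` U) ?f" by (rule C1_subset[OF D1_C1[OF fD(1) c(1)] Ui])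
 have HU: "?f y * ?F i y = H i y" if "y \<in> snd c ` U" for i y using that Ui by (auto simp: H_def)
 have "C1 (snd c ` U \<union> - K) (H i)" for i
 proof (rule C1_union[OF Uo Ko])
  show "C1 (snd c ` U) (H i)" by (rule C1_cong[OF Uo C1_mult[OF fC flux_C1[OF \<eta>]] HU])
  show "C1 (- K) (H i)" by (rule C1_cong[OF Ko C1_const[of _ 0]]) (use HK in simp)
 qed
 hence H: "C1 UNIV (H i)" for i by (simp add: UK)
 have "(LINT p|M. \<Gamma> f \<eta> p + f p * LL c \<eta> p) =
   (LBINT y. indicator (img_of c) y * ((\<Gamma> f \<eta> (inv_of c y) + f (inv_of c y) * LL c \<eta> (inv_of c y)) * \<rho> c y))"
 proof (rule chart_integral[OF c(1)])
  show "(\<lambda>p. \<Gamma> f \<eta> p + f p * LL c \<eta> p) \<in> borel_measurable borel"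
   by (intro borel_measurable_continuous_onI continuous_on_add \<Gamma>_continuous ch fD c)
  show "\<Gamma> f \<eta> p + f p * LL c \<eta> p = 0" if "p \<notin> dom_of c" for p
  proof -
   have "p \<notin> ?S" using that sd by blast
   thus ?thesis using \<Gamma>_support[OF fD(1) c(4)] h0 by simp
  qed
 qed
 also have "\<dots> = (LBINT y. (\<Sum>i\<in>UNIV. partial i (H i) y))"
 proof (intro Bochner_Integration.integral_cong refl)
  fix y
  show "indicator (img_of c) y * ((\<Gamma> f \<eta> (inv_of c y) + f (inv_of c y) * LL c \<eta> (inv_of c y)) * \<rho> c y) = (\<Sum>i\<in>UNIV. partial i (H i) y)"
  proof (cases "y \<in> K")
   case False
   have "partial i (H i) y = 0" for i
    using partial_cong[OF Ko, of y "H i" "\<lambda>_. 0" i] HK False partial_const[of i 0 y] by simp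
   moreover have "\<Gamma> f \<eta> (inv_of c y) + f (inv_of c y) * LL c \<eta> (inv_of c y) = 0" if "y \<in> img_of c"
    using \<Gamma>_support[OF fD(1) c(4) ns[OF that False]] h0[OF ns[OF that False]] by simp
   ultimately show ?thesis by (auto simp: indicator_def)
  next
   case True
   hence y: "y \<in> snd c ` U" "y \<in> img_of c" using f(2) c(3) unfolding K_def by blast+
   note iv = chart(7,6)[OF c(1) y(2)]
   have "partial i (H i) y = ?f y * partial i (?F i) y + partial i ?f y * ?F i y" for i
    unfolding partial_mult[OF fC flux_C1[OF \<eta>] y(1), symmetric]
    using HU by (intro partial_cong[OF Uo y(1)]) auto
   moreover have "\<Gamma> f \<eta> (inv_of c y) * \<rho> c y = (\<Sum>i\<in>UNIV. partial i ?f y * ?F i y)"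
    by (simp add: \<Gamma>_chart[OF c(1) iv(1) fD(1) c(4)] inner_vec_def matrix_vector_mult_def gr_def iv(2) flux_def sum_distrib_right sum_distrib_left mult_ac)
   moreover have "LL c \<eta> (inv_of c y) * \<rho> c y = (\<Sum>i\<in>UNIV. partial i (?F i) y)"
    using density_pos[OF c(1) y(2)] by (simp add: iv(2) Lap_def)
   ultimately show ?thesis using y(2)
    by (simp add: indicator_def sum.distrib sum_distrib_left[symmetric] distrib_right mult.assoc)
  qed
 qed
 also have "\<dots> = 0"
  using integral_partial_zero[OF H K HK] by (simp add: Bochner_Integration.integral_sum)
 finally show "(LINT p|M. \<Gamma> f \<eta> p + f p * LL c \<eta> p) = 0" .
qed

text \<open>In the chart c the bump is the cube of the positive part of 1 - |y - y0|^2 / r^2, which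
  is twice continuously differentiable across the sphere. In the other charts only C^1 is claimed,
  by composition with the transition map.\<close>

lemma bump_ex:
 assumes U: "open U" "p \<in> U"
 shows "\<exists>c \<beta>. C2 c (dom_of c) \<beta> \<and> \<beta> \<in> DD \<and> (\<forall>x. 0 \<le> \<beta> x) \<and> \<beta> p = 1 \<and> closure {x. \<beta> x \<noteq> 0} \<subseteq> U \<inter> dom_of c"
proof -
 obtain c where c: "c \<in> A" "p \<in> dom_of c" using chart_ex by blast
 define V where "V = U \<inter> dom_of c"
 have V: "open V" "p \<in> V" "V \<subseteq> dom_of c" using U c chart(1)[OF c(1)] by (auto simp: V_def)
 define y0 where "y0 = snd c p"
 obtain r where r: "r > 0" "cball y0 r \<subseteq> snd c ` V"
  using open_image[OF c(1) V(1,3), unfolded open_contains_cball] V(2) unfolding y0_def by blast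
 define K where "K = inv_of c ` cball y0 r"
 have ci: "cball y0 r \<subseteq> img_of c" using r(2) V(3) by blast
 have K: "compact K" "closed K" "K \<subseteq> V"
 proof -
  show "compact K" unfolding K_def
   by (rule compact_continuous_image[OF continuous_on_subset[OF chart(4)[OF c(1)] ci]]) simp
  thus "closed K" by (rule compact_imp_closed)
  show "K \<subseteq> V"
  proof
   fix q assume "q \<in> K"
   then obtain y where "y \<in> cball y0 r" "q = inv_of c y" unfolding K_def by blast
   moreover obtain q' where "q' \<in> V" "y = snd c q'" using calculation r(2) by blast
   ultimately show "q \<in> V" using chart(5)[OF c(1), of q'] V(3) by auto
  qed
 qed
 define b where "b y = 1 - ((y - y0) \<bullet> (y - y0)) / r\<^sup>2" for y
 define P where "P s = s * (max 0 s)\<^sup>2" for s :: real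
 have P: "(P has_real_derivative 3 * (max 0 s)\<^sup>2) (at s)" for s
  unfolding P_def[abs_def]
  by (rule derivative_eq_intros max_sq_deriv refl)+ (simp add: max_def power2_eq_square)
 define b' where "b' y v = - (2 * ((y - y0) \<bullet> v) / r\<^sup>2)" for y v
 have bd: "(b has_derivative b' y) (at y)" for y
  unfolding b_def[abs_def] b'_def[abs_def] using r(1)
  by (auto intro!: derivative_eq_intros simp: inner_commute fun_eq_iff field_simps)
 have b'c: "C1 UNIV (\<lambda>y. b' y v)" for v
  unfolding b'_def by (rule C1_I[of _ _ "\<lambda>y w. - (2 * (w \<bullet> v) / r\<^sup>2)"])
   (use r(1) in \<open>auto intro!: derivative_eq_intros continuous_intros simp: field_simps fun_eq_iff\<close>)
 have bC: "C1 UNIV b" by (rule C1_I[OF bd C1_continuous[OF b'c]])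
 have BC: "C1 UNIV (\<lambda>y. P (b y))"
  by (rule C1_comp[OF bC P]) (intro continuous_intros)
 have "frechet_derivative (\<lambda>y. P (b y)) (at y) = (\<lambda>v. 3 * (max 0 (b y))\<^sup>2 * b' y v)" for y
  using diff_chain_at[OF bd has_field_derivative_imp_has_derivative[OF P]]
  by (intro frechet_derivative_eqI) (simp add: o_def)
 hence pB: "partial j (\<lambda>y. P (b y)) = (\<lambda>y. 3 * (max 0 (b y))\<^sup>2 * b' y (axis j 1))" for j
  by (simp add: partial_def fun_eq_iff)
 have "C1 UNIV (\<lambda>y. (max 0 (b y))\<^sup>2)"
  by (rule C1_comp[OF bC max_sq_deriv]) (intro continuous_intros)
 hence pBC: "C1 UNIV (partial j (\<lambda>y. P (b y)))" for j
  unfolding pB by (intro C1_mult[OF C1_mult[OF C1_const]] b'c)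
 define \<beta> where "\<beta> q = (if q \<in> dom_of c then P (b (snd c q)) else 0)" for q
 have \<beta>0: "\<beta> q = 0" if "q \<notin> K" for q
 proof (cases "q \<in> dom_of c")
  case True
  hence "snd c q \<notin> cball y0 r" using that chart(5)[OF c(1) True] unfolding K_def by (metis image_eqI)
  hence "r\<^sup>2 < (dist y0 (snd c q))\<^sup>2" using r(1) by (intro power_strict_mono) auto
  also have "(dist y0 (snd c q))\<^sup>2 = (snd c q - y0) \<bullet> (snd c q - y0)"
   by (metis dist_commute dist_norm power2_norm_eq_inner)
  finally have "b (snd c q) < 0" using r(1) by (simp add: b_def)
  thus ?thesis by (simp add: \<beta>_def P_def)
 qed (simp add: \<beta>_def)
 have Pn: "P s \<ge> 0" for s by (cases "s \<ge> 0") (simp_all add: P_def)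
 have D1: "\<beta> \<in> D1" unfolding D1_def mem_Collect_eq
 proof
  fix d assume d: "d \<in> A"
  let ?W = "snd d ` (dom_of d \<inter> dom_of c)" and ?W' = "snd d ` (dom_of d - K)"
  have o: "open ?W" "open ?W'" using chart(1)[OF d] chart(1)[OF c(1)] K(2) by (intro open_image[OF d]; blast)+
  have "?W \<union> ?W' = img_of d" using K(3) V(3) by blast
  moreover have "C1 (?W \<union> ?W') (\<beta> \<circ> inv_of d)"
  proof (rule C1_union[OF o])
   show "C1 ?W (\<beta> \<circ> inv_of d)"
   proof (rule C1_cong[OF o(1) C1_compose[OF BC transition[OF d c(1)]]])
    fix y assume "y \<in> ?W"
    thus "P (b ((snd c \<circ> inv_of d) y)) = (\<beta> \<circ> inv_of d) y" using chart(5)[OF d] by (auto simp: \<beta>_def)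
   qed simp
   show "C1 ?W' (\<beta> \<circ> inv_of d)"
   proof (rule C1_cong[OF o(2) C1_const[of _ 0]])
    fix y assume "y \<in> ?W'"
    thus "0 = (\<beta> \<circ> inv_of d) y" using chart(5)[OF d] \<beta>0 by auto
   qed
  qed
  ultimately show "C1 (img_of d) (\<beta> \<circ> inv_of d)" by simp
 qed
 have cl: "closure {x. \<beta> x \<noteq> 0} \<subseteq> K" using \<beta>0 by (intro closure_minimal[OF _ K(2)]) blast
 have DD: "\<beta> \<in> DD"
  using D1 compact_support_subset[of K "{x. \<beta> x \<noteq> 0}"] K(1,2) \<beta>0 by (auto simp: DD_def closure_closed)
 have "C1 (img_of c) (partial j (\<beta> \<circ> inv_of c))" for j
 proof (rule C1_cong[OF chart(2)[OF c(1)] C1_subset[OF pBC subset_UNIV]])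
  fix y assume y: "y \<in> img_of c"
  show "partial j (\<lambda>y. P (b y)) y = partial j (\<beta> \<circ> inv_of c) y"
   by (rule partial_cong[OF chart(2)[OF c(1)] y]) (simp add: \<beta>_def chart(6,7)[OF c(1)])
 qed
 hence "C2 c (dom_of c) \<beta>" using c(1) chart(1)[OF c(1)] D1 by (auto simp: C2_def)
 moreover have "\<beta> p = 1" using c(2) by (simp add: \<beta>_def P_def b_def y0_def)
 moreover have "\<forall>x. 0 \<le> \<beta> x" using Pn by (simp add: \<beta>_def)
 moreover have "closure {x. \<beta> x \<noteq> 0} \<subseteq> U \<inter> dom_of c" using cl K(3) unfolding V_def by (rule subset_trans)
 ultimately show ?thesis using DD by blast
qed

text \<open>Cut-off functions that equal \<open>1\<close> near a point split a given \<open>f\<close> into pieces supported in single charts.\<close>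

lemma wlI:
 assumes \<eta>: "\<eta> \<in> DD" and L: "L \<in> bfs M"
  and loc: "\<And>p. \<exists>c U. C2 c U \<eta> \<and> p \<in> U \<and> (\<forall>q\<in>U. L q = LL c \<eta> q)"
 shows "wl \<eta> L"
 unfolding wl_def
proof (intro conjI \<eta> L ballI)
 fix f assume f: "f \<in> DD"
 \<comment> \<open>The defect in the identity to be proved. It is additive in h, so it can be
   localised.\<close>
 define T where "T h = (LINT x|M. \<Gamma> h \<eta> x) + ip h L" for h
 have i: "integrable M (\<Gamma> h \<eta>)" "integrable M (\<lambda>x. h x * L x)" if "h \<in> DD" for h
  using bfs_integrable[OF carre_bfs[OF that DD_D1[OF \<eta>]]] bfs_integrable[OF bfs_mult[OF DD_bfs[OF that] L]] by (simp_all add: mult.commute)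
 have T_add: "T (\<lambda>x. h x + k x) = T h + T k" if "h \<in> DD" "k \<in> DD" for h k
  using i[OF that(1)] i[OF that(2)] carre_add[OF DD_D1[OF that(1)] DD_D1[OF that(2)], of \<eta>]
  by (simp add: T_def distrib_right)
 have T_local: "T h = 0" if h: "h \<in> DD" "closure {x. h x \<noteq> 0} \<subseteq> U" "C2 c U \<eta>" "\<forall>q\<in>U. L q = LL c \<eta> q" for h c U
 proof -
  have "h x * L x = h x * LL c \<eta> x" for x
   using h(2,4) support_outside[of x h] by (cases "x \<in> U") auto
  hence "(LINT x|M. \<Gamma> h \<eta> x + h x * LL c \<eta> x) = (LINT x|M. \<Gamma> h \<eta> x + h x * L x)" by (simp only:)
  also have "\<dots> = T h" using i[OF h(1)] unfolding T_def by simp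
  finally have "T h = (LINT x|M. \<Gamma> h \<eta> x + h x * LL c \<eta> x)" by simp
  thus ?thesis using green(2)[OF h(3,1,2)] by simp
 qed
 \<comment> \<open>Q vanishes at 0 and equals 1 from 1/2 on, so Q composed with a bump \<beta> is 1
   in a neighbourhood of p.\<close>
 define Q where "Q s = 1 - (max 0 (1 - 2 * s))\<^sup>2" for s :: real
 have Q: "C1_fun Q (\<lambda>s. 4 * max 0 (1 - 2 * s))"
 proof -
  have "((\<lambda>s. (max 0 (1 - 2 * s))\<^sup>2) has_real_derivative 2 * max 0 (1 - 2 * s) * (- 2)) (at s)" for s :: real
   by (rule DERIV_chain2[OF max_sq_deriv]) (auto intro!: derivative_eq_intros)
  from DERIV_diff[OF DERIV_const this] have "(Q has_real_derivative 4 * max 0 (1 - 2 * s)) (at s)" for s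
   unfolding Q_def[abs_def] by simp
  thus ?thesis by (auto simp: C1_fun_def Q_def intro!: continuous_intros)
 qed
 have "\<exists>\<theta> V c U. \<theta> \<in> DD \<and> open V \<and> p \<in> V \<and> (\<forall>x\<in>V. \<theta> x = 1) \<and> closure {x. \<theta> x \<noteq> 0} \<subseteq> U \<and>
   C2 c U \<eta> \<and> (\<forall>q\<in>U. L q = LL c \<eta> q)" for p
 proof -
  obtain c U where U: "C2 c U \<eta>" "p \<in> U" "\<forall>q\<in>U. L q = LL c \<eta> q" using loc by blast
  hence "open U" by (simp add: C2_def)
  from bump_ex[OF this U(2)] obtain \<beta> where \<beta>: "\<beta> \<in> DD" "\<forall>x. 0 \<le> \<beta> x" "\<beta> p = 1" "closure {x. \<beta> x \<noteq> 0} \<subseteq> U" by blast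
  have "closure {x. Q (\<beta> x) \<noteq> 0} \<subseteq> closure {x. \<beta> x \<noteq> 0}" by (rule closure_mono) (auto simp: Q_def)
  moreover have "open {x. \<beta> x > 1/2}" by (intro open_Collect_less continuous_on_const D1_continuous DD_D1 \<beta>)
  moreover have "\<forall>x\<in>{x. \<beta> x > 1/2}. Q (\<beta> x) = 1" by (auto simp: Q_def)
  ultimately show ?thesis using DD_comp[OF \<beta>(1) Q] \<beta> U by (intro exI[of _ "\<lambda>x. Q (\<beta> x)"] exI[of _ "{x. \<beta> x > 1/2}"] exI[of _ c] exI[of _ U]) auto
 qed
 then obtain \<theta> V where \<theta>: "\<And>p. \<theta> p \<in> DD" "\<And>p. open (V p)" "\<And>p. p \<in> V p" "\<And>p x. x \<in> V p ==> \<theta> p x = 1"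
  "\<And>p. \<exists>c U. closure {x. \<theta> p x \<noteq> 0} \<subseteq> U \<and> C2 c U \<eta> \<and> (\<forall>q\<in>U. L q = LL c \<eta> q)" by metis
 \<comment> \<open>Each cut-off splits h into h * \<theta> p, settled by \<open>T_local\<close>, and
   a rest that vanishes on V p and so is covered by one set fewer.\<close>
 have ind: "finite I ==> h \<in> DD ==> {x. h x \<noteq> 0} \<subseteq> (\<Union>p\<in>I. V p) ==> T h = 0" for I h
 proof (induction I arbitrary: h rule: finite_induct)
  case empty
  hence "h = (\<lambda>_. 0)" by auto
  thus ?case using T_add[OF DD_0 DD_0] by simp
 next
  case (insert p I)
  let ?a = "\<lambda>x. h x * \<theta> p x" and ?b = "\<lambda>x. h x - h x * \<theta> p x"
  have D: "?a \<in> DD" "?b \<in> DD" using D_mult(1)[OF insert.prems(1) \<theta>(1)] D_diff insert.prems(1) by blast+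
  obtain c U where U: "closure {x. \<theta> p x \<noteq> 0} \<subseteq> U" "C2 c U \<eta>" "\<forall>q\<in>U. L q = LL c \<eta> q" using \<theta>(5) by blast
  have "closure {x. ?a x \<noteq> 0} \<subseteq> closure {x. \<theta> p x \<noteq> 0}" by (rule closure_mono) auto
  with U have "T ?a = 0" by (intro T_local[OF D(1) _ U(2,3)]) blast
  moreover have "{x. ?b x \<noteq> 0} \<subseteq> (\<Union>p\<in>I. V p)" using insert.prems(2) \<theta>(4)[of _ p] by force
  hence "T ?b = 0" by (rule insert.IH[OF D(2)])
  ultimately show ?case using T_add[OF D] by simp
 qed
 have K: "compact (closure {x. f x \<noteq> 0})" using f by (simp add: DD_def)
 obtain I where "finite I" "closure {x. f x \<noteq> 0} \<subseteq> (\<Union>p\<in>I. V p)"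
  by (rule compactE_image[OF K, of UNIV V]) (use \<theta>(2,3) in blast)+
 hence "T f = 0" using closure_subset[of "{x. f x \<noteq> 0}"] by (intro ind[OF _ f]) blast+
 thus "E f \<eta> = - ip f L" by (simp add: T_def E_def)
qed

text \<open>The density is positive, and a nonempty open set of coordinates is not
  negligible.\<close>

lemma open_positive:
 assumes "open U" "p \<in> U" shows "emeasure M U > 0"
proof (rule ccontr)
 assume "\<not> emeasure M U > 0"
 hence z: "emeasure M U = 0" by simp
 obtain c where c: "c \<in> A" "p \<in> dom_of c" using chart_ex by blast
 let ?V = "U \<inter> dom_of c"
 have V: "open ?V" "?V \<subseteq> dom_of c" using assms chart(1)[OF c(1)] by auto
 have o: "open (snd c ` ?V)" by (rule open_image[OF c(1) V])
 have "emeasure M ?V \<le> emeasure M U" using assms(1) by (intro emeasure_mono) (auto simp: sets_vol)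
 moreover have "emeasure M ?V = (\<integral>\<^sup>+y\<in>snd c ` ?V. ennreal (\<rho> c y) \<partial>lborel)"
  using volume_measure_props(2)[OF c(1) _ V(2)] emeasure_vol[OF c(1), of ?V] V by (simp add: Int_absorb1)
 ultimately have "(\<integral>\<^sup>+y. ennreal (\<rho> c y) * indicator (snd c ` ?V) y \<partial>lborel) = 0" using z by simp
 moreover have "(\<lambda>y. ennreal (\<rho> c y) * indicator (snd c ` ?V) y) \<in> borel_measurable lborel"
 proof -
  have "(\<lambda>y. ennreal (indicator (snd c ` ?V) y *\<^sub>R \<rho> c y)) \<in> borel_measurable lborel"
   using borel_measurable_continuous_on_indicator[OF borel_open[OF o] continuous_on_subset[OF C1_continuous[OF density_C1[OF c(1)]] image_mono[OF V(2)]]] by simp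
  also have "(\<lambda>y. ennreal (indicator (snd c ` ?V) y *\<^sub>R \<rho> c y)) = (\<lambda>y. ennreal (\<rho> c y) * indicator (snd c ` ?V) y)"
   by (auto simp: fun_eq_iff indicator_def)
  finally show ?thesis .
 qed
 ultimately have "AE y in lborel. ennreal (\<rho> c y) * indicator (snd c ` ?V) y = 0" by (simp add: nn_integral_0_iff_AE)
 hence "AE y in lborel. y \<notin> snd c ` ?V"
 proof (rule eventually_mono)
  fix y assume e: "ennreal (\<rho> c y) * indicator (snd c ` ?V) y = 0"
  show "y \<notin> snd c ` ?V"
  proof
   assume y: "y \<in> snd c ` ?V"
   hence "\<rho> c y > 0" by (intro density_pos[OF c(1)]) blast
   thus False using e y by simp
  qed
 qed
 hence "snd c ` ?V \<in> null_sets lborel" using o by (subst (asm) AE_iff_null_sets[symmetric]) auto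
 hence "negligible (snd c ` ?V)" using null_sets_completionI[of _ lborel] by (simp add: negligible_iff_null_sets)
 moreover have "\<not> negligible (snd c ` ?V)" using assms(2) c(2) by (intro open_not_negligible[OF o]) blast
 ultimately show False by blast
qed

text \<open>Both sides satisfy the same weak identity, which spares the transformation of second derivatives.\<close>

lemma LL_unique:
 assumes C: "C2 c (dom_of c) \<eta>" "C2 d (dom_of d) \<eta>" and p: "p \<in> dom_of c \<inter> dom_of d"
 shows "LL c \<eta> p = LL d \<eta> p"
proof (rule ccontr)
 assume ne: "LL c \<eta> p \<noteq> LL d \<eta> p"
 define W where "W q = LL c \<eta> q - LL d \<eta> q" for q
 let ?U = "dom_of c \<inter> dom_of d"
 have U: "open ?U" using C by (auto simp: C2_def)
 have "continuous_on ?U (\<lambda>q. W p * W q)" unfolding W_def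
  by (intro continuous_on_mult continuous_on_const continuous_on_diff
    continuous_on_subset[OF LL_continuous[OF C(1)] Int_lower1] continuous_on_subset[OF LL_continuous[OF C(2)] Int_lower2])
 hence "open (?U \<inter> (\<lambda>q. W p * W q) -` {0<..})" by (intro continuous_open_preimage U) auto
 moreover have "W p * W p > 0" using ne by (metis W_def eq_iff_diff_eq_0 not_real_square_gt_zero)
 ultimately obtain \<beta> where \<beta>: "\<beta> \<in> DD" "\<forall>x. 0 \<le> \<beta> x" "\<beta> p = 1"
  "closure {x. \<beta> x \<noteq> 0} \<subseteq> ?U \<inter> (\<lambda>q. W p * W q) -` {0<..}"
  using bump_ex[of "?U \<inter> (\<lambda>q. W p * W q) -` {0<..}" p] p by auto
 \<comment> \<open>The factor W p makes ?h q = \<beta> q * (W p * W q) nonnegative on the support of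
   \<beta>, whichever sign W p has.\<close>
 let ?h = "\<lambda>q. W p * (\<beta> q * LL c \<eta> q - \<beta> q * LL d \<eta> q)"
 have i: "integrable M (\<lambda>q. \<beta> q * LL e \<eta> q)" "(LINT q|M. \<beta> q * LL e \<eta> q) = - (LINT q|M. \<Gamma> \<beta> \<eta> q)"
  if "C2 e (dom_of e) \<eta>" "closure {x. \<beta> x \<noteq> 0} \<subseteq> dom_of e" for e
 proof -
  have "\<eta> \<in> D1" using that by (simp add: C2_def)
  hence g: "integrable M (\<Gamma> \<beta> \<eta>)" by (intro bfs_integrable carre_bfs \<beta>)
  show l: "integrable M (\<lambda>q. \<beta> q * LL e \<eta> q)" by (rule bfs_integrable[OF green(1)[OF that(1) \<beta>(1) that(2)]])
  show "(LINT q|M. \<beta> q * LL e \<eta> q) = - (LINT q|M. \<Gamma> \<beta> \<eta> q)" using green(2)[OF that(1) \<beta>(1) that(2)] g l by simp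
 qed
 have sub: "closure {x. \<beta> x \<noteq> 0} \<subseteq> dom_of c" "closure {x. \<beta> x \<noteq> 0} \<subseteq> dom_of d" using \<beta>(4) by auto
 have ih: "integrable M ?h" using i(1)[OF C(1) sub(1)] i(1)[OF C(2) sub(2)] by simp
 have z: "(LINT q|M. ?h q) = 0" using i[OF C(1) sub(1)] i[OF C(2) sub(2)] by simp
 have h: "?h q = \<beta> q * (W p * W q)" for q by (simp add: W_def algebra_simps)
 have pos: "?h q \<ge> 0" for q
 proof (cases "\<beta> q = 0")
  case False
  hence "q \<in> closure {x. \<beta> x \<noteq> 0}" using support_outside[of q \<beta>] by blast
  hence "W p * W q > 0" using \<beta>(4) by auto
  thus ?thesis unfolding h using \<beta>(2) by simp
 qed simp
 have "AE q in M. ?h q = 0" using integral_nonneg_eq_0_iff_AE[OF ih] pos z by simp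
 hence "AE q in M. \<beta> q \<le> 0"
 proof (rule eventually_mono)
  fix q assume e: "?h q = 0"
  show "\<beta> q \<le> 0"
  proof (rule ccontr)
   assume n: "\<not> \<beta> q \<le> 0"
   hence "q \<in> closure {x. \<beta> x \<noteq> 0}" using support_outside[of q \<beta>] by fastforce
   hence "W p * W q > 0" using \<beta>(4) by auto
   thus False using e n unfolding h by auto
  qed
 qed
 moreover have o: "open {q. \<beta> q > 0}" by (intro open_Collect_less continuous_on_const D1_continuous DD_D1 \<beta>)
 ultimately have "emeasure M {q. \<beta> q > 0} = 0"
  by (subst (asm) AE_iff_measurable[of "{q. \<beta> q > 0}"]) (auto simp: not_le sets_vol)
 thus False using open_positive[OF o, of p] \<beta>(3) by simp
qed

end

text \<open>The axiom \<open>bumps\<close> is where work is done: the Laplacian of a bump in its own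
  chart, extended by 0, is recognised locally by \<open>wlI\<close>. At points outside that chart's
  domain another chart is used, on a set where the bump vanishes.\<close>

sublocale fast_diffusion \<subseteq> dirichlet_space "volume_measure A g" DD \<Gamma> m
proof
 show "sets M = sets borel" by (rule volume_measure_props)
 show "continuous_on UNIV f" if "f \<in> DD" for f using that by (intro D1_continuous DD_D1)
 show "compact (closure {x. f x \<noteq> 0})" if "f \<in> DD" for f using that by (simp add: DD_def)
 fix U :: "'a set" and p assume U: "open U" "p \<in> U"
 obtain c \<beta> where \<beta>: "C2 c (dom_of c) \<beta>" "\<beta> \<in> DD" "\<forall>x. 0 \<le> \<beta> x" "\<beta> p = 1" "closure {x. \<beta> x \<noteq> 0} \<subseteq> U \<inter> dom_of c"
  using bump_ex[OF U] by blast
 have c: "c \<in> A" "open (dom_of c)" "\<beta> \<in> D1" using \<beta>(1) by (auto simp: C2_def)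
 let ?S = "closure {x. \<beta> x \<noteq> 0}"
 define L where "L q = (if q \<in> dom_of c then LL c \<beta> q else 0)" for q
 have L0: "L q = 0" if "q \<notin> ?S" for q using LL_zero[OF c(1) _ that] by (simp add: L_def)
 have "continuous_on (dom_of c \<union> - ?S) L"
 proof (rule continuous_on_open_Un[OF c(2) open_Compl[OF closed_closure]])
  show "continuous_on (dom_of c) L"
   by (rule continuous_on_eq[OF LL_continuous[OF \<beta>(1)]]) (simp add: L_def)
  show "continuous_on (- ?S) L"
   by (rule continuous_on_eq[OF continuous_on_const[of _ 0]]) (use L0 in simp)
 qed
 moreover have "dom_of c \<union> - ?S = UNIV" using \<beta>(5) by blast
 ultimately have "L \<in> bfs M" using \<beta>(2) L0 by (intro cont_bfs[of L ?S]) (auto simp: DD_def)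
 moreover have "\<exists>d V. C2 d V \<beta> \<and> q \<in> V \<and> (\<forall>x\<in>V. L x = LL d \<beta> x)" for q
 proof (cases "q \<in> dom_of c")
  case True
  thus ?thesis using \<beta>(1) by (intro exI[of _ c] exI[of _ "dom_of c"]) (simp add: L_def)
 next
  case False
  obtain d where d: "d \<in> A" "q \<in> dom_of d" using chart_ex by blast
  let ?V = "dom_of d - ?S"
  have V: "open ?V" "?V \<subseteq> dom_of d" "q \<in> ?V" using chart(1)[OF d(1)] False \<beta>(5) d(2) by auto
  have o: "open (snd d ` ?V)" by (rule open_image[OF d(1) V(1,2)])
  have z: "(\<beta> \<circ> inv_of d) y = 0" if y: "y \<in> snd d ` ?V" for y
  proof -
   obtain x where "x \<in> dom_of d" "x \<notin> ?S" "y = snd d x" using y by blast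
   thus ?thesis using chart(5)[OF d(1), of x] support_outside[of x \<beta>] by simp
  qed
  have "C1 (snd d ` ?V) (partial j (\<beta> \<circ> inv_of d))" for j
  proof (rule C1_cong[OF o C1_const[of _ 0]])
   show "0 = partial j (\<beta> \<circ> inv_of d) y" if "y \<in> snd d ` ?V" for y
    using partial_cong[OF o that, of "\<beta> \<circ> inv_of d" "\<lambda>_. 0" j] z partial_const[of j 0 y] by simp
  qed
  hence "C2 d ?V \<beta>" using d(1) V c(3) by (simp add: C2_def)
  moreover have "L x = LL d \<beta> x" if "x \<in> ?V" for x using LL_zero[OF d(1), of x \<beta>] L0[of x] that by simp
  ultimately show ?thesis using V(3) by blast
 qed
 ultimately have "wl \<beta> L" by (rule wlI[OF \<beta>(2)])
 moreover have "\<beta> x = 0" if "x \<notin> U" for x using that \<beta>(5) by (intro support_outside) blast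
 moreover have "\<beta> p > 0" using \<beta>(4) by simp
 ultimately show "\<exists>\<eta> L. wl \<eta> L \<and> (\<forall>x. 0 \<le> \<eta> x) \<and> 0 < \<eta> p \<and> (\<forall>x. x \<notin> U \<longrightarrow> \<eta> x = 0)"
  using \<beta>(3) by blast
qed

section \<open>Smooth test functions\<close>

lemma C1_slice:
 fixes Z :: "(real^'n::finite) \<times> real \<Rightarrow> real"
 assumes Z: "C1 (S \<times> UNIV) Z"
 shows "C1 S (\<lambda>y. Z (y, t))"
  and "y \<in> S ==> partial j (\<lambda>y. Z (y, t)) y = frechet_derivative Z (at (y, t)) (axis j 1, 0)"
  and "y \<in> S ==> ((\<lambda>s. Z (y, s)) has_real_derivative frechet_derivative Z (at (y, t)) (0, 1)) (at t)"
proof -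
 have F: "(Z has_derivative frechet_derivative Z (at (y, t))) (at (y, t))" if "y \<in> S" for y t
  by (rule C1_has_derivative[OF Z]) (use that in simp)
 have d: "((\<lambda>y. Z (y, t)) has_derivative (\<lambda>v. frechet_derivative Z (at (y, t)) (v, 0))) (at y)" if "y \<in> S" for y
  using diff_chain_at[OF has_derivative_Pair[OF has_derivative_ident has_derivative_const] F[OF that]] by (simp add: o_def)
 show "C1 S (\<lambda>y. Z (y, t))"
 proof (rule C1_I[OF d])
  fix v
  have "continuous_on (S \<times> UNIV) (\<lambda>z. frechet_derivative Z (at z) (v, 0))" using Z by (simp add: C1_def)
  thus "continuous_on S (\<lambda>y. frechet_derivative Z (at (y, t)) (v, 0))"
   by (rule continuous_on_compose2[where f = "\<lambda>y. (y, t)"]) (auto intro!: continuous_intros)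
 qed
 assume y: "y \<in> S"
 show "partial j (\<lambda>y. Z (y, t)) y = frechet_derivative Z (at (y, t)) (axis j 1, 0)"
  unfolding partial_def frechet_derivative_eqI[OF d[OF y]] by simp
 have "((\<lambda>s. Z (y, s)) has_derivative (\<lambda>r. frechet_derivative Z (at (y, t)) (0, r))) (at t)"
  using diff_chain_at[OF has_derivative_Pair[OF has_derivative_const has_derivative_ident] F[OF y]] by (simp add: o_def)
 moreover have "(\<lambda>r. frechet_derivative Z (at (y, t)) (0, r)) = (*) (frechet_derivative Z (at (y, t)) (0, 1))"
 proof
  show "frechet_derivative Z (at (y, t)) (0, r) = frechet_derivative Z (at (y, t)) (0, 1) * r" for r
   using linear_scale[OF has_derivative_linear[OF F[OF y, of t]], of r "(0, 1)"] by (simp add: mult.commute)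
 qed
 ultimately show "((\<lambda>s. Z (y, s)) has_real_derivative frechet_derivative Z (at (y, t)) (0, 1)) (at t)"
  by (simp only: has_field_derivative_def)
qed

context fast_diffusion begin

text \<open>The nested derivatives in \<open>Lap\<close> hide the dependence on time; in the
  expanded form each factor is visibly continuous in space and time.\<close>

lemma Lap_expand:
 assumes c: "c \<in> A" and y: "y \<in> img_of c" and F: "\<And>j. C1 (img_of c) (partial j F)"
 shows "Lap c F y = (\<Sum>i\<in>UNIV. \<Sum>j\<in>UNIV. \<rho> c y * Gi c (inv_of c y) $ i $ j * partial i (partial j F) y +
   partial i (\<lambda>y. \<rho> c y * Gi c (inv_of c y) $ i $ j) y * partial j F y) / \<rho> c y"
proof -
 have a: "C1 (img_of c) (\<lambda>y. \<rho> c y * Gi c (inv_of c y) $ i $ j)" for i j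
  by (rule C1_mult[OF density_C1[OF c] Gi_C1[OF c]])
 have "flux c F i = (\<lambda>y. \<Sum>j\<in>UNIV. \<rho> c y * Gi c (inv_of c y) $ i $ j * partial j F y)" for i
  by (simp add: flux_def fun_eq_iff sum_distrib_left mult.assoc)
 thus ?thesis
  unfolding Lap_def by (simp only: partial_sum[OF C1_mult[OF a F] y] partial_mult[OF a F y])
qed

lemma laplace_beltrami_chart:
 assumes "\<And>c. c \<in> A ==> C2 c (dom_of c) \<eta>" "c \<in> A" "p \<in> dom_of c"
 shows "laplace_beltrami A g \<eta> p = LL c \<eta> p"
 unfolding laplace_beltrami_LL using assms chart_at[of p] by (intro LL_unique) auto

lemma laplace_beltrami_outside: "p \<notin> closure {x. \<eta> x \<noteq> 0} ==> laplace_beltrami A g \<eta> p = 0"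
 unfolding laplace_beltrami_LL by (rule LL_zero[OF chart_at])

text \<open>\<open>laplace_beltrami\<close> agrees with the coordinate expression of every chart,
  which yields both its continuity and the local hypothesis of \<open>wlI\<close>.\<close>

lemma tp_laplace_beltrami:
 assumes \<eta>: "\<eta> \<in> DD" "\<And>c. c \<in> A ==> C2 c (dom_of c) \<eta>"
 shows "tp \<eta> (laplace_beltrami A g \<eta>)"
proof -
 let ?L = "laplace_beltrami A g \<eta>" and ?K = "closure {x. \<eta> x \<noteq> 0}"
 note lc = laplace_beltrami_chart[OF \<eta>(2)]
 have K: "compact ?K" using \<eta>(1) by (simp add: DD_def)
 have "continuous_on (dom_of c) ?L" if c: "c \<in> A" for c
  by (rule continuous_on_eq[OF LL_continuous[OF \<eta>(2)[OF c]]]) (simp add: lc[OF _ c])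
 hence "continuous_on (\<Union>c\<in>A. dom_of c) ?L" using chart(1) by (intro continuous_on_open_UN) blast+
 hence "continuous_on UNIV ?L" using atlas by (simp add: smooth_atlas_def)
 hence "?L \<in> bfs M" by (rule cont_bfs[OF _ K]) (rule laplace_beltrami_outside)
 moreover have "\<exists>c U. C2 c U \<eta> \<and> p \<in> U \<and> (\<forall>q\<in>U. ?L q = LL c \<eta> q)" for p
  using chart_at[of p] \<eta>(2) lc by blast
 ultimately have "wl \<eta> ?L" by (rule wlI[OF \<eta>(1)])
 moreover have "\<eta> x = 0 \<and> ?L x = 0" if "x \<notin> ?K" for x
  using support_outside[OF that] laplace_beltrami_outside[OF that] by simp
 ultimately show ?thesis unfolding tp_def using K by blast
qed

lemma tp_test_function:
 assumes "\<eta> \<in> test_functions A" shows "tp \<eta> (laplace_beltrami A g \<eta>)"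
proof (rule tp_laplace_beltrami)
 have s: "smooth_on (img_of c) (\<eta> \<circ> inv_of c)" if "c \<in> A" for c using assms that by (simp add: test_functions_def)
 have D: "\<eta> \<in> D1" using smooth_C1(1)[OF chart(2) s] by (simp add: D1_def)
 thus "\<eta> \<in> DD" using assms by (simp add: DD_def test_functions_def)
 show "C2 c (dom_of c) \<eta>" if c: "c \<in> A" for c
  using c D chart(1)[OF c] smooth_C1(1)[OF chart(2)[OF c] smooth_C1(2)[OF chart(2)[OF c] s[OF c]]]
  by (simp add: C2_def partial_def[abs_def])
qed

text \<open>Joint continuity in (x, t) is checked chart by chart in \<open>cov\<close>, with
  \<open>laplace_beltrami\<close> replaced by the coordinate expression of that chart.\<close>

lemma stt_test_function:
 assumes \<zeta>: "\<zeta> \<in> spacetime_test_functions A"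
 shows "stt \<zeta> (\<lambda>(x, t). deriv (\<lambda>s. \<zeta> (x, s)) t) (\<lambda>(x, t). laplace_beltrami A g (\<lambda>x'. \<zeta> (x', t)) x)"
proof -
 let ?K = "closure {z. \<zeta> z \<noteq> 0}"
 define Z where "Z c = (\<lambda>(y, t). \<zeta> (inv_of c y, t))" for c :: "('a, 'n) chart"
 define Zj where "Zj c j = (\<lambda>z. frechet_derivative (Z c) (at z) (axis j 1, 0))" for c j
 have o: "open (img_of c \<times> (UNIV :: real set))" if "c \<in> A" for c using chart(2)[OF that] by (intro open_Times) auto
 have sm: "smooth_on (img_of c \<times> UNIV) (Z c)" if "c \<in> A" for c
  using \<zeta> that by (simp add: spacetime_test_functions_def Z_def)
 have ZC: "C1 (img_of c \<times> UNIV) (Z c)" "C1 (img_of c \<times> UNIV) (Zj c j)" if "c \<in> A" for c j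
  using smooth_C1(1)[OF o[OF that] sm[OF that]] smooth_C1(1)[OF o[OF that] smooth_C1(2)[OF o[OF that] sm[OF that]]]
  by (simp_all add: Zj_def[abs_def])
 have sl: "(\<lambda>x'. \<zeta> (x', t)) \<circ> inv_of c = (\<lambda>y. Z c (y, t))" for c t by (simp add: Z_def fun_eq_iff)
 have pj: "partial j (\<lambda>y. Z c (y, t)) y = Zj c j (y, t)" if "c \<in> A" "y \<in> img_of c" for c j y t
  unfolding Zj_def by (rule C1_slice(2)[OF ZC(1)[OF that(1)] that(2)])
 have pC: "C1 (img_of c) (partial j (\<lambda>y. Z c (y, t)))" if "c \<in> A" for c j t
  by (rule C1_cong[OF chart(2)[OF that] C1_slice(1)[OF ZC(2)[OF that]]]) (simp add: pj[OF that])
 have K: "compact ?K" "?K \<subseteq> UNIV \<times> {0<..}" using \<zeta> by (auto simp: spacetime_test_functions_def)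
 have K0: "\<zeta> z = 0" if "z \<notin> ?K" for z by (rule support_outside[OF that])
 have cf: "compact (fst ` ?K)" "compact (snd ` ?K)" by (intro compact_continuous_image K continuous_intros)+
 have D1: "(\<lambda>x. \<zeta> (x, t)) \<in> D1" for t
  using C1_slice(1)[OF ZC(1)] by (simp add: D1_def sl)
 have DD: "(\<lambda>x. \<zeta> (x, t)) \<in> DD" for t
 proof -
  have "{x. \<zeta> (x, t) \<noteq> 0} \<subseteq> fst ` ?K" using K0 by force
  thus ?thesis using D1 compact_support_subset[of "fst ` ?K"] cf(1) compact_imp_closed[OF cf(1)]
   by (simp add: DD_def closure_closed)
 qed
 have C2t: "C2 c (dom_of c) (\<lambda>x. \<zeta> (x, t))" if "c \<in> A" for c t
  using that D1 chart(1)[OF that] pC[OF that] by (simp add: C2_def sl)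
 let ?Z = "\<lambda>(x, t). deriv (\<lambda>s. \<zeta> (x, s)) t" and ?L = "\<lambda>(x, t). laplace_beltrami A g (\<lambda>x'. \<zeta> (x', t)) x"
 have dt: "((\<lambda>s. \<zeta> (x, s)) has_real_derivative frechet_derivative (Z c) (at (snd c x, t)) (0, 1)) (at t)"
  if "c \<in> A" "x \<in> dom_of c" for c x t
  using C1_slice(3)[OF ZC(1)[OF that(1)], of "snd c x" t] that chart(5)[OF that] by (simp add: Z_def)
 have cov: "continuous_on UNIV W" if W: "\<And>c. c \<in> A ==> continuous_on (img_of c \<times> UNIV) (V c)"
  "\<And>c x t. c \<in> A ==> x \<in> dom_of c ==> W (x, t) = V c (snd c x, t)"
  for W :: "'a \<times> real \<Rightarrow> real" and V
 proof -
  have "continuous_on (dom_of c \<times> UNIV) W" if c: "c \<in> A" for c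
  proof -
   have "continuous_on (dom_of c \<times> UNIV) (\<lambda>z. V c (snd c (fst z), snd z))"
    by (rule continuous_on_compose2[OF W(1)[OF c]])
     (auto intro!: continuous_intros continuous_on_compose2[OF chart(3)[OF c]])
   thus ?thesis by (rule continuous_on_eq) (auto simp: W(2)[OF c])
  qed
  hence "continuous_on (\<Union>c\<in>A. dom_of c \<times> (UNIV :: real set)) W"
   using open_Times[OF chart(1) open_UNIV] by (intro continuous_on_open_UN) blast+
  moreover have "(\<Union>c\<in>A. dom_of c \<times> (UNIV :: real set)) = (\<Union>c\<in>A. dom_of c) \<times> UNIV" by blast
  hence "(\<Union>c\<in>A. dom_of c \<times> (UNIV :: real set)) = UNIV" using atlas by (simp add: smooth_atlas_def)
  ultimately show ?thesis by simp
 qed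
 have cZ: "continuous_on UNIV ?Z"
 proof (rule cov)
  show "continuous_on (img_of c \<times> UNIV) (\<lambda>z. frechet_derivative (Z c) (at z) (0, 1))" if "c \<in> A" for c
   using ZC(1)[OF that] by (simp add: C1_def)
  show "?Z (x, t) = frechet_derivative (Z c) (at (snd c x, t)) (0, 1)" if "c \<in> A" "x \<in> dom_of c" for c x t
   using DERIV_imp_deriv[OF dt[OF that]] by simp
 qed
 have cL: "continuous_on UNIV ?L"
 proof (rule cov)
  let ?a = "\<lambda>c i j y. \<rho> c y * Gi c (inv_of c y) $ i $ j"
  let ?V = "\<lambda>c z. (\<Sum>i\<in>UNIV. \<Sum>j\<in>UNIV. ?a c i j (fst z) * frechet_derivative (Zj c j) (at z) (axis i 1, 0) +
    partial i (?a c i j) (fst z) * Zj c j z) / \<rho> c (fst z)"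
  fix c assume c: "c \<in> A"
  have a: "C1 (img_of c) (?a c i j)" for i j by (rule C1_mult[OF density_C1[OF c] Gi_C1[OF c]])
  have f: "continuous_on (img_of c \<times> UNIV) (\<lambda>z. h (fst z))" if "continuous_on (img_of c) h" for h :: "real^'n \<Rightarrow> real"
   by (rule continuous_on_compose2[OF that]) (auto intro: continuous_intros)
  have zj: "continuous_on (img_of c \<times> UNIV) (\<lambda>z. frechet_derivative (Zj c j) (at z) v)" for j v
   using ZC(2)[OF c] unfolding C1_def by blast
  show "continuous_on (img_of c \<times> UNIV) (?V c)"
  proof (intro continuous_on_divide continuous_on_sum continuous_on_add continuous_on_mult zj
    f[OF C1_continuous[OF Gi_C1[OF c]]] f[OF C1_partial[OF a]] f[OF C1_continuous[OF density_C1[OF c]]] C1_continuous[OF ZC(2)[OF c]])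
   show "\<forall>z\<in>img_of c \<times> UNIV. \<rho> c (fst z) \<noteq> 0" using density_pos[OF c] by (metis less_irrefl mem_Times_iff)
  qed
  fix x t assume x: "x \<in> dom_of c"
  let ?F = "\<lambda>y. Z c (y, t)"
  have y: "snd c x \<in> img_of c" using x by blast
  have "partial i (partial j ?F) (snd c x) = frechet_derivative (Zj c j) (at (snd c x, t)) (axis i 1, 0)" for i j
   unfolding C1_slice(2)[OF ZC(2)[OF c] y, symmetric]
   by (rule partial_cong[OF chart(2)[OF c] y]) (simp add: pj[OF c])
  thus "?L (x, t) = ?V c (snd c x, t)"
   using laplace_beltrami_chart[OF C2t c x] by (simp add: sl Lap_expand[OF c y pC[OF c]] pj[OF c y])
 qed
 have Z0: "?Z (x, t) = 0" if n: "(x, t) \<notin> ?K" for x t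
 proof -
  have "continuous_on UNIV (\<lambda>s::real. (x, s))" by (intro continuous_intros)
  from open_vimage[OF open_Compl[OF closed_closure] this] have o: "open {s. (x, s) \<in> - ?K}" by (simp add: vimage_def)
  have "((\<lambda>s. \<zeta> (x, s)) has_real_derivative 0) (at t)"
  proof (rule has_field_derivative_transform_within_open[OF DERIV_const o])
   show "t \<in> {s. (x, s) \<in> - ?K}" using n by blast
   show "0 = \<zeta> (x, s)" if "s \<in> {s. (x, s) \<in> - ?K}" for s using K0[of "(x, s)"] that by simp
  qed
  thus ?thesis by (simp add: DERIV_imp_deriv)
 qed
 have L0: "?L (x, t) = 0" if n: "(x, t) \<notin> ?K" for x t
 proof -
  have "continuous_on UNIV (\<lambda>x'::'a. (x', t))" by (intro continuous_intros)
  from closed_vimage[OF closed_closure this] have "closed {x'. (x', t) \<in> ?K}" by (simp add: vimage_def)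
  moreover have "{x'. \<zeta> (x', t) \<noteq> 0} \<subseteq> {x'. (x', t) \<in> ?K}" using K0 by blast
  ultimately have "closure {x'. \<zeta> (x', t) \<noteq> 0} \<subseteq> {x'. (x', t) \<in> ?K}" by (intro closure_minimal)
  hence "x \<notin> closure {x'. \<zeta> (x', t) \<noteq> 0}" using n by blast
  from laplace_beltrami_outside[OF this] show ?thesis by simp
 qed
 obtain a b where ab: "0 < a" "a \<le> b" "snd ` ?K \<subseteq> {a..b::real}"
 proof (cases "?K = {}")
  case True
  \<comment> \<open>Any interval of positive times serves an empty support.\<close>
  hence "snd ` ?K \<subseteq> {1..1}" by (metis image_empty empty_subsetI)
  thus ?thesis by (rule that[OF zero_less_one order_refl])
 next
  case False
  hence ne: "snd ` ?K \<noteq> {}" by (simp only: image_is_empty not_False_eq_True)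
  obtain s where s: "s \<in> snd ` ?K" "\<forall>r\<in>snd ` ?K. s \<le> r" using compact_attains_inf[OF cf(2) ne] by blast
  obtain t where t: "t \<in> snd ` ?K" "\<forall>r\<in>snd ` ?K. r \<le> t" using compact_attains_sup[OF cf(2) ne] by blast
  have "s > 0" using s(1) K(2) by auto
  moreover have "s \<le> t" using s t by blast
  moreover have "snd ` ?K \<subseteq> {s..t}" using s(2) t(2) unfolding subset_eq atLeastAtMost_iff by blast
  ultimately show ?thesis by (rule that)
 qed
 have "\<zeta> (x, t) = 0 \<and> ?Z (x, t) = 0 \<and> ?L (x, t) = 0" if "(x, t) \<notin> fst ` ?K \<times> {a..b}" for x t
 proof -
  have "(x, t) \<notin> ?K" using that ab(3) by force
  thus ?thesis using K0 Z0 L0 by blast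
 qed
 hence "\<exists>K a b. compact K \<and> 0 < a \<and> a \<le> b \<and> (\<forall>x t. (x, t) \<notin> K \<times> {a..b} \<longrightarrow> \<zeta> (x, t) = 0 \<and> ?Z (x, t) = 0 \<and> ?L (x, t) = 0)"
  using ab(1,2) cf(1) by blast
 moreover have "tp (\<lambda>x. \<zeta> (x, t)) (\<lambda>x. ?L (x, t))" for t
  using tp_laplace_beltrami[OF DD C2t] by simp
 moreover have "((\<lambda>s. \<zeta> (x, s)) has_real_derivative ?Z (x, t)) (at t)" for x t
  using dt[OF chart_at] DERIV_imp_deriv[OF dt[OF chart_at]] by simp
 ultimately show ?thesis unfolding stt_def using cZ cL by blast
qed

text \<open>\<open>L1_loc\<close> speaks only of u restricted to compact sets; measurability of u
  itself is recovered along the exhaustion.\<close>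

lemma L1_loc_loc:
 assumes u: "u \<in> L1_loc M UNIV" shows "loc u"
proof -
 have i: "integrable M (\<lambda>x. indicator K x * u x)" if "compact K" for K
  using u that by (simp add: L1_loc_def set_integrable_def)
 obtain K where K: "\<And>n::nat. compact (K n :: 'a set)" "incseq K" "(\<Union>n. K n) = UNIV" using exhaustion by blast
 have "u \<in> borel_measurable M"
 proof (rule borel_measurable_LIMSEQ_real)
  show "(\<lambda>x. indicator (K n) x * u x) \<in> borel_measurable M" for n using i[OF K(1)] by (rule borel_measurable_integrable)
  fix x
  obtain N where "x \<in> K N" using K(3) by blast
  hence "indicator (K n) x * u x = u x" if "n \<ge> N" for n using incseqD[OF K(2) that] by auto
  thus "(\<lambda>n. indicator (K n) x * u x) \<longlonglongrightarrow> u x"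
   by (intro tendsto_eventually) (auto simp: eventually_sequentially)
 qed
 thus ?thesis using i by (simp add: loc_def)
qed

lemma distributional_solution_exists:
 assumes u0: "u0 \<in> L1_loc M UNIV"
 shows "\<exists>u. distributional_solution A g m u0 u \<and> u \<in> C_L1_loc M"
proof -
 obtain u where u: "u \<in> L1_loc MT (UNIV \<times> {0..})" "u \<in> C_L1_loc M"
  "\<And>\<eta> L. tp \<eta> L ==> ((\<lambda>t. LINT x|M. u (x, t) * \<eta> x) \<longlongrightarrow> ip u0 \<eta>) (at 0 within {0..})"
  "\<And>\<zeta> Z L. stt \<zeta> Z L ==> (LINT z|MT. u z * Z z) + (LINT z|MT. spow (u z) m * L z) = 0"
  using weak_solution_exists[OF L1_loc_loc[OF u0]] by blast
 have "distr_time_derivative A g u \<zeta> = distr_laplacian A g (\<lambda>z. spow (u z) m) \<zeta>"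
  if "\<zeta> \<in> spacetime_test_functions A" for \<zeta>
  using u(4)[OF stt_test_function[OF that]]
  by (simp add: distr_time_derivative_def distr_laplacian_def split_beta')
 \<comment> \<open>The filter of the essential limit is finer than the neighbourhoods of 0 within
   {0..}, so ordinary convergence implies the essential one.\<close>
 moreover have "inf (at_right 0) (ae_filter lborel) \<le> at (0::real) within {0..}"
  by (rule le_infI1) (auto intro: at_le)
 ultimately show ?thesis
  using u(1,2) tendsto_mono u(3)[OF tp_test_function] unfolding distributional_solution_def by blast
qed

end

theorem theorem1p2:
  fixes A :: "('a::{t2_space, second_countable_topology}, 'n::finite) chart set"
    and g :: "('a, 'n) metric_tensor"
    and m :: real
    and u\<^sub>0 :: "'a \<Rightarrow> real"
  assumes "riemannian_manifold A g"
    and "complete_manifold A g"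
    and "connected (UNIV :: 'a set)"
    and "\<not> compact (UNIV :: 'a set)"
    and "0 < m" "m < 1"
    and "u\<^sub>0 \<in> L1_loc (volume_measure A g) UNIV"
  shows "\<exists>u. distributional_solution A g m u\<^sub>0 u \<and> u \<in> C_L1_loc (volume_measure A g)"
proof -
 interpret fast_diffusion A g m by standard (use assms in auto)
 show ?thesis by (rule distributional_solution_exists) (use assms in simp)
qed

end
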